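(* Let $\mathcal H=\mathcal H_+\oplus\mathcal H_-$ be a polarized Hilbert space, and let $\mathrm{Gr}_{\mathrm{res}}$, $U_{\mathrm{res}}$ and $\mathfrak U_{\mathrm{res}}=\{u \text{ partial isometry on }\mathcal H : u^*u,\,uu^*\in \mathrm{Gr}_{\mathrm{res}}\}$ be as in the context. Let $(V_\alpha,\psi_\alpha)_\alpha$ be a smooth atlas of the Banach Lie group $U_+$, with $V_\alpha\subset U_+$ open and $\psi_\alpha:V_\alpha\to\mathfrak u_+$. Let $(\Omega_\beta,\sigma_\beta)_\beta$ be a family in which the $\Omega_\beta\subset\mathrm{Gr}_{\mathrm{res}}$ are open sets covering $\mathrm{Gr}_{\mathrm{res}}$ and each $\sigma_\beta:\Omega_\beta\to U_{\mathrm{res}}$ is a smooth map with $\sigma_\beta(W)\mathcal H_+=W$ for all $W\in\Omega_\beta$; assume moreover that each $\Omega_\beta$ is contained in the domain of the chart $\phi_{W_\beta}$ of $\mathrm{Gr}_{\mathrm{res}}$ for some $W_\beta\in\Omega_\beta$, and let $\tilde\psi_\beta:\Omega_\beta\to L^2(W_\beta,W_\beta^\perp)$ be the restriction of $\phi_{W_\beta}$. Put $$\Omega_{\alpha\beta\gamma}=\{u\in\mathfrak U_{\mathrm{res}} : u^*u\in\Omega_\beta,\ uu^*\in\Omega_\gamma,\ (\sigma_\gamma(uu^* )^{-1}\,u\,\sigma_\beta(u^*u))|_{\mathcal H_+}\in V_\alpha\}$$ and define $\Phi_{\alpha\beta\gamma}:\Omega_{\alpha\beta\gamma}\to L^2(W_\gamma,W_\gamma^\perp)\times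 L^2(W_\beta,W_\beta^\perp)\times\mathfrak u_+$ by $$\Phi_{\alpha\beta\gamma}(u)=\Big(\tilde\psi_\gamma(uu^* ),\ \tilde\psi_\beta(u^*u),\ \psi_\alpha\big((\sigma_\gamma(uu^* )^{-1}\,u\,\sigma_\beta(u^*u))|_{\mathcal H_+}\big)\Big).$$ Then the family $(\Omega_{\alpha\beta\gamma},\Phi_{\alpha\beta\gamma})$ is a smooth atlas on $\mathfrak U_{\mathrm{res}}$, making it a smooth Banach manifold modelled on the Banach spaces $L^2(W_\gamma,W_\gamma^\perp)\times L^2(W_\beta,W_\beta^\perp)\times\mathfrak u_+$.
   Context: $\mathcal H$ is a separable complex Hilbert space with a fixed orthogonal decomposition $\mathcal H=\mathcal H_+\oplus\mathcal H_-$ into infinite-dimensional closed subspaces; $P_\pm$ are the orthogonal projectors onto $\mathcal H_\pm$. $L^\infty$ denotes bounded operators, $L^2$ denotes Hilbert--Schmidt operators with the Hilbert--Schmidt norm $\|\cdot\|_2$. A closed subspace $W$ is identified with the orthogonal projector $P_W$ onto it. A partial isometry is a bounded operator $u$ on $\mathcal H$ such that $u^*u$ (equivalently $uu^*$) is an orthogonal projector. The restricted Grassmannian $\mathrm{Gr}_{\mathrm{res}}$ is the set of closed subspaces $W\subset\mathcal H$ such that the orthogonal projection $W\to\mathcal H_+$ is Fredholm and the orthogonal projection $W\to\mathcal H_-$ is Hilbert--Schmidt. It is a Hilbert manifold with charts $\phi_W$, $W\in\mathrm{Gr}_{\mathrm{res}}$: the domain is $\{V\in\mathrm{Gr}_{\mathrm{res}}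 : P_W|_V:V\to W \text{ is invertible}\}$ and $\phi_W(V)=P_{W^\perp}(P_W|_V)^{-1}\in L^2(W,W^\perp)$, whose inverse sends $A$ to its graph $\{w+Aw: w\in W\}$. $U_{\mathrm{res}}=\{g \text{ unitary on }\mathcal H : [g,P_+]\in L^2(\mathcal H)\}$ is a Banach Lie group with Lie algebra $\mathfrak u_{\mathrm{res}}=\{x \text{ bounded skew-adjoint on }\mathcal H: [x,P_+]\in L^2(\mathcal H)\}$, with the standard norm $\|x\|_\infty+\|[x,P_+]\|_2$ and the corresponding topology on $U_{\mathrm{res}}$; it acts transitively on $\mathrm{Gr}_{\mathrm{res}}$ by $W\mapsto gW$. $U_+$ is the unitary group of $\mathcal H_+$ with the operator norm topology, a Banach Lie group whose Lie algebra is the space $\mathfrak u_+$ of bounded skew-adjoint operators on $\mathcal H_+$. Smooth families $(\Omega_\beta,\sigma_\beta)$ as in the claim exist. *)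

theory Defs
  imports "HOL-Analysis.Analysis"
begin

section \<open>Complex Hilbert spaces\<close>

text \<open>The real structure of a complex Hilbert space is that of the library class
  \<open>real_inner\<close>, with \<open>inner = Re cinner\<close>; hence \<open>norm x = sqrt (Re (cinner x x))\<close>, and the library
  type of bounded real-linear operators is available.  The complex inner product is antilinear in
  its first argument.\<close>

class complex_inner = real_inner +
  fixes scaleC :: "complex \<Rightarrow> 'a \<Rightarrow> 'a" (infixr "*\<^sub>C" 75)
    and cinner :: "'a \<Rightarrow> 'a \<Rightarrow> complex"
  assumes scaleR_scaleC: "scaleR r x = complex_of_real r *\<^sub>C x"
    and scaleC_add_right: "c *\<^sub>C (x + y) = c *\<^sub>C x + c *\<^sub>C y"
    and scaleC_add_left: "(c + d) *\<^sub>C x = c *\<^sub>C x + d *\<^sub>C x"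
    and scaleC_scaleC: "c *\<^sub>C d *\<^sub>C x = (c * d) *\<^sub>C x"
    and cinner_commute: "cinner x y = cnj (cinner y x)"
    and cinner_add_right: "cinner x (y + z) = cinner x y + cinner x z"
    and cinner_scaleC_right: "cinner x (c *\<^sub>C y) = c * cinner x y"
    and inner_eq_Re_cinner: "inner x y = Re (cinner x y)"

class complex_hilbert = complex_inner + complete_space

abbreviation cspan :: "'a::complex_inner set \<Rightarrow> 'a set" where
  "cspan \<equiv> module.span scaleC"

definition closed_csubspace :: "'a::complex_inner set \<Rightarrow> bool" where
  "closed_csubspace W \<longleftrightarrow> module.subspace scaleC W \<and> closed W"

definition finite_cdim :: "'a::complex_inner set \<Rightarrow> bool" where
  "finite_cdim S \<longleftrightarrow> (\<exists>B. finite B \<and> S \<subseteq> cspan B)"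

definition ocomp :: "'a::complex_inner set \<Rightarrow> 'a set" where
  "ocomp W = {x. \<forall>w\<in>W. cinner w x = 0}"

definition polarization :: "'a::complex_hilbert set \<Rightarrow> 'a set \<Rightarrow> bool" where
  "polarization Hp Hm \<longleftrightarrow>
     closed_csubspace Hp \<and> closed_csubspace Hm \<and>
     \<not> finite_cdim Hp \<and> \<not> finite_cdim Hm \<and>
     (\<forall>x\<in>Hp. \<forall>y\<in>Hm. cinner x y = 0) \<and>
     (\<forall>z. \<exists>x\<in>Hp. \<exists>y\<in>Hm. z = x + y)"

section \<open>Bounded operators\<close>

text \<open>The bounded operators are the complex-linear elements of the library type
  \<open>'a \<Rightarrow>\<^sub>L 'a\<close>.  An operator between closed subspaces \<open>W\<close> and \<open>V\<close> is
  represented by its extension by zero on the orthogonal complement of \<open>W\<close>; this does not change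
  operator norms or Hilbert--Schmidt norms.\<close>

definition clinear_op :: "('a::complex_inner \<Rightarrow>\<^sub>L 'a) \<Rightarrow> bool" where
  "clinear_op A \<longleftrightarrow> Vector_Spaces.linear scaleC scaleC (blinfun_apply A)"

definition cadj :: "('a::complex_inner \<Rightarrow>\<^sub>L 'a) \<Rightarrow> ('a \<Rightarrow>\<^sub>L 'a)" where
  "cadj A = (THE B. \<forall>x y. cinner (blinfun_apply A x) y = cinner x (blinfun_apply B y))"

definition proj :: "'a::complex_inner set \<Rightarrow> ('a \<Rightarrow>\<^sub>L 'a)" where
  "proj W = (THE P. \<forall>x. blinfun_apply P x \<in> W \<and> x - blinfun_apply P x \<in> ocomp W)"

definition orth_projector :: "('a::complex_inner \<Rightarrow>\<^sub>L 'a) \<Rightarrow> bool" where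
  "orth_projector P \<longleftrightarrow> clinear_op P \<and> P o\<^sub>L P = P \<and> cadj P = P"

definition partial_isometry :: "('a::complex_inner \<Rightarrow>\<^sub>L 'a) \<Rightarrow> bool" where
  "partial_isometry u \<longleftrightarrow> clinear_op u \<and> orth_projector (cadj u o\<^sub>L u)"

definition commutator :: "('a::complex_inner \<Rightarrow>\<^sub>L 'a) \<Rightarrow> ('a \<Rightarrow>\<^sub>L 'a) \<Rightarrow> ('a \<Rightarrow>\<^sub>L 'a)" where
  "commutator A B = (A o\<^sub>L B) - (B o\<^sub>L A)"

definition is_onb :: "'a::complex_inner set \<Rightarrow> bool" where
  "is_onb B \<longleftrightarrow> (\<forall>x\<in>B. \<forall>y\<in>B. cinner x y = (if x = y then 1 else 0)) \<and> closure (cspan B) = UNIV"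

text \<open>Neither the Hilbert--Schmidt property nor the norm depends on the choice of the
  orthonormal basis.\<close>

definition hilbert_schmidt :: "('a::complex_inner \<Rightarrow>\<^sub>L 'a) \<Rightarrow> bool" where
  "hilbert_schmidt A \<longleftrightarrow> clinear_op A \<and>
     (\<lambda>e. (norm (blinfun_apply A e))\<^sup>2) summable_on (SOME B. is_onb B)"

definition hs_norm :: "('a::complex_inner \<Rightarrow>\<^sub>L 'a) \<Rightarrow> real" where
  "hs_norm A = sqrt (\<Sum>\<^sub>\<infinity>e\<in>(SOME B. is_onb B). (norm (blinfun_apply A e))\<^sup>2)"

definition fredholm_between ::
    "'a::complex_inner set \<Rightarrow> 'a set \<Rightarrow> ('a \<Rightarrow>\<^sub>L 'a) \<Rightarrow> bool" where
  "fredholm_between W V A \<longleftrightarrow>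
     blinfun_apply A ` W \<subseteq> V \<and> closed (blinfun_apply A ` W) \<and>
     finite_cdim {w \<in> W. blinfun_apply A w = 0} \<and>
     (\<exists>B. finite B \<and> B \<subseteq> V \<and> V \<subseteq> cspan (blinfun_apply A ` W \<union> B))"

definition invertible_between ::
    "'a::complex_inner set \<Rightarrow> 'a set \<Rightarrow> ('a \<Rightarrow>\<^sub>L 'a) \<Rightarrow> bool" where
  "invertible_between V W A \<longleftrightarrow> bij_betw (blinfun_apply A) V W \<and>
     (\<exists>C. \<forall>v\<in>V. norm v \<le> C * norm (blinfun_apply A v))"

text \<open>Inverses in the corner algebra \<open>e L e\<close>, whose unit is the projector \<open>e\<close>; for the
  projector onto \<open>W\<close> this is the algebra of bounded operators on \<open>W\<close>.\<close>

definition inverse_in :: "('a::complex_inner \<Rightarrow>\<^sub>L 'a) \<Rightarrow> ('a \<Rightarrow>\<^sub>L 'a) \<Rightarrow> ('a \<Rightarrow>\<^sub>L 'a) \<Rightarrow> bool" where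
  "inverse_in e a b \<longleftrightarrow> e o\<^sub>L b o\<^sub>L e = b \<and> a o\<^sub>L b = e \<and> b o\<^sub>L a = e"

definition op_inverse :: "('a::complex_inner \<Rightarrow>\<^sub>L 'a) \<Rightarrow> ('a \<Rightarrow>\<^sub>L 'a) \<Rightarrow> ('a \<Rightarrow>\<^sub>L 'a)" where
  "op_inverse e a = (THE b. inverse_in e a b)"

definition unitaries :: "('a::complex_inner \<Rightarrow>\<^sub>L 'a) \<Rightarrow> ('a \<Rightarrow>\<^sub>L 'a) set" where
  "unitaries e = {u. clinear_op u \<and> e o\<^sub>L u o\<^sub>L e = u \<and> cadj u o\<^sub>L u = e \<and> u o\<^sub>L cadj u = e}"

section \<open>Smooth maps between Banach spaces\<close>

text \<open>The model spaces of a Banach manifold vary from chart to chart and are not types.  A normed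
  space is therefore given by a linear subspace of an ambient vector space together with a norm on
  that subspace; the norm of the ambient type is irrelevant.\<close>

datatype 'v nspace = NSpace (vecs: "'v set") (nrm: "'v \<Rightarrow> real")

abbreviation ndist :: "'v::real_vector nspace \<Rightarrow> 'v \<Rightarrow> 'v \<Rightarrow> real" where
  "ndist E \<equiv> \<lambda>x y. nrm E (x - y)"

abbreviation ntop :: "'v::real_vector nspace \<Rightarrow> 'v topology" where
  "ntop E \<equiv> Metric_space.mtopology (vecs E) (ndist E)"

definition banach_space :: "'v::real_vector nspace \<Rightarrow> bool" where
  "banach_space E \<longleftrightarrow>
     subspace (vecs E) \<and>
     (\<forall>x\<in>vecs E. 0 \<le> nrm E x \<and> (nrm E x = 0 \<longleftrightarrow> x = 0)) \<and>
     (\<forall>x\<in>vecs E. \<forall>r. nrm E (r *\<^sub>R x) = \<bar>r\<bar> * nrm E x) \<and>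
     (\<forall>x\<in>vecs E. \<forall>y\<in>vecs E. nrm E (x + y) \<le> nrm E x + nrm E y) \<and>
     Metric_space.mcomplete (vecs E) (ndist E)"

definition prod_nspace :: "'v nspace \<Rightarrow> 'w nspace \<Rightarrow> ('v \<times> 'w) nspace" where
  "prod_nspace E F = NSpace (vecs E \<times> vecs F) (\<lambda>(x, y). nrm E x + nrm F y)"

text \<open>A bounded \<open>k\<close>-linear map takes its arguments as a list of length \<open>k\<close>.\<close>

definition bounded_multilinear ::
    "'v::real_vector nspace \<Rightarrow> 'w::real_vector nspace \<Rightarrow> nat \<Rightarrow> ('v list \<Rightarrow> 'w) \<Rightarrow> bool" where
  "bounded_multilinear E F k m \<longleftrightarrow>
     (\<forall>vs. length vs = k \<and> set vs \<subseteq> vecs E \<longrightarrow> m vs \<in> vecs F) \<and>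
     (\<forall>us ws v w a b. length us + length ws + 1 = k \<and>
        set us \<subseteq> vecs E \<and> set ws \<subseteq> vecs E \<and> v \<in> vecs E \<and> w \<in> vecs E \<longrightarrow>
        m (us @ (a *\<^sub>R v + b *\<^sub>R w) # ws) = a *\<^sub>R m (us @ v # ws) + b *\<^sub>R m (us @ w # ws)) \<and>
     (\<exists>C. \<forall>vs. length vs = k \<and> set vs \<subseteq> vecs E \<longrightarrow>
        nrm F (m vs) \<le> C * prod_list (map (nrm E) vs))"

text \<open>Frechet smoothness on an open set \<open>U\<close>: \<open>D k x\<close> is the \<open>k\<close>-th derivative of \<open>f\<close> at \<open>x\<close>.
  The last clause says that \<open>D k\<close>, as a map from \<open>U\<close> into the space of bounded \<open>k\<close>-linear maps with
  its operator norm, is Frechet differentiable with derivative \<open>D (Suc k)\<close>, under the usual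
  isometric identification of \<open>L(E, L\<^sup>k(E; F))\<close> with the space of bounded \<open>(k+1)\<close>-linear maps.\<close>

definition smooth_on ::
    "'v::real_vector nspace \<Rightarrow> 'w::real_vector nspace \<Rightarrow> 'v set \<Rightarrow> ('v \<Rightarrow> 'w) \<Rightarrow> bool" where
  "smooth_on E F U f \<longleftrightarrow> openin (ntop E) U \<and>
     (\<exists>D :: nat \<Rightarrow> 'v \<Rightarrow> 'v list \<Rightarrow> 'w.
        (\<forall>x\<in>U. D 0 x [] = f x) \<and>
        (\<forall>k. \<forall>x\<in>U. bounded_multilinear E F k (D k x)) \<and>
        (\<forall>k. \<forall>x\<in>U. \<forall>\<epsilon>>0. \<exists>\<delta>>0. \<forall>h\<in>vecs E. nrm E h < \<delta> \<and> x + h \<in> U \<longrightarrow>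
           (\<forall>vs. length vs = k \<and> set vs \<subseteq> vecs E \<longrightarrow>
              nrm F (D k (x + h) vs - D k x vs - D (Suc k) x (h # vs))
                \<le> \<epsilon> * nrm E h * prod_list (map (nrm E) vs))))"

section \<open>Banach manifolds\<close>

datatype ('m, 'v) chart = Chart (chart_dom: "'m set") (coord: "'m \<Rightarrow> 'v") (model: "'v nspace")

definition is_chart :: "'m set \<Rightarrow> ('m, 'v::real_vector) chart \<Rightarrow> bool" where
  "is_chart M c \<longleftrightarrow> chart_dom c \<subseteq> M \<and> inj_on (coord c) (chart_dom c) \<and> banach_space (model c) \<and>
     openin (ntop (model c)) (coord c ` chart_dom c)"

definition compatible ::
    "('m, 'v::real_vector) chart \<Rightarrow> ('m, 'w::real_vector) chart \<Rightarrow> bool" where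
  "compatible c d \<longleftrightarrow>
     smooth_on (model c) (model d) (coord c ` (chart_dom c \<inter> chart_dom d)) (coord d \<circ> inv_into (chart_dom c) (coord c)) \<and>
     smooth_on (model d) (model c) (coord d ` (chart_dom c \<inter> chart_dom d)) (coord c \<circ> inv_into (chart_dom d) (coord d))"

definition smooth_atlas :: "'m set \<Rightarrow> ('m, 'v::real_vector) chart set \<Rightarrow> bool" where
  "smooth_atlas M A \<longleftrightarrow> (\<Union>c\<in>A. chart_dom c) = M \<and> (\<forall>c\<in>A. is_chart M c) \<and>
     (\<forall>c\<in>A. \<forall>d\<in>A. compatible c d)"

definition atlas_topology :: "'m set \<Rightarrow> ('m, 'v::real_vector) chart set \<Rightarrow> 'm topology" where
  "atlas_topology M A = topology (\<lambda>S. S \<subseteq> M \<and>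
     (\<forall>c\<in>A. openin (ntop (model c)) (coord c ` (S \<inter> chart_dom c))))"

definition banach_manifold :: "'m set \<Rightarrow> ('m, 'v::real_vector) chart set \<Rightarrow> bool" where
  "banach_manifold M A \<longleftrightarrow> smooth_atlas M A \<and> Hausdorff_space (atlas_topology M A)"

text \<open>\<open>A\<close> is an atlas of the manifold structure on \<open>M\<close> that is defined by the atlas \<open>B\<close>.\<close>

definition atlas_of_manifold ::
    "'m set \<Rightarrow> ('m, 'w::real_vector) chart set \<Rightarrow> ('m, 'v::real_vector) chart set \<Rightarrow> bool" where
  "atlas_of_manifold M B A \<longleftrightarrow> smooth_atlas M A \<and> (\<forall>c\<in>A. \<forall>d\<in>B. compatible c d)"

text \<open>Smoothness of \<open>f\<close>, defined on the subset \<open>S\<close> of the manifold \<open>M\<close> with atlas \<open>A\<close>, with values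
  in a manifold with atlas \<open>B\<close>.  Continuity is part of the definition, since the neighbourhood \<open>N\<close>
  is mapped into the domain of \<open>d\<close>.\<close>

definition smooth_map ::
    "'m set \<Rightarrow> ('m, 'v::real_vector) chart set \<Rightarrow> 'm set \<Rightarrow>
     ('n, 'w::real_vector) chart set \<Rightarrow> ('m \<Rightarrow> 'n) \<Rightarrow> bool" where
  "smooth_map M A S B f \<longleftrightarrow>
     (\<forall>p\<in>S. \<exists>c\<in>A. \<exists>d\<in>B. \<exists>N.
        openin (atlas_topology M A) N \<and> p \<in> N \<and> N \<subseteq> chart_dom c \<inter> S \<and> f ` N \<subseteq> chart_dom d \<and>
        smooth_on (model c) (model d) (coord c ` N) (coord d \<circ> f \<circ> inv_into (chart_dom c) (coord c)))"

section \<open>The restricted Grassmannian\<close>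

definition Gr_res :: "'a::complex_hilbert set \<Rightarrow> 'a set \<Rightarrow> 'a set set" where
  "Gr_res Hp Hm = {W. closed_csubspace W \<and> fredholm_between W Hp (proj Hp) \<and>
     hilbert_schmidt (proj Hm o\<^sub>L proj W)}"

definition L2_perp :: "'a::complex_hilbert set \<Rightarrow> ('a \<Rightarrow>\<^sub>L 'a) nspace" where
  "L2_perp W = NSpace {A. hilbert_schmidt A \<and> proj (ocomp W) o\<^sub>L A o\<^sub>L proj W = A} hs_norm"

definition graph_dom :: "'a::complex_hilbert set \<Rightarrow> 'a set \<Rightarrow> 'a set \<Rightarrow> 'a set set" where
  "graph_dom Hp Hm W = {V \<in> Gr_res Hp Hm. invertible_between V W (proj W)}"

definition graph_coord :: "'a::complex_hilbert set \<Rightarrow> 'a set \<Rightarrow> ('a \<Rightarrow>\<^sub>L 'a)" where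
  "graph_coord W V = Blinfun (\<lambda>x.
     blinfun_apply (proj (ocomp W))
       (inv_into V (blinfun_apply (proj W)) (blinfun_apply (proj W) x)))"

definition Gr_atlas ::
    "'a::complex_hilbert set \<Rightarrow> 'a set \<Rightarrow> ('a set, 'a \<Rightarrow>\<^sub>L 'a) chart set" where
  "Gr_atlas Hp Hm =
     (\<lambda>W. Chart (graph_dom Hp Hm W) (graph_coord W) (L2_perp W)) ` Gr_res Hp Hm"

section \<open>The Banach Lie groups\<close>

text \<open>A group \<open>G\<close> of unitaries of a corner algebra, with Lie algebra \<open>L\<close>, carries the
  manifold structure given by the left translates of the Cayley coordinate, the inverse of
  \<open>x \<mapsto> g (e + x/2) (e - x/2)\<^sup>-\<^sup>1\<close>, which maps \<open>L\<close> onto an open neighbourhood of \<open>g\<close>.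
  This is the same structure as the one given by the exponential coordinates \<open>x \<mapsto> g exp x\<close>.\<close>

definition cayley_chart ::
    "('a::complex_hilbert \<Rightarrow>\<^sub>L 'a) \<Rightarrow> ('a \<Rightarrow>\<^sub>L 'a) set \<Rightarrow> ('a \<Rightarrow>\<^sub>L 'a) nspace \<Rightarrow> ('a \<Rightarrow>\<^sub>L 'a) \<Rightarrow>
     ('a \<Rightarrow>\<^sub>L 'a, 'a \<Rightarrow>\<^sub>L 'a) chart" where
  "cayley_chart e G L g =
     Chart {u \<in> G. \<exists>b. inverse_in e ((op_inverse e g o\<^sub>L u) + e) b}
       (\<lambda>u. 2 *\<^sub>R (((op_inverse e g o\<^sub>L u) - e) o\<^sub>L op_inverse e ((op_inverse e g o\<^sub>L u) + e)))
       L"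

definition U_res :: "'a::complex_hilbert set \<Rightarrow> ('a \<Rightarrow>\<^sub>L 'a) set" where
  "U_res Hp = {g \<in> unitaries id_blinfun. hilbert_schmidt (commutator g (proj Hp))}"

definition lie_u_res :: "'a::complex_hilbert set \<Rightarrow> ('a \<Rightarrow>\<^sub>L 'a) nspace" where
  "lie_u_res Hp = NSpace
     {x. clinear_op x \<and> cadj x = - x \<and> hilbert_schmidt (commutator x (proj Hp))}
     (\<lambda>x. norm x + hs_norm (commutator x (proj Hp)))"

definition U_res_atlas ::
    "'a::complex_hilbert set \<Rightarrow> ('a \<Rightarrow>\<^sub>L 'a, 'a \<Rightarrow>\<^sub>L 'a) chart set" where
  "U_res_atlas Hp = cayley_chart id_blinfun (U_res Hp) (lie_u_res Hp) ` U_res Hp"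

definition U_plus :: "'a::complex_hilbert set \<Rightarrow> ('a \<Rightarrow>\<^sub>L 'a) set" where
  "U_plus Hp = unitaries (proj Hp)"

definition lie_u_plus :: "'a::complex_hilbert set \<Rightarrow> ('a \<Rightarrow>\<^sub>L 'a) nspace" where
  "lie_u_plus Hp = NSpace
     {x. clinear_op x \<and> cadj x = - x \<and> proj Hp o\<^sub>L x o\<^sub>L proj Hp = x} norm"

definition U_plus_atlas ::
    "'a::complex_hilbert set \<Rightarrow> ('a \<Rightarrow>\<^sub>L 'a, 'a \<Rightarrow>\<^sub>L 'a) chart set" where
  "U_plus_atlas Hp = cayley_chart (proj Hp) (U_plus Hp) (lie_u_plus Hp) ` U_plus Hp"

section \<open>The restricted partial isometries\<close>

text \<open>The closed subspaces identified with the projectors \<open>u\<^sup>* u\<close> and \<open>u u\<^sup>*\<close>.\<close>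

definition ini :: "('a::complex_hilbert \<Rightarrow>\<^sub>L 'a) \<Rightarrow> 'a set" where
  "ini u = range (blinfun_apply (cadj u o\<^sub>L u))"

definition fin :: "('a::complex_hilbert \<Rightarrow>\<^sub>L 'a) \<Rightarrow> 'a set" where
  "fin u = range (blinfun_apply (u o\<^sub>L cadj u))"

definition PI_res :: "'a::complex_hilbert set \<Rightarrow> 'a set \<Rightarrow> ('a \<Rightarrow>\<^sub>L 'a) set" where
  "PI_res Hp Hm = {u. partial_isometry u \<and> ini u \<in> Gr_res Hp Hm \<and> fin u \<in> Gr_res Hp Hm}"

text \<open>The restriction to \<open>H\<^sub>+\<close> of \<open>\<sigma>\<^sub>\<gamma>(u u\<^sup>*)\<^sup>-\<^sup>1 u \<sigma>\<^sub>\<beta>(u\<^sup>* u)\<close>, extended by zero; the arguments \<open>s\<close> and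
  \<open>t\<close> are the sections \<open>\<sigma>\<^sub>\<beta>\<close> and \<open>\<sigma>\<^sub>\<gamma>\<close>.\<close>

definition middle ::
    "'a::complex_hilbert set \<Rightarrow> ('a set \<Rightarrow> ('a \<Rightarrow>\<^sub>L 'a)) \<Rightarrow> ('a set \<Rightarrow> ('a \<Rightarrow>\<^sub>L 'a)) \<Rightarrow>
     ('a \<Rightarrow>\<^sub>L 'a) \<Rightarrow> ('a \<Rightarrow>\<^sub>L 'a)" where
  "middle Hp s t u = op_inverse id_blinfun (t (fin u)) o\<^sub>L u o\<^sub>L s (ini u) o\<^sub>L proj Hp"

end

theory Submission
  imports Defs
begin

text \<open>Let \<open>P = u\<^sup>* u\<close> and \<open>Q = u u\<^sup>*\<close> be the initial and final projectors of a restricted partial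
  isometry \<open>u\<close>.  The unitary \<open>\<sigma>\<^sub>\<beta>(P)\<close> carries \<open>H\<^sub>+\<close> onto the range of \<open>P\<close>, so \<open>v = \<sigma>\<^sub>\<gamma>(Q)\<^sup>* u \<sigma>\<^sub>\<beta>(P)\<close> is a
  unitary of \<open>H\<^sub>+\<close> and \<open>u = \<sigma>\<^sub>\<gamma>(Q) v \<sigma>\<^sub>\<beta>(P)\<^sup>*\<close>.  Hence a chart is a bijection onto a product of three open sets,
  and its inverse is a product of smooth operator-valued functions; the transition maps are composed
  of this inverse, the sections, and the coordinate changes of \<open>Gr\<^sub>r\<^sub>e\<^sub>s\<close> and \<open>U\<^sub>+\<close>.  A change of graph
  coordinates is \<open>A \<mapsto> P\<^sub>W\<^sub>'\<^sup>\<bottom> (1 + A) (P\<^sub>W\<^sub>' (1 + A))\<^sup>-\<^sup>1\<close>, which is smooth in the Hilbert--Schmidt norm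
  as \<open>P\<^sub>W\<^sub>'\<^sup>\<bottom> P\<^sub>W\<close> is Hilbert--Schmidt; that in turn follows from the existence of one
  subspace with Hilbert--Schmidt coordinates in both charts, so no Fredholm theory is needed.\<close>

section \<open>Normed spaces and uniform families of differentiable maps\<close>

text \<open>The bijection is pure operator algebra; the obstacle is the calculus. The model spaces
  are subspaces with norms of their own, so library derivatives do not apply, and
  \<open>smooth_on\<close> asks for a whole sequence of multilinear derivatives with uniform
  remainders. It is therefore traded for a local notion \<open>smooth_at\<close>, equivalent to it
  on open sets and stable under sums, bounded bilinear maps, inversion of operators and composition
  with smooth maps. Three norms meet: the Hilbert-Schmidt norm of graph coordinates, the finer norm
  of \<open>lie_u_res\<close> for the sections, and the operator norm. The operator norm is the
  common ground: sections and charts of \<open>U_plus\<close> are translated from Cayley coordinates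
  into smooth operator-valued maps, and only the \<open>U_plus\<close> component of a transition map
  is translated back. Graph coordinates need more care: the inverse operator is controlled in
  operator norm only, so a Hilbert-Schmidt factor has to stay to its left.\<close>

locale normed_nspace =
  fixes E :: "'v::real_vector nspace"
  assumes subspace_vecs: "subspace (vecs E)"
    and nrm_nonneg [simp]: "0 \<le> nrm E x"
    and nrm_minus [simp]: "nrm E (- x) = nrm E x"
    and nrm_eq_0: "x \<in> vecs E \<Longrightarrow> nrm E x = 0 \<Longrightarrow> x = 0"
    and nrm_scaleR: "x \<in> vecs E \<Longrightarrow> nrm E (r *\<^sub>R x) = \<bar>r\<bar> * nrm E x"
    and nrm_triangle: "x \<in> vecs E \<Longrightarrow> y \<in> vecs E \<Longrightarrow> nrm E (x + y) \<le> nrm E x + nrm E y"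
begin

lemma zero_mem [simp]: "0 \<in> vecs E"
  and add_mem [simp]: "x \<in> vecs E \<Longrightarrow> y \<in> vecs E \<Longrightarrow> x + y \<in> vecs E"
  and scale_mem [simp]: "x \<in> vecs E \<Longrightarrow> r *\<^sub>R x \<in> vecs E"
  and minus_mem [simp]: "x \<in> vecs E \<Longrightarrow> - x \<in> vecs E"
  and diff_mem [simp]: "x \<in> vecs E \<Longrightarrow> y \<in> vecs E \<Longrightarrow> x - y \<in> vecs E"
  using subspace_vecs by (auto simp: subspace_0 subspace_add subspace_scale subspace_neg subspace_diff)

lemma sum_mem: "(\<And>i. i \<in> S \<Longrightarrow> f i \<in> vecs E) \<Longrightarrow> (\<Sum>i\<in>S. f i) \<in> vecs E"
  by (rule subspace_sum[OF subspace_vecs])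

lemma nrm_0 [simp]: "nrm E 0 = 0"
  using nrm_scaleR[of 0 0] by simp

lemma nrm_diff: "x \<in> vecs E \<Longrightarrow> y \<in> vecs E \<Longrightarrow> nrm E (x - y) \<le> nrm E x + nrm E y"
  using nrm_triangle[of x "- y"] by simp

lemma nrm_commute: "nrm E (x - y) = nrm E (y - x)"
  by (metis minus_diff_eq nrm_minus)

sublocale Metric_space "vecs E" "ndist E"
proof
  fix x y z assume "x \<in> vecs E" "y \<in> vecs E" "z \<in> vecs E"
  then show "ndist E x z \<le> ndist E x y + ndist E y z"
    using nrm_triangle[of "x - y" "y - z"] by simp
next
  fix x y assume "x \<in> vecs E" "y \<in> vecs E"
  then show "ndist E x y = 0 \<longleftrightarrow> x = y"
    using nrm_eq_0[of "x - y"] by auto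
qed (simp_all add: nrm_commute)

text \<open>Openness in terms of increments, the form in which \<open>smooth_on\<close> speaks of
  neighbourhoods.\<close>

lemma openin_ntop: "openin (ntop E) U \<longleftrightarrow>
    U \<subseteq> vecs E \<and> (\<forall>x\<in>U. \<exists>d>0. \<forall>h\<in>vecs E. nrm E h < d \<longrightarrow> x + h \<in> U)"
proof -
  have "mball x d \<subseteq> U \<longleftrightarrow> (\<forall>h\<in>vecs E. nrm E h < d \<longrightarrow> x + h \<in> U)" if "x \<in> vecs E" for x d
  proof
    assume *: "mball x d \<subseteq> U"
    show "\<forall>h\<in>vecs E. nrm E h < d \<longrightarrow> x + h \<in> U"
      using * that by (auto simp: subset_iff)
  next
    assume *: "\<forall>h\<in>vecs E. nrm E h < d \<longrightarrow> x + h \<in> U"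
    show "mball x d \<subseteq> U"
    proof
      fix y assume "y \<in> mball x d"
      then have "y - x \<in> vecs E" "nrm E (y - x) < d" by (auto simp: nrm_commute)
      with * show "y \<in> U" by fastforce
    qed
  qed
  then show ?thesis
    unfolding openin_mtopology by (meson subsetD)
qed

lemma openin_vecs: "openin (ntop E) U \<Longrightarrow> U \<subseteq> vecs E"
  by (simp add: openin_ntop)

end

text \<open>The locale demands nonnegativity and symmetry of the norm on the whole ambient type.
  This holds for \<open>norm\<close>, \<open>hs_norm\<close> and the sums built from them, and it
  spares membership conditions in the estimates.\<close>

lemma normed_nspaceI_banach:
  assumes "normed_nspace E" "Metric_space.mcomplete (vecs E) (ndist E)"
  shows "banach_space E"
proof -
  interpret normed_nspace E by fact
  show ?thesis
    unfolding banach_space_def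
    using assms subspace_vecs nrm_eq_0 nrm_scaleR nrm_triangle by auto
qed

text \<open>The neighbourhood filter of 0 in \<open>E\<close>, seen as a filter of increments. It
  turns the epsilon-delta clauses of \<open>smooth_on\<close> into \<open>eventually\<close>, so
  that finitely many smallness conditions combine by \<open>eventually_elim\<close>.\<close>

definition nsmall :: "'v::real_vector nspace \<Rightarrow> 'v filter" where
  "nsmall E = (INF d\<in>{0<..}. principal {h \<in> vecs E. nrm E h < d})"

lemma eventually_nsmall: "eventually P (nsmall E) \<longleftrightarrow> (\<exists>d>0. \<forall>h\<in>vecs E. nrm E h < d \<longrightarrow> P h)"
  unfolding nsmall_def
proof (subst eventually_INF_base)
  fix a b :: real assume "a \<in> {0<..}" "b \<in> {0<..}"
  then show "\<exists>x\<in>{0<..}. principal {h \<in> vecs E. nrm E h < x}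
      \<le> inf (principal {h \<in> vecs E. nrm E h < a}) (principal {h \<in> vecs E. nrm E h < b})"
    by (intro bexI[of _ "min a b"]) auto
qed (auto simp: eventually_principal)

lemma eventually_nsmall_mem: "\<forall>\<^sub>F h in nsmall E. h \<in> vecs E"
  by (auto simp: eventually_nsmall intro!: exI[of _ 1])

lemma eventually_nsmall_less: "0 < d \<Longrightarrow> \<forall>\<^sub>F h in nsmall E. nrm E h < d"
  by (auto simp: eventually_nsmall)

lemma eventually_nsmall_mult_less:
  assumes "0 < d" "0 \<le> L"
  shows "\<forall>\<^sub>F h in nsmall E. L * nrm E h < d"
proof -
  have "L * nrm E h < d" if "nrm E h < d / (L + 1)" "0 \<le> L" "0 < d" for h
  \<comment> \<open>\<open>E\<close> is arbitrary here, so \<open>nrm E h\<close> may be negative.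
    The \<open>+ 1\<close> in the radius covers \<open>L = 0\<close>.\<close>
  proof (cases "nrm E h \<le> 0")
    case True then show ?thesis using that
      by (smt (verit) mult_nonneg_nonpos)
  next
    case False
    then have "L * nrm E h \<le> (L + 1) * nrm E h" by (simp add: distrib_right)
    also have "\<dots> < d" using that by (simp add: field_simps)
    finally show ?thesis .
  qed
  with assms show ?thesis
    by (intro eventually_mono[OF eventually_nsmall_less[of "d / (L + 1)"]]) auto
qed

text \<open>The order-0 condition is boundedness, uniform in the family but only near each point.
  Continuity enters one order higher, through the Lipschitz estimate that a bounded derivative
  family yields.\<close>

definition locally_bounded :: "'v::real_vector nspace \<Rightarrow> 'w::real_vector nspace \<Rightarrow> 'v set \<Rightarrow> ('v \<Rightarrow> 'w) set \<Rightarrow> bool"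
  where "locally_bounded E F U \<F> \<longleftrightarrow> (\<forall>x\<in>U. (\<forall>f\<in>\<F>. f x \<in> vecs F) \<and>
    (\<exists>C. \<forall>\<^sub>F h in nsmall E. x + h \<in> U \<longrightarrow> (\<forall>f\<in>\<F>. nrm F (f (x + h)) \<le> C)))"

definition linear_between :: "'v::real_vector nspace \<Rightarrow> 'w::real_vector nspace \<Rightarrow> ('v \<Rightarrow> 'w) \<Rightarrow> bool"
  where "linear_between E F l \<longleftrightarrow> (\<forall>x\<in>vecs E. l x \<in> vecs F) \<and>
    (\<forall>x\<in>vecs E. \<forall>y\<in>vecs E. \<forall>a b. l (a *\<^sub>R x + b *\<^sub>R y) = a *\<^sub>R l x + b *\<^sub>R l y)"

text \<open>A function is paired with a chosen derivative, because \<open>U\<close> need not be open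
  and the derivative need not be unique. The remainder is uniform over the family: applied to the
  values of a multilinear derivative on unit vectors, this is Frechet differentiability in the
  operator norm.\<close>

definition unif_deriv ::
  "'v::real_vector nspace \<Rightarrow> 'w::real_vector nspace \<Rightarrow> 'v set \<Rightarrow> (('v \<Rightarrow> 'w) \<times> ('v \<Rightarrow> 'v \<Rightarrow> 'w)) set \<Rightarrow> bool"
  where "unif_deriv E F U P \<longleftrightarrow> (\<forall>x\<in>U. (\<forall>(f, f')\<in>P. linear_between E F (f' x)) \<and>
    (\<forall>\<epsilon>>0. \<forall>\<^sub>F h in nsmall E. x + h \<in> U \<longrightarrow>
       (\<forall>(f, f')\<in>P. nrm F (f (x + h) - f x - f' x h) \<le> \<epsilon> * nrm E h)))"

text \<open>Directions run through the closed unit ball, so a uniform bound for this family is a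
  bound for the operator norms of the derivatives.\<close>

definition deriv_family :: "'v nspace \<Rightarrow> (('v \<Rightarrow> 'w) \<times> ('v \<Rightarrow> 'v \<Rightarrow> 'w)) set \<Rightarrow> ('v \<Rightarrow> 'w) set"
  where "deriv_family E P = {\<lambda>x. f' x h | f f' h. (f, f') \<in> P \<and> h \<in> vecs E \<and> nrm E h \<le> 1}"

text \<open>A set of functions replaces the operator-valued derivative: the directional derivatives in
  unit directions form again a set of functions between the same spaces, so that differentiability
  of every finite order is defined by a recursion that does not change the types.\<close>

primrec equi_C ::
  "nat \<Rightarrow> 'v::real_vector nspace \<Rightarrow> 'w::real_vector nspace \<Rightarrow> 'v set \<Rightarrow> ('v \<Rightarrow> 'w) set \<Rightarrow> bool" where
  "equi_C 0 E F U \<F> \<longleftrightarrow> locally_bounded E F U \<F>"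
| "equi_C (Suc n) E F U \<F> \<longleftrightarrow> locally_bounded E F U \<F> \<and>
    (\<exists>P. \<F> \<subseteq> fst ` P \<and> unif_deriv E F U P \<and> equi_C n E F U (deriv_family E P))"

lemma locally_boundedD:
  assumes "locally_bounded E F U \<F>" "x \<in> U"
  shows "\<And>f. f \<in> \<F> \<Longrightarrow> f x \<in> vecs F"
    and "\<exists>C\<ge>0. \<forall>\<^sub>F h in nsmall E. x + h \<in> U \<longrightarrow> (\<forall>f\<in>\<F>. nrm F (f (x + h)) \<le> C)"
proof -
  obtain C where C: "\<forall>\<^sub>F h in nsmall E. x + h \<in> U \<longrightarrow> (\<forall>f\<in>\<F>. nrm F (f (x + h)) \<le> C)"
    using assms unfolding locally_bounded_def by blast
  show "\<exists>C\<ge>0. \<forall>\<^sub>F h in nsmall E. x + h \<in> U \<longrightarrow> (\<forall>f\<in>\<F>. nrm F (f (x + h)) \<le> C)"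
    by (rule exI[of _ "max C 0"]) (use C in \<open>auto elim!: eventually_mono\<close>)
qed (use assms in \<open>auto simp: locally_bounded_def\<close>)

lemma locally_bounded_at:
  assumes "locally_bounded E F U \<F>" "x \<in> U" "normed_nspace E"
  shows "\<exists>C\<ge>0. \<forall>f\<in>\<F>. nrm F (f x) \<le> C"
proof -
  interpret E: normed_nspace E by fact
  obtain C where "C \<ge> 0" "\<forall>\<^sub>F h in nsmall E. x + h \<in> U \<longrightarrow> (\<forall>f\<in>\<F>. nrm F (f (x + h)) \<le> C)"
    using locally_boundedD(2)[OF assms(1,2)] by blast
  then obtain d where "d > 0" "\<And>h. h \<in> vecs E \<Longrightarrow> nrm E h < d \<Longrightarrow> x + h \<in> U \<Longrightarrow> \<forall>f\<in>\<F>. nrm F (f (x + h)) \<le> C"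
    unfolding eventually_nsmall by blast
  from this(1) this(2)[of 0] show ?thesis using \<open>x \<in> U\<close> \<open>C \<ge> 0\<close> by auto
qed

lemma linear_betweenD:
  assumes "linear_between E F l"
  shows "x \<in> vecs E \<Longrightarrow> l x \<in> vecs F"
    and "x \<in> vecs E \<Longrightarrow> y \<in> vecs E \<Longrightarrow> l (a *\<^sub>R x + b *\<^sub>R y) = a *\<^sub>R l x + b *\<^sub>R l y"
    and "x \<in> vecs E \<Longrightarrow> y \<in> vecs E \<Longrightarrow> l (x + y) = l x + l y"
    and "x \<in> vecs E \<Longrightarrow> y \<in> vecs E \<Longrightarrow> l (x - y) = l x - l y"
    and "x \<in> vecs E \<Longrightarrow> l (a *\<^sub>R x) = a *\<^sub>R l x"
proof -
  have *: "x \<in> vecs E \<Longrightarrow> y \<in> vecs E \<Longrightarrow> l (a *\<^sub>R x + b *\<^sub>R y) = a *\<^sub>R l x + b *\<^sub>R l y" for x y a b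
    using assms by (auto simp: linear_between_def)
  show "x \<in> vecs E \<Longrightarrow> l x \<in> vecs F"
    using assms by (auto simp: linear_between_def)
  show "x \<in> vecs E \<Longrightarrow> y \<in> vecs E \<Longrightarrow> l (a *\<^sub>R x + b *\<^sub>R y) = a *\<^sub>R l x + b *\<^sub>R l y"
    by (rule *)
  show "x \<in> vecs E \<Longrightarrow> y \<in> vecs E \<Longrightarrow> l (x + y) = l x + l y"
    using *[of x y 1 1] by simp
  show "x \<in> vecs E \<Longrightarrow> y \<in> vecs E \<Longrightarrow> l (x - y) = l x - l y"
    using *[of x y 1 "- 1"] by simp
  show "x \<in> vecs E \<Longrightarrow> l (a *\<^sub>R x) = a *\<^sub>R l x"
    using *[of x x a 0] by simp
qed

lemma linear_between_unit_bound:
  assumes "normed_nspace E" "normed_nspace F" "linear_between E F l" "h \<in> vecs E"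
    and b: "\<And>k. k \<in> vecs E \<Longrightarrow> nrm E k \<le> 1 \<Longrightarrow> nrm F (l k) \<le> C"
  shows "nrm F (l h) \<le> C * nrm E h"
proof -
  interpret E: normed_nspace E by fact
  interpret F: normed_nspace F by fact
  note l = linear_betweenD[OF assms(3)]
  show ?thesis
  proof (cases "nrm E h = 0")
    case True
    then have "h = 0" using E.nrm_eq_0 assms(4) by auto
    then have "l h = 0" using l(5)[of 0 0] by simp
    then show ?thesis using True by simp
  next
    case False
    then have p: "nrm E h > 0" using E.nrm_nonneg[of h] by linarith
    let ?k = "(1 / nrm E h) *\<^sub>R h"
    have "nrm F (l ?k) \<le> C"
      using assms(4) p by (intro b) (auto simp: E.nrm_scaleR)
    then show ?thesis
      using assms(4) p l(1,5)[of h] by (simp add: F.nrm_scaleR field_simps)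
  qed
qed

lemma unif_derivD:
  assumes "unif_deriv E F U P" "x \<in> U"
  shows "\<And>f f'. (f, f') \<in> P \<Longrightarrow> linear_between E F (f' x)"
    and "\<And>\<epsilon>. \<epsilon> > 0 \<Longrightarrow> \<forall>\<^sub>F h in nsmall E. x + h \<in> U \<longrightarrow>
       (\<forall>f f'. (f, f') \<in> P \<longrightarrow> nrm F (f (x + h) - f x - f' x h) \<le> \<epsilon> * nrm E h)"
proof -
  have *: "(\<forall>(f, f')\<in>P. linear_between E F (f' x)) \<and>
    (\<forall>\<epsilon>>0. \<forall>\<^sub>F h in nsmall E. x + h \<in> U \<longrightarrow>
       (\<forall>(f, f')\<in>P. nrm F (f (x + h) - f x - f' x h) \<le> \<epsilon> * nrm E h))"
    using assms unfolding unif_deriv_def by blast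
  show "linear_between E F (f' x)" if "(f, f') \<in> P" for f f'
    using * that by blast
  fix \<epsilon> :: real assume "\<epsilon> > 0"
  with * have "\<forall>\<^sub>F h in nsmall E. x + h \<in> U \<longrightarrow>
       (\<forall>(f, f')\<in>P. nrm F (f (x + h) - f x - f' x h) \<le> \<epsilon> * nrm E h)" by blast
  then show "\<forall>\<^sub>F h in nsmall E. x + h \<in> U \<longrightarrow>
       (\<forall>f f'. (f, f') \<in> P \<longrightarrow> nrm F (f (x + h) - f x - f' x h) \<le> \<epsilon> * nrm E h)"
    by eventually_elim blast
qed

lemma unif_derivI:
  assumes "\<And>x f f'. x \<in> U \<Longrightarrow> (f, f') \<in> P \<Longrightarrow> linear_between E F (f' x)"
    and "\<And>x \<epsilon>. x \<in> U \<Longrightarrow> \<epsilon> > 0 \<Longrightarrow> \<forall>\<^sub>F h in nsmall E. x + h \<in> U \<longrightarrow>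
       (\<forall>f f'. (f, f') \<in> P \<longrightarrow> nrm F (f (x + h) - f x - f' x h) \<le> \<epsilon> * nrm E h)"
  shows "unif_deriv E F U P"
  unfolding unif_deriv_def
proof (intro ballI conjI allI impI)
  fix x p assume "x \<in> U" "p \<in> P"
  then show "case p of (f, f') \<Rightarrow> linear_between E F (f' x)"
    using assms(1) by (cases p) auto
next
  fix x and \<epsilon> :: real assume "x \<in> U" "\<epsilon> > 0"
  from assms(2)[OF this] show "\<forall>\<^sub>F h in nsmall E. x + h \<in> U \<longrightarrow>
       (\<forall>(f, f')\<in>P. nrm F (f (x + h) - f x - f' x h) \<le> \<epsilon> * nrm E h)"
    by eventually_elim blast
qed

text \<open>If \<open>C\<close> bounds the derivative family at \<open>x\<close>, the remainder
  estimate with \<epsilon> = 1 gives the constant \<open>C + 1\<close> for increments; the same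
  constant serves for the derivatives. This estimate plays the part of continuity in the product
  rule, the chain rule and the inversion of operators.\<close>

lemma unif_deriv_lipschitz:
  assumes "normed_nspace E" "normed_nspace F" and P: "unif_deriv E F U P"
    and b: "locally_bounded E F U (deriv_family E P)" and "x \<in> U"
    and bf: "locally_bounded E F U (fst ` P)"
  obtains L where "L \<ge> 0" "\<forall>f f' h. (f, f') \<in> P \<longrightarrow> h \<in> vecs E \<longrightarrow> nrm F (f' x h) \<le> L * nrm E h"
    "\<forall>\<^sub>F h in nsmall E. x + h \<in> U \<longrightarrow> (\<forall>f f'. (f, f') \<in> P \<longrightarrow> nrm F (f (x + h) - f x) \<le> L * nrm E h)"
proof -
  interpret E: normed_nspace E by fact
  interpret F: normed_nspace F by fact
  obtain C where C: "C \<ge> 0" "\<And>f. f \<in> deriv_family E P \<Longrightarrow> nrm F (f x) \<le> C"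
    using locally_bounded_at[OF b \<open>x \<in> U\<close> assms(1)] by blast
  have 1: "nrm F (f' x h) \<le> C * nrm E h" if "(f, f') \<in> P" "h \<in> vecs E" for f f' h
  proof (rule linear_between_unit_bound[OF assms(1,2) unif_derivD(1)[OF P \<open>x \<in> U\<close> that(1)] that(2)])
    fix k assume "k \<in> vecs E" "nrm E k \<le> 1"
    with that have "(\<lambda>x. f' x k) \<in> deriv_family E P" unfolding deriv_family_def by blast
    with C(2) show "nrm F (f' x k) \<le> C" by blast
  qed
  show ?thesis
  proof (rule that[of "C + 1"])
    have "nrm F (f' x h) \<le> (C + 1) * nrm E h" if "(f, f') \<in> P" "h \<in> vecs E" for f f' h
      using 1[OF that] E.nrm_nonneg[of h] by (simp add: distrib_right del: E.nrm_nonneg)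
    then show "\<forall>f f' h. (f, f') \<in> P \<longrightarrow> h \<in> vecs E \<longrightarrow> nrm F (f' x h) \<le> (C + 1) * nrm E h" by blast
    show "\<forall>\<^sub>F h in nsmall E. x + h \<in> U \<longrightarrow> (\<forall>f f'. (f, f') \<in> P \<longrightarrow> nrm F (f (x + h) - f x) \<le> (C + 1) * nrm E h)"
      using unif_derivD(2)[OF P \<open>x \<in> U\<close>, of 1, simplified] eventually_nsmall_mem
    proof eventually_elim
      case (elim h)
      show ?case
      proof safe
        fix f f' assume a: "x + h \<in> U" "(f, f') \<in> P"
        then have f: "f \<in> fst ` P" by force
        have m: "f (x + h) \<in> vecs F" "f x \<in> vecs F"
          using locally_boundedD(1)[OF bf] a(1) \<open>x \<in> U\<close> f by auto
        have m': "f' x h \<in> vecs F"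
          using linear_betweenD(1)[OF unif_derivD(1)[OF P \<open>x \<in> U\<close> a(2)]] elim by auto
        have "nrm F ((f (x + h) - f x - f' x h) + f' x h) \<le> nrm E h + C * nrm E h"
          using elim a 1[OF a(2), of h] m m'
          by (intro order.trans[OF F.nrm_triangle]) (auto intro!: add_mono)
        then show "nrm F (f (x + h) - f x) \<le> (C + 1) * nrm E h"
          by (simp add: distrib_right add.commute)
      qed
    qed
  qed (use C in simp)
qed

lemma locally_bounded_mono:
  assumes "locally_bounded E F U \<F>" "\<G> \<subseteq> \<F>" "V \<subseteq> U"
  shows "locally_bounded E F V \<G>"
proof -
  have "(\<exists>C. \<forall>\<^sub>F h in nsmall E. x + h \<in> V \<longrightarrow> (\<forall>f\<in>\<G>. nrm F (f (x + h)) \<le> C)) \<and> (\<forall>f\<in>\<G>. f x \<in> vecs F)" if "x \<in> V" for x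
  proof -
    have "x \<in> U" using that assms by auto
    from locally_boundedD[OF assms(1) this] obtain C where
      "\<forall>\<^sub>F h in nsmall E. x + h \<in> U \<longrightarrow> (\<forall>f\<in>\<F>. nrm F (f (x + h)) \<le> C)" by blast
    then have "\<forall>\<^sub>F h in nsmall E. x + h \<in> V \<longrightarrow> (\<forall>f\<in>\<G>. nrm F (f (x + h)) \<le> C)"
      by eventually_elim (use assms in auto)
    then show ?thesis using locally_boundedD(1)[OF assms(1) \<open>x \<in> U\<close>] assms(2) by blast
  qed
  then show ?thesis unfolding locally_bounded_def by blast
qed

lemma equi_C_locally_bounded: "equi_C n E F U \<F> \<Longrightarrow> locally_bounded E F U \<F>"
  by (cases n) auto

lemma equi_C_mono:
  assumes "equi_C n E F U \<F>" "\<G> \<subseteq> \<F>" "V \<subseteq> U"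
  shows "equi_C n E F V \<G>"
  using assms
proof (induction n arbitrary: \<F> \<G>)
  case 0 then show ?case by (auto intro: locally_bounded_mono)
next
  case (Suc n)
  then obtain P where P: "\<F> \<subseteq> fst ` P" "unif_deriv E F U P" "equi_C n E F U (deriv_family E P)" by auto
  have "unif_deriv E F V P"
  proof (rule unif_derivI)
    fix x \<epsilon> assume "x \<in> V" "(\<epsilon>::real) > 0"
    then have "x \<in> U" using Suc.prems by auto
    from unif_derivD(2)[OF P(2) this \<open>\<epsilon> > 0\<close>]
    show "\<forall>\<^sub>F h in nsmall E. x + h \<in> V \<longrightarrow>
       (\<forall>f f'. (f, f') \<in> P \<longrightarrow> nrm F (f (x + h) - f x - f' x h) \<le> \<epsilon> * nrm E h)"
      by eventually_elim (use Suc.prems in auto)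
  qed (use unif_derivD(1)[OF P(2)] Suc.prems in blast)
  moreover have "equi_C n E F V (deriv_family E P)"
    using Suc.IH[OF P(3)] Suc.prems by blast
  moreover have "locally_bounded E F V \<G>"
    using Suc.prems by (auto intro: locally_bounded_mono)
  ultimately show ?case using P(1) Suc.prems by auto
qed

lemma equi_C_SucD: "equi_C (Suc n) E F U \<F> \<Longrightarrow> equi_C n E F U \<F>"
proof (induction n arbitrary: \<F>)
  case 0 then show ?case by simp
next
  case (Suc n) then show ?case by (metis equi_C.simps(2))
qed

lemma equi_C_le: "equi_C n E F U \<F> \<Longrightarrow> m \<le> n \<Longrightarrow> equi_C m E F U \<F>"
  by (induction n) (auto simp: le_Suc_eq dest: equi_C_SucD simp del: equi_C.simps)

text \<open>The definition asks only for an inclusion, which is easy to establish. Discarding the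
  pairs whose function lies outside the family gives the equality that is convenient to use.\<close>

lemma equi_C_SucE:
  assumes "equi_C (Suc n) E F U \<F>"
  obtains P where "\<F> = fst ` P" "unif_deriv E F U P" "equi_C n E F U (deriv_family E P)"
proof -
  obtain P where P: "\<F> \<subseteq> fst ` P" "unif_deriv E F U P" "equi_C n E F U (deriv_family E P)"
    using assms by auto
  let ?Q = "{p \<in> P. fst p \<in> \<F>}"
  have "unif_deriv E F U ?Q"
  proof (rule unif_derivI)
    fix x \<epsilon> assume "x \<in> U" "(\<epsilon>::real) > 0"
    from unif_derivD(2)[OF P(2) this]
    show "\<forall>\<^sub>F h in nsmall E. x + h \<in> U \<longrightarrow>
       (\<forall>f f'. (f, f') \<in> ?Q \<longrightarrow> nrm F (f (x + h) - f x - f' x h) \<le> \<epsilon> * nrm E h)"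
      by eventually_elim blast
  qed (use unif_derivD(1)[OF P(2)] in blast)
  moreover have "equi_C n E F U (deriv_family E ?Q)"
    by (rule equi_C_mono[OF P(3)]) (auto simp: deriv_family_def)
  moreover have "\<F> = fst ` ?Q" using P(1) by force
  ultimately show ?thesis using that by blast
qed

text \<open>Only values on \<open>U\<close> count: the old derivative is kept and attached to the
  new function, which agrees with the old one on \<open>U\<close>.\<close>

lemma equi_C_cong:
  assumes "equi_C n E F U \<F>" "\<And>g. g \<in> \<G> \<Longrightarrow> \<exists>f\<in>\<F>. \<forall>x\<in>U. f x = g x"
  shows "equi_C n E F U \<G>"
proof -
  have b: "locally_bounded E F U \<G>"
  proof -
    have "(\<exists>C. \<forall>\<^sub>F h in nsmall E. x + h \<in> U \<longrightarrow> (\<forall>f\<in>\<G>. nrm F (f (x + h)) \<le> C)) \<and> (\<forall>f\<in>\<G>. f x \<in> vecs F)" if "x \<in> U" for x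
    proof -
      note b = locally_boundedD[OF equi_C_locally_bounded[OF assms(1)] that]
      from b(2) obtain C where
        "\<forall>\<^sub>F h in nsmall E. x + h \<in> U \<longrightarrow> (\<forall>f\<in>\<F>. nrm F (f (x + h)) \<le> C)" by blast
      then have "\<forall>\<^sub>F h in nsmall E. x + h \<in> U \<longrightarrow> (\<forall>f\<in>\<G>. nrm F (f (x + h)) \<le> C)"
        by eventually_elim (use assms(2) in metis)
      moreover have "\<forall>f\<in>\<G>. f x \<in> vecs F" using b(1) assms(2) that by metis
      ultimately show ?thesis by blast
    qed
    then show ?thesis unfolding locally_bounded_def by blast
  qed
  show ?thesis
  proof (cases n)
    case 0 with b show ?thesis by simp
  next
    case (Suc m)
    with assms obtain P where P: "\<F> = fst ` P" "unif_deriv E F U P" "equi_C m E F U (deriv_family E P)"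
      using equi_C_SucE by blast
    let ?Q = "{(g, f') | g f f'. (f, f') \<in> P \<and> (\<forall>x\<in>U. f x = g x)}"
    have "unif_deriv E F U ?Q"
    proof (rule unif_derivI)
      fix x \<epsilon> assume "x \<in> U" "(\<epsilon>::real) > 0"
      from unif_derivD(2)[OF P(2) this]
      show "\<forall>\<^sub>F h in nsmall E. x + h \<in> U \<longrightarrow>
         (\<forall>f f'. (f, f') \<in> ?Q \<longrightarrow> nrm F (f (x + h) - f x - f' x h) \<le> \<epsilon> * nrm E h)"
        by eventually_elim (use \<open>x \<in> U\<close> in force)
    qed (use unif_derivD(1)[OF P(2)] in blast)
    moreover have "equi_C m E F U (deriv_family E ?Q)"
      by (rule equi_C_mono[OF P(3)]) (auto simp: deriv_family_def)
    moreover have "\<G> \<subseteq> fst ` ?Q"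
    proof
      fix g assume "g \<in> \<G>"
      with assms(2) obtain f where "f \<in> \<F>" "\<forall>x\<in>U. f x = g x" by blast
      moreover then obtain f' where "(f, f') \<in> P" using P(1) by auto
      ultimately have "(g, f') \<in> ?Q" by blast
      then show "g \<in> fst ` ?Q" by force
    qed
    ultimately show ?thesis using b Suc by auto
  qed
qed

section \<open>Rules of calculus for families: unions, constants, sums, products, linear
  maps\<close>

lemma deriv_familyI:
  "(f, f') \<in> P \<Longrightarrow> h \<in> vecs E \<Longrightarrow> nrm E h \<le> 1 \<Longrightarrow> (\<lambda>x. f' x h) \<in> deriv_family E P"
  by (auto simp: deriv_family_def)

lemma deriv_familyE:
  assumes "k \<in> deriv_family E P"
  obtains f f' h where "k = (\<lambda>x. f' x h)" "(f, f') \<in> P" "h \<in> vecs E" "nrm E h \<le> 1"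
  using assms by (auto simp: deriv_family_def)

lemma equi_C_Un:
  assumes "equi_C n E F U \<F>" "equi_C n E F U \<G>"
  shows "equi_C n E F U (\<F> \<union> \<G>)"
  using assms
proof (induction n arbitrary: \<F> \<G>)
  case 0
  have "(\<exists>C. \<forall>\<^sub>F h in nsmall E. x + h \<in> U \<longrightarrow> (\<forall>f\<in>\<F> \<union> \<G>. nrm F (f (x + h)) \<le> C)) \<and> (\<forall>f\<in>\<F> \<union> \<G>. f x \<in> vecs F)"
    if x: "x \<in> U" for x
  proof -
    have b: "locally_bounded E F U \<F>" "locally_bounded E F U \<G>" using 0 by auto
    obtain C where C: "\<forall>\<^sub>F h in nsmall E. x + h \<in> U \<longrightarrow> (\<forall>f\<in>\<F>. nrm F (f (x + h)) \<le> C)"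
      using locally_boundedD(2)[OF b(1) x] by blast
    obtain D where D: "\<forall>\<^sub>F h in nsmall E. x + h \<in> U \<longrightarrow> (\<forall>f\<in>\<G>. nrm F (f (x + h)) \<le> D)"
      using locally_boundedD(2)[OF b(2) x] by blast
    from C D have "\<forall>\<^sub>F h in nsmall E. x + h \<in> U \<longrightarrow> (\<forall>f\<in>\<F> \<union> \<G>. nrm F (f (x + h)) \<le> max C D)"
      by eventually_elim fastforce
    moreover have "\<forall>f\<in>\<F> \<union> \<G>. f x \<in> vecs F"
      using locally_boundedD(1)[OF b(1) x] locally_boundedD(1)[OF b(2) x] by blast
    ultimately show ?thesis by blast
  qed
  then show ?case by (simp add: locally_bounded_def)
next
  case (Suc n)
  obtain P where P: "\<F> = fst ` P" "unif_deriv E F U P" "equi_C n E F U (deriv_family E P)"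
    using Suc.prems(1) by (rule equi_C_SucE)
  obtain Q where Q: "\<G> = fst ` Q" "unif_deriv E F U Q" "equi_C n E F U (deriv_family E Q)"
    using Suc.prems(2) by (rule equi_C_SucE)
  have "unif_deriv E F U (P \<union> Q)"
  proof (rule unif_derivI)
    fix x and \<epsilon> :: real assume "x \<in> U" "\<epsilon> > 0"
    from unif_derivD(2)[OF P(2) this] unif_derivD(2)[OF Q(2) this]
    show "\<forall>\<^sub>F h in nsmall E. x + h \<in> U \<longrightarrow>
       (\<forall>f f'. (f, f') \<in> P \<union> Q \<longrightarrow> nrm F (f (x + h) - f x - f' x h) \<le> \<epsilon> * nrm E h)"
      by eventually_elim blast
  qed (use unif_derivD(1)[OF P(2)] unif_derivD(1)[OF Q(2)] in blast)
  moreover have "deriv_family E (P \<union> Q) = deriv_family E P \<union> deriv_family E Q"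
    by (auto simp: deriv_family_def)
  moreover have "locally_bounded E F U (\<F> \<union> \<G>)"
    using Suc.IH[of \<F> \<G>] Suc.prems equi_C_SucD equi_C_locally_bounded by blast
  ultimately show ?case
    using Suc.IH[OF P(3) Q(3)] P(1) Q(1) by (auto intro!: exI[of _ "P \<union> Q"])
qed

lemma linear_between_zero: "normed_nspace F \<Longrightarrow> linear_between E F (\<lambda>h. 0)"
  by (simp add: linear_between_def normed_nspace.zero_mem)

lemma equi_C_const:
  assumes "normed_nspace E" "normed_nspace F" "\<And>c. c \<in> S \<Longrightarrow> c \<in> vecs F \<and> nrm F c \<le> C"
  shows "equi_C n E F U ((\<lambda>c x. c) ` S)"
  using assms(3)
proof (induction n arbitrary: S C)
  case 0 then show ?case by (auto simp: locally_bounded_def intro!: exI[of _ C] always_eventually)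
next
  case (Suc n)
  interpret E: normed_nspace E by fact
  interpret F: normed_nspace F by fact
  let ?P = "(\<lambda>c. (\<lambda>x. c, \<lambda>x h. 0)) ` S"
  have "unif_deriv E F U ?P"
    by (rule unif_derivI) (auto simp: linear_between_zero[OF assms(2)] intro!: always_eventually)
  moreover have "equi_C n E F U ((\<lambda>c x. c) ` {0})"
    by (rule Suc.IH) auto
  then have "equi_C n E F U (deriv_family E ?P)"
    by (rule equi_C_mono) (auto simp: deriv_family_def)
  moreover have "locally_bounded E F U ((\<lambda>c x. c) ` S)"
    using Suc.prems by (auto simp: locally_bounded_def intro!: exI[of _ C] always_eventually)
  ultimately show ?case by (auto simp: image_comp o_def intro!: exI[of _ ?P])
qed

text \<open>The two members are chosen independently: the product rule pairs every derivative of one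
  factor with every member of the other family.\<close>

definition pointwise2 :: "('a \<Rightarrow> 'b \<Rightarrow> 'c) \<Rightarrow> ('v \<Rightarrow> 'a) set \<Rightarrow> ('v \<Rightarrow> 'b) set \<Rightarrow> ('v \<Rightarrow> 'c) set"
  where "pointwise2 b \<F> \<G> = {\<lambda>x. b (f x) (g x) | f g. f \<in> \<F> \<and> g \<in> \<G>}"

lemma pointwise2I: "f \<in> \<F> \<Longrightarrow> g \<in> \<G> \<Longrightarrow> (\<lambda>x. b (f x) (g x)) \<in> pointwise2 b \<F> \<G>"
  by (auto simp: pointwise2_def)

lemma equi_C_add:
  assumes "normed_nspace E" "normed_nspace F" "equi_C n E F U \<F>" "equi_C n E F U \<G>"
  shows "equi_C n E F U (pointwise2 (+) \<F> \<G>)"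
proof -
  interpret F: normed_nspace F by fact
  have b: "locally_bounded E F U (pointwise2 (+) \<F> \<G>)"
    if bb: "locally_bounded E F U \<F>" "locally_bounded E F U \<G>" for \<F> \<G> :: "('a \<Rightarrow> 'b) set"
    unfolding locally_bounded_def
  proof (intro ballI conjI)
    fix x assume "x \<in> U"
    obtain C where C: "\<forall>\<^sub>F h in nsmall E. x + h \<in> U \<longrightarrow> (\<forall>f\<in>\<F>. nrm F (f (x + h)) \<le> C)"
      using locally_boundedD(2)[OF bb(1) \<open>x \<in> U\<close>] by blast
    obtain D where D: "\<forall>\<^sub>F h in nsmall E. x + h \<in> U \<longrightarrow> (\<forall>f\<in>\<G>. nrm F (f (x + h)) \<le> D)"
      using locally_boundedD(2)[OF bb(2) \<open>x \<in> U\<close>] by blast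
    have "\<forall>\<^sub>F h in nsmall E. x + h \<in> U \<longrightarrow> (\<forall>f\<in>pointwise2 (+) \<F> \<G>. nrm F (f (x + h)) \<le> C + D)"
      using C D
    proof eventually_elim
      case (elim h)
      { fix f g assume fg: "f \<in> \<F>" "g \<in> \<G>" "x + h \<in> U"
        have "nrm F (f (x + h) + g (x + h)) \<le> nrm F (f (x + h)) + nrm F (g (x + h))"
          using fg locally_boundedD(1)[OF bb(1)] locally_boundedD(1)[OF bb(2)] by (intro F.nrm_triangle) blast+
        also have "\<dots> \<le> C + D" using fg elim by (intro add_mono) auto
        finally have "nrm F (f (x + h) + g (x + h)) \<le> C + D" . }
      then show ?case unfolding pointwise2_def by blast
    qed
    then show "\<exists>C. \<forall>\<^sub>F h in nsmall E. x + h \<in> U \<longrightarrow> (\<forall>f\<in>pointwise2 (+) \<F> \<G>. nrm F (f (x + h)) \<le> C)"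
      by blast
    show "f x \<in> vecs F" if "f \<in> pointwise2 (+) \<F> \<G>" for f
      using that locally_boundedD(1)[OF bb(1) \<open>x \<in> U\<close>] locally_boundedD(1)[OF bb(2) \<open>x \<in> U\<close>]
      by (auto simp: pointwise2_def)
  qed
  show ?thesis using assms(3,4)
  proof (induction n arbitrary: \<F> \<G>)
    case 0 then show ?case by (simp add: b)
  next
    case (Suc n)
    obtain P where P: "\<F> = fst ` P" "unif_deriv E F U P" "equi_C n E F U (deriv_family E P)"
      using Suc.prems(1) by (rule equi_C_SucE)
    obtain Q where Q: "\<G> = fst ` Q" "unif_deriv E F U Q" "equi_C n E F U (deriv_family E Q)"
      using Suc.prems(2) by (rule equi_C_SucE)
    note bF = equi_C_locally_bounded[OF Suc.prems(1)] and bG = equi_C_locally_bounded[OF Suc.prems(2)]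
    let ?R = "{(\<lambda>x. f x + g x, \<lambda>x h. f' x h + g' x h) | f f' g g'. (f, f') \<in> P \<and> (g, g') \<in> Q}"
    have "unif_deriv E F U ?R"
    proof (rule unif_derivI)
      fix x f f' assume "x \<in> U" "(f, f') \<in> ?R"
      then obtain f1 f1' g1 g1' where *: "(f1, f1') \<in> P" "(g1, g1') \<in> Q" "f' = (\<lambda>x h. f1' x h + g1' x h)"
        by blast
      note l = unif_derivD(1)[OF P(2) \<open>x \<in> U\<close> *(1)] unif_derivD(1)[OF Q(2) \<open>x \<in> U\<close> *(2)]
      show "linear_between E F (f' x)"
        unfolding linear_between_def *(3)
        using linear_betweenD(1,2)[OF l(1)] linear_betweenD(1,2)[OF l(2)] by (simp add: algebra_simps)
    next
      fix x and \<epsilon> :: real assume "x \<in> U" "\<epsilon> > 0"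
      then have "\<epsilon> / 2 > 0" by simp
      from unif_derivD(2)[OF P(2) \<open>x \<in> U\<close> this] unif_derivD(2)[OF Q(2) \<open>x \<in> U\<close> this] eventually_nsmall_mem
      show "\<forall>\<^sub>F h in nsmall E. x + h \<in> U \<longrightarrow>
         (\<forall>f f'. (f, f') \<in> ?R \<longrightarrow> nrm F (f (x + h) - f x - f' x h) \<le> \<epsilon> * nrm E h)"
      proof eventually_elim
        case (elim h)
        show ?case
        proof (intro impI allI)
          fix f f' assume "x + h \<in> U" "(f, f') \<in> ?R"
          then obtain f1 f1' g1 g1' where *: "(f1, f1') \<in> P" "(g1, g1') \<in> Q" "f = (\<lambda>x. f1 x + g1 x)"
            "f' = (\<lambda>x h. f1' x h + g1' x h)" by blast
          then have fg: "f1 \<in> \<F>" "g1 \<in> \<G>" using P(1) Q(1) by force+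
          have m: "f1 (x + h) \<in> vecs F" "f1 x \<in> vecs F" "g1 (x + h) \<in> vecs F" "g1 x \<in> vecs F"
              "f1' x h \<in> vecs F" "g1' x h \<in> vecs F"
            using locally_boundedD(1)[OF bF _ fg(1)] locally_boundedD(1)[OF bG _ fg(2)] \<open>x \<in> U\<close> \<open>x + h \<in> U\<close>
              linear_betweenD(1)[OF unif_derivD(1)[OF P(2) \<open>x \<in> U\<close> *(1)]]
              linear_betweenD(1)[OF unif_derivD(1)[OF Q(2) \<open>x \<in> U\<close> *(2)]] elim(3) by auto
          have "f (x + h) - f x - f' x h = (f1 (x + h) - f1 x - f1' x h) + (g1 (x + h) - g1 x - g1' x h)"
            by (simp add: * algebra_simps)
          also have "nrm F \<dots> \<le> nrm F (f1 (x + h) - f1 x - f1' x h) + nrm F (g1 (x + h) - g1 x - g1' x h)"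
            using m by (intro F.nrm_triangle) auto
          also have "\<dots> \<le> \<epsilon> / 2 * nrm E h + \<epsilon> / 2 * nrm E h"
            using elim * \<open>x + h \<in> U\<close> by (intro add_mono) blast+
          finally show "nrm F (f (x + h) - f x - f' x h) \<le> \<epsilon> * nrm E h" by simp
        qed
      qed
    qed
    moreover have "equi_C n E F U (deriv_family E ?R)"
    proof (rule equi_C_mono[OF Suc.IH[OF P(3) Q(3)]])
      show "deriv_family E ?R \<subseteq> pointwise2 (+) (deriv_family E P) (deriv_family E Q)"
      proof
        fix k assume "k \<in> deriv_family E ?R"
        then obtain f f' g g' h where "(f, f') \<in> P" "(g, g') \<in> Q" "h \<in> vecs E" "nrm E h \<le> 1"
          and k: "k = (\<lambda>x. f' x h + g' x h)" by (elim deriv_familyE) blast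
        then show "k \<in> pointwise2 (+) (deriv_family E P) (deriv_family E Q)"
          unfolding k by (intro pointwise2I deriv_familyI)
      qed
    qed simp
    moreover have "pointwise2 (+) \<F> \<G> \<subseteq> fst ` ?R"
    proof
      fix k assume "k \<in> pointwise2 (+) \<F> \<G>"
      then obtain f g where "f \<in> \<F>" "g \<in> \<G>" and k: "k = (\<lambda>x. f x + g x)" by (auto simp: pointwise2_def)
      then obtain f' g' where "(f, f') \<in> P" "(g, g') \<in> Q" using P(1) Q(1) by force
      then have "(k, \<lambda>x h. f' x h + g' x h) \<in> ?R" using k by blast
      then show "k \<in> fst ` ?R" by force
    qed
    ultimately show ?case using b[OF bF bG] by auto
  qed
qed

text \<open>Prepared for the chain rule, where a \<open>j\<close>-linear expression differentiates
  into \<open>j + 1\<close> terms, each of them some member of one big family.\<close>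

lemma equi_C_sum:
  assumes "normed_nspace E" "normed_nspace F" "equi_C n E F U \<F>"
  shows "equi_C n E F U {\<lambda>x. \<Sum>i<(m::nat). \<phi> i x | \<phi>. \<forall>i<m. \<phi> i \<in> \<F>}"
proof (induction m)
  case 0
  interpret F: normed_nspace F by fact
  have "equi_C n E F U ((\<lambda>c x. c) ` {0})"
    by (rule equi_C_const[OF assms(1,2), of _ 0]) auto
  then show ?case by (rule equi_C_mono) auto
next
  case (Suc m)
  show ?case
  proof (rule equi_C_mono[OF equi_C_add[OF assms(1,2) Suc assms(3)]])
    let ?S = "\<lambda>m. {\<lambda>x. \<Sum>i<m. \<phi> i x | \<phi>. \<forall>i<m. \<phi> i \<in> \<F>}"
    show "?S (Suc m) \<subseteq> pointwise2 (+) (?S m) \<F>"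
    proof
      fix k assume "k \<in> ?S (Suc m)"
      then obtain \<phi> where \<phi>: "\<forall>i<Suc m. \<phi> i \<in> \<F>" and k: "k = (\<lambda>x. (\<Sum>i<m. \<phi> i x) + \<phi> m x)" by auto
      from \<phi> have "(\<lambda>x. \<Sum>i<m. \<phi> i x) \<in> ?S m" "\<phi> m \<in> \<F>" by auto
      then show "k \<in> pointwise2 (+) (?S m) \<F>" unfolding k by (rule pointwise2I)
    qed
  qed simp
qed

definition bounded_linear_between :: "'v::real_vector nspace \<Rightarrow> 'w::real_vector nspace \<Rightarrow> ('v \<Rightarrow> 'w) \<Rightarrow> bool"
  where "bounded_linear_between E F l \<longleftrightarrow> linear_between E F l \<and> (\<exists>C\<ge>0. \<forall>x\<in>vecs E. nrm F (l x) \<le> C * nrm E x)"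

definition bounded_bilinear_between ::
  "'v::real_vector nspace \<Rightarrow> 'w::real_vector nspace \<Rightarrow> 'u::real_vector nspace \<Rightarrow> ('v \<Rightarrow> 'w \<Rightarrow> 'u) \<Rightarrow> bool"
  where "bounded_bilinear_between E F G b \<longleftrightarrow>
    (\<forall>x\<in>vecs E. linear_between F G (b x)) \<and> (\<forall>y\<in>vecs F. linear_between E G (\<lambda>x. b x y)) \<and>
    (\<exists>C\<ge>0. \<forall>x\<in>vecs E. \<forall>y\<in>vecs F. nrm G (b x y) \<le> C * nrm E x * nrm F y)"

lemma equi_C_bilinear:
  fixes E :: "'v::real_vector nspace"
  assumes nE: "normed_nspace E" and nF: "normed_nspace F" and nG: "normed_nspace G" and nH: "normed_nspace H"
    and bil: "bounded_bilinear_between F G H b"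
    and "equi_C n E F U \<F>" "equi_C n E G U \<G>"
  shows "equi_C n E H U (pointwise2 b \<F> \<G>)"
proof -
  interpret E: normed_nspace E by fact
  interpret F: normed_nspace F by fact
  interpret G: normed_nspace G by fact
  interpret H: normed_nspace H by fact
  obtain K where K: "K \<ge> 0" "\<And>x y. x \<in> vecs F \<Longrightarrow> y \<in> vecs G \<Longrightarrow> nrm H (b x y) \<le> K * nrm F x * nrm G y"
    using bil by (auto simp: bounded_bilinear_between_def)
  have l1: "linear_between G H (b x)" if "x \<in> vecs F" for x
    using bil that by (auto simp: bounded_bilinear_between_def)
  have l2: "linear_between F H (\<lambda>x. b x y)" if "y \<in> vecs G" for y
    using bil that by (auto simp: bounded_bilinear_between_def)
  have mem: "b x y \<in> vecs H" if "x \<in> vecs F" "y \<in> vecs G" for x y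
    using linear_betweenD(1)[OF l1] that by blast
  have K': "nrm H (b x y) \<le> K * C * D"
    if "x \<in> vecs F" "y \<in> vecs G" "nrm F x \<le> C" "nrm G y \<le> D" for x y C D
  proof -
    have "0 \<le> C" "0 \<le> D" using that F.nrm_nonneg[of x] G.nrm_nonneg[of y] by linarith+
    have "nrm H (b x y) \<le> K * nrm F x * nrm G y" using K that by blast
    also have "\<dots> \<le> K * C * D" using K(1) that \<open>0 \<le> C\<close> by (intro mult_mono mult_nonneg_nonneg) auto
    finally show ?thesis .
  qed
  have bd: "locally_bounded E H U (pointwise2 b \<F> \<G>)"
    if bb: "locally_bounded E F U \<F>" "locally_bounded E G U \<G>" for \<F> \<G>
    unfolding locally_bounded_def
  proof (intro ballI conjI)
    fix x assume "x \<in> U"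
    obtain C where C: "\<forall>\<^sub>F h in nsmall E. x + h \<in> U \<longrightarrow> (\<forall>f\<in>\<F>. nrm F (f (x + h)) \<le> C)"
      using locally_boundedD(2)[OF bb(1) \<open>x \<in> U\<close>] by blast
    obtain D where D: "\<forall>\<^sub>F h in nsmall E. x + h \<in> U \<longrightarrow> (\<forall>f\<in>\<G>. nrm G (f (x + h)) \<le> D)"
      using locally_boundedD(2)[OF bb(2) \<open>x \<in> U\<close>] by blast
    have "\<forall>\<^sub>F h in nsmall E. x + h \<in> U \<longrightarrow> (\<forall>f\<in>pointwise2 b \<F> \<G>. nrm H (f (x + h)) \<le> K * C * D)"
      using C D
    proof eventually_elim
      case (elim h)
      { fix f g assume fg: "f \<in> \<F>" "g \<in> \<G>" "x + h \<in> U"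
        have "nrm H (b (f (x + h)) (g (x + h))) \<le> K * C * D"
          using fg locally_boundedD(1)[OF bb(1)] locally_boundedD(1)[OF bb(2)] elim by (intro K') blast+ }
      then show ?case unfolding pointwise2_def by blast
    qed
    then show "\<exists>C. \<forall>\<^sub>F h in nsmall E. x + h \<in> U \<longrightarrow> (\<forall>f\<in>pointwise2 b \<F> \<G>. nrm H (f (x + h)) \<le> C)"
      by blast
    show "f x \<in> vecs H" if "f \<in> pointwise2 b \<F> \<G>" for f
      using that locally_boundedD(1)[OF bb(1) \<open>x \<in> U\<close>] locally_boundedD(1)[OF bb(2) \<open>x \<in> U\<close>] mem
      by (auto simp: pointwise2_def)
  qed
  show ?thesis using assms(6,7)
  proof (induction n arbitrary: \<F> \<G>)
    case 0 then show ?case by (simp add: bd)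
  next
    case (Suc n)
    obtain P where P: "\<F> = fst ` P" "unif_deriv E F U P" "equi_C n E F U (deriv_family E P)"
      using Suc.prems(1) by (rule equi_C_SucE)
    obtain Q where Q: "\<G> = fst ` Q" "unif_deriv E G U Q" "equi_C n E G U (deriv_family E Q)"
      using Suc.prems(2) by (rule equi_C_SucE)
    note bF = equi_C_locally_bounded[OF Suc.prems(1)] and bG = equi_C_locally_bounded[OF Suc.prems(2)]
    note dF = equi_C_locally_bounded[OF P(3)] and dG = equi_C_locally_bounded[OF Q(3)]
    define R where "R = {(\<lambda>x. b (f x) (g x), \<lambda>x h. b (f' x h) (g x) + b (f x) (g' x h)) |
        f f' g g'. (f, f') \<in> P \<and> (g, g') \<in> Q}"
    have mP: "f x \<in> vecs F" if "(f, f') \<in> P" "x \<in> U" for f f' x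
      using locally_boundedD(1)[OF bF that(2)] that(1) P(1) by force
    have mQ: "f x \<in> vecs G" if "(f, f') \<in> Q" "x \<in> U" for f f' x
      using locally_boundedD(1)[OF bG that(2)] that(1) Q(1) by force
    have "unif_deriv E H U R"
    proof (rule unif_derivI)
      fix x f f' assume "x \<in> U" "(f, f') \<in> R"
      then obtain f1 f1' g1 g1' where *: "(f1, f1') \<in> P" "(g1, g1') \<in> Q"
          "f' = (\<lambda>x h. b (f1' x h) (g1 x) + b (f1 x) (g1' x h))"
        unfolding R_def by blast
      note l = unif_derivD(1)[OF P(2) \<open>x \<in> U\<close> *(1)] unif_derivD(1)[OF Q(2) \<open>x \<in> U\<close> *(2)]
      note m = mP[OF *(1) \<open>x \<in> U\<close>] mQ[OF *(2) \<open>x \<in> U\<close>]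
      show "linear_between E H (f' x)"
        unfolding linear_between_def *(3)
        using linear_betweenD(1,2)[OF l(1)] linear_betweenD(1,2)[OF l(2)]
          linear_betweenD(1,2)[OF l1[OF m(1)]] linear_betweenD(1,2)[OF l2[OF m(2)]]
        by (simp add: algebra_simps)
    next
      fix x and \<epsilon> :: real assume x: "x \<in> U" and e: "\<epsilon> > 0"
      obtain C where C: "C \<ge> 0"
        "\<forall>\<^sub>F h in nsmall E. x + h \<in> U \<longrightarrow> (\<forall>f\<in>\<G>. nrm G (f (x + h)) \<le> C)"
        using locally_boundedD(2)[OF bG x] by blast
      obtain D where D: "D \<ge> 0" "\<forall>f\<in>\<F>. nrm F (f x) \<le> D"
        using locally_bounded_at[OF bF x nE] by blast
      obtain L where L: "L \<ge> 0" "\<forall>f f' h. (f, f') \<in> P \<longrightarrow> h \<in> vecs E \<longrightarrow> nrm F (f' x h) \<le> L * nrm E h"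
          "\<forall>\<^sub>F h in nsmall E. x + h \<in> U \<longrightarrow> (\<forall>f f'. (f, f') \<in> P \<longrightarrow> nrm F (f (x + h) - f x) \<le> L * nrm E h)"
        by (rule unif_deriv_lipschitz[OF nE nF P(2) dF x bF[unfolded P(1)]])
      obtain M where M: "M \<ge> 0" "\<forall>f f' h. (f, f') \<in> Q \<longrightarrow> h \<in> vecs E \<longrightarrow> nrm G (f' x h) \<le> M * nrm E h"
          "\<forall>\<^sub>F h in nsmall E. x + h \<in> U \<longrightarrow> (\<forall>f f'. (f, f') \<in> Q \<longrightarrow> nrm G (f (x + h) - f x) \<le> M * nrm E h)"
        by (rule unif_deriv_lipschitz[OF nE nG Q(2) dG x bG[unfolded Q(1)]])
      \<comment> \<open>The remainder will be at most \<open>(K * C * \<eta> + K * L * M * nrm E h +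
        K * D * \<eta>) * nrm E h\<close>. For small \<open>h\<close> the middle coefficient drops
        below \<eta>, hence the \<open>+ 1\<close> in the denominator.\<close>
      define \<eta> where "\<eta> = \<epsilon> / (K * C + K * D + 1)"
      have p: "K * C + K * D + 1 > 0" using K(1) C(1) D(1)
        by (intro add_nonneg_pos add_nonneg_nonneg mult_nonneg_nonneg) auto
      then have \<eta>: "\<eta> > 0" "\<eta> * (K * C + K * D + 1) = \<epsilon>" using e by (auto simp: \<eta>_def)
      have "0 \<le> K * L * M" using K(1) L(1) M(1) by simp
      from unif_derivD(2)[OF P(2) x \<eta>(1)] unif_derivD(2)[OF Q(2) x \<eta>(1)] eventually_nsmall_mem C(2) M(3)
        eventually_nsmall_mult_less[OF \<eta>(1) this, of E]
      show "\<forall>\<^sub>F h in nsmall E. x + h \<in> U \<longrightarrow>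
         (\<forall>f f'. (f, f') \<in> R \<longrightarrow> nrm H (f (x + h) - f x - f' x h) \<le> \<epsilon> * nrm E h)"
      proof eventually_elim
        case (elim h)
        show ?case
        proof (intro impI allI)
          fix k k' assume xh: "x + h \<in> U" and "(k, k') \<in> R"
          then obtain f f' g g' where *: "(f, f') \<in> P" "(g, g') \<in> Q" "k = (\<lambda>x. b (f x) (g x))"
            "k' = (\<lambda>x h. b (f' x h) (g x) + b (f x) (g' x h))" unfolding R_def by blast
          have m: "f (x + h) \<in> vecs F" "f x \<in> vecs F" "g (x + h) \<in> vecs G" "g x \<in> vecs G"
              "f' x h \<in> vecs F" "g' x h \<in> vecs G"
            using mP[OF *(1)] mQ[OF *(2)] x xh
              linear_betweenD(1)[OF unif_derivD(1)[OF P(2) x *(1)]]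
              linear_betweenD(1)[OF unif_derivD(1)[OF Q(2) x *(2)]] elim(3) by auto
          have fg: "f \<in> \<F>" "g \<in> \<G>" using P(1) Q(1) * by force+
          \<comment> \<open>The remainder of the product splits into the remainder of the first
            factor against the moved second one, a mixed term of second order, and the remainder of
            the second factor against the fixed first one.\<close>
          let ?a = "b (f (x + h) - f x - f' x h) (g (x + h))"
          let ?b = "b (f' x h) (g (x + h) - g x)"
          let ?c = "b (f x) (g (x + h) - g x - g' x h)"
          have "?a = b (f (x + h)) (g (x + h)) - b (f x) (g (x + h)) - b (f' x h) (g (x + h))"
            "?b = b (f' x h) (g (x + h)) - b (f' x h) (g x)"
            "?c = b (f x) (g (x + h)) - b (f x) (g x) - b (f x) (g' x h)"
            using m by (simp_all add: linear_betweenD(4)[OF l1] linear_betweenD(4)[OF l2])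
          then have eq: "k (x + h) - k x - k' x h = (?a + ?b) + ?c"
            by (simp add: *(3,4))
          have "nrm H (k (x + h) - k x - k' x h) \<le> nrm H ?a + nrm H ?b + nrm H ?c"
            unfolding eq by (rule order.trans[OF H.nrm_triangle add_mono[OF H.nrm_triangle order.refl]]) (use m mem in auto)
          also have "\<dots> \<le> K * (\<eta> * nrm E h) * C + K * (L * nrm E h) * (M * nrm E h) + K * D * (\<eta> * nrm E h)"
          proof -
            have "nrm H ?a \<le> K * (\<eta> * nrm E h) * C"
              using elim(1)[rule_format, OF xh *(1)] elim(4)[rule_format, OF xh fg(2)] by (intro K' F.diff_mem m)
            moreover have "nrm H ?b \<le> K * (L * nrm E h) * (M * nrm E h)"
              using L(2)[rule_format, OF *(1) elim(3)] elim(5)[rule_format, OF xh *(2)] by (intro K' G.diff_mem m)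
            moreover have "nrm H ?c \<le> K * D * (\<eta> * nrm E h)"
              using D(2)[rule_format, OF fg(1)] elim(2)[rule_format, OF xh *(2)] by (intro K' G.diff_mem m)
            ultimately show ?thesis by linarith
          qed
          also have "\<dots> = (K * C * \<eta> + (K * L * M * nrm E h) + K * D * \<eta>) * nrm E h"
            by (simp add: algebra_simps)
          also have "\<dots> \<le> (K * C * \<eta> + \<eta> + K * D * \<eta>) * nrm E h"
            using elim(6) by (intro mult_right_mono E.nrm_nonneg) linarith
          also have "\<dots> = \<epsilon> * nrm E h" by (simp add: \<eta>(2)[symmetric] algebra_simps)
          finally show "nrm H (k (x + h) - k x - k' x h) \<le> \<epsilon> * nrm E h" .
        qed
      qed
    qed
    moreover have "equi_C n E H U (deriv_family E R)"
    \<comment> \<open>Each term of the product rule pairs a derivative family of order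
      \<open>n\<close> with an original family of order \<open>Suc n\<close>, which is lowered by
      one order before the induction hypothesis applies.\<close>
    proof (rule equi_C_mono[OF equi_C_add[OF nE nH Suc.IH[OF P(3) equi_C_SucD[OF Suc.prems(2)]]
              Suc.IH[OF equi_C_SucD[OF Suc.prems(1)] Q(3)]]])
      let ?D = "pointwise2 (+) (pointwise2 b (deriv_family E P) \<G>) (pointwise2 b \<F> (deriv_family E Q))"
      show "deriv_family E R \<subseteq> ?D"
      proof
        fix k assume "k \<in> deriv_family E R"
        then obtain f f' g g' h where *: "(f, f') \<in> P" "(g, g') \<in> Q" "h \<in> vecs E" "nrm E h \<le> 1"
          and k: "k = (\<lambda>x. b (f' x h) (g x) + b (f x) (g' x h))" unfolding R_def by (elim deriv_familyE) blast
        have "f \<in> \<F>" "g \<in> \<G>" using * P(1) Q(1) by force+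
        with * show "k \<in> ?D"
          unfolding k by (intro pointwise2I deriv_familyI)
      qed
    qed simp
    moreover have "pointwise2 b \<F> \<G> \<subseteq> fst ` R"
    proof
      fix k assume "k \<in> pointwise2 b \<F> \<G>"
      then obtain f g where "f \<in> \<F>" "g \<in> \<G>" and k: "k = (\<lambda>x. b (f x) (g x))" by (auto simp: pointwise2_def)
      then obtain f' g' where "(f, f') \<in> P" "(g, g') \<in> Q" using P(1) Q(1) by force
      then have "(k, \<lambda>x h. b (f' x h) (g x) + b (f x) (g' x h)) \<in> R" using k R_def by blast
      then show "k \<in> fst ` R" by force
    qed
    ultimately show ?case using bd[OF bF bG] by auto
  qed
qed

text \<open>A bounded linear \<open>l\<close> becomes the bilinear map sending \<open>c\<close> and
  \<open>y\<close> to \<open>c *\<^sub>R l y\<close>, applied to the constant 1 in the real line; so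
  the product rule covers it.\<close>

lemma equi_C_linear:
  assumes nE: "normed_nspace E" and nF: "normed_nspace F" and nG: "normed_nspace G"
    and l: "bounded_linear_between F G l" and f: "equi_C n E F U \<F>"
  shows "equi_C n E G U ((\<lambda>f x. l (f x)) ` \<F>)"
proof -
  define R where "R = NSpace (UNIV :: real set) abs"
  interpret F: normed_nspace F by fact
  interpret G: normed_nspace G by fact
  have R: "normed_nspace R" by unfold_locales (auto simp: R_def abs_mult)
  obtain C where C: "C \<ge> 0" "\<And>x. x \<in> vecs F \<Longrightarrow> nrm G (l x) \<le> C * nrm F x"
    using l by (auto simp: bounded_linear_between_def)
  have lin: "linear_between F G l" using l by (auto simp: bounded_linear_between_def)
  have "linear_between F G (\<lambda>y. c *\<^sub>R l y)" for c
    unfolding linear_between_def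
    by (simp add: linear_betweenD(1)[OF lin] linear_betweenD(2)[OF lin] scaleR_add_right mult.commute)
  moreover have "linear_between R G (\<lambda>c. c *\<^sub>R l y)" if "y \<in> vecs F" for y
    unfolding linear_between_def
    using that by (simp add: linear_betweenD(1)[OF lin] scaleR_add_left)
  moreover have "nrm G (c *\<^sub>R l y) \<le> C * nrm R c * nrm F y" if "y \<in> vecs F" for c y
  proof -
    have "\<bar>c\<bar> * nrm G (l y) \<le> \<bar>c\<bar> * (C * nrm F y)" by (intro mult_left_mono C that) simp
    then show ?thesis
      using linear_betweenD(1)[OF lin that] by (simp add: G.nrm_scaleR R_def mult.left_commute)
  qed
  ultimately have "bounded_bilinear_between R F G (\<lambda>c y. c *\<^sub>R l y)"
    unfolding bounded_bilinear_between_def using C(1) by blast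
  from equi_C_bilinear[OF nE R nF nG this equi_C_const[OF nE R, of "{1}" 1] f]
  have "equi_C n E G U (pointwise2 (\<lambda>c y. c *\<^sub>R l y) ((\<lambda>c x. c) ` {1}) \<F>)"
    by (auto simp: R_def)
  then show ?thesis by (rule equi_C_mono) (force simp: pointwise2_def)+
qed

text \<open>The derivative family consists of the constant functions with value in the unit ball,
  which \<open>equi_C_const\<close> handles.\<close>

lemma equi_C_id:
  assumes nE: "normed_nspace E" and U: "U \<subseteq> vecs E"
  shows "equi_C n E E U {\<lambda>x. x}"
proof -
  interpret E: normed_nspace E by fact
  have b: "locally_bounded E E U {\<lambda>x. x}"
    unfolding locally_bounded_def
  proof (intro ballI conjI exI)
    fix x assume "x \<in> U"
    have "\<forall>\<^sub>F h in nsmall E. nrm E (x + h) \<le> nrm E x + 1"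
      using eventually_nsmall_mem eventually_nsmall_less[OF zero_less_one]
      by eventually_elim (use E.nrm_triangle[of x] U \<open>x \<in> U\<close> in fastforce)
    then show "\<forall>\<^sub>F h in nsmall E. x + h \<in> U \<longrightarrow> (\<forall>f\<in>{\<lambda>x. x}. nrm E (f (x + h)) \<le> nrm E x + 1)"
      by eventually_elim simp
  qed (use U in auto)
  show ?thesis
  proof (cases n)
    case 0 with b show ?thesis by simp
  next
    case (Suc m)
    let ?P = "{(\<lambda>x. x, \<lambda>x h. h)} :: (('a \<Rightarrow> 'a) \<times> ('a \<Rightarrow> 'a \<Rightarrow> 'a)) set"
    have "unif_deriv E E U ?P"
      by (rule unif_derivI) (auto simp: linear_between_def intro!: always_eventually)
    moreover have "equi_C m E E U (deriv_family E ?P)"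
      by (rule equi_C_mono[OF equi_C_const[OF nE nE, of "{h \<in> vecs E. nrm E h \<le> 1}" 1]])
        (auto simp: deriv_family_def)
    ultimately show ?thesis using b Suc by (auto intro!: exI[of _ ?P])
  qed
qed

section \<open>Multilinear maps on lists of vectors\<close>

definition multilinear ::
  "'v::real_vector nspace \<Rightarrow> 'w::real_vector nspace \<Rightarrow> nat \<Rightarrow> ('v list \<Rightarrow> 'w) \<Rightarrow> bool"
  where "multilinear E F k m \<longleftrightarrow>
     (\<forall>vs. length vs = k \<and> set vs \<subseteq> vecs E \<longrightarrow> m vs \<in> vecs F) \<and>
     (\<forall>us ws v w a b. length us + length ws + 1 = k \<and>
        set us \<subseteq> vecs E \<and> set ws \<subseteq> vecs E \<and> v \<in> vecs E \<and> w \<in> vecs E \<longrightarrow>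
        m (us @ (a *\<^sub>R v + b *\<^sub>R w) # ws) = a *\<^sub>R m (us @ v # ws) + b *\<^sub>R m (us @ w # ws))"

lemma multilinearD:
  assumes "multilinear E F k m"
  shows "length vs = k \<Longrightarrow> set vs \<subseteq> vecs E \<Longrightarrow> m vs \<in> vecs F"
    and "length us + length ws + 1 = k \<Longrightarrow> set us \<subseteq> vecs E \<Longrightarrow> set ws \<subseteq> vecs E \<Longrightarrow> v \<in> vecs E \<Longrightarrow>
      w \<in> vecs E \<Longrightarrow> m (us @ (a *\<^sub>R v + b *\<^sub>R w) # ws) = a *\<^sub>R m (us @ v # ws) + b *\<^sub>R m (us @ w # ws)"
  using assms unfolding multilinear_def by blast+

lemma multilinearI:
  assumes "\<And>vs. length vs = k \<Longrightarrow> set vs \<subseteq> vecs E \<Longrightarrow> m vs \<in> vecs F"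
    and "\<And>us ws v w a b. length us + length ws + 1 = k \<Longrightarrow> set us \<subseteq> vecs E \<Longrightarrow> set ws \<subseteq> vecs E \<Longrightarrow> v \<in> vecs E \<Longrightarrow>
      w \<in> vecs E \<Longrightarrow> m (us @ (a *\<^sub>R v + b *\<^sub>R w) # ws) = a *\<^sub>R m (us @ v # ws) + b *\<^sub>R m (us @ w # ws)"
  shows "multilinear E F k m"
  using assms unfolding multilinear_def by blast

lemma multilinear_Cons:
  assumes "multilinear E F (Suc k) m" "v \<in> vecs E"
  shows "multilinear E F k (\<lambda>vs. m (v # vs))"
proof (rule multilinearI)
  fix us ws u w a b
  assume "length us + length ws + 1 = k" "set us \<subseteq> vecs E" "set ws \<subseteq> vecs E" "u \<in> vecs E" "w \<in> vecs E"
  then show "m (v # us @ (a *\<^sub>R u + b *\<^sub>R w) # ws) = a *\<^sub>R m (v # us @ u # ws) + b *\<^sub>R m (v # us @ w # ws)"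
    using multilinearD(2)[OF assms(1), of "v # us" ws u w a b] assms(2) by simp
qed (use multilinearD(1)[OF assms(1)] assms(2) in simp)

lemma multilinear_head:
  assumes "multilinear E F (Suc k) m" "length vs = k" "set vs \<subseteq> vecs E"
  shows "linear_between E F (\<lambda>v. m (v # vs))"
  unfolding linear_between_def
  using multilinearD(1)[OF assms(1)] multilinearD(2)[OF assms(1), of "[]" vs] assms(2,3) by simp

lemma bounded_multilinear_iff:
  assumes "normed_nspace E"
  shows "bounded_multilinear E F k m \<longleftrightarrow> multilinear E F k m \<and>
    (\<exists>C\<ge>0. \<forall>vs. length vs = k \<and> set vs \<subseteq> vecs E \<longrightarrow> nrm F (m vs) \<le> C * prod_list (map (nrm E) vs))"
proof -
  interpret E: normed_nspace E by fact
  have p: "0 \<le> prod_list (map (nrm E) vs)" for vs by (induction vs) auto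
  have "nrm F (m vs) \<le> max C 0 * prod_list (map (nrm E) vs)"
    if "nrm F (m vs) \<le> C * prod_list (map (nrm E) vs)" for C vs
    using that mult_right_mono[OF max.cobounded1[of C 0] p[of vs]] by linarith
  then have "(\<exists>C\<ge>0. \<forall>vs. length vs = k \<and> set vs \<subseteq> vecs E \<longrightarrow> nrm F (m vs) \<le> C * prod_list (map (nrm E) vs)) \<longleftrightarrow>
    (\<exists>C. \<forall>vs. length vs = k \<and> set vs \<subseteq> vecs E \<longrightarrow> nrm F (m vs) \<le> C * prod_list (map (nrm E) vs))"
    by (metis max.cobounded2)
  then show ?thesis unfolding bounded_multilinear_def multilinear_def by blast
qed

lemma (in normed_nspace) prod_nrm_le:
  "(\<And>v. v \<in> set vs \<Longrightarrow> nrm E v \<le> R) \<Longrightarrow> prod_list (map (nrm E) vs) \<le> R ^ length vs"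
proof (induction vs)
  case (Cons v vs)
  have "0 \<le> R" using Cons.prems[of v] nrm_nonneg[of v] by (simp del: nrm_nonneg)
  have p: "0 \<le> prod_list (map (nrm E) vs)" by (induction vs) auto
  show ?case using Cons p \<open>0 \<le> R\<close> by (simp add: mult_mono)
qed simp

text \<open>Homogeneity in every slot reduces statements about arbitrary lists to lists from the
  unit ball. A zero vector does no harm: division by zero gives 0, so its normalised version is 0,
  and both sides vanish.\<close>

lemma multilinear_normalize:
  assumes "normed_nspace E" "multilinear E F k m" "length vs = k" "set vs \<subseteq> vecs E"
  shows "m vs = prod_list (map (nrm E) vs) *\<^sub>R m (map (\<lambda>v. (1 / nrm E v) *\<^sub>R v) vs)"
  using assms(2-)
proof (induction vs arbitrary: k m)
  case (Cons v vs)
  interpret E: normed_nspace E by fact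
  obtain k' where k: "k = Suc k'" using Cons.prems by (cases k) auto
  let ?n = "map (\<lambda>v. (1 / nrm E v) *\<^sub>R v) vs" and ?u = "(1 / nrm E v) *\<^sub>R v"
  have n: "set ?n \<subseteq> vecs E" "length ?n = k'" using Cons.prems k by auto
  have l: "linear_between E F (\<lambda>v. m (v # ?n))"
    using multilinear_head[of E F k' m ?n] Cons.prems k n by simp
  have "v = nrm E v *\<^sub>R ?u" using E.nrm_eq_0[of v] Cons.prems by (cases "nrm E v = 0") auto
  then have "m (v # ?n) = nrm E v *\<^sub>R m (?u # ?n)"
    using linear_betweenD(5)[OF l, of ?u "nrm E v"] Cons.prems by simp
  moreover have "m (v # vs) = prod_list (map (nrm E) vs) *\<^sub>R m (v # ?n)"
    using Cons.IH[OF multilinear_Cons, of k' m v] Cons.prems k by simp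
  ultimately show ?case by (simp add: mult.commute)
qed simp

text \<open>First-order and second-order estimates for a multilinear map when all its arguments move
  from \<open>q\<close> to \<open>p\<close>. Here \<open>r\<close> is the linear part of the move,
  \<open>s\<close> the size of the move, \<open>e\<close> the error of the linear part, and
  \<open>R\<close> bounds all arguments. Telescoping works along the list: with its head fixed,
  \<open>m\<close> is multilinear in the tail, with the norm of the head absorbed into
  \<open>K\<close>.\<close>

lemma multilinear_increment:
  fixes p q r :: "'x \<Rightarrow> 'v::real_vector"
    and R s e K :: real
  assumes nE: "normed_nspace E" and nF: "normed_nspace F"
    and "R \<ge> 1" "s \<ge> 0" "e \<ge> 0"
    and "\<And>x. x \<in> set xs \<Longrightarrow> p x \<in> vecs E \<and> q x \<in> vecs E \<and> r x \<in> vecs E"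
    and "\<And>x. x \<in> set xs \<Longrightarrow> nrm E (p x) \<le> R \<and> nrm E (q x) \<le> R \<and> nrm E (r x) \<le> s \<and>
      nrm E (p x - q x) \<le> s \<and> nrm E (p x - q x - r x) \<le> e"
    and "multilinear E F (length xs) m" "K \<ge> 0"
    and "\<And>vs. length vs = length xs \<Longrightarrow> set vs \<subseteq> vecs E \<Longrightarrow> nrm F (m vs) \<le> K * prod_list (map (nrm E) vs)"
  shows "nrm F (m (map p xs) - m (map q xs)) \<le> K * R ^ length xs * (length xs * s)"
    and "nrm F (m (map p xs) - m (map q xs) - (\<Sum>i<length xs. m ((map q xs)[i := r (xs ! i)])))
      \<le> K * R ^ length xs * (length xs * (e + length xs * s\<^sup>2))"
  using assms(6-)
proof (induction xs arbitrary: m K)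
  case Nil
  interpret F: normed_nspace F by fact
  { case 1 then show ?case by simp next case 2 then show ?case by simp }
next
  case (Cons a xs)
  interpret E: normed_nspace E by fact
  interpret F: normed_nspace F by fact
  let ?k = "length xs" and ?P = "map p xs" and ?Q = "map q xs"
  let ?sum = "\<lambda>m. \<Sum>i<?k. m (?Q[i := r (xs ! i)])"
  have *: "nrm F (m (map p (a # xs)) - m (map q (a # xs))) \<le> K * R ^ length (a # xs) * (length (a # xs) * s)
    \<and> nrm F (m (map p (a # xs)) - m (map q (a # xs)) - (\<Sum>i<length (a # xs). m ((map q (a # xs))[i := r ((a # xs) ! i)])))
      \<le> K * R ^ length (a # xs) * (length (a # xs) * (e + length (a # xs) * s\<^sup>2))"
    if mem: "\<And>x. x \<in> set (a # xs) \<Longrightarrow> p x \<in> vecs E \<and> q x \<in> vecs E \<and> r x \<in> vecs E"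
      and bd: "\<And>x. x \<in> set (a # xs) \<Longrightarrow> nrm E (p x) \<le> R \<and> nrm E (q x) \<le> R \<and> nrm E (r x) \<le> s \<and>
        nrm E (p x - q x) \<le> s \<and> nrm E (p x - q x - r x) \<le> e"
      and m: "multilinear E F (length (a # xs)) m" and K: "K \<ge> 0"
      and b: "\<And>vs. length vs = length (a # xs) \<Longrightarrow> set vs \<subseteq> vecs E \<Longrightarrow> nrm F (m vs) \<le> K * prod_list (map (nrm E) vs)"
    for m K
  proof -
    have m': "multilinear E F (Suc ?k) m" using m by simp
    have PQ: "set ?P \<subseteq> vecs E" "set ?Q \<subseteq> vecs E" using mem by auto
    have a: "p a \<in> vecs E" "q a \<in> vecs E" "r a \<in> vecs E" using mem by auto
    have upd: "set (?Q[i := r (xs ! i)]) \<subseteq> vecs E" if "i < ?k" for i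
      using that mem by (intro subset_trans[OF set_update_subset_insert]) auto
    have hd: "nrm F (m (v # vs)) \<le> K * t * R ^ ?k"
      if "v \<in> vecs E" "nrm E v \<le> t" "length vs = ?k" "set vs \<subseteq> vecs E" "\<And>v. v \<in> set vs \<Longrightarrow> nrm E v \<le> R" for v t vs
    proof -
      have "0 \<le> t" using that(2) E.nrm_nonneg[of v] by linarith
      have q: "0 \<le> prod_list (map (nrm E) vs)" by (induction vs) auto
      have "nrm F (m (v # vs)) \<le> K * (nrm E v * prod_list (map (nrm E) vs))"
        using b[of "v # vs"] that by simp
      also have "\<dots> \<le> K * (t * R ^ ?k)"
        using E.prod_nrm_le[of vs R] that K q \<open>0 \<le> t\<close> by (intro mult_left_mono mult_mono) auto
      finally show ?thesis by simp
    qed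
    have bv: "nrm F (m (v # vs)) \<le> K * t * prod_list (map (nrm E) vs)"
      if "v \<in> vecs E" "nrm E v \<le> t" "length vs = ?k" "set vs \<subseteq> vecs E" for v t vs
    proof -
      have q: "0 \<le> prod_list (map (nrm E) vs)" by (induction vs) auto
      have "nrm F (m (v # vs)) \<le> K * (nrm E v * prod_list (map (nrm E) vs))"
        using b[of "v # vs"] that by simp
      also have "\<dots> \<le> K * (t * prod_list (map (nrm E) vs))"
        using that K q by (intro mult_left_mono mult_right_mono) auto
      finally show ?thesis by simp
    qed
    have IH1: "nrm F (m (v # ?P) - m (v # ?Q)) \<le> K * t * R ^ ?k * (?k * s)"
      and IH2: "nrm F (m (v # ?P) - m (v # ?Q) - ?sum (\<lambda>vs. m (v # vs))) \<le> K * t * R ^ ?k * (?k * (e + ?k * s\<^sup>2))"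
      if "v \<in> vecs E" "nrm E v \<le> t" for v t
    proof -
      have "0 \<le> t" using that(2) E.nrm_nonneg[of v] by linarith
      then have "0 \<le> K * t" using K by simp
      show "nrm F (m (v # ?P) - m (v # ?Q)) \<le> K * t * R ^ ?k * (?k * s)"
        by (rule Cons.IH(1)[OF _ _ multilinear_Cons[OF m' that(1)] \<open>0 \<le> K * t\<close> bv[OF that]]) (use mem bd in auto)
      show "nrm F (m (v # ?P) - m (v # ?Q) - ?sum (\<lambda>vs. m (v # vs))) \<le> K * t * R ^ ?k * (?k * (e + ?k * s\<^sup>2))"
        by (rule Cons.IH(2)[OF _ _ multilinear_Cons[OF m' that(1)] \<open>0 \<le> K * t\<close> bv[OF that]]) (use mem bd in auto)
    qed
    note lin = linear_betweenD[OF multilinear_head[OF m' _ PQ(1)], simplified]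
    have mm: "m (v # ?P) \<in> vecs F" "m (v # ?Q) \<in> vecs F" if "v \<in> vecs E" for v
      using multilinearD(1)[OF m', of "v # ?P"] multilinearD(1)[OF m', of "v # ?Q"] PQ that by auto
    have ms: "m (v # ?Q[i := r (xs ! i)]) \<in> vecs F" if "v \<in> vecs E" "i < ?k" for v i
      using multilinearD(1)[OF m', of "v # ?Q[i := r (xs ! i)]"] upd that by simp
    have nP: "\<And>v. v \<in> set ?P \<Longrightarrow> nrm E v \<le> R" using bd by auto
    let ?A = "K * R ^ Suc ?k"
    have A: "0 \<le> ?A" using K assms(3) by simp
    \<comment> \<open>A head of norm at most \<open>t\<close> replaces one factor \<open>R\<close>;
      \<open>R \<ge> 1\<close> restores the full power of \<open>R\<close> that the claimed bound
      contains.\<close>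
    have RA: "K * t * R ^ ?k \<le> ?A * t" if "0 \<le> t" for t
    proof -
      have "K * R ^ ?k \<le> ?A" using assms(3) K by (intro mult_left_mono power_increasing) auto
      from mult_right_mono[OF this that] show ?thesis by (simp add: mult_ac)
    qed
    have RR: "K * R * R ^ ?k = ?A" by simp
    have q1: "nrm F (m (q a # ?P) - m (q a # ?Q)) \<le> ?A * (?k * s)"
      using IH1[of "q a" R] a bd by (simp add: mult_ac)
    have d1: "nrm F (m (p a # ?P) - m (q a # ?P)) \<le> ?A * s"
    proof -
      have "nrm F (m ((p a - q a) # ?P)) \<le> K * s * R ^ ?k" using a bd PQ nP by (intro hd) auto
      then show ?thesis using lin(4)[of "p a" "q a"] a RA[OF assms(4)] by simp
    qed
    have e1: "nrm F (m (map p (a # xs)) - m (map q (a # xs))) \<le> ?A * (real (Suc ?k) * s)"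
    proof -
      have eq: "m (map p (a # xs)) - m (map q (a # xs)) = (m (p a # ?P) - m (q a # ?P)) + (m (q a # ?P) - m (q a # ?Q))"
        by simp
      have "nrm F (m (map p (a # xs)) - m (map q (a # xs))) \<le> ?A * s + ?A * (?k * s)"
        unfolding eq by (rule order.trans[OF F.nrm_triangle add_mono[OF d1 q1]]) (simp_all add: mm a)
      then show ?thesis by (simp add: algebra_simps)
    qed
    let ?S = "?sum (\<lambda>vs. m (q a # vs))"
    have Smem: "?S \<in> vecs F" by (intro F.sum_mem ms a) simp
    have sum: "(\<Sum>i<length (a # xs). m ((map q (a # xs))[i := r ((a # xs) ! i)])) = m (r a # ?Q) + ?S"
      by (simp add: sum.lessThan_Suc_shift del: sum.lessThan_Suc)
    have t1: "nrm F (m (p a # ?P) - m (q a # ?P) - m (r a # ?P)) \<le> ?A * e"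
    proof -
      have "nrm F (m ((p a - q a - r a) # ?P)) \<le> K * e * R ^ ?k" using a bd PQ nP by (intro hd) auto
      then show ?thesis using lin(4)[of "p a" "q a"] lin(4)[of "p a - q a" "r a"] a RA[OF assms(5)] by simp
    qed
    have t2: "nrm F (m (r a # ?P) - m (r a # ?Q)) \<le> ?A * (?k * s\<^sup>2)"
    proof -
      have "nrm F (m (r a # ?P) - m (r a # ?Q)) \<le> K * s * R ^ ?k * (?k * s)" using IH1[of "r a" s] a bd by simp
      also have "\<dots> \<le> ?A * s * (?k * s)" using RA[OF assms(4)] assms(4) by (intro mult_right_mono) auto
      finally show ?thesis by (simp add: power2_eq_square mult_ac)
    qed
    have t3: "nrm F (m (q a # ?P) - m (q a # ?Q) - ?S) \<le> ?A * (?k * (e + ?k * s\<^sup>2))"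
      using IH2[of "q a" R] a bd by (simp add: mult_ac)
    have e2: "nrm F (m (map p (a # xs)) - m (map q (a # xs)) - (m (r a # ?Q) + ?S))
        \<le> ?A * (real (Suc ?k) * (e + real (Suc ?k) * s\<^sup>2))"
    proof -
      \<comment> \<open>Three errors: linearising the head, moving the tail behind the linear part
        of the head (of second order in \<open>s\<close>), and linearising the tail behind the old
        head.\<close>
      have eq: "m (map p (a # xs)) - m (map q (a # xs)) - (m (r a # ?Q) + ?S) =
        (m (p a # ?P) - m (q a # ?P) - m (r a # ?P)) +
        ((m (r a # ?P) - m (r a # ?Q)) + (m (q a # ?P) - m (q a # ?Q) - ?S))"
        by simp
      have "nrm F (m (map p (a # xs)) - m (map q (a # xs)) - (m (r a # ?Q) + ?S)) \<le>
          ?A * e + (?A * (?k * s\<^sup>2) + ?A * (?k * (e + ?k * s\<^sup>2)))"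
        unfolding eq
        by (rule order.trans[OF F.nrm_triangle add_mono[OF t1 order.trans[OF F.nrm_triangle add_mono[OF t2 t3]]]])
          (simp_all add: mm a Smem)
      also have "\<dots> = ?A * (e + (?k * s\<^sup>2 + ?k * (e + ?k * s\<^sup>2)))" by (simp add: distrib_left)
      also have "\<dots> \<le> ?A * (real (Suc ?k) * (e + real (Suc ?k) * s\<^sup>2))"
      proof (rule mult_left_mono[OF _ A])
        have "real (Suc ?k) * (e + real (Suc ?k) * s\<^sup>2) - (e + (?k * s\<^sup>2 + ?k * (e + ?k * s\<^sup>2))) = (?k + 1) * s\<^sup>2"
          by (simp add: algebra_simps)
        moreover have "0 \<le> (?k + 1) * s\<^sup>2" by simp
        ultimately show "e + (?k * s\<^sup>2 + ?k * (e + ?k * s\<^sup>2)) \<le> real (Suc ?k) * (e + real (Suc ?k) * s\<^sup>2)"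
          by linarith
      qed
      finally show ?thesis .
    qed
    show ?thesis unfolding sum using e1 e2 by simp
  qed
  { case 1 from *[OF 1] show ?case by blast next case 2 from *[OF 2] show ?case by blast }
qed

section \<open>From a sequence of derivatives to families, and the chain rule\<close>

definition derivs_on ::
  "'v::real_vector nspace \<Rightarrow> 'w::real_vector nspace \<Rightarrow> 'v set \<Rightarrow> (nat \<Rightarrow> 'v \<Rightarrow> 'v list \<Rightarrow> 'w) \<Rightarrow> bool"
  where "derivs_on E F U D \<longleftrightarrow> (\<forall>k. \<forall>x\<in>U. bounded_multilinear E F k (D k x)) \<and>
    (\<forall>k. \<forall>x\<in>U. \<forall>\<epsilon>>0. \<forall>\<^sub>F h in nsmall E. x + h \<in> U \<longrightarrow>
      (\<forall>vs. length vs = k \<and> set vs \<subseteq> vecs E \<longrightarrow>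
        nrm F (D k (x + h) vs - D k x vs - D (Suc k) x (h # vs)) \<le> \<epsilon> * nrm E h * prod_list (map (nrm E) vs)))"

lemma smooth_on_iff_derivs:
  "smooth_on E F U f \<longleftrightarrow> openin (ntop E) U \<and> (\<exists>D. (\<forall>x\<in>U. D 0 x [] = f x) \<and> derivs_on E F U D)"
  unfolding smooth_on_def derivs_on_def eventually_nsmall by (simp add: imp_conjL)

lemma derivs_onD:
  assumes "derivs_on E F U D" "x \<in> U"
  shows "bounded_multilinear E F k (D k x)"
    and "\<epsilon> > 0 \<Longrightarrow> \<forall>\<^sub>F h in nsmall E. x + h \<in> U \<longrightarrow>
      (\<forall>vs. length vs = k \<and> set vs \<subseteq> vecs E \<longrightarrow>
        nrm F (D k (x + h) vs - D k x vs - D (Suc k) x (h # vs)) \<le> \<epsilon> * nrm E h * prod_list (map (nrm E) vs))"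
  using assms unfolding derivs_on_def by blast+

lemma derivs_on_multilinear:
  assumes "normed_nspace E" "derivs_on E F U D" "x \<in> U"
  shows "multilinear E F k (D k x)"
    and "\<exists>C\<ge>0. \<forall>vs. length vs = k \<and> set vs \<subseteq> vecs E \<longrightarrow> nrm F (D k x vs) \<le> C * prod_list (map (nrm E) vs)"
  using derivs_onD(1)[OF assms(2,3), of k] unfolding bounded_multilinear_iff[OF assms(1)] by auto

text \<open>Operator norms of \<open>k\<close>-linear maps are suprema over such lists.\<close>

definition unit_list :: "'v nspace \<Rightarrow> nat \<Rightarrow> 'v list \<Rightarrow> bool"
  where "unit_list E k vs \<longleftrightarrow> length vs = k \<and> (\<forall>v\<in>set vs. v \<in> vecs E \<and> nrm E v \<le> 1)"

lemma (in normed_nspace) unit_list_normalize: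
  "length vs = k \<Longrightarrow> set vs \<subseteq> vecs E \<Longrightarrow> unit_list E k (map (\<lambda>v. (1 / nrm E v) *\<^sub>R v) vs)"
  unfolding unit_list_def using nrm_scaleR by fastforce

lemma (in normed_nspace) unit_list_prod:
  assumes "unit_list E k vs"
  shows "length vs = k" "set vs \<subseteq> vecs E" "prod_list (map (nrm E) vs) \<le> 1"
  using assms prod_nrm_le[of vs 1] by (auto simp: unit_list_def)

text \<open>The derivative of \<open>D k\<close> along a unit list, taken in a unit direction
  \<open>h\<close>, is \<open>D (Suc k)\<close> along the list extended by \<open>h\<close>. The
  families therefore reproduce themselves with \<open>k\<close> raised by one, and induction on the
  order closes for all \<open>k\<close> at once.\<close>

lemma equi_C_derivs:
  assumes nE: "normed_nspace E" and nF: "normed_nspace F" and D: "derivs_on E F U D"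
  shows "equi_C n E F U {\<lambda>x. D k x vs | vs. unit_list E k vs}"
proof (induction n arbitrary: k)
  interpret E: normed_nspace E by fact
  interpret F: normed_nspace F by fact
  have mem: "D k x vs \<in> vecs F" if "x \<in> U" "length vs = k" "set vs \<subseteq> vecs E" for k x vs
    using multilinearD(1)[OF derivs_on_multilinear(1)[OF nE D that(1)] that(2,3)] .
  have b: "locally_bounded E F U {\<lambda>x. D k x vs | vs. unit_list E k vs}" for k
    unfolding locally_bounded_def
  proof (intro ballI conjI)
    fix x f assume "x \<in> U" "f \<in> {\<lambda>x. D k x vs | vs. unit_list E k vs}"
    then show "f x \<in> vecs F" using mem E.unit_list_prod by blast
  next
    fix x assume x: "x \<in> U"
    obtain A where A: "A \<ge> 0" "\<And>vs. length vs = k \<Longrightarrow> set vs \<subseteq> vecs E \<Longrightarrow> nrm F (D k x vs) \<le> A * prod_list (map (nrm E) vs)"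
      using derivs_on_multilinear(2)[OF nE D x, of k] by blast
    obtain B where B: "B \<ge> 0" "\<And>vs. length vs = Suc k \<Longrightarrow> set vs \<subseteq> vecs E \<Longrightarrow> nrm F (D (Suc k) x vs) \<le> B * prod_list (map (nrm E) vs)"
      using derivs_on_multilinear(2)[OF nE D x, of "Suc k"] by blast
    from derivs_onD(2)[OF D x zero_less_one, of k] eventually_nsmall_mem eventually_nsmall_less[OF zero_less_one]
    \<comment> \<open>\<open>A\<close> and \<open>B\<close> bound \<open>D k x\<close> and
      \<open>D (Suc k) x\<close> on unit lists, and the leading 1 is the remainder for \<epsilon> =
      1 and \<open>nrm E h < 1\<close>.\<close>
    have "\<forall>\<^sub>F h in nsmall E. x + h \<in> U \<longrightarrow> (\<forall>f\<in>{\<lambda>x. D k x vs | vs. unit_list E k vs}. nrm F (f (x + h)) \<le> 1 + (A + B))"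
    proof eventually_elim
      case (elim h)
      { fix vs assume u: "unit_list E k vs" and xh: "x + h \<in> U"
        note u = E.unit_list_prod[OF u]
        have p: "0 \<le> prod_list (map (nrm E) vs)" by (induction vs) auto
        let ?d = "D k (x + h) vs - D k x vs - D (Suc k) x (h # vs)"
        have m: "D k (x + h) vs \<in> vecs F" "D k x vs \<in> vecs F" "D (Suc k) x (h # vs) \<in> vecs F"
          using mem[OF xh u(1,2)] mem[OF x u(1,2)] mem[OF x, of "h # vs" "Suc k"] u elim(2) by simp_all
        have "nrm F ?d \<le> 1 * nrm E h * prod_list (map (nrm E) vs)"
          by (rule elim(1)[rule_format, OF xh conjI[OF u(1,2)]])
        also have "\<dots> \<le> 1 * 1 * 1" using elim(3) u p by (intro mult_mono) auto
        finally have 1: "nrm F ?d \<le> 1" by simp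
        have "nrm F (D k x vs) \<le> A * prod_list (map (nrm E) vs)" by (rule A(2)[OF u(1,2)])
        also have "\<dots> \<le> A * 1" using u A by (intro mult_left_mono) auto
        finally have 2: "nrm F (D k x vs) \<le> A" by simp
        have "nrm F (D (Suc k) x (h # vs)) \<le> B * (nrm E h * prod_list (map (nrm E) vs))"
          using B(2)[of "h # vs"] u elim(2) by simp
        also have "\<dots> \<le> B * (1 * 1)" using u B elim(3) p by (intro mult_left_mono mult_mono) auto
        finally have 3: "nrm F (D (Suc k) x (h # vs)) \<le> B" by simp
        have "nrm F (?d + (D k x vs + D (Suc k) x (h # vs))) \<le> 1 + (A + B)"
          by (rule order.trans[OF F.nrm_triangle add_mono[OF 1 order.trans[OF F.nrm_triangle add_mono[OF 2 3]]]])
            (simp_all add: m)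
        then have "nrm F (D k (x + h) vs) \<le> 1 + (A + B)" by simp }
      then show ?case by blast
    qed
    then show "\<exists>C. \<forall>\<^sub>F h in nsmall E. x + h \<in> U \<longrightarrow> (\<forall>f\<in>{\<lambda>x. D k x vs | vs. unit_list E k vs}. nrm F (f (x + h)) \<le> C)"
      by blast
  qed
  { case 0 show ?case using b by simp }
  { case (Suc n)
    define P where "P = {(\<lambda>x. D k x vs, \<lambda>x h. D (Suc k) x (h # vs)) | vs. unit_list E k vs}"
    have "unif_deriv E F U P"
    proof (rule unif_derivI)
      fix x f f' assume x: "x \<in> U" and "(f, f') \<in> P"
      then obtain vs where vs: "unit_list E k vs" "f' = (\<lambda>x h. D (Suc k) x (h # vs))" by (auto simp: P_def)
      from multilinear_head[OF derivs_on_multilinear(1)[OF nE D x] E.unit_list_prod(1,2)[OF vs(1)]]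
      show "linear_between E F (f' x)" by (simp add: vs(2))
    next
      fix x and \<epsilon> :: real assume x: "x \<in> U" and e: "\<epsilon> > 0"
      from derivs_onD(2)[OF D x e, of k]
      show "\<forall>\<^sub>F h in nsmall E. x + h \<in> U \<longrightarrow>
         (\<forall>f f'. (f, f') \<in> P \<longrightarrow> nrm F (f (x + h) - f x - f' x h) \<le> \<epsilon> * nrm E h)"
      proof eventually_elim
        case (elim h)
        { fix vs assume u: "unit_list E k vs" and xh: "x + h \<in> U"
          note u = E.unit_list_prod[OF u]
          have "nrm F (D k (x + h) vs - D k x vs - D (Suc k) x (h # vs)) \<le> \<epsilon> * nrm E h * prod_list (map (nrm E) vs)"
            by (rule elim[rule_format, OF xh conjI[OF u(1,2)]])
          also have "\<dots> \<le> \<epsilon> * nrm E h * 1" using u e by (intro mult_left_mono) auto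
          finally have "nrm F (D k (x + h) vs - D k x vs - D (Suc k) x (h # vs)) \<le> \<epsilon> * nrm E h" by simp }
        then show ?case unfolding P_def by blast
      qed
    qed
    moreover have "equi_C n E F U (deriv_family E P)"
    proof (rule equi_C_mono[OF Suc.IH[of "Suc k"]])
      show "deriv_family E P \<subseteq> {\<lambda>x. D (Suc k) x vs | vs. unit_list E (Suc k) vs}"
      proof
        fix g assume "g \<in> deriv_family E P"
        then obtain f f' h where "(f, f') \<in> P" and h: "h \<in> vecs E" "nrm E h \<le> 1" and g: "g = (\<lambda>x. f' x h)"
          by (rule deriv_familyE)
        then obtain vs where vs: "unit_list E k vs" "f' = (\<lambda>x h. D (Suc k) x (h # vs))" by (auto simp: P_def)
        have "unit_list E (Suc k) (h # vs)" using vs(1) h by (auto simp: unit_list_def)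
        then show "g \<in> {\<lambda>x. D (Suc k) x vs | vs. unit_list E (Suc k) vs}" using g vs(2) by blast
      qed
    qed simp
    moreover have "{\<lambda>x. D k x vs | vs. unit_list E k vs} \<subseteq> fst ` P" by (force simp: P_def)
    ultimately show ?case using b by auto }
qed

text \<open>What holds for small increments in \<open>F\<close> holds for the increment of a
  Lipschitz function. This transports remainder estimates at \<open>f x\<close> back to
  \<open>x\<close>.\<close>

lemma eventually_nsmall_compose:
  assumes "eventually P (nsmall F)" "0 \<le> L"
    and "\<forall>\<^sub>F h in nsmall E. Q h \<longrightarrow> d h \<in> vecs F \<and> nrm F (d h) \<le> L * nrm E h"
  shows "\<forall>\<^sub>F h in nsmall E. Q h \<longrightarrow> P (d h)"
proof -
  obtain \<delta> where \<delta>: "\<delta> > 0" "\<And>k. k \<in> vecs F \<Longrightarrow> nrm F k < \<delta> \<Longrightarrow> P k"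
    using assms(1) unfolding eventually_nsmall by blast
  from assms(3) eventually_nsmall_mult_less[OF \<delta>(1) assms(2), of E]
  show ?thesis by eventually_elim (use \<delta>(2) in force)
qed

text \<open>The arguments of the derivatives \<open>D j\<close> have to vary with \<open>x\<close> too: differentiating a composition
  inserts derivatives of \<open>f\<close> there, and with this generality the induction closes.\<close>

lemma equi_C_compose_derivs:
  fixes E :: "'v::real_vector nspace" and F :: "'w::real_vector nspace" and G :: "'u::real_vector nspace"
  assumes nE: "normed_nspace E" and nF: "normed_nspace F" and nG: "normed_nspace G"
    and D: "derivs_on F G V D" and fV: "f ` U \<subseteq> V"
    and f: "equi_C (Suc n) E F U {f}" and \<K>: "equi_C n E F U \<K>"
  shows "equi_C n E G U {\<lambda>x. D j (f x) (map (\<lambda>k. k x) ks) | ks. length ks = j \<and> set ks \<subseteq> \<K>}"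
  using f \<K>
proof (induction n arbitrary: j \<K>)
  interpret E: normed_nspace E by fact
  interpret F: normed_nspace F by fact
  interpret G: normed_nspace G by fact
  define C where "C j \<K> = {\<lambda>x. D j (f x) (map (\<lambda>k. k x) ks) | ks. length ks = j \<and> set ks \<subseteq> \<K>}" for j \<K>
  have mem: "D k (f x) vs \<in> vecs G" if "x \<in> U" "length vs = k" "set vs \<subseteq> vecs F" for k x vs
    using multilinearD(1)[OF derivs_on_multilinear(1)[OF nF D, of "f x"] that(2,3)] fV that(1) by blast
  have b: "locally_bounded E G U (C j \<K>)"
    if f: "equi_C (Suc 0) E F U {f}" and K: "locally_bounded E F U \<K>" for j \<K>
    unfolding locally_bounded_def
  proof (intro ballI conjI)
    fix x g assume x: "x \<in> U" and "g \<in> C j \<K>"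
    then obtain ks where ks: "length ks = j" "set ks \<subseteq> \<K>" "g = (\<lambda>x. D j (f x) (map (\<lambda>k. k x) ks))"
      unfolding C_def by blast
    have "set (map (\<lambda>k. k x) ks) \<subseteq> vecs F" using locally_boundedD(1)[OF K x] ks(2) by auto
    then show "g x \<in> vecs G" using mem[OF x, of "map (\<lambda>k. k x) ks" j] ks(1,3) by simp
  next
    fix x assume x: "x \<in> U"
    then have y: "f x \<in> V" using fV by blast
    obtain P where P: "{f} = fst ` P" "unif_deriv E F U P" "equi_C 0 E F U (deriv_family E P)"
      using f by (rule equi_C_SucE)
    obtain L where L: "L \<ge> 0" "\<forall>f f' h. (f, f') \<in> P \<longrightarrow> h \<in> vecs E \<longrightarrow> nrm F (f' x h) \<le> L * nrm E h"
        "\<forall>\<^sub>F h in nsmall E. x + h \<in> U \<longrightarrow> (\<forall>f f'. (f, f') \<in> P \<longrightarrow> nrm F (f (x + h) - f x) \<le> L * nrm E h)"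
      by (rule unif_deriv_lipschitz[OF nE nF P(2) equi_C_locally_bounded[OF P(3)] x
            equi_C_locally_bounded[OF f, unfolded P(1)]])
    obtain f' where f': "(f, f') \<in> P" using P(1) by force
    have fm: "f x \<in> vecs F" if "x \<in> U" for x
      using locally_boundedD(1)[OF equi_C_locally_bounded[OF f] that] by simp
    have "\<forall>\<^sub>F h in nsmall E. x + h \<in> U \<longrightarrow> f (x + h) - f x \<in> vecs F \<and> nrm F (f (x + h) - f x) \<le> L * nrm E h"
      using L(3) by eventually_elim (use f' fm x in auto)
    note d = this and small = eventually_nsmall_compose[OF _ L(1) this]
    obtain R where R: "\<forall>\<^sub>F h in nsmall E. x + h \<in> U \<longrightarrow> (\<forall>k\<in>\<K>. nrm F (k (x + h)) \<le> R)" "R \<ge> 0"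
      using locally_boundedD(2)[OF K x] by blast
    obtain A where A: "A \<ge> 0" "\<And>vs. length vs = j \<Longrightarrow> set vs \<subseteq> vecs F \<Longrightarrow> nrm G (D j (f x) vs) \<le> A * prod_list (map (nrm F) vs)"
      using derivs_on_multilinear(2)[OF nF D y, of j] by blast
    obtain B where B: "B \<ge> 0" "\<And>vs. length vs = Suc j \<Longrightarrow> set vs \<subseteq> vecs F \<Longrightarrow> nrm G (D (Suc j) (f x) vs) \<le> B * prod_list (map (nrm F) vs)"
      using derivs_on_multilinear(2)[OF nF D y, of "Suc j"] by blast
    from small[OF derivs_onD(2)[OF D y zero_less_one, of j]] small[OF eventually_nsmall_less[OF zero_less_one]] d R(1)
    have "\<forall>\<^sub>F h in nsmall E. x + h \<in> U \<longrightarrow> (\<forall>g\<in>C j \<K>. nrm G (g (x + h)) \<le> R ^ j + (A * R ^ j + B * R ^ j))"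
    proof eventually_elim
      case (elim h)
      { fix ks assume ks: "length ks = j" "set ks \<subseteq> \<K>" and xh: "x + h \<in> U"
        let ?vs = "map (\<lambda>k. k (x + h)) ks" and ?d = "f (x + h) - f x"
        have z: "f x + ?d = f (x + h)" by simp
        have u: "length ?vs = j" "set ?vs \<subseteq> vecs F" using ks locally_boundedD(1)[OF K xh] by auto
        have p: "0 \<le> prod_list (map (nrm F) ?vs)" by (induction ks) auto
        have pR: "prod_list (map (nrm F) ?vs) \<le> R ^ j"
          using F.prod_nrm_le[of ?vs R] elim(4) xh ks by auto
        have d: "?d \<in> vecs F" "nrm F ?d \<le> 1" using elim(2,3) xh by auto
        let ?D = "D j (f (x + h)) ?vs - D j (f x) ?vs - D (Suc j) (f x) (?d # ?vs)"
        have m: "D j (f (x + h)) ?vs \<in> vecs G" "D j (f x) ?vs \<in> vecs G" "D (Suc j) (f x) (?d # ?vs) \<in> vecs G"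
          using mem[OF xh u] mem[OF x u] mem[OF x, of "?d # ?vs" "Suc j"] u d by auto
        have "f (x + h) \<in> V" using fV xh by blast
        then have "nrm G ?D \<le> 1 * nrm F ?d * prod_list (map (nrm F) ?vs)"
          using elim(1)[rule_format, OF xh _ conjI[OF u]] z by simp
        also have "\<dots> \<le> 1 * 1 * R ^ j" using d p pR by (intro mult_mono) auto
        finally have 1: "nrm G ?D \<le> R ^ j" by simp
        have 2: "nrm G (D j (f x) ?vs) \<le> A * R ^ j"
          using A(2)[OF u] mult_left_mono[OF pR A(1)] by linarith
        have "nrm G (D (Suc j) (f x) (?d # ?vs)) \<le> B * (nrm F ?d * prod_list (map (nrm F) ?vs))"
          using B(2)[of "?d # ?vs"] u d by simp
        also have "\<dots> \<le> B * (1 * R ^ j)" using B d p pR by (intro mult_left_mono mult_mono) auto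
        finally have 3: "nrm G (D (Suc j) (f x) (?d # ?vs)) \<le> B * R ^ j" by simp
        have "nrm G (?D + (D j (f x) ?vs + D (Suc j) (f x) (?d # ?vs))) \<le> R ^ j + (A * R ^ j + B * R ^ j)"
          by (rule order.trans[OF G.nrm_triangle add_mono[OF 1 order.trans[OF G.nrm_triangle add_mono[OF 2 3]]]])
            (simp_all only: m G.add_mem G.diff_mem)
        then have "nrm G (D j (f (x + h)) ?vs) \<le> R ^ j + (A * R ^ j + B * R ^ j)" by simp }
      then show ?case unfolding C_def by blast
    qed
    then show "\<exists>B. \<forall>\<^sub>F h in nsmall E. x + h \<in> U \<longrightarrow> (\<forall>g\<in>C j \<K>. nrm G (g (x + h)) \<le> B)" by blast
  qed
  { case 0 then show ?case using b[unfolded C_def] by simp }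
  { case (Suc n)
    note fn = Suc.prems(1) and Kn = Suc.prems(2)
    obtain Pf where Pf: "{f} = fst ` Pf" "unif_deriv E F U Pf" "equi_C (Suc n) E F U (deriv_family E Pf)"
      using fn by (rule equi_C_SucE)
    obtain f' where f': "(f, f') \<in> Pf" using Pf(1) by force
    obtain Q where Q: "\<K> = fst ` Q" "unif_deriv E F U Q" "equi_C n E F U (deriv_family E Q)"
      using Kn by (rule equi_C_SucE)
    note bf = equi_C_locally_bounded[OF fn] and bK = equi_C_locally_bounded[OF Kn]
    note bPf = equi_C_locally_bounded[OF Pf(3)] and bQ = equi_C_locally_bounded[OF Q(3)]
    have fm: "f x \<in> vecs F" if "x \<in> U" for x using locally_boundedD(1)[OF bf that] by simp
    have qm: "fst q x \<in> vecs F" if "x \<in> U" "q \<in> Q" for q x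
      using locally_boundedD(1)[OF bK that(1)] that(2) Q(1) by blast
    have qm': "snd q x h \<in> vecs F" if "x \<in> U" "q \<in> Q" "h \<in> vecs E" for q x h
      using linear_betweenD(1)[OF unif_derivD(1)[OF Q(2) that(1)], of "fst q" "snd q"] that by simp
    have ql: "linear_between E F (snd q x)" if "x \<in> U" "q \<in> Q" for q x
      using unif_derivD(1)[OF Q(2) that(1), of "fst q" "snd q"] that by simp
    have fl: "linear_between E F (f' x)" if "x \<in> U" for x
      using unif_derivD(1)[OF Pf(2) that f'] .
    define val where "val qs x = map (\<lambda>q. fst q x) qs" for qs :: "(('v \<Rightarrow> 'w) \<times> ('v \<Rightarrow> 'v \<Rightarrow> 'w)) list" and x
    \<comment> \<open>The derivative of \<open>D j (f x)\<close> at moving arguments. Moving the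
      base point inserts the derivative of \<open>f\<close> as a new first argument of
      \<open>D (Suc j)\<close>; moving the \<open>i\<close>-th argument replaces it by its
      derivative.\<close>
    define der where "der qs x h = D (Suc j) (f x) (f' x h # val qs x) +
      (\<Sum>i<j. D j (f x) ((val qs x)[i := snd (qs ! i) x h]))" for qs x h
    define P where "P = {(\<lambda>x. D j (f x) (val qs x), der qs) | qs. length qs = j \<and> set qs \<subseteq> Q}"
    have val: "length (val qs x) = j" "set (val qs x) \<subseteq> vecs F"
      if "x \<in> U" "length qs = j" "set qs \<subseteq> Q" for qs x
      using that qm by (auto simp: val_def)
    have upd: "set ((val qs x)[i := snd (qs ! i) x h]) \<subseteq> vecs F"
      if "x \<in> U" "length qs = j" "set qs \<subseteq> Q" "i < j" "h \<in> vecs E" for qs x i h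
    proof -
      have "qs ! i \<in> Q" using that nth_mem by blast
      then show ?thesis using val[OF that(1-3)] qm'[OF that(1) _ that(5)]
        by (intro subset_trans[OF set_update_subset_insert]) auto
    qed
    have "unif_deriv E G U P"
    proof (rule unif_derivI)
      fix x g g' assume x: "x \<in> U" and "(g, g') \<in> P"
      then obtain qs where qs: "length qs = j" "set qs \<subseteq> Q" "g' = der qs" by (auto simp: P_def)
      note ml = derivs_on_multilinear(1)[OF nF D, of "f x"]
      have y: "f x \<in> V" using fV x by blast
      note v = val[OF x qs(1,2)]
      show "linear_between E G (g' x)"
        unfolding linear_between_def qs(3)
      proof (intro conjI ballI allI)
        fix h assume h: "h \<in> vecs E"
        show "der qs x h \<in> vecs G"
          unfolding der_def
          using mem[OF x, of "f' x h # val qs x" "Suc j"] linear_betweenD(1)[OF fl[OF x] h] v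
            upd[OF x qs(1,2) _ h]
          by (intro G.add_mem G.sum_mem mem[OF x]) auto
      next
        fix h k a b assume h: "h \<in> vecs E" and k: "k \<in> vecs E"
        have 1: "D (Suc j) (f x) (f' x (a *\<^sub>R h + b *\<^sub>R k) # val qs x) =
            a *\<^sub>R D (Suc j) (f x) (f' x h # val qs x) + b *\<^sub>R D (Suc j) (f x) (f' x k # val qs x)"
          using linear_betweenD(2)[OF multilinear_head[OF ml[OF y] v] linear_betweenD(1)[OF fl[OF x] h]
              linear_betweenD(1)[OF fl[OF x] k]] linear_betweenD(2)[OF fl[OF x] h k] by simp
        have 2: "D j (f x) ((val qs x)[i := snd (qs ! i) x (a *\<^sub>R h + b *\<^sub>R k)]) =
            a *\<^sub>R D j (f x) ((val qs x)[i := snd (qs ! i) x h]) + b *\<^sub>R D j (f x) ((val qs x)[i := snd (qs ! i) x k])"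
          if i: "i < j" for i
        proof -
          have q: "qs ! i \<in> Q" using i qs nth_mem by blast
          have "D j (f x) (take i (val qs x) @ (a *\<^sub>R snd (qs ! i) x h + b *\<^sub>R snd (qs ! i) x k) # drop (Suc i) (val qs x)) =
            a *\<^sub>R D j (f x) (take i (val qs x) @ snd (qs ! i) x h # drop (Suc i) (val qs x)) +
            b *\<^sub>R D j (f x) (take i (val qs x) @ snd (qs ! i) x k # drop (Suc i) (val qs x))"
          proof (rule multilinearD(2)[OF ml[OF y]])
            show "set (take i (val qs x)) \<subseteq> vecs F" "set (drop (Suc i) (val qs x)) \<subseteq> vecs F"
              using v(2) set_take_subset set_drop_subset by (meson subset_trans)+
          qed (use i v qm'[OF x q] h k in auto)
          then show ?thesis
            using i v by (simp add: upd_conv_take_nth_drop linear_betweenD(2)[OF ql[OF x q] h k])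
        qed
        show "der qs x (a *\<^sub>R h + b *\<^sub>R k) = a *\<^sub>R der qs x h + b *\<^sub>R der qs x k"
          unfolding der_def 1 by (simp add: 2 scaleR_add_right sum.distrib scaleR_sum_right)
      qed
    next
      fix x and \<epsilon> :: real assume x: "x \<in> U" and e: "\<epsilon> > 0"
      have y: "f x \<in> V" using fV x by blast
      note ml = derivs_on_multilinear(1)[OF nF D y]
      obtain L where L: "L \<ge> 0" "\<forall>f f' h. (f, f') \<in> Pf \<longrightarrow> h \<in> vecs E \<longrightarrow> nrm F (f' x h) \<le> L * nrm E h"
          "\<forall>\<^sub>F h in nsmall E. x + h \<in> U \<longrightarrow> (\<forall>f f'. (f, f') \<in> Pf \<longrightarrow> nrm F (f (x + h) - f x) \<le> L * nrm E h)"
        by (rule unif_deriv_lipschitz[OF nE nF Pf(2) bPf x bf[unfolded Pf(1)]])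
      obtain M where M: "M \<ge> 0" "\<forall>f f' h. (f, f') \<in> Q \<longrightarrow> h \<in> vecs E \<longrightarrow> nrm F (f' x h) \<le> M * nrm E h"
          "\<forall>\<^sub>F h in nsmall E. x + h \<in> U \<longrightarrow> (\<forall>f f'. (f, f') \<in> Q \<longrightarrow> nrm F (f (x + h) - f x) \<le> M * nrm E h)"
        by (rule unif_deriv_lipschitz[OF nE nF Q(2) bQ x bK[unfolded Q(1)]])
      have d: "\<forall>\<^sub>F h in nsmall E. x + h \<in> U \<longrightarrow> f (x + h) - f x \<in> vecs F \<and> nrm F (f (x + h) - f x) \<le> L * nrm E h"
        using L(3) by eventually_elim (use f' fm x in auto)
      note small = eventually_nsmall_compose[OF _ L(1) d]
      obtain R1 where R1: "\<forall>\<^sub>F h in nsmall E. x + h \<in> U \<longrightarrow> (\<forall>k\<in>\<K>. nrm F (k (x + h)) \<le> R1)"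
        using locally_boundedD(2)[OF bK x] by blast
      obtain R2 where R2: "\<forall>k\<in>\<K>. nrm F (k x) \<le> R2"
        using locally_bounded_at[OF bK x nE] by blast
      \<comment> \<open>\<open>multilinear_increment\<close> wants a single bound for the arguments
        at \<open>x\<close> and at \<open>x + h\<close>, and one that is at least 1.\<close>
      define R where "R = max 1 (max R1 R2)"
      have R: "R \<ge> 1" "R1 \<le> R" "R2 \<le> R" by (auto simp: R_def)
      obtain A where A: "A \<ge> 0" "\<And>vs. length vs = j \<Longrightarrow> set vs \<subseteq> vecs F \<Longrightarrow> nrm G (D j (f x) vs) \<le> A * prod_list (map (nrm F) vs)"
        using derivs_on_multilinear(2)[OF nF D y, of j] by blast
      obtain B where B: "B \<ge> 0" "\<And>vs. length vs = Suc j \<Longrightarrow> set vs \<subseteq> vecs F \<Longrightarrow> nrm G (D (Suc j) (f x) vs) \<le> B * prod_list (map (nrm F) vs)"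
        using derivs_on_multilinear(2)[OF nF D y, of "Suc j"] by blast
      \<comment> \<open>\<open>c1\<close> collects the coefficients of the three remainders of size
        \<eta>: that of \<open>D j\<close>, that of \<open>f\<close>, and those of the
        \<open>j\<close> arguments. \<open>c2\<close> collects the terms of second order in
        \<open>nrm E h\<close>. Each group gets half of \<epsilon>.\<close>
      define c1 where "c1 = (L + B + A * j) * R ^ j"
      define c2 where "c2 = B * L * R ^ j * (j * M) + A * R ^ j * (j * (j * M\<^sup>2))"
      have c1: "c1 \<ge> 0" unfolding c1_def using A(1) B(1) L(1) R(1) by (intro mult_nonneg_nonneg add_nonneg_nonneg) auto
      have c2: "c2 \<ge> 0" unfolding c2_def using A(1) B(1) L(1) M(1) R(1)
        by (intro mult_nonneg_nonneg add_nonneg_nonneg) auto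
      define \<eta> where "\<eta> = \<epsilon> / 2 / (c1 + 1)"
      have \<eta>: "\<eta> > 0" "\<eta> * c1 \<le> \<epsilon> / 2" using e c1 by (auto simp: \<eta>_def field_simps)
      have e2: "\<epsilon> / 2 > 0" using e by simp
      from small[OF derivs_onD(2)[OF D y \<eta>(1), of j]] d R1 M(3) unif_derivD(2)[OF Pf(2) x \<eta>(1)]
        unif_derivD(2)[OF Q(2) x \<eta>(1)] eventually_nsmall_mem eventually_nsmall_mult_less[OF e2 c2, of E]
      show "\<forall>\<^sub>F h in nsmall E. x + h \<in> U \<longrightarrow>
         (\<forall>g g'. (g, g') \<in> P \<longrightarrow> nrm G (g (x + h) - g x - g' x h) \<le> \<epsilon> * nrm E h)"
      proof eventually_elim
        case (elim h)
        note h = elim(7)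
        { fix qs assume qs: "length qs = j" "set qs \<subseteq> Q" and xh: "x + h \<in> U"
          let ?p = "val qs (x + h)" and ?q = "val qs x" and ?d = "f (x + h) - f x" and ?t = "nrm E h"
          let ?S = "\<Sum>i<j. D j (f x) (?q[i := snd (qs ! i) x h])"
          have z: "f x + ?d = f (x + h)" by simp
          note vp = val[OF xh qs] and vq = val[OF x qs]
          have d: "?d \<in> vecs F" "nrm F ?d \<le> L * ?t" using elim(2) xh by auto
          have f'm: "f' x h \<in> vecs F" "nrm F (f' x h) \<le> L * ?t"
            using linear_betweenD(1)[OF fl[OF x] h] L(2)[rule_format, OF f' h] by auto
          have pn: "0 \<le> prod_list (map (nrm F) ?p)" by (induction qs) (auto simp: val_def)
          have Kmem: "fst q \<in> \<K>" if "q \<in> set qs" for q using that qs Q(1) by auto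
          have "nrm F v \<le> R" if v: "v \<in> set ?p" for v
          proof -
            from v obtain q where q: "q \<in> set qs" "v = fst q (x + h)" unfolding val_def set_map by blast
            show ?thesis unfolding q(2) using elim(3)[rule_format, OF xh Kmem[OF q(1)]] R(2) by (rule order.trans)
          qed
          from F.prod_nrm_le[of ?p R, OF this] have pR: "prod_list (map (nrm F) ?p) \<le> R ^ j"
            unfolding vp(1) .
          have mm: "D j (f (x + h)) ?p \<in> vecs G" "D j (f x) ?p \<in> vecs G" "D j (f x) ?q \<in> vecs G"
            by (rule mem[OF xh vp] mem[OF x vp] mem[OF x vq])+
          have mS: "D (Suc j) (f x) (w # ?p) \<in> vecs G" "D (Suc j) (f x) (w # ?q) \<in> vecs G" if "w \<in> vecs F" for w
            using mem[OF x, of "w # ?p" "Suc j"] mem[OF x, of "w # ?q" "Suc j"] vp vq that by auto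
          have mSum: "?S \<in> vecs G" using upd[OF x qs _ h] vq by (intro G.sum_mem mem[OF x]) auto
          have xs: "\<And>q. q \<in> set qs \<Longrightarrow> fst q (x + h) \<in> vecs F \<and> fst q x \<in> vecs F \<and> snd q x h \<in> vecs F"
            using qm qm' x xh h qs by blast
          have bds: "\<And>q. q \<in> set qs \<Longrightarrow> nrm F (fst q (x + h)) \<le> R \<and> nrm F (fst q x) \<le> R \<and> nrm F (snd q x h) \<le> M * ?t \<and>
              nrm F (fst q (x + h) - fst q x) \<le> M * ?t \<and> nrm F (fst q (x + h) - fst q x - snd q x h) \<le> \<eta> * ?t"
          proof (intro conjI)
            fix q assume q: "q \<in> set qs"
            then have qQ: "(fst q, snd q) \<in> Q" using qs by auto
            show "nrm F (fst q (x + h)) \<le> R" using elim(3)[rule_format, OF xh Kmem[OF q]] R by linarith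
            show "nrm F (fst q x) \<le> R" using R2[rule_format, OF Kmem[OF q]] R by linarith
            show "nrm F (snd q x h) \<le> M * ?t" by (rule M(2)[rule_format, OF qQ h])
            show "nrm F (fst q (x + h) - fst q x) \<le> M * ?t" by (rule elim(4)[rule_format, OF xh qQ])
            show "nrm F (fst q (x + h) - fst q x - snd q x h) \<le> \<eta> * ?t" by (rule elim(6)[rule_format, OF xh qQ])
          qed
          have s0: "0 \<le> M * ?t" "0 \<le> \<eta> * ?t" "0 \<le> L * ?t" using M(1) L(1) \<eta>(1) by simp_all
          have t4: "nrm G (D j (f x) ?p - D j (f x) ?q - ?S) \<le> A * R ^ j * (j * (\<eta> * ?t + j * (M * ?t)\<^sup>2))"
          proof -
            have m: "multilinear F G (length qs) (D j (f x))" using ml[of j] qs by simp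
            have b:  "nrm G (D j (f x) vs) \<le> A * prod_list (map (nrm F) vs)"
              if "length vs = length qs" "set vs \<subseteq> vecs F" for vs
              using A(2)[of vs] that qs by simp
            show ?thesis
              using multilinear_increment(2)[where p = "\<lambda>q. fst q (x + h)" and q = "\<lambda>q. fst q x" and
                  r = "\<lambda>q. snd q x h", OF nF nG R(1) s0(1,2) xs bds m A(1) b] qs
              by (simp add: val_def)
          qed
          have mh: "multilinear F G (length qs) (\<lambda>vs. D (Suc j) (f x) (f' x h # vs))"
            using multilinear_Cons[OF ml f'm(1)] qs by simp
          have bh: "nrm G (D (Suc j) (f x) (f' x h # vs)) \<le> B * (L * ?t) * prod_list (map (nrm F) vs)"
            if "length vs = length qs" "set vs \<subseteq> vecs F" for vs
          proof -
            have q: "0 \<le> prod_list (map (nrm F) vs)" by (induction vs) auto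
            have "nrm G (D (Suc j) (f x) (f' x h # vs)) \<le> B * (nrm F (f' x h) * prod_list (map (nrm F) vs))"
              using B(2)[of "f' x h # vs"] that qs f'm by simp
            also have "\<dots> \<le> B * (L * ?t * prod_list (map (nrm F) vs))"
              using f'm(2) q B(1) by (intro mult_left_mono mult_right_mono) auto
            finally show ?thesis by (simp add: mult.assoc)
          qed
          have "0 \<le> B * (L * ?t)" using B(1) s0(3) by simp
          from multilinear_increment(1)[where p = "\<lambda>q. fst q (x + h)" and q = "\<lambda>q. fst q x" and r = "\<lambda>q. snd q x h",
              OF nF nG R(1) s0(1,2) xs bds mh this bh]
          have t3: "nrm G (D (Suc j) (f x) (f' x h # ?p) - D (Suc j) (f x) (f' x h # ?q)) \<le>
              B * (L * ?t) * R ^ j * (j * (M * ?t))"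
            using qs by (simp add: val_def)
          have t2: "nrm G (D (Suc j) (f x) (?d # ?p) - D (Suc j) (f x) (f' x h # ?p)) \<le> B * (\<eta> * ?t) * R ^ j"
          proof -
            have "D (Suc j) (f x) (?d # ?p) - D (Suc j) (f x) (f' x h # ?p) = D (Suc j) (f x) ((?d - f' x h) # ?p)"
              using linear_betweenD(4)[OF multilinear_head[OF ml vp] d(1) f'm(1)] by simp
            also have "nrm G \<dots> \<le> B * (nrm F (?d - f' x h) * prod_list (map (nrm F) ?p))"
              using B(2)[of "(?d - f' x h) # ?p"] vp d f'm by simp
            also have "\<dots> \<le> B * (\<eta> * ?t * R ^ j)"
              using elim(5)[rule_format, OF xh f'] pR pn B(1) s0 by (intro mult_left_mono mult_mono) auto
            finally show ?thesis by (simp add: mult.assoc)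
          qed
          have t1: "nrm G (D j (f (x + h)) ?p - D j (f x) ?p - D (Suc j) (f x) (?d # ?p)) \<le> \<eta> * (L * ?t) * R ^ j"
          proof -
            have "f (x + h) \<in> V" using fV xh by blast
            then have "nrm G (D j (f (x + h)) ?p - D j (f x) ?p - D (Suc j) (f x) (?d # ?p)) \<le>
                \<eta> * nrm F ?d * prod_list (map (nrm F) ?p)"
              using elim(1)[rule_format, OF xh _ conjI[OF vp]] z by simp
            also have "\<dots> \<le> \<eta> * (L * ?t) * R ^ j"
              using d pR pn \<eta>(1) s0(3) L(1) by (intro mult_mono mult_left_mono mult_nonneg_nonneg) auto
            finally show ?thesis .
          qed
          \<comment> \<open>Four errors in turn: moving the base point of \<open>D j\<close>,
            replacing the increment of \<open>f\<close> by its derivative, moving the arguments of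
            \<open>D (Suc j)\<close> back to \<open>x\<close>, and linearising the arguments of
            \<open>D j\<close>.\<close>
          have eq: "D j (f (x + h)) ?p - D j (f x) ?q - der qs x h =
              (D j (f (x + h)) ?p - D j (f x) ?p - D (Suc j) (f x) (?d # ?p)) +
              ((D (Suc j) (f x) (?d # ?p) - D (Suc j) (f x) (f' x h # ?p)) +
              ((D (Suc j) (f x) (f' x h # ?p) - D (Suc j) (f x) (f' x h # ?q)) +
              (D j (f x) ?p - D j (f x) ?q - ?S)))"
            by (simp add: der_def)
          have "nrm G (D j (f (x + h)) ?p - D j (f x) ?q - der qs x h) \<le>
            \<eta> * (L * ?t) * R ^ j + (B * (\<eta> * ?t) * R ^ j + (B * (L * ?t) * R ^ j * (j * (M * ?t)) +
              A * R ^ j * (j * (\<eta> * ?t + j * (M * ?t)\<^sup>2))))"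
            unfolding eq
            by (rule order.trans[OF G.nrm_triangle add_mono[OF t1 order.trans[OF G.nrm_triangle add_mono[OF t2
                order.trans[OF G.nrm_triangle add_mono[OF t3 t4]]]]]])
              (intro G.add_mem G.diff_mem mm mS mSum d f'm)+
          also have "\<dots> = (\<eta> * c1 + c2 * ?t) * ?t"
            unfolding c1_def c2_def by (simp add: algebra_simps power2_eq_square)
          also have "\<dots> \<le> \<epsilon> * ?t"
            using elim(8) \<eta>(2) by (intro mult_right_mono) auto
          finally have "nrm G (D j (f (x + h)) ?p - D j (f x) ?q - der qs x h) \<le> \<epsilon> * ?t" . }
        then show ?case unfolding P_def by blast
      qed
    qed
    moreover have "equi_C n E G U (deriv_family E P)"
    proof -
      \<comment> \<open>Everything that differentiation can put into an argument slot: old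
        arguments, derivatives of \<open>f\<close>, derivatives of old arguments. All of it has
        order at least \<open>n\<close>, as the induction hypothesis requires.\<close>
      define \<K>' where "\<K>' = \<K> \<union> (deriv_family E Pf \<union> deriv_family E Q)"
      have "equi_C n E F U \<K>'"
        unfolding \<K>'_def by (intro equi_C_Un equi_C_SucD[OF Kn] equi_C_SucD[OF Pf(3)] Q(3))
      note IH = Suc.IH[OF equi_C_SucD[OF fn] this]
      let ?\<F> = "C (Suc j) \<K>' \<union> C j \<K>'"
      have "equi_C n E G U ?\<F>" unfolding C_def by (intro equi_C_Un IH)
      note S = equi_C_sum[OF nE nG this, of "Suc j"]
      show ?thesis
      proof (rule equi_C_mono[OF S])
        show "deriv_family E P \<subseteq> {\<lambda>x. \<Sum>i<Suc j. \<phi> i x | \<phi>. \<forall>i<Suc j. \<phi> i \<in> ?\<F>}"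
        proof
          fix k assume "k \<in> deriv_family E P"
          then obtain g g' h where "(g, g') \<in> P" and h: "h \<in> vecs E" "nrm E h \<le> 1" and "k = (\<lambda>x. g' x h)"
            by (rule deriv_familyE)
          then obtain qs where qs: "length qs = j" "set qs \<subseteq> Q" and k: "k = (\<lambda>x. der qs x h)" by (auto simp: P_def)
          let ?ks = "map fst qs"
          have ks: "length ?ks = j" "set ?ks \<subseteq> \<K>'" using qs Q(1) by (auto simp: \<K>'_def)
          \<comment> \<open>Index 0 carries the term that differentiates \<open>f\<close>, index
            \<open>Suc i\<close> the term that differentiates the \<open>i\<close>-th
            argument.\<close>
          define \<phi> where "\<phi> i = (case i of 0 \<Rightarrow> \<lambda>x. D (Suc j) (f x) (map (\<lambda>k. k x) ((\<lambda>x. f' x h) # ?ks))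
            | Suc i \<Rightarrow> \<lambda>x. D j (f x) (map (\<lambda>k. k x) (?ks[i := \<lambda>x. snd (qs ! i) x h])))" for i
          have "\<phi> i \<in> ?\<F>" if "i < Suc j" for i
          proof (cases i)
            case 0
            have "(\<lambda>x. f' x h) \<in> \<K>'" using deriv_familyI[OF f' h] by (simp add: \<K>'_def)
            then have "length ((\<lambda>x. f' x h) # ?ks) = Suc j \<and> set ((\<lambda>x. f' x h) # ?ks) \<subseteq> \<K>'" using ks by simp
            then have "\<phi> i \<in> C (Suc j) \<K>'" unfolding C_def \<phi>_def 0 by (simp only: nat.case) blast
            then show ?thesis by blast
          next
            case (Suc i')
            then have "qs ! i' \<in> Q" using that qs nth_mem by fastforce
            then have "(fst (qs ! i'), snd (qs ! i')) \<in> Q" by simp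
            from deriv_familyI[OF this h] have "(\<lambda>x. snd (qs ! i') x h) \<in> \<K>'" by (simp add: \<K>'_def)
            then have "length (?ks[i' := \<lambda>x. snd (qs ! i') x h]) = j \<and> set (?ks[i' := \<lambda>x. snd (qs ! i') x h]) \<subseteq> \<K>'"
              using ks by (intro conjI subset_trans[OF set_update_subset_insert]) auto
            then have "\<phi> i \<in> C j \<K>'" unfolding C_def \<phi>_def Suc by (simp only: nat.case) blast
            then show ?thesis by blast
          qed
          moreover have "k = (\<lambda>x. \<Sum>i<Suc j. \<phi> i x)"
            unfolding k der_def
            by (rule ext) (simp add: sum.lessThan_Suc_shift \<phi>_def val_def map_update o_def del: sum.lessThan_Suc)
          ultimately show "k \<in> {\<lambda>x. \<Sum>i<Suc j. \<phi> i x | \<phi>. \<forall>i<Suc j. \<phi> i \<in> ?\<F>}" by blast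
        qed
      qed simp
    qed
    moreover have "C j \<K> \<subseteq> fst ` P"
    proof
      fix g assume "g \<in> C j \<K>"
      then obtain ks where ks: "length ks = j" "set ks \<subseteq> \<K>" "g = (\<lambda>x. D j (f x) (map (\<lambda>k. k x) ks))"
        unfolding C_def by blast
      then have "ks \<in> lists (fst ` Q)" using Q(1) by auto
      then obtain qs where "qs \<in> lists Q" "ks = map fst qs" unfolding lists_image by blast
      then have "(g, der qs) \<in> P" using ks unfolding P_def val_def by (auto simp: o_def)
      then show "g \<in> fst ` P" by force
    qed
    moreover have "locally_bounded E G U (C j \<K>)"
      using b[OF equi_C_le[OF fn] bK] by simp
    ultimately have "equi_C (Suc n) E G U (C j \<K>)" by auto
    then show ?case unfolding C_def . }
qed

section \<open>Iterated directional derivatives, and smoothness at a point\<close>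

definition has_deriv ::
  "'v::real_vector nspace \<Rightarrow> 'w::real_vector nspace \<Rightarrow> ('v \<Rightarrow> 'w) \<Rightarrow> 'v \<Rightarrow> ('v \<Rightarrow> 'w) \<Rightarrow> bool"
  where "has_deriv E F f x l \<longleftrightarrow> linear_between E F l \<and> f x \<in> vecs F \<and> (\<forall>\<^sub>F h in nsmall E. f (x + h) \<in> vecs F) \<and>
    (\<forall>\<epsilon>>0. \<forall>\<^sub>F h in nsmall E. nrm F (f (x + h) - f x - l h) \<le> \<epsilon> * nrm E h)"

text \<open>Choosing the derivative pointwise makes no reference to a neighbourhood, so derivatives
  found on different neighbourhoods agree by construction. At points of differentiability the choice
  is harmless by \<open>has_deriv_unique\<close>.\<close>

definition dir_deriv ::
  "'v::real_vector nspace \<Rightarrow> 'w::real_vector nspace \<Rightarrow> ('v \<Rightarrow> 'w) \<Rightarrow> 'v \<Rightarrow> 'v \<Rightarrow> 'w"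
  where "dir_deriv E F f h x = (SOME l. has_deriv E F f x l) h"

text \<open>The head of the list is the direction of the last differentiation, as in
  \<open>smooth_on\<close>, where \<open>D (Suc k) x (h # vs)\<close> differentiates
  \<open>D k\<close> in direction \<open>h\<close>.\<close>

primrec iter_deriv ::
  "'v::real_vector nspace \<Rightarrow> 'w::real_vector nspace \<Rightarrow> ('v \<Rightarrow> 'w) \<Rightarrow> 'v list \<Rightarrow> 'v \<Rightarrow> 'w" where
  "iter_deriv E F f [] = f"
| "iter_deriv E F f (h # vs) = dir_deriv E F (iter_deriv E F f vs) h"

text \<open>The difference of two derivatives is linear and of smaller order than its argument;
  evaluating it at a small multiple of \<open>h\<close> and dividing by the factor shows that it
  vanishes.\<close>

lemma has_deriv_unique:
  assumes nE: "normed_nspace E" and nF: "normed_nspace F"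
    and l: "has_deriv E F f x l" and l': "has_deriv E F f x l'" and h: "h \<in> vecs E"
  shows "l h = l' h"
proof (rule ccontr)
  interpret E: normed_nspace E by fact
  interpret F: normed_nspace F by fact
  assume "l h \<noteq> l' h"
  have L: "linear_between E F l" and L': "linear_between E F l'" using l l' by (auto simp: has_deriv_def)
  have m: "l k \<in> vecs F" "l' k \<in> vecs F" if "k \<in> vecs E" for k
    using linear_betweenD(1)[OF L that] linear_betweenD(1)[OF L' that] by auto
  let ?u = "nrm F (l h - l' h)"
  have u: "?u > 0" using F.nrm_eq_0[of "l h - l' h"] m[OF h] \<open>l h \<noteq> l' h\<close> F.nrm_nonneg[of "l h - l' h"]
    by (smt (verit) F.diff_mem right_minus_eq)
  \<comment> \<open>The two remainders add up to \<open>2 * e * nrm E k\<close>; after rescaling to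
    \<open>h\<close> this bounds \<open>?u\<close> by \<open>?u / 2\<close>. The \<open>+ 1\<close>
    keeps the denominator positive when \<open>nrm E h = 0\<close>.\<close>
  define e where "e = ?u / (4 * (nrm E h + 1))"
  have n: "nrm E h + 1 > 0" using E.nrm_nonneg[of h] by (simp add: add_nonneg_pos)
  have e: "e > 0" using u n by (simp add: e_def)
  have "\<forall>\<^sub>F k in nsmall E. k \<in> vecs E \<longrightarrow> nrm F (l k - l' k) \<le> 2 * e * nrm E k"
    using l[unfolded has_deriv_def, THEN conjunct2, THEN conjunct2, THEN conjunct2, rule_format, OF e]
      l'[unfolded has_deriv_def, THEN conjunct2, THEN conjunct2, THEN conjunct2, rule_format, OF e]
      l[unfolded has_deriv_def, THEN conjunct2, THEN conjunct2, THEN conjunct1]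
  proof eventually_elim
    case (elim k)
    have fx: "f x \<in> vecs F" using l by (simp add: has_deriv_def)
    show ?case
    proof
      assume k: "k \<in> vecs E"
      have "nrm F ((f (x + k) - f x - l' k) - (f (x + k) - f x - l k)) \<le> e * nrm E k + e * nrm E k"
        using m[OF k] fx elim by (intro order.trans[OF F.nrm_diff add_mono]) auto
      then show "nrm F (l k - l' k) \<le> 2 * e * nrm E k" by simp
    qed
  qed
  then obtain d where d: "d > 0" "\<And>k. k \<in> vecs E \<Longrightarrow> nrm E k < d \<Longrightarrow> nrm F (l k - l' k) \<le> 2 * e * nrm E k"
    unfolding eventually_nsmall by blast
  define t where "t = d / (2 * (nrm E h + 1))"
  have t: "t > 0" using d n by (simp add: t_def)
  have "t * nrm E h < d"
  proof -
    have "t * nrm E h \<le> t * (nrm E h + 1)" using t by (intro mult_left_mono) auto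
    also have "\<dots> = d / 2"
    proof -
      have "d / (2 * m) * m = d / 2" if "m > 0" for m :: real using that by simp
      from this[OF n] show ?thesis by (simp only: t_def)
    qed
    finally show ?thesis using d(1) by linarith
  qed
  then have "nrm F (l (t *\<^sub>R h) - l' (t *\<^sub>R h)) \<le> 2 * e * nrm E (t *\<^sub>R h)"
    using d(2)[of "t *\<^sub>R h"] h t by (simp add: E.nrm_scaleR)
  moreover have "l (t *\<^sub>R h) - l' (t *\<^sub>R h) = t *\<^sub>R (l h - l' h)"
    using linear_betweenD(5)[OF L h] linear_betweenD(5)[OF L' h] by (simp add: scaleR_diff_right)
  moreover have "nrm F (t *\<^sub>R (l h - l' h)) = t * ?u" "nrm E (t *\<^sub>R h) = t * nrm E h"
    using F.nrm_scaleR[OF F.diff_mem[OF m[OF h]], of t] E.nrm_scaleR[OF h, of t] t by simp_all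
  ultimately have "t * ?u \<le> t * (2 * e * nrm E h)" by (simp only: mult_ac)
  then have "?u \<le> 2 * e * nrm E h" using t by (simp only: mult_le_cancel_left_pos)
  also have "\<dots> \<le> 2 * e * (nrm E h + 1)" using e by simp
  also have "\<dots> = ?u / 2"
  proof -
    have "2 * (u / (4 * m)) * m = u / 2" if "m > 0" for u m :: real using that by simp
    from this[OF n] show ?thesis by (simp only: e_def)
  qed
  finally show False using u by simp
qed

lemma dir_deriv_eq:
  assumes "normed_nspace E" "normed_nspace F" "has_deriv E F f x l" "h \<in> vecs E"
  shows "dir_deriv E F f h x = l h"
  unfolding dir_deriv_def
  using has_deriv_unique[OF assms(1,2) someI[where P = "has_deriv E F f x", OF assms(3)] assms(3,4)] .

lemma has_deriv_lincomb:
  assumes nF: "normed_nspace F" and f: "has_deriv E F f x l" and g: "has_deriv E F g x m"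
  shows "has_deriv E F (\<lambda>x. a *\<^sub>R f x + b *\<^sub>R g x) x (\<lambda>h. a *\<^sub>R l h + b *\<^sub>R m h)"
proof -
  interpret F: normed_nspace F by fact
  have L: "linear_between E F l" and M: "linear_between E F m" using f g by (auto simp: has_deriv_def)
  have fx: "f x \<in> vecs F" "g x \<in> vecs F" using f g by (auto simp: has_deriv_def)
  have ev: "\<forall>\<^sub>F h in nsmall E. f (x + h) \<in> vecs F" "\<forall>\<^sub>F h in nsmall E. g (x + h) \<in> vecs F"
    using f g by (auto simp: has_deriv_def)
  have "linear_between E F (\<lambda>h. a *\<^sub>R l h + b *\<^sub>R m h)"
    unfolding linear_between_def
    using linear_betweenD(1)[OF L] linear_betweenD(1)[OF M] linear_betweenD(2)[OF L] linear_betweenD(2)[OF M]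
    by (simp add: algebra_simps)
  moreover have "\<forall>\<^sub>F h in nsmall E. a *\<^sub>R f (x + h) + b *\<^sub>R g (x + h) \<in> vecs F"
    using ev by eventually_elim auto
  moreover have "\<forall>\<^sub>F h in nsmall E. nrm F (a *\<^sub>R f (x + h) + b *\<^sub>R g (x + h) - (a *\<^sub>R f x + b *\<^sub>R g x) -
      (a *\<^sub>R l h + b *\<^sub>R m h)) \<le> \<epsilon> * nrm E h" if e: "\<epsilon> > 0" for \<epsilon>
  proof -
    define e where "e = \<epsilon> / (\<bar>a\<bar> + \<bar>b\<bar> + 1)"
    have e: "e > 0" "(\<bar>a\<bar> + \<bar>b\<bar>) * e \<le> \<epsilon>" using that by (auto simp: e_def field_simps)
    have "\<forall>\<^sub>F h in nsmall E. nrm F (f (x + h) - f x - l h) \<le> e * nrm E h"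
      "\<forall>\<^sub>F h in nsmall E. nrm F (g (x + h) - g x - m h) \<le> e * nrm E h"
      using f g e unfolding has_deriv_def by auto
    with ev eventually_nsmall_mem show ?thesis
    proof eventually_elim
      case (elim h)
      have lm: "l h \<in> vecs F" "m h \<in> vecs F" using linear_betweenD(1)[OF L] linear_betweenD(1)[OF M] elim by auto
      let ?f = "f (x + h) - f x - l h" and ?g = "g (x + h) - g x - m h"
      have mem: "?f \<in> vecs F" "?g \<in> vecs F" using lm fx elim by auto
      have eq: "a *\<^sub>R f (x + h) + b *\<^sub>R g (x + h) - (a *\<^sub>R f x + b *\<^sub>R g x) - (a *\<^sub>R l h + b *\<^sub>R m h) = a *\<^sub>R ?f + b *\<^sub>R ?g"
        by (simp add: algebra_simps)
      have "nrm F (a *\<^sub>R ?f + b *\<^sub>R ?g) \<le> \<bar>a\<bar> * nrm F ?f + \<bar>b\<bar> * nrm F ?g"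
        using F.nrm_triangle[of "a *\<^sub>R ?f" "b *\<^sub>R ?g"] mem by (simp only: F.scale_mem F.nrm_scaleR)
      also have "\<dots> \<le> \<bar>a\<bar> * (e * nrm E h) + \<bar>b\<bar> * (e * nrm E h)"
        using elim by (intro add_mono mult_left_mono) auto
      also have "\<dots> = (\<bar>a\<bar> + \<bar>b\<bar>) * e * nrm E h" by (simp add: algebra_simps)
      finally have *: "nrm F (a *\<^sub>R ?f + b *\<^sub>R ?g) \<le> (\<bar>a\<bar> + \<bar>b\<bar>) * e * nrm E h" .
      show ?case
      \<comment> \<open>\<open>E\<close> is not assumed to be normed here. A negative
        \<open>nrm E h\<close> would make the remainder of \<open>f\<close> negative, against
        nonnegativity of \<open>nrm F\<close>.\<close>
      proof (cases "0 \<le> nrm E h")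
        case True
        show ?thesis unfolding eq using * mult_right_mono[OF e(2) True] by linarith
      next
        case False
        then have "e * nrm E h < 0" using e by (simp add: mult_pos_neg)
        moreover have "0 \<le> nrm F ?f" by simp
        ultimately show ?thesis using elim(4) by linarith
      qed
    qed
  qed
  ultimately show ?thesis unfolding has_deriv_def using fx by auto
qed

lemma has_deriv_cong:
  assumes "has_deriv E F f x l" "f x = g x" "\<forall>\<^sub>F h in nsmall E. f (x + h) = g (x + h)"
  shows "has_deriv E F g x l"
proof -
  have "\<forall>\<^sub>F h in nsmall E. g (x + h) \<in> vecs F"
    using assms(1)[unfolded has_deriv_def, THEN conjunct2, THEN conjunct2, THEN conjunct1] assms(3)
    by eventually_elim simp
  moreover have "\<forall>\<^sub>F h in nsmall E. nrm F (g (x + h) - g x - l h) \<le> \<epsilon> * nrm E h" if "\<epsilon> > 0" for \<epsilon>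
    using assms(1)[unfolded has_deriv_def, THEN conjunct2, THEN conjunct2, THEN conjunct2, rule_format, OF that] assms(3)
    by eventually_elim (simp add: assms(2))
  ultimately show ?thesis using assms(1,2) by (simp add: has_deriv_def)
qed

lemma (in normed_nspace) eventually_nsmall_open:
  "openin (ntop E) N \<Longrightarrow> x \<in> N \<Longrightarrow> \<forall>\<^sub>F h in nsmall E. x + h \<in> N"
  by (simp add: openin_ntop eventually_nsmall)

lemma unif_deriv_has_deriv:
  assumes nE: "normed_nspace E" and N: "openin (ntop E) N" and P: "unif_deriv E F N P"
    and b: "locally_bounded E F N (fst ` P)" and f: "(f, f') \<in> P" and x: "x \<in> N"
  shows "has_deriv E F f x (f' x)"
proof -
  interpret E: normed_nspace E by fact
  note ev = E.eventually_nsmall_open[OF N x]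
  have m: "f y \<in> vecs F" if "y \<in> N" for y using locally_boundedD(1)[OF b that] f by force
  from ev have "\<forall>\<^sub>F h in nsmall E. f (x + h) \<in> vecs F" by eventually_elim (rule m)
  moreover have "\<forall>\<^sub>F h in nsmall E. nrm F (f (x + h) - f x - f' x h) \<le> \<epsilon> * nrm E h" if "\<epsilon> > 0" for \<epsilon>
    using unif_derivD(2)[OF P x that] ev by eventually_elim (use f in blast)
  ultimately show ?thesis
    using unif_derivD(1)[OF P x f] m[OF x] by (simp add: has_deriv_def)
qed

text \<open>Induction on \<open>k\<close>: the new first slot is linear because a derivative is
  linear, and the remaining slots stay linear because differentiation is linear in the function. The
  unit-list family of step \<open>Suc k\<close> agrees on \<open>N\<close> with members of the
  derivative family of step \<open>k\<close>, by uniqueness, so one order is spent per step.\<close>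

lemma equi_C_iter_deriv:
  assumes nE: "normed_nspace E" and nF: "normed_nspace F" and N: "openin (ntop E) N"
    and "equi_C (n + k) E F N {f}"
  shows "(\<forall>x\<in>N. multilinear E F k (\<lambda>vs. iter_deriv E F f vs x)) \<and>
    equi_C n E F N {iter_deriv E F f vs | vs. unit_list E k vs}"
  using assms(4)
proof (induction k arbitrary: n)
  case 0
  then have "\<forall>x\<in>N. f x \<in> vecs F" using locally_boundedD(1)[OF equi_C_locally_bounded] by blast
  moreover have "{iter_deriv E F f vs | vs. unit_list E 0 vs} = {f}"
    by (auto simp: unit_list_def)
  ultimately show ?case using 0 by (auto simp: multilinear_def)
next
  case (Suc k)
  interpret E: normed_nspace E by fact
  interpret F: normed_nspace F by fact
  let ?D = "iter_deriv E F f"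
  have IH: "\<And>x. x \<in> N \<Longrightarrow> multilinear E F k (\<lambda>vs. ?D vs x)"
    "equi_C (Suc n) E F N {?D vs | vs. unit_list E k vs}"
    using Suc.IH[of "Suc n"] Suc.prems by auto
  obtain P where P: "{?D vs | vs. unit_list E k vs} = fst ` P" "unif_deriv E F N P" "equi_C n E F N (deriv_family E P)"
    using IH(2) by (rule equi_C_SucE)
  note bP = equi_C_locally_bounded[OF IH(2), unfolded P(1)]
  note hd = unif_deriv_has_deriv[OF nE N P(2) bP]
  \<comment> \<open>The family provides derivatives along unit lists only. By multilinearity any
    other list differs from its normalised version by a scalar factor, and this holds on all of
    \<open>N\<close>, hence near \<open>x\<close>.\<close>
  have dd: "\<exists>l. has_deriv E F (?D vs) x l" if vs: "length vs = k" "set vs \<subseteq> vecs E" and x: "x \<in> N" for vs x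
  proof -
    let ?vs = "map (\<lambda>v. (1 / nrm E v) *\<^sub>R v) vs" and ?c = "prod_list (map (nrm E) vs)"
    have "?D ?vs \<in> fst ` P" unfolding P(1)[symmetric] using E.unit_list_normalize[OF vs] by blast
    then obtain g' where g': "(?D ?vs, g') \<in> P" by force
    have 1: "has_deriv E F (\<lambda>x. ?c *\<^sub>R ?D ?vs x + 0 *\<^sub>R ?D ?vs x) x (\<lambda>h. ?c *\<^sub>R g' x h + 0 *\<^sub>R g' x h)"
      by (rule has_deriv_lincomb[OF nF hd[OF g' x] hd[OF g' x]])
    have eq: "?c *\<^sub>R ?D ?vs y + 0 *\<^sub>R ?D ?vs y = ?D vs y" if "y \<in> N" for y
      using multilinear_normalize[OF nE IH(1)[OF that] vs] by simp
    have 2: "\<forall>\<^sub>F h in nsmall E. ?c *\<^sub>R ?D ?vs (x + h) + 0 *\<^sub>R ?D ?vs (x + h) = ?D vs (x + h)"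
      using E.eventually_nsmall_open[OF N x] by eventually_elim (rule eq)
    from has_deriv_cong[OF 1 eq[OF x] 2] show ?thesis by blast
  qed
  have ml: "multilinear E F (Suc k) (\<lambda>vs. ?D vs x)" if x: "x \<in> N" for x
  proof (rule multilinearI)
    fix vs assume vs: "length vs = Suc k" "set vs \<subseteq> vecs E"
    then obtain h ws where hws: "vs = h # ws" by (cases vs) auto
    then obtain l where l: "has_deriv E F (?D ws) x l" using dd[of ws, OF _ _ x] vs by auto
    then have "?D vs x = l h" using dir_deriv_eq[OF nE nF l] vs hws by simp
    then show "?D vs x \<in> vecs F" using l vs hws linear_betweenD(1) by (auto simp: has_deriv_def)
  next
    fix us ws v w a b
    assume len: "length us + length ws + 1 = Suc k" and us: "set us \<subseteq> vecs E" and ws: "set ws \<subseteq> vecs E"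
      and v: "v \<in> vecs E" and w: "w \<in> vecs E"
    show "?D (us @ (a *\<^sub>R v + b *\<^sub>R w) # ws) x = a *\<^sub>R ?D (us @ v # ws) x + b *\<^sub>R ?D (us @ w # ws) x"
    proof (cases us)
      case Nil
      then obtain l where l: "has_deriv E F (?D ws) x l" using dd[of ws, OF _ ws x] len by auto
      then have lin: "linear_between E F l" by (simp add: has_deriv_def)
      show ?thesis
        using Nil v w linear_betweenD(2)[OF lin v w]
          dir_deriv_eq[OF nE nF l v] dir_deriv_eq[OF nE nF l w] dir_deriv_eq[OF nE nF l, of "a *\<^sub>R v + b *\<^sub>R w"]
        by simp
    next
      case (Cons h us')
      then have h: "h \<in> vecs E" and us': "set us' \<subseteq> vecs E" and len': "length us' + length ws + 1 = k"
        using us len by auto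
      obtain l where l: "has_deriv E F (?D (us' @ v # ws)) x l"
        using dd[of "us' @ v # ws" x] len' us' ws v x by auto
      obtain m where m: "has_deriv E F (?D (us' @ w # ws)) x m"
        using dd[of "us' @ w # ws" x] len' us' ws w x by auto
      have eq: "a *\<^sub>R ?D (us' @ v # ws) y + b *\<^sub>R ?D (us' @ w # ws) y = ?D (us' @ (a *\<^sub>R v + b *\<^sub>R w) # ws) y"
        if "y \<in> N" for y
        using multilinearD(2)[OF IH(1)[OF that] len' us' ws v w] by simp
      have "\<forall>\<^sub>F h in nsmall E. a *\<^sub>R ?D (us' @ v # ws) (x + h) + b *\<^sub>R ?D (us' @ w # ws) (x + h) =
          ?D (us' @ (a *\<^sub>R v + b *\<^sub>R w) # ws) (x + h)"
        using E.eventually_nsmall_open[OF N x] by eventually_elim (rule eq)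
      from has_deriv_cong[OF has_deriv_lincomb[OF nF l m, of a b] eq[OF x] this]
      have "has_deriv E F (?D (us' @ (a *\<^sub>R v + b *\<^sub>R w) # ws)) x (\<lambda>h. a *\<^sub>R l h + b *\<^sub>R m h)" .
      from dir_deriv_eq[OF nE nF this h] dir_deriv_eq[OF nE nF l h] dir_deriv_eq[OF nE nF m h]
      show ?thesis using Cons by simp
    qed
  qed
  moreover have "equi_C n E F N {?D vs | vs. unit_list E (Suc k) vs}"
  proof (rule equi_C_cong[OF P(3)])
    fix g assume "g \<in> {?D vs | vs. unit_list E (Suc k) vs}"
    then obtain us where us: "unit_list E (Suc k) us" "g = ?D us" by blast
    then obtain h vs where h: "us = h # vs" by (cases us) (auto simp: unit_list_def)
    have hv: "h \<in> vecs E" "nrm E h \<le> 1" "unit_list E k vs" using us(1) h by (auto simp: unit_list_def)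
    then have "?D vs \<in> fst ` P" unfolding P(1)[symmetric] by blast
    then obtain g' where g': "(?D vs, g') \<in> P" by force
    have "g' x h = g x" if "x \<in> N" for x
      using dir_deriv_eq[OF nE nF hd[OF g' that] hv(1)] us(2) h by simp
    then show "\<exists>f\<in>deriv_family E P. \<forall>x\<in>N. f x = g x"
      using deriv_familyI[OF g' hv(1,2)] by (intro bexI[of _ "\<lambda>x. g' x h"]) auto
  qed
  ultimately show ?case by blast
qed

text \<open>The neighbourhood may shrink as \<open>n\<close> grows. This makes the notion local and
  lets each rule below intersect neighbourhoods freely.\<close>

definition smooth_at ::
  "'v::real_vector nspace \<Rightarrow> 'w::real_vector nspace \<Rightarrow> ('v \<Rightarrow> 'w) \<Rightarrow> 'v \<Rightarrow> bool"
  where "smooth_at E F f x \<longleftrightarrow> (\<forall>n. \<exists>N. openin (ntop E) N \<and> x \<in> N \<and> equi_C n E F N {f})"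

text \<open>A sequence of derivatives on an open set gives every order at once, by
  \<open>equi_C_derivs\<close>. Conversely \<open>iter_deriv\<close> does not mention the
  neighbourhoods, so the information found on the neighbourhoods of various orders and points
  assembles into one sequence on \<open>U\<close>.\<close>

theorem smooth_on_iff_smooth_at:
  assumes nE: "normed_nspace E" and nF: "normed_nspace F"
  shows "smooth_on E F U f \<longleftrightarrow> openin (ntop E) U \<and> (\<forall>x\<in>U. smooth_at E F f x)"
proof -
  interpret E: normed_nspace E by fact
  interpret F: normed_nspace F by fact
  let ?D = "\<lambda>k x vs. iter_deriv E F f vs x"
  have 1: "smooth_at E F f x" if "openin (ntop E) U" "\<forall>x\<in>U. D 0 x [] = f x" "derivs_on E F U D" "x \<in> U" for D x
    unfolding smooth_at_def
  proof (intro allI exI[of _ U] conjI that)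
    fix n
    show "equi_C n E F U {f}"
      by (rule equi_C_cong[OF equi_C_derivs[OF nE nF that(3), of n 0]])
        (use that(2) in \<open>auto simp: unit_list_def\<close>)
  qed
  have 2: "derivs_on E F U ?D" if U: "openin (ntop E) U" and s: "\<forall>x\<in>U. smooth_at E F f x"
    unfolding derivs_on_def
  proof (intro conjI allI ballI impI)
    fix k x assume x: "x \<in> U"
    obtain N where N: "openin (ntop E) N" "x \<in> N" "equi_C (0 + k) E F N {f}"
      using s[rule_format, OF x, unfolded smooth_at_def] by blast
    note * = equi_C_iter_deriv[OF nE nF N(1,3)]
    from * have ml: "multilinear E F k (\<lambda>vs. ?D k x vs)" using N(2) by blast
    obtain C where C: "C \<ge> 0" "\<forall>g\<in>{iter_deriv E F f vs | vs. unit_list E k vs}. nrm F (g x) \<le> C"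
      using locally_bounded_at[OF equi_C_locally_bounded[OF *[THEN conjunct2]] N(2) nE] by blast
    have "nrm F (?D k x vs) \<le> C * prod_list (map (nrm E) vs)" if vs: "length vs = k" "set vs \<subseteq> vecs E" for vs
    proof -
      let ?vs = "map (\<lambda>v. (1 / nrm E v) *\<^sub>R v) vs" and ?c = "prod_list (map (nrm E) vs)"
      have c: "?c \<ge> 0" by (induction vs) auto
      note u = E.unit_list_normalize[OF vs]
      have "?D k x ?vs \<in> vecs F" using multilinearD(1)[OF ml, of ?vs] u by (auto simp: unit_list_def)
      then have "nrm F (?D k x vs) = ?c * nrm F (?D k x ?vs)"
        using multilinear_normalize[OF nE ml vs] c by (simp add: F.nrm_scaleR)
      also have "\<dots> \<le> ?c * C" using C(2) u c by (intro mult_left_mono) auto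
      finally show ?thesis by (simp add: mult.commute)
    qed
    then show "bounded_multilinear E F k (?D k x)"
      unfolding bounded_multilinear_iff[OF nE] using ml C(1) by blast
  next
    fix k x and \<epsilon> :: real assume x: "x \<in> U" and e: "\<epsilon> > 0"
    obtain N where N: "openin (ntop E) N" "x \<in> N" "equi_C (Suc k) E F N {f}"
      using s[rule_format, OF x, unfolded smooth_at_def] by blast
    \<comment> \<open>Order \<open>Suc k\<close> is read in two ways: as multilinearity of the
      derivative of order \<open>Suc k\<close>, and as one further uniform derivative of the family
      of order \<open>k\<close>.\<close>
    have 1: "equi_C (0 + Suc k) E F N {f}" and 2: "equi_C (Suc 0 + k) E F N {f}" using N(3) by simp_all
    have mlS: "multilinear E F (Suc k) (?D (Suc k) x)"
      using equi_C_iter_deriv[OF nE nF N(1) 1] N(2) by blast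
    have ml: "multilinear E F k (?D k y)" if "y \<in> N" for y
      using equi_C_iter_deriv[OF nE nF N(1) 2] that by blast
    have eq: "equi_C (Suc 0) E F N {iter_deriv E F f vs | vs. unit_list E k vs}"
      using equi_C_iter_deriv[OF nE nF N(1) 2] by blast
    obtain P where P: "{iter_deriv E F f vs | vs. unit_list E k vs} = fst ` P" "unif_deriv E F N P"
      "equi_C 0 E F N (deriv_family E P)"
      using eq by (rule equi_C_SucE)
    note hd = unif_deriv_has_deriv[OF nE N(1) P(2) equi_C_locally_bounded[OF eq, unfolded P(1)]]
    show "\<forall>\<^sub>F h in nsmall E. x + h \<in> U \<longrightarrow> (\<forall>vs. length vs = k \<and> set vs \<subseteq> vecs E \<longrightarrow>
        nrm F (?D k (x + h) vs - ?D k x vs - ?D (Suc k) x (h # vs)) \<le> \<epsilon> * nrm E h * prod_list (map (nrm E) vs))"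
      using unif_derivD(2)[OF P(2) N(2) e] E.eventually_nsmall_open[OF N(1,2)] eventually_nsmall_mem
    proof eventually_elim
      case (elim h)
      have "nrm F (?D k (x + h) vs - ?D k x vs - ?D (Suc k) x (h # vs)) \<le> \<epsilon> * nrm E h * prod_list (map (nrm E) vs)"
        if vs: "length vs = k" "set vs \<subseteq> vecs E" for vs
      proof -
        let ?vs = "map (\<lambda>v. (1 / nrm E v) *\<^sub>R v) vs" and ?c = "prod_list (map (nrm E) vs)"
        have c: "?c \<ge> 0" by (induction vs) auto
        note u = E.unit_list_normalize[OF vs]
        have u': "length ?vs = k" "set ?vs \<subseteq> vecs E" using u by (auto simp: unit_list_def)
        have "iter_deriv E F f ?vs \<in> fst ` P" unfolding P(1)[symmetric] using u by blast
        then obtain g' where g': "(iter_deriv E F f ?vs, g') \<in> P" by force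
        have d: "?D (Suc k) x (h # ?vs) = g' x h"
          using dir_deriv_eq[OF nE nF hd[OF g' N(2)] elim(3)] by simp
        let ?d = "?D k (x + h) ?vs - ?D k x ?vs - ?D (Suc k) x (h # ?vs)"
        have m: "?d \<in> vecs F"
          using multilinearD(1)[OF ml[OF elim(2)] u'] multilinearD(1)[OF ml[OF N(2)] u']
            multilinearD(1)[OF mlS, of "h # ?vs"] u' elim(3) by auto
        have "nrm F ?d \<le> \<epsilon> * nrm E h" unfolding d by (rule elim(1)[rule_format, OF elim(2) g'])
        then have "?c * nrm F ?d \<le> ?c * (\<epsilon> * nrm E h)" using c by (rule mult_left_mono)
        moreover have "?D k (x + h) vs - ?D k x vs - ?D (Suc k) x (h # vs) = ?c *\<^sub>R ?d"
          using multilinear_normalize[OF nE ml[OF elim(2)] vs] multilinear_normalize[OF nE ml[OF N(2)] vs]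
            multilinear_normalize[OF nE multilinear_Cons[OF mlS elim(3)] vs] by (simp add: scaleR_diff_right)
        ultimately show ?thesis using F.nrm_scaleR[OF m, of ?c] c by (simp add: mult_ac)
      qed
      then show ?case by blast
    qed
  qed
  show ?thesis
  proof
    assume "smooth_on E F U f"
    then show "openin (ntop E) U \<and> (\<forall>x\<in>U. smooth_at E F f x)"
      unfolding smooth_on_iff_derivs using 1 by blast
  next
    assume *: "openin (ntop E) U \<and> (\<forall>x\<in>U. smooth_at E F f x)"
    then have "derivs_on E F U ?D" by (intro 2) auto
    then show "smooth_on E F U f"
      unfolding smooth_on_iff_derivs using * by (intro conjI exI[of _ ?D]) auto
  qed
qed

text \<open>Order one is the least that gives the local Lipschitz bound; order 0 is mere
  boundedness.\<close>

lemma equi_C_continuous: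
  assumes nE: "normed_nspace E" and nF: "normed_nspace F"
    and f: "equi_C (Suc 0) E F N {f}" and N: "openin (ntop E) N" and V: "openin (ntop F) V"
  shows "openin (ntop E) {x \<in> N. f x \<in> V}"
proof -
  interpret E: normed_nspace E by fact
  interpret F: normed_nspace F by fact
  obtain P where P: "{f} = fst ` P" "unif_deriv E F N P" "equi_C 0 E F N (deriv_family E P)"
    using f by (rule equi_C_SucE)
  obtain f' where f': "(f, f') \<in> P" using P(1) by force
  have "\<forall>\<^sub>F h in nsmall E. x + h \<in> {x \<in> N. f x \<in> V}" if x: "x \<in> N" "f x \<in> V" for x
  proof -
    obtain L where L: "L \<ge> 0" "\<forall>f f' h. (f, f') \<in> P \<longrightarrow> h \<in> vecs E \<longrightarrow> nrm F (f' x h) \<le> L * nrm E h"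
        "\<forall>\<^sub>F h in nsmall E. x + h \<in> N \<longrightarrow> (\<forall>f f'. (f, f') \<in> P \<longrightarrow> nrm F (f (x + h) - f x) \<le> L * nrm E h)"
      by (rule unif_deriv_lipschitz[OF nE nF P(2) equi_C_locally_bounded[OF P(3)] x(1)
            equi_C_locally_bounded[OF f, unfolded P(1)]])
    have fm: "f x \<in> vecs F" if "x \<in> N" for x
      using locally_boundedD(1)[OF equi_C_locally_bounded[OF f] that] by simp
    have "\<forall>\<^sub>F h in nsmall E. x + h \<in> N \<longrightarrow> f (x + h) - f x \<in> vecs F \<and> nrm F (f (x + h) - f x) \<le> L * nrm E h"
      using L(3) by eventually_elim (use f' fm x in auto)
    from eventually_nsmall_compose[OF F.eventually_nsmall_open[OF V x(2)] L(1) this] E.eventually_nsmall_open[OF N x(1)]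
    show ?thesis by eventually_elim simp
  qed
  moreover have "{x \<in> N. f x \<in> V} \<subseteq> vecs E" using N by (auto simp: E.openin_ntop)
  ultimately show ?thesis unfolding E.openin_ntop eventually_nsmall by blast
qed

section \<open>Rules of calculus at a point\<close>

lemma smooth_atE:
  assumes "smooth_at E F f x"
  obtains N where "openin (ntop E) N" "x \<in> N" "equi_C n E F N {f}"
  using assms unfolding smooth_at_def by blast

lemma smooth_at_continuous:
  assumes nE: "normed_nspace E" and nF: "normed_nspace F"
    and f: "smooth_at E F f x" and V: "openin (ntop F) V" "f x \<in> V"
  obtains N where "openin (ntop E) N" "x \<in> N" "\<And>y. y \<in> N \<Longrightarrow> f y \<in> V"
proof -
  obtain N where "openin (ntop E) N" "x \<in> N" "equi_C (Suc 0) E F N {f}"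
    using smooth_atE[OF f] by blast
  from equi_C_continuous[OF nE nF this(3,1) V(1)] that[of "{x \<in> N. f x \<in> V}"] this(2) V(2)
  show ?thesis by blast
qed

lemma smooth_at_cong:
  assumes f: "smooth_at E F f x" and N: "openin (ntop E) N" "x \<in> N" and eq: "\<And>y. y \<in> N \<Longrightarrow> f y = g y"
  shows "smooth_at E F g x"
  unfolding smooth_at_def
proof
  fix n
  obtain M where M: "openin (ntop E) M" "x \<in> M" "equi_C n E F M {f}" using smooth_atE[OF f] by blast
  have "equi_C n E F (M \<inter> N) {g}"
    by (rule equi_C_cong[OF equi_C_mono[OF M(3) subset_refl]]) (use eq in auto)
  then show "\<exists>N. openin (ntop E) N \<and> x \<in> N \<and> equi_C n E F N {g}"
    using M(1,2) N by blast
qed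

text \<open>The case \<open>j = 0\<close> of \<open>equi_C_compose_derivs\<close>, with no
  arguments, where \<open>D 0\<close> is \<open>g\<close>. Order \<open>Suc n\<close> of
  \<open>f\<close> pays for order \<open>n\<close> of the composition.\<close>

lemma smooth_at_compose:
  assumes nE: "normed_nspace E" and nF: "normed_nspace F" and nG: "normed_nspace G"
    and f: "smooth_at E F f x" and g: "smooth_on F G V g" and V: "f x \<in> V"
  shows "smooth_at E G (\<lambda>x. g (f x)) x"
  unfolding smooth_at_def
proof
  fix n
  obtain D where D: "openin (ntop F) V" "\<And>y. y \<in> V \<Longrightarrow> D 0 y [] = g y" "derivs_on F G V D"
    using g unfolding smooth_on_iff_derivs by blast
  obtain M where M: "openin (ntop E) M" "x \<in> M" "equi_C (Suc n) E F M {f}"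
    using smooth_atE[OF f] by blast
  let ?N = "{x \<in> M. f x \<in> V}"
  have N: "openin (ntop E) ?N"
    by (rule equi_C_continuous[OF nE nF equi_C_le[OF M(3)] M(1) D(1)]) simp
  have fN: "equi_C (Suc n) E F ?N {f}" by (rule equi_C_mono[OF M(3)]) auto
  have "equi_C n E F ?N {}" by (rule equi_C_mono[OF equi_C_SucD[OF fN]]) auto
  from equi_C_compose_derivs[OF nE nF nG D(3) _ fN this, of 0]
  have "equi_C n E G ?N {\<lambda>x. D 0 (f x) (map (\<lambda>k. k x) ks) | ks. length ks = 0 \<and> set ks \<subseteq> {}}" by blast
  then have "equi_C n E G ?N {\<lambda>x. g (f x)}"
    by (rule equi_C_cong) (use D(2) in auto)
  then show "\<exists>N. openin (ntop E) N \<and> x \<in> N \<and> equi_C n E G N {\<lambda>x. g (f x)}"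
    using N M(2) V by blast
qed

lemma smooth_at_id: "normed_nspace E \<Longrightarrow> x \<in> vecs E \<Longrightarrow> smooth_at E E (\<lambda>x. x) x"
  unfolding smooth_at_def
  by (intro allI exI[of _ "vecs E"] conjI equi_C_id)
    (auto simp: normed_nspace.openin_ntop normed_nspace.add_mem intro: exI[of _ "1::real"])

lemma smooth_at_const:
  assumes nE: "normed_nspace E" and nF: "normed_nspace F" and "c \<in> vecs F" "x \<in> vecs E"
  shows "smooth_at E F (\<lambda>x. c) x"
proof -
  interpret E: normed_nspace E by fact
  have "openin (ntop E) (vecs E)" by (auto simp: E.openin_ntop intro!: exI[of _ 1])
  moreover have "equi_C n E F (vecs E) {\<lambda>x. c}" for n
    using equi_C_const[OF nE nF, of "{c}" "nrm F c" n "vecs E"] assms(3) by simp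
  ultimately show ?thesis using assms(4) unfolding smooth_at_def by blast
qed

lemma smooth_at_linear:
  assumes nE: "normed_nspace E" and nF: "normed_nspace F" and nG: "normed_nspace G"
    and f: "smooth_at E F f x" and l: "bounded_linear_between F G l"
  shows "smooth_at E G (\<lambda>x. l (f x)) x"
  unfolding smooth_at_def
proof
  fix n
  obtain N where "openin (ntop E) N" "x \<in> N" "equi_C n E F N {f}" using smooth_atE[OF f] by blast
  with equi_C_linear[OF nE nF nG l this(3)]
  show "\<exists>N. openin (ntop E) N \<and> x \<in> N \<and> equi_C n E G N {\<lambda>x. l (f x)}" by auto
qed

lemma smooth_at_bilinear:
  assumes nE: "normed_nspace E" and nF: "normed_nspace F" and nG: "normed_nspace G" and nH: "normed_nspace H"
    and f: "smooth_at E F f x" and g: "smooth_at E G g x" and b: "bounded_bilinear_between F G H b"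
  shows "smooth_at E H (\<lambda>x. b (f x) (g x)) x"
  unfolding smooth_at_def
proof
  fix n
  obtain M where M: "openin (ntop E) M" "x \<in> M" "equi_C n E F M {f}" using smooth_atE[OF f] by blast
  obtain N where N: "openin (ntop E) N" "x \<in> N" "equi_C n E G N {g}" using smooth_atE[OF g] by blast
  have "equi_C n E F (M \<inter> N) {f}" "equi_C n E G (M \<inter> N) {g}"
    by (rule equi_C_mono[OF M(3)] equi_C_mono[OF N(3)]; simp)+
  from equi_C_bilinear[OF nE nF nG nH b this]
  have "equi_C n E H (M \<inter> N) {\<lambda>x. b (f x) (g x)}" by (simp add: pointwise2_def)
  then show "\<exists>N. openin (ntop E) N \<and> x \<in> N \<and> equi_C n E H N {\<lambda>x. b (f x) (g x)}"
    using M(1,2) N(1,2) by blast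
qed

lemma smooth_at_add:
  assumes nE: "normed_nspace E" and nF: "normed_nspace F"
    and f: "smooth_at E F f x" and g: "smooth_at E F g x"
  shows "smooth_at E F (\<lambda>x. f x + g x) x"
  unfolding smooth_at_def
proof
  fix n
  obtain M where M: "openin (ntop E) M" "x \<in> M" "equi_C n E F M {f}" using smooth_atE[OF f] by blast
  obtain N where N: "openin (ntop E) N" "x \<in> N" "equi_C n E F N {g}" using smooth_atE[OF g] by blast
  have "equi_C n E F (M \<inter> N) {f}" "equi_C n E F (M \<inter> N) {g}"
    by (rule equi_C_mono[OF M(3)] equi_C_mono[OF N(3)]; simp)+
  from equi_C_add[OF nE nF this]
  have "equi_C n E F (M \<inter> N) {\<lambda>x. f x + g x}" by (simp add: pointwise2_def)
  then show "\<exists>N. openin (ntop E) N \<and> x \<in> N \<and> equi_C n E F N {\<lambda>x. f x + g x}"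
    using M(1,2) N(1,2) by blast
qed

section \<open>Products of normed spaces\<close>

lemma vecs_prod_nspace [simp]: "vecs (prod_nspace E F) = vecs E \<times> vecs F"
  and nrm_prod_nspace [simp]: "nrm (prod_nspace E F) (x, y) = nrm E x + nrm F y"
  by (simp_all add: prod_nspace_def)

lemma normed_prod_nspace:
  assumes "normed_nspace E" "normed_nspace F"
  shows "normed_nspace (prod_nspace E F)"
proof -
  interpret E: normed_nspace E by fact
  interpret F: normed_nspace F by fact
  show ?thesis
  proof
    show "subspace (vecs (prod_nspace E F))" using subspace_Times[OF E.subspace_vecs F.subspace_vecs] by simp
  next
    fix x assume x: "x \<in> vecs (prod_nspace E F)" "nrm (prod_nspace E F) x = 0"
    then have "nrm E (fst x) = 0" "nrm F (snd x) = 0"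
      using E.nrm_nonneg[of "fst x"] F.nrm_nonneg[of "snd x"]
      by (cases x; simp add: add_nonneg_eq_0_iff)+
    then show "x = 0" using x E.nrm_eq_0 F.nrm_eq_0 by (cases x) (auto simp: zero_prod_def)
  next
    fix x y assume "x \<in> vecs (prod_nspace E F)" "y \<in> vecs (prod_nspace E F)"
    then show "nrm (prod_nspace E F) (x + y) \<le> nrm (prod_nspace E F) x + nrm (prod_nspace E F) y"
      using E.nrm_triangle[of "fst x" "fst y"] F.nrm_triangle[of "snd x" "snd y"]
      by (cases x; cases y) (simp add: plus_prod_def)
  next
    fix x r assume "x \<in> vecs (prod_nspace E F)"
    then show "nrm (prod_nspace E F) (r *\<^sub>R x) = \<bar>r\<bar> * nrm (prod_nspace E F) x"
      using E.nrm_scaleR[of "fst x" r] F.nrm_scaleR[of "snd x" r]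
      by (cases x) (simp add: scaleR_prod_def distrib_left)
  next
    fix x show "0 \<le> nrm (prod_nspace E F) x" by (cases x) simp
  next
    fix x show "nrm (prod_nspace E F) (- x) = nrm (prod_nspace E F) x" by (cases x) (simp add: uminus_prod_def)
  qed
qed

lemma bounded_linear_prod_nspace:
  assumes "normed_nspace E" "normed_nspace F"
  shows "bounded_linear_between (prod_nspace E F) E fst"
    and "bounded_linear_between (prod_nspace E F) F snd"
    and "bounded_linear_between E (prod_nspace E F) (\<lambda>x. (x, 0))"
    and "bounded_linear_between F (prod_nspace E F) (\<lambda>y. (0, y))"
proof -
  interpret E: normed_nspace E by fact
  interpret F: normed_nspace F by fact
  show "bounded_linear_between (prod_nspace E F) E fst" "bounded_linear_between (prod_nspace E F) F snd"
    "bounded_linear_between E (prod_nspace E F) (\<lambda>x. (x, 0))"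
    "bounded_linear_between F (prod_nspace E F) (\<lambda>y. (0, y))"
    unfolding bounded_linear_between_def linear_between_def by (auto intro!: exI[of _ 1])
qed

text \<open>A pair is the sum of the images of its components under the two bounded linear
  coordinate injections.\<close>

lemma smooth_at_Pair:
  assumes nE: "normed_nspace E" and nF: "normed_nspace F" and nG: "normed_nspace G"
    and f: "smooth_at E F f x" and g: "smooth_at E G g x"
  shows "smooth_at E (prod_nspace F G) (\<lambda>x. (f x, g x)) x"
proof -
  note P = normed_prod_nspace[OF nF nG]
  have "smooth_at E (prod_nspace F G) (\<lambda>x. (f x, 0) + (0, g x)) x"
    by (intro smooth_at_add[OF nE P] smooth_at_linear[OF nE nF P f bounded_linear_prod_nspace(3)[OF nF nG]]
        smooth_at_linear[OF nE nG P g bounded_linear_prod_nspace(4)[OF nF nG]])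
  then show ?thesis by simp
qed

lemma openin_prod_nspace:
  assumes "normed_nspace E" "normed_nspace F" "openin (ntop E) A" "openin (ntop F) B"
  shows "openin (ntop (prod_nspace E F)) (A \<times> B)"
proof -
  interpret E: normed_nspace E by fact
  interpret F: normed_nspace F by fact
  interpret P: normed_nspace "prod_nspace E F" by (rule normed_prod_nspace) fact+
  show ?thesis unfolding P.openin_ntop
  proof (intro conjI ballI)
    show "A \<times> B \<subseteq> vecs (prod_nspace E F)" using assms(3,4) by (auto simp: E.openin_ntop F.openin_ntop)
    fix p assume "p \<in> A \<times> B"
    then obtain x y where p: "p = (x, y)" "x \<in> A" "y \<in> B" by blast
    obtain d where d: "d > 0" "\<forall>h\<in>vecs E. nrm E h < d \<longrightarrow> x + h \<in> A" using assms(3) p by (auto simp: E.openin_ntop)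
    obtain e where e: "e > 0" "\<forall>h\<in>vecs F. nrm F h < e \<longrightarrow> y + h \<in> B" using assms(4) p by (auto simp: F.openin_ntop)
    show "\<exists>d>0. \<forall>h\<in>vecs (prod_nspace E F). nrm (prod_nspace E F) h < d \<longrightarrow> p + h \<in> A \<times> B"
    proof (intro exI[of _ "min d e"] conjI ballI impI)
      fix h assume "h \<in> vecs (prod_nspace E F)" and h2: "nrm (prod_nspace E F) h < min d e"
      then obtain u v where h: "h = (u, v)" "u \<in> vecs E" "v \<in> vecs F" by auto
      have "nrm E u < d" "nrm F v < e" using h2 h(1) E.nrm_nonneg[of u] F.nrm_nonneg[of v] by (auto simp del: E.nrm_nonneg F.nrm_nonneg)
      then show "p + h \<in> A \<times> B" using d e h p by (simp add: plus_prod_def)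
    qed (use d e in auto)
  qed
qed

lemma (in normed_nspace) mcomplete_iff:
  "mcomplete \<longleftrightarrow> (\<forall>\<sigma> :: nat \<Rightarrow> _. range \<sigma> \<subseteq> vecs E \<and> (\<forall>\<epsilon>>0. \<exists>N. \<forall>m n. N \<le> m \<longrightarrow> N \<le> n \<longrightarrow> nrm E (\<sigma> m - \<sigma> n) < \<epsilon>) \<longrightarrow>
    (\<exists>l\<in>vecs E. \<forall>\<epsilon>>0. \<exists>N. \<forall>n\<ge>N. nrm E (\<sigma> n - l) < \<epsilon>))"
proof -
  have "limitin mtopology \<sigma> l sequentially \<longleftrightarrow> l \<in> vecs E \<and> (\<forall>\<epsilon>>0. \<exists>N. \<forall>n\<ge>N. nrm E (\<sigma> n - l) < \<epsilon>)"
    if "range \<sigma> \<subseteq> vecs E" for \<sigma> :: "nat \<Rightarrow> _" and l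
  proof -
    have "\<sigma> n \<in> vecs E" for n using that by auto
    then show ?thesis unfolding limitin_metric eventually_sequentially by simp
  qed
  then have "(\<exists>l. limitin mtopology \<sigma> l sequentially) \<longleftrightarrow> (\<exists>l\<in>vecs E. \<forall>\<epsilon>>0. \<exists>N. \<forall>n\<ge>N. nrm E (\<sigma> n - l) < \<epsilon>)"
    if "range \<sigma> \<subseteq> vecs E" for \<sigma> :: "nat \<Rightarrow> _"
    using that by blast
  then show ?thesis unfolding mcomplete_def MCauchy_def by (simp cong: imp_cong)
qed

lemma banach_prod_nspace:
  assumes nE: "normed_nspace E" and nF: "normed_nspace F"
    and cE: "Metric_space.mcomplete (vecs E) (ndist E)" and cF: "Metric_space.mcomplete (vecs F) (ndist F)"
  shows "Metric_space.mcomplete (vecs (prod_nspace E F)) (ndist (prod_nspace E F))"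
proof -
  interpret E: normed_nspace E by fact
  interpret F: normed_nspace F by fact
  interpret P: normed_nspace "prod_nspace E F" by (rule normed_prod_nspace) fact+
  show ?thesis unfolding P.mcomplete_iff
  proof (intro allI impI, elim conjE)
    fix \<sigma> :: "nat \<Rightarrow> 'a \<times> 'b"
    assume r: "range \<sigma> \<subseteq> vecs (prod_nspace E F)"
      and c: "\<forall>\<epsilon>>0. \<exists>N. \<forall>m n. N \<le> m \<longrightarrow> N \<le> n \<longrightarrow> nrm (prod_nspace E F) (\<sigma> m - \<sigma> n) < \<epsilon>"
    have p: "nrm (prod_nspace E F) (u - v) = nrm E (fst u - fst v) + nrm F (snd u - snd v)" for u v
      by (cases u; cases v) (simp add: minus_prod_def)
    have "\<exists>N. \<forall>m n. N \<le> m \<longrightarrow> N \<le> n \<longrightarrow> nrm E (fst (\<sigma> m) - fst (\<sigma> n)) < \<epsilon> \<and> nrm F (snd (\<sigma> m) - snd (\<sigma> n)) < \<epsilon>"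
      if e: "\<epsilon> > 0" for \<epsilon>
    proof -
      obtain N where N: "\<forall>m n. N \<le> m \<longrightarrow> N \<le> n \<longrightarrow> nrm (prod_nspace E F) (\<sigma> m - \<sigma> n) < \<epsilon>" using c e by blast
      show ?thesis
      proof (intro exI[of _ N] allI impI)
        fix m n assume "N \<le> m" "N \<le> n"
        then have "nrm E (fst (\<sigma> m) - fst (\<sigma> n)) + nrm F (snd (\<sigma> m) - snd (\<sigma> n)) < \<epsilon>" using N p by simp
        then show "nrm E (fst (\<sigma> m) - fst (\<sigma> n)) < \<epsilon> \<and> nrm F (snd (\<sigma> m) - snd (\<sigma> n)) < \<epsilon>"
          using E.nrm_nonneg[of "fst (\<sigma> m) - fst (\<sigma> n)"] F.nrm_nonneg[of "snd (\<sigma> m) - snd (\<sigma> n)"] by linarith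
      qed
    qed
    note C = this
    have s: "\<sigma> n \<in> vecs E \<times> vecs F" for n using r by auto
    have "range (\<lambda>n. fst (\<sigma> n)) \<subseteq> vecs E" "range (\<lambda>n. snd (\<sigma> n)) \<subseteq> vecs F"
      using s by (auto simp: mem_Times_iff)
    then obtain a b where a: "a \<in> vecs E" "\<forall>\<epsilon>>0. \<exists>N. \<forall>n\<ge>N. nrm E (fst (\<sigma> n) - a) < \<epsilon>"
      and b: "b \<in> vecs F" "\<forall>\<epsilon>>0. \<exists>N. \<forall>n\<ge>N. nrm F (snd (\<sigma> n) - b) < \<epsilon>"
      using cE[unfolded E.mcomplete_iff, rule_format, of "\<lambda>n. fst (\<sigma> n)"]
        cF[unfolded F.mcomplete_iff, rule_format, of "\<lambda>n. snd (\<sigma> n)"] C by metis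
    show "\<exists>l\<in>vecs (prod_nspace E F). \<forall>\<epsilon>>0. \<exists>N. \<forall>n\<ge>N. nrm (prod_nspace E F) (\<sigma> n - l) < \<epsilon>"
    proof (intro bexI[of _ "(a, b)"] allI impI)
      fix \<epsilon> :: real assume "\<epsilon> > 0"
      then have e: "\<epsilon> / 2 > 0" by simp
      obtain M N where "\<forall>n\<ge>M. nrm E (fst (\<sigma> n) - a) < \<epsilon> / 2" "\<forall>n\<ge>N. nrm F (snd (\<sigma> n) - b) < \<epsilon> / 2"
        using a(2) b(2) e by blast
      then have "\<forall>n\<ge>max M N. nrm E (fst (\<sigma> n) - a) + nrm F (snd (\<sigma> n) - b) < \<epsilon>"
        by (metis add_strict_mono field_sum_of_halves max.boundedE)
      then show "\<exists>N. \<forall>n\<ge>N. nrm (prod_nspace E F) (\<sigma> n - (a, b)) < \<epsilon>"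
        unfolding p fst_conv snd_conv by blast
    qed (use a b in simp)
  qed
qed

section \<open>Complex Hilbert spaces\<close>

interpretation cvs: vector_space "scaleC :: complex \<Rightarrow> 'a \<Rightarrow> 'a::complex_inner"
proof
  \<comment> \<open>The unit law is inherited from the real scalar action.\<close>
  fix x :: 'a show "1 *\<^sub>C x = x" using scaleR_scaleC[of 1 x] by simp
qed (simp_all add: scaleC_add_right scaleC_add_left scaleC_scaleC)

lemma cinner_0_right [simp]: "cinner x 0 = 0"
  using cinner_add_right[of x 0 0] by simp

lemma cinner_0_left [simp]: "cinner 0 x = 0"
  by (subst cinner_commute) simp

lemma cinner_add_left: "cinner (x + y) z = cinner x z + cinner y z"
  by (metis cinner_add_right cinner_commute complex_cnj_add)

lemma cinner_scaleC_left: "cinner (c *\<^sub>C x) y = cnj c * cinner x y"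
  by (metis cinner_scaleC_right cinner_commute complex_cnj_mult)

lemma cinner_minus_right [simp]: "cinner x (- y) = - cinner x y"
  by (metis cinner_add_right cinner_0_right add.right_inverse add_eq_0_iff)

lemma cinner_minus_left [simp]: "cinner (- x) y = - cinner x y"
  by (metis cinner_minus_right cinner_commute complex_cnj_minus)

lemma cinner_diff_right: "cinner x (y - z) = cinner x y - cinner x z"
  using cinner_add_right[of x y "- z"] by simp

lemma cinner_diff_left: "cinner (x - y) z = cinner x z - cinner y z"
  using cinner_add_left[of x "- y" z] by simp

lemma cinner_sum_right: "cinner x (\<Sum>i\<in>S. f i) = (\<Sum>i\<in>S. cinner x (f i))"
  by (induction S rule: infinite_finite_induct) (simp_all add: cinner_add_right)

lemma cinner_sum_left: "cinner (\<Sum>i\<in>S. f i) x = (\<Sum>i\<in>S. cinner (f i) x)"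
  by (induction S rule: infinite_finite_induct) (simp_all add: cinner_add_left)

lemma cinner_self: "cinner x x = complex_of_real ((norm x)\<^sup>2)"
proof -
  have "Im (cinner x x) = 0" using cinner_commute[of x x] by (metis complex_cnj_cancel_iff Reals_cnj_iff complex_is_Real_iff)
  moreover have "Re (cinner x x) = (norm x)\<^sup>2" by (simp add: inner_eq_Re_cinner[symmetric] power2_norm_eq_inner)
  ultimately show ?thesis by (simp add: complex_eq_iff)
qed

text \<open>Lets complex identities be checked on the real inner product, once for \<open>x\<close>
  and once for its multiple by the imaginary unit.\<close>

lemma Im_cinner: "Im (cinner x y) = inner (\<i> *\<^sub>C x) y"
  by (simp add: inner_eq_Re_cinner cinner_scaleC_left)

lemma cinner_eqI: "(\<And>x. cinner x y = cinner x z) \<Longrightarrow> y = z"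
  using cinner_self[of "y - z"] cinner_diff_right[of "y - z" y z] by simp

lemma norm_scaleC: "norm (c *\<^sub>C x) = cmod c * norm x"
proof -
  have "complex_of_real ((norm (c *\<^sub>C x))\<^sup>2) = cnj c * c * complex_of_real ((norm x)\<^sup>2)"
    unfolding cinner_self[symmetric] by (simp add: cinner_scaleC_left cinner_scaleC_right)
  also have "cnj c * c = complex_of_real ((cmod c)\<^sup>2)"
    by (metis complex_norm_square mult.commute)
  finally have "(norm (c *\<^sub>C x))\<^sup>2 = (cmod c * norm x)\<^sup>2"
    by (simp only: of_real_mult[symmetric] of_real_eq_iff power_mult_distrib)
  then show ?thesis by (simp add: power2_eq_iff_nonneg)
qed

text \<open>Multiplying \<open>y\<close> by a suitable phase \<open>c\<close> makes the inner
  product real and nonnegative; then the real Cauchy-Schwarz inequality applies.\<close>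

lemma cmod_cinner_le: "cmod (cinner x y) \<le> norm x * norm y"
proof (cases "cinner x y = 0")
  case False
  define c where "c = cnj (cinner x y) / cmod (cinner x y)"
  have c: "cmod c = 1" using False by (simp add: c_def norm_divide)
  have "cinner x (c *\<^sub>C y) = complex_of_real ((cmod (cinner x y))\<^sup>2) / cmod (cinner x y)"
    unfolding complex_norm_square c_def cinner_scaleC_right by (simp add: mult.commute)
  also have "\<dots> = complex_of_real (cmod (cinner x y))"
    unfolding of_real_divide[symmetric] using False by (simp add: power2_eq_square)
  finally have "cinner x (c *\<^sub>C y) = complex_of_real (cmod (cinner x y))" .
  then have "cmod (cinner x y) = inner x (c *\<^sub>C y)" by (simp add: inner_eq_Re_cinner)
  also have "\<dots> \<le> norm x * norm (c *\<^sub>C y)" by (rule norm_cauchy_schwarz)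
  finally show ?thesis using c by (simp add: norm_scaleC)
qed simp

section \<open>Orthogonal decomposition and Riesz representation over the reals\<close>

lemma csubspace_subspace: "cvs.subspace W \<Longrightarrow> subspace W"
  unfolding cvs.subspace_def subspace_def by (simp add: scaleR_scaleC)

text \<open>A minimising sequence for the distance from \<open>x\<close> to \<open>W\<close> is
  Cauchy by the parallelogram law, and the limit has a residual orthogonal to \<open>W\<close>,
  since otherwise a small step inside \<open>W\<close> would come closer.\<close>

lemma orthogonal_decomposition:
  fixes x :: "'a::{real_inner, complete_space}"
  assumes W: "subspace W" "closed W"
  shows "\<exists>p\<in>W. \<forall>w\<in>W. inner w (x - p) = 0"
proof -
  let ?S = "(\<lambda>w. (norm (x - w))\<^sup>2) ` W"
  define d where "d = Inf ?S"
  have 0: "0 \<in> W" using W by (simp add: subspace_0)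
  have bdd: "bdd_below ?S" by (rule bdd_belowI[of _ 0]) auto
  have d: "d \<le> (norm (x - w))\<^sup>2" if "w \<in> W" for w
    unfolding d_def using that bdd by (intro cInf_lower) auto
  have "\<exists>w\<in>W. (norm (x - w))\<^sup>2 < d + 1 / real (Suc n)" for n
  proof -
    have "Inf ?S < d + 1 / real (Suc n)" by (simp add: d_def)
    then show ?thesis using cInf_lessD[of ?S] 0 by blast
  qed
  then obtain p where p: "p n \<in> W" "(norm (x - p n))\<^sup>2 < d + 1 / real (Suc n)" for n by metis
  \<comment> \<open>The midpoint of two members lies in \<open>W\<close>, so its squared distance
    from \<open>x\<close> is at least \<open>d\<close>; the parallelogram law turns this into
    closeness of the two members.\<close>
  have par: "(norm (p m - p n))\<^sup>2 \<le> 2 / real (Suc m) + 2 / real (Suc n)" for m n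
  proof -
    have "(1 / 2) *\<^sub>R (p m + p n) \<in> W" using p W by (simp add: subspace_add subspace_scale)
    from d[OF this] have "4 * d \<le> 4 * (norm (x - (1 / 2) *\<^sub>R (p m + p n)))\<^sup>2" by simp
    moreover have "(norm (p m - p n))\<^sup>2 + 4 * (norm (x - (1 / 2) *\<^sub>R (p m + p n)))\<^sup>2 =
        2 * (norm (x - p m))\<^sup>2 + 2 * (norm (x - p n))\<^sup>2"
      by (simp add: power2_norm_eq_inner inner_diff inner_add algebra_simps inner_commute)
    ultimately have "(norm (p m - p n))\<^sup>2 \<le> 2 * (norm (x - p m))\<^sup>2 + 2 * (norm (x - p n))\<^sup>2 - 4 * d" by linarith
    also have "\<dots> \<le> 2 / real (Suc m) + 2 / real (Suc n)" using p(2)[of m] p(2)[of n] by simp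
    finally show ?thesis .
  qed
  have "Cauchy p"
  proof (rule CauchyI)
    fix e :: real assume "e > 0"
    then have "e\<^sup>2 / 4 > 0" by simp
    then obtain M where M: "1 / real (Suc M) < e\<^sup>2 / 4" using nat_approx_posE by blast
    have "norm (p m - p n) < e" if "m \<ge> M" "n \<ge> M" for m n
    proof -
      have "1 / real (Suc m) \<le> 1 / real (Suc M)" "1 / real (Suc n) \<le> 1 / real (Suc M)"
        using that by (auto simp: frac_le)
      then have "(norm (p m - p n))\<^sup>2 < e\<^sup>2" using par[of m n] M by simp
      then show ?thesis using \<open>e > 0\<close> by (simp add: power_less_imp_less_base)
    qed
    then show "\<exists>M. \<forall>m\<ge>M. \<forall>n\<ge>M. norm (p m - p n) < e" by blast
  qed
  then obtain q where q: "p \<longlonglongrightarrow> q" using Cauchy_convergent_iff convergent_def by blast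
  then have qW: "q \<in> W" using W(2) p(1) closed_sequentially by blast
  have "(norm (x - q))\<^sup>2 \<le> d"
  proof (rule LIMSEQ_le)
    show "(\<lambda>n. (norm (x - p n))\<^sup>2) \<longlonglongrightarrow> (norm (x - q))\<^sup>2" using q by (intro tendsto_intros)
    show "(\<lambda>n. d + 1 / real (Suc n)) \<longlonglongrightarrow> d"
      using tendsto_add[OF tendsto_const[of d] LIMSEQ_inverse_real_of_nat] by (simp add: inverse_eq_divide)
    show "\<exists>N. \<forall>n\<ge>N. (norm (x - p n))\<^sup>2 \<le> d + 1 / real (Suc n)" using p(2) less_imp_le by blast
  qed
  then have min: "(norm (x - q))\<^sup>2 \<le> (norm (x - q - w))\<^sup>2" if "w \<in> W" for w
    unfolding diff_diff_eq using d[OF subspace_add[OF W(1) qW that]] by (rule order.trans)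
  have "inner w (x - q) = 0" if w: "w \<in> W" for w
  proof (cases "w = 0")
    case False
    \<comment> \<open>This \<open>t\<close> minimises the distance from \<open>x - q\<close> to the
      line through \<open>w\<close>.\<close>
    define t where "t = inner w (x - q) / (norm w)\<^sup>2"
    have "(norm (x - q - t *\<^sub>R w))\<^sup>2 = (norm (x - q))\<^sup>2 - 2 * t * inner w (x - q) + t * t * (norm w)\<^sup>2"
      by (simp add: power2_norm_eq_inner inner_diff algebra_simps inner_commute)
    also have "\<dots> = (norm (x - q))\<^sup>2 - (inner w (x - q))\<^sup>2 / (norm w)\<^sup>2"
      using False by (simp add: t_def power2_eq_square field_simps)
    finally have "(inner w (x - q))\<^sup>2 / (norm w)\<^sup>2 \<le> 0"
      using min[of "t *\<^sub>R w"] w W by (simp add: subspace_scale)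
    then show ?thesis using False by (simp add: divide_le_0_iff)
  qed simp
  then show ?thesis using qW by blast
qed

text \<open>If \<open>f\<close> is nonzero, the residual \<open>u\<close> of a vector outside the
  kernel is orthogonal to the kernel, and every \<open>y\<close> differs from a multiple of
  \<open>u\<close> by an element of the kernel.\<close>

lemma Riesz_representation:
  fixes f :: "'a::{real_inner, complete_space} \<Rightarrow> real"
  assumes "bounded_linear f"
  shows "\<exists>z. \<forall>x. f x = inner x z"
proof (cases "\<forall>x. f x = 0")
  case False
  interpret f: bounded_linear f by fact
  obtain x where x: "f x \<noteq> 0" using False by blast
  have "closed {x. f x = 0}" by (intro closed_Collect_eq f.continuous_on continuous_on_id continuous_on_const)
  moreover have "subspace {x. f x = 0}" by (auto simp: subspace_def f.add f.scaleR)
  ultimately obtain p where p: "f p = 0" "\<And>w. f w = 0 \<Longrightarrow> inner w (x - p) = 0"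
    using orthogonal_decomposition[of "{x. f x = 0}" x] by blast
  define u where "u = x - p"
  have fu: "f u = f x" using p(1) by (simp add: u_def f.diff)
  then have u: "u \<noteq> 0" using x by auto
  have "f y = inner y ((f u / (norm u)\<^sup>2) *\<^sub>R u)" for y
  proof -
    have "f (y - (f y / f u) *\<^sub>R u) = 0" using fu x by (simp add: f.diff f.scaleR)
    from p(2)[OF this] have "inner y u = f y / f u * (norm u)\<^sup>2"
      by (simp add: u_def[symmetric] inner_diff power2_norm_eq_inner)
    then show ?thesis using u fu x by simp
  qed
  then show ?thesis by blast
qed (auto intro: exI[of _ 0])

section \<open>Complex-linear operators and adjoints\<close>

lemma clinear_op_iff: "clinear_op A \<longleftrightarrow> (\<forall>c x. blinfun_apply A (c *\<^sub>C x) = c *\<^sub>C blinfun_apply A x)"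
proof
  assume "clinear_op A"
  then interpret Vector_Spaces.linear scaleC scaleC "blinfun_apply A" by (simp add: clinear_op_def)
  show "\<forall>c x. blinfun_apply A (c *\<^sub>C x) = c *\<^sub>C blinfun_apply A x" by (simp add: scale)
next
  assume "\<forall>c x. blinfun_apply A (c *\<^sub>C x) = c *\<^sub>C blinfun_apply A x"
  then show "clinear_op A" unfolding clinear_op_def by unfold_locales (auto simp: blinfun.add_right)
qed

lemma clinear_op_comp [simp]: "clinear_op A \<Longrightarrow> clinear_op B \<Longrightarrow> clinear_op (A o\<^sub>L B)"
  and clinear_op_add [simp]: "clinear_op A \<Longrightarrow> clinear_op B \<Longrightarrow> clinear_op (A + B)"
  and clinear_op_diff [simp]: "clinear_op A \<Longrightarrow> clinear_op B \<Longrightarrow> clinear_op (A - B)"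
  and clinear_op_minus [simp]: "clinear_op A \<Longrightarrow> clinear_op (- A)"
  and clinear_op_zero [simp]: "clinear_op 0"
  and clinear_op_id [simp]: "clinear_op id_blinfun"
  and clinear_op_scaleR [simp]: "clinear_op A \<Longrightarrow> clinear_op (r *\<^sub>R A)"
  unfolding clinear_op_iff
  by (simp_all add: blinfun.bilinear_simps scaleC_add_right cvs.scale_right_diff_distrib scaleR_scaleC
      scaleC_scaleC mult.commute)

text \<open>Riesz gives the adjoint for the real inner product. As \<open>A\<close> is
  complex-linear, the same operator serves for the imaginary part, by
  \<open>Im_cinner\<close>.\<close>

lemma adjoint_exists:
  fixes A :: "'a::complex_hilbert \<Rightarrow>\<^sub>L 'a"
  assumes A: "clinear_op A"
  obtains B where "\<And>x y. cinner (blinfun_apply A x) y = cinner x (blinfun_apply B y)" "norm B \<le> norm A"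
proof -
  have "\<exists>z. \<forall>x. inner (blinfun_apply A x) y = inner x z" for y
    by (rule Riesz_representation) (intro bounded_linear_intros)
  then obtain b where b: "inner (blinfun_apply A x) y = inner x (b y)" for x y by metis
  have eqI: "u = v" if "\<And>x. inner x u = inner x v" for u v :: 'a
  proof -
    have "inner (u - v) (u - v) = 0" using that[of "u - v"] by (simp add: inner_diff_right)
    then show ?thesis by simp
  qed
  have bd: "norm (b y) \<le> norm A * norm y" for y
  proof (cases "b y = 0")
    case False
    have "norm (b y) * norm (b y) = inner (blinfun_apply A (b y)) y"
      using b[of "b y" y] by (simp add: power2_norm_eq_inner flip: power2_eq_square)
    also have "\<dots> \<le> norm (blinfun_apply A (b y)) * norm y" by (rule norm_cauchy_schwarz)
    also have "\<dots> \<le> norm A * norm (b y) * norm y" by (intro mult_right_mono norm_blinfun) simp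
    finally have "norm (b y) * norm (b y) \<le> norm (b y) * (norm A * norm y)" by (simp add: mult_ac)
    then show ?thesis using False by simp
  qed simp
  have lin: "bounded_linear b"
  proof (rule bounded_linear_intro)
    show "b (x + y) = b x + b y" for x y by (rule eqI) (simp add: b[symmetric] inner_add_right)
    show "b (r *\<^sub>R x) = r *\<^sub>R b x" for r x by (rule eqI) (simp add: b[symmetric])
    show "norm (b y) \<le> norm y * norm A" for y using bd by (simp add: mult.commute)
  qed
  show ?thesis
  proof (rule that[of "Blinfun b"])
    fix x y
    have "Im (cinner (blinfun_apply A x) y) = Im (cinner x (b y))"
      using A b[of "\<i> *\<^sub>C x" y] by (simp add: Im_cinner clinear_op_iff)
    then show "cinner (blinfun_apply A x) y = cinner x (blinfun_apply (Blinfun b) y)"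
      using b[of x y] by (simp add: complex_eq_iff inner_eq_Re_cinner bounded_linear_Blinfun_apply[OF lin])
    show "norm (Blinfun b) \<le> norm A"
      by (rule norm_blinfun_bound) (simp_all add: bd bounded_linear_Blinfun_apply[OF lin])
  qed
qed

lemma cadj_eqI:
  assumes "\<And>x y. cinner (blinfun_apply A x) y = cinner x (blinfun_apply B y)"
  shows "cadj A = B"
  unfolding cadj_def
proof (rule the_equality)
  show "\<forall>x y. cinner (blinfun_apply A x) y = cinner x (blinfun_apply B y)" using assms by blast
  fix C assume "\<forall>x y. cinner (blinfun_apply A x) y = cinner x (blinfun_apply C y)"
  then show "C = B" by (intro blinfun_eqI cinner_eqI) (simp add: assms)
qed

context
  fixes A :: "'a::complex_hilbert \<Rightarrow>\<^sub>L 'a"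
  assumes A: "clinear_op A"
begin

lemma cinner_cadj: "cinner (blinfun_apply A x) y = cinner x (blinfun_apply (cadj A) y)"
  and norm_cadj_le: "norm (cadj A) \<le> norm A"
  using adjoint_exists[OF A] cadj_eqI by metis+

lemma cinner_cadj': "cinner (blinfun_apply (cadj A) x) y = cinner x (blinfun_apply A y)"
  by (metis cinner_cadj cinner_commute)

lemma clinear_cadj [simp]: "clinear_op (cadj A)"
  unfolding clinear_op_iff
  by (intro allI cinner_eqI) (simp add: cinner_cadj[symmetric] cinner_scaleC_right)

lemma cadj_cadj [simp]: "cadj (cadj A) = A"
  by (rule cadj_eqI) (rule cinner_cadj')

lemma cadj_scaleR: "cadj (r *\<^sub>R A) = r *\<^sub>R cadj A"
  by (rule cadj_eqI) (simp add: blinfun.bilinear_simps scaleR_scaleC cinner_scaleC_left cinner_scaleC_right cinner_cadj)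

end

lemma cadj_comp: "clinear_op A \<Longrightarrow> clinear_op B \<Longrightarrow> cadj (A o\<^sub>L B) = cadj B o\<^sub>L cadj A"
  for A B :: "'a::complex_hilbert \<Rightarrow>\<^sub>L 'a"
  by (rule cadj_eqI) (simp add: cinner_cadj)

lemma cadj_add: "clinear_op A \<Longrightarrow> clinear_op B \<Longrightarrow> cadj (A + B) = cadj A + cadj B"
  for A B :: "'a::complex_hilbert \<Rightarrow>\<^sub>L 'a"
  by (rule cadj_eqI) (simp add: cinner_cadj blinfun.bilinear_simps cinner_add_left cinner_add_right)

lemma cadj_diff: "clinear_op A \<Longrightarrow> clinear_op B \<Longrightarrow> cadj (A - B) = cadj A - cadj B"
  for A B :: "'a::complex_hilbert \<Rightarrow>\<^sub>L 'a"
  by (rule cadj_eqI) (simp add: cinner_cadj blinfun.bilinear_simps cinner_diff_left cinner_diff_right)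

lemma cadj_id [simp]: "cadj id_blinfun = id_blinfun"
  by (rule cadj_eqI) simp

lemma clinear_limit:
  assumes "A \<longlonglongrightarrow> B" "\<And>n. clinear_op (A n)"
  shows "clinear_op (B :: 'a::complex_inner \<Rightarrow>\<^sub>L 'a)"
  unfolding clinear_op_iff
proof (intro allI)
  fix c x
  have lim: "(\<lambda>n. blinfun_apply (A n) y) \<longlonglongrightarrow> blinfun_apply B y" for y
    using assms(1) by (intro tendsto_intros)
  have "bounded_linear ((*\<^sub>C) c :: 'a \<Rightarrow> 'a)"
    by (rule bounded_linear_intro[of _ "cmod c"])
      (simp_all add: scaleC_add_right scaleR_scaleC scaleC_scaleC norm_scaleC mult.commute)
  from bounded_linear.tendsto[OF this lim[of x]]
  have "(\<lambda>n. blinfun_apply (A n) (c *\<^sub>C x)) \<longlonglongrightarrow> c *\<^sub>C blinfun_apply B x"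
    using assms(2) by (simp add: clinear_op_iff)
  with lim show "blinfun_apply B (c *\<^sub>C x) = c *\<^sub>C blinfun_apply B x"
    by (rule LIMSEQ_unique)
qed

section \<open>Orthogonal projectors\<close>

lemma csubspace_ocomp: "cvs.subspace (ocomp W)"
  by (auto simp: cvs.subspace_def ocomp_def cinner_add_right cinner_scaleC_right)

text \<open>The orthogonal complement is an intersection of kernels of real inner products, two for
  each \<open>w\<close>.\<close>

lemma closed_ocomp: "closed (ocomp W)"
proof -
  have "ocomp W = (\<Inter>w\<in>W. {x. inner w x = 0} \<inter> {x. inner (\<i> *\<^sub>C w) x = 0})"
    unfolding ocomp_def by (auto simp: complex_eq_iff inner_eq_Re_cinner[symmetric] Im_cinner)
  moreover have "closed {x. inner w x = 0}" for w :: 'a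
    by (intro closed_Collect_eq continuous_intros)
  ultimately show ?thesis by (auto intro!: closed_INT closed_Int)
qed

lemma closed_csubspace_ocomp: "closed_csubspace (ocomp W)"
  by (simp add: closed_csubspace_def csubspace_ocomp closed_ocomp)

context
  fixes W :: "'a::complex_hilbert set"
  assumes W: "closed_csubspace W"
begin

lemma proj_unique:
  assumes "y \<in> W" "x - y \<in> ocomp W" "z \<in> W" "x - z \<in> ocomp W"
  shows "y = z"
proof -
  have "y - z \<in> W" using W assms cvs.subspace_diff by (auto simp: closed_csubspace_def)
  then have "cinner (y - z) (x - z) = 0" "cinner (y - z) (x - y) = 0" using assms by (auto simp: ocomp_def)
  then have "cinner (y - z) (y - z) = 0" by (simp add: cinner_diff_right)
  then show ?thesis by (simp add: cinner_self)
qed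

text \<open>The real orthogonal decomposition is already the complex one, because \<open>W\<close>
  is closed under multiplication by the imaginary unit. Linearity comes from uniqueness of the
  decomposition, the bound 1 from Pythagoras.\<close>

lemma proj_exists: "\<exists>P. \<forall>x. blinfun_apply P x \<in> W \<and> x - blinfun_apply P x \<in> ocomp W"
proof -
  have sW: "cvs.subspace W" "subspace W" "closed W"
    using W csubspace_subspace by (auto simp: closed_csubspace_def)
  have "\<exists>p. p \<in> W \<and> x - p \<in> ocomp W" for x
  proof -
    obtain p where p: "p \<in> W" "\<forall>w\<in>W. inner w (x - p) = 0" using orthogonal_decomposition[OF sW(2,3)] by blast
    have "cinner w (x - p) = 0" if "w \<in> W" for w
      using p(2) that sW(1) by (simp add: complex_eq_iff inner_eq_Re_cinner[symmetric] Im_cinner cvs.subspace_scale)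
    then show ?thesis using p(1) by (auto simp: ocomp_def)
  qed
  then obtain p where p: "p x \<in> W" "x - p x \<in> ocomp W" for x by metis
  note oc = csubspace_ocomp[of W] csubspace_subspace[OF csubspace_ocomp[of W]]
  have lin: "bounded_linear p"
  proof (rule bounded_linear_intro[of _ 1])
    fix x y r
    have "x - p x + (y - p y) \<in> ocomp W" using oc p subspace_add by blast
    then have "x + y - (p x + p y) \<in> ocomp W" by (simp add: algebra_simps)
    then show "p (x + y) = p x + p y"
      using proj_unique[OF p(1,2)] p sW subspace_add by blast
    have "r *\<^sub>R (x - p x) \<in> ocomp W" using oc p subspace_scale by blast
    then have "r *\<^sub>R x - r *\<^sub>R p x \<in> ocomp W" by (simp add: scaleR_diff_right)
    then show "p (r *\<^sub>R x) = r *\<^sub>R p x"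
      using proj_unique[OF p(1,2)] p sW subspace_scale by blast
    have "inner (p x) (x - p x) = 0" using p by (simp add: ocomp_def inner_eq_Re_cinner)
    then have "(norm x)\<^sup>2 = (norm (p x))\<^sup>2 + (norm (x - p x))\<^sup>2"
      by (simp add: power2_norm_eq_inner inner_diff inner_commute algebra_simps)
    then have "(norm (p x))\<^sup>2 \<le> (norm x)\<^sup>2" by simp
    then have "norm (p x) \<le> norm x" by (rule power2_le_imp_le) simp
    then show "norm (p x) \<le> norm x * 1" by simp
  qed
  show ?thesis by (rule exI[of _ "Blinfun p"]) (simp add: bounded_linear_Blinfun_apply[OF lin] p)
qed

lemma proj_mem [simp]: "blinfun_apply (proj W) x \<in> W"
  and proj_perp: "x - blinfun_apply (proj W) x \<in> ocomp W"
proof -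
  have "\<exists>!P. \<forall>x. blinfun_apply P x \<in> W \<and> x - blinfun_apply P x \<in> ocomp W"
  proof (rule ex_ex1I[OF proj_exists])
    fix P Q
    assume "\<forall>x. blinfun_apply P x \<in> W \<and> x - blinfun_apply P x \<in> ocomp W"
      "\<forall>x. blinfun_apply Q x \<in> W \<and> x - blinfun_apply Q x \<in> ocomp W"
    then show "P = Q" by (intro blinfun_eqI proj_unique) auto
  qed
  from theI'[OF this]
  show "blinfun_apply (proj W) x \<in> W" "x - blinfun_apply (proj W) x \<in> ocomp W"
    unfolding proj_def by auto
qed

lemma proj_eqI: "y \<in> W \<Longrightarrow> x - y \<in> ocomp W \<Longrightarrow> blinfun_apply (proj W) x = y"
  using proj_unique proj_mem proj_perp by blast

lemma proj_eq_self: "x \<in> W \<Longrightarrow> blinfun_apply (proj W) x = x"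
  by (rule proj_eqI) (auto simp: ocomp_def)

lemma clinear_proj [simp]: "clinear_op (proj W)"
  unfolding clinear_op_iff
proof (intro allI proj_eqI)
  fix c x
  show "c *\<^sub>C blinfun_apply (proj W) x \<in> W" using W by (simp add: closed_csubspace_def cvs.subspace_scale)
  have "c *\<^sub>C (x - blinfun_apply (proj W) x) \<in> ocomp W"
    using csubspace_ocomp proj_perp cvs.subspace_scale by blast
  then show "c *\<^sub>C x - c *\<^sub>C blinfun_apply (proj W) x \<in> ocomp W" by (simp add: cvs.scale_right_diff_distrib)
qed

lemma proj_idem [simp]: "proj W o\<^sub>L proj W = proj W"
  by (rule blinfun_eqI) (simp add: proj_eq_self)

lemma cadj_proj [simp]: "cadj (proj W) = proj W"
proof (rule cadj_eqI)
  fix x y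
  have "cinner (blinfun_apply (proj W) x) (y - blinfun_apply (proj W) y) = 0"
    using proj_perp[of y] by (auto simp: ocomp_def)
  moreover have "cinner (blinfun_apply (proj W) y) (x - blinfun_apply (proj W) x) = 0"
    using proj_perp[of x] by (auto simp: ocomp_def)
  then have "cinner (x - blinfun_apply (proj W) x) (blinfun_apply (proj W) y) = 0"
    by (metis cinner_commute complex_cnj_zero)
  ultimately show "cinner (blinfun_apply (proj W) x) y = cinner x (blinfun_apply (proj W) y)"
    by (simp add: cinner_diff_left cinner_diff_right)
qed

lemma range_proj: "range (blinfun_apply (proj W)) = W"
  using proj_eq_self by (metis proj_mem image_subsetI rangeI subsetI subset_antisym)

end

lemma proj_ocomp:
  fixes W :: "'a::complex_hilbert set"
  assumes W: "closed_csubspace W"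
  shows "proj (ocomp W) = id_blinfun - proj W"
proof (rule blinfun_eqI)
  fix x
  have "cinner w (blinfun_apply (proj W) x) = 0" if "w \<in> ocomp W" for w
  proof -
    have "cinner (blinfun_apply (proj W) x) w = 0" using that proj_mem[OF W, of x] by (auto simp: ocomp_def)
    then show ?thesis by (subst cinner_commute) simp
  qed
  then have "x - (x - blinfun_apply (proj W) x) \<in> ocomp (ocomp W)" by (simp add: ocomp_def[of "ocomp W"])
  from proj_eqI[OF closed_csubspace_ocomp proj_perp[OF W] this]
  show "blinfun_apply (proj (ocomp W)) x = blinfun_apply (id_blinfun - proj W) x"
    by (simp add: blinfun.bilinear_simps)
qed

text \<open>The dictionary between projectors and closed subspaces. The range of an idempotent is
  its set of fixed points, hence closed.\<close>

lemma orth_projectorD: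
  fixes P :: "'a::complex_hilbert \<Rightarrow>\<^sub>L 'a"
  assumes "orth_projector P"
  shows "closed_csubspace (range (blinfun_apply P))" and "proj (range (blinfun_apply P)) = P"
proof -
  have P: "clinear_op P" "cadj P = P" and PP: "blinfun_apply P (blinfun_apply P x) = blinfun_apply P x" for x
    using assms by (auto simp: orth_projector_def) (metis blinfun_apply_blinfun_compose)
  have r: "range (blinfun_apply P) = {x. blinfun_apply P x = x}" using PP by auto (metis rangeI)
  show c: "closed_csubspace (range (blinfun_apply P))"
    unfolding closed_csubspace_def
  proof
    show "cvs.subspace (range (blinfun_apply P))"
      using P(1) unfolding r cvs.subspace_def by (auto simp: blinfun.bilinear_simps clinear_op_iff)
    show "closed (range (blinfun_apply P))"
      unfolding r by (intro closed_Collect_eq continuous_intros)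
  qed
  show "proj (range (blinfun_apply P)) = P"
  proof (rule blinfun_eqI, rule proj_eqI[OF c])
    fix x
    show "x - blinfun_apply P x \<in> ocomp (range (blinfun_apply P))"
      using P PP by (auto simp: ocomp_def cinner_cadj blinfun.bilinear_simps)
  qed simp
qed

section \<open>Orthonormal bases and Hilbert--Schmidt operators\<close>

definition orthonormal :: "'a::complex_inner set \<Rightarrow> bool"
  where "orthonormal B \<longleftrightarrow> (\<forall>x\<in>B. \<forall>y\<in>B. cinner x y = (if x = y then 1 else 0))"

lemma orthonormal_subset: "orthonormal B \<Longrightarrow> F \<subseteq> B \<Longrightarrow> orthonormal F"
  by (auto simp: orthonormal_def subset_iff)

lemma is_onb_iff: "is_onb B \<longleftrightarrow> orthonormal B \<and> closure (cspan B) = UNIV"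
  by (simp add: is_onb_def orthonormal_def)

lemma closure_csubspace:
  assumes "cvs.subspace (W :: 'a::complex_inner set)"
  shows "closed_csubspace (closure W)"
  unfolding closed_csubspace_def
proof
  have add: "x + y \<in> closure W" if xy: "x \<in> closure W" "y \<in> closure W" for x y
  proof -
    obtain f where f: "\<forall>n. f n \<in> W" "f \<longlonglongrightarrow> x" using xy(1) unfolding closure_sequential by blast
    obtain g where g: "\<forall>n. g n \<in> W" "g \<longlonglongrightarrow> y" using xy(2) unfolding closure_sequential by blast
    have "\<forall>n. f n + g n \<in> W" using f(1) g(1) assms by (simp add: cvs.subspace_add)
    then show ?thesis
      unfolding closure_sequential using tendsto_add[OF f(2) g(2)] by (intro exI[of _ "\<lambda>n. f n + g n"] conjI)
  qed
  have "c *\<^sub>C x \<in> closure W" if x: "x \<in> closure W" for c x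
  proof -
    obtain f where f: "\<forall>n. f n \<in> W" "f \<longlonglongrightarrow> x" using x unfolding closure_sequential by blast
    have "bounded_linear ((*\<^sub>C) c :: 'a \<Rightarrow> 'a)"
      by (rule bounded_linear_intro[of _ "cmod c"])
        (simp_all add: scaleC_add_right scaleR_scaleC scaleC_scaleC norm_scaleC mult.commute)
    from bounded_linear.tendsto[OF this f(2)] have lim: "(\<lambda>n. c *\<^sub>C f n) \<longlonglongrightarrow> c *\<^sub>C x" .
    have "\<forall>n. c *\<^sub>C f n \<in> W" using f(1) assms by (simp add: cvs.subspace_scale)
    then show ?thesis
      unfolding closure_sequential using lim by (intro exI[of _ "\<lambda>n. c *\<^sub>C f n"] conjI)
  qed
  then show "cvs.subspace (closure W)"
    using add closure_subset[of W] cvs.subspace_0[OF assms] by (auto simp: cvs.subspace_def)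
qed simp

text \<open>Zorn's lemma gives a maximal orthonormal set. If its closed span missed a vector, the
  normalised residual of that vector could be added to the set.\<close>

lemma is_onb_exists: "\<exists>B :: 'a::complex_hilbert set. is_onb B"
proof -
  have "\<exists>M\<in>{B :: 'a set. orthonormal B}. \<forall>X\<in>{B. orthonormal B}. M \<subseteq> X \<longrightarrow> X = M"
  proof (rule subset_Zorn')
    fix C :: "'a set set" assume C: "subset.chain {B. orthonormal B} C"
    have *: "cinner x y = (if x = y then 1 else 0)" if xy: "x \<in> X" "X \<in> C" "y \<in> Y" "Y \<in> C" for x y X Y
    proof -
      have "X \<subseteq> Y \<or> Y \<subseteq> X" using C xy by (auto simp: subset.chain_def)
      then obtain Z where "Z \<in> C" "x \<in> Z" "y \<in> Z" using xy by blast
      then show ?thesis using C by (auto simp: subset.chain_def orthonormal_def subset_iff)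
    qed
    have "orthonormal (\<Union>C)"
      unfolding orthonormal_def by (intro ballI, elim UnionE) (rule *)
    then show "\<Union>C \<in> {B. orthonormal B}" by simp
  qed
  then obtain M :: "'a set" where M: "orthonormal M" "\<And>X. orthonormal X \<Longrightarrow> M \<subseteq> X \<Longrightarrow> X = M" by auto
  let ?W = "closure (cvs.span M)"
  have W: "closed_csubspace ?W" by (rule closure_csubspace[OF cvs.subspace_span])
  have "x \<in> ?W" for x
  proof (rule ccontr)
    assume x: "x \<notin> ?W"
    define u where "u = x - blinfun_apply (proj ?W) x"
    have u0: "u \<noteq> 0" using x proj_mem[OF W, of x] by (auto simp: u_def)
    have u: "cinner w u = 0" if "w \<in> ?W" for w
      using proj_perp[OF W, of x] that by (simp add: u_def ocomp_def)
    define e where "e = complex_of_real (1 / norm u) *\<^sub>C u"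
    have e: "cinner w e = 0" if "w \<in> M" for w
    proof -
      have "w \<in> ?W" using that closure_subset cvs.span_superset by blast
      from u[OF this] show ?thesis by (simp add: e_def cinner_scaleC_right)
    qed
    have e': "cinner e w = 0" if "w \<in> M" for w using e[OF that] by (subst cinner_commute) simp
    have ee: "cinner e e = 1"
    proof -
      have "norm e = 1" using u0 by (simp add: e_def norm_scaleC norm_divide)
      then show ?thesis by (simp add: cinner_self)
    qed
    have "e \<notin> M" using e[of e] ee by auto
    moreover have "orthonormal (insert e M)"
      unfolding orthonormal_def using M(1) e e' ee \<open>e \<notin> M\<close> by (auto simp: orthonormal_def)
    ultimately show False using M(2)[of "insert e M"] by blast
  qed
  then have "is_onb M" using M(1) by (auto simp: is_onb_iff)
  then show ?thesis ..
qed

text \<open>The same choice as in \<open>hilbert_schmidt\<close> and \<open>hs_norm\<close>; all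
  estimates below refer to this one basis.\<close>

abbreviation onb :: "'a::complex_hilbert set" where "onb \<equiv> SOME B. is_onb B"

lemma is_onb_onb: "is_onb onb"
  using is_onb_exists by (rule someI_ex)

lemma orthonormal_onb: "orthonormal onb"
  using is_onb_onb unfolding is_onb_iff[of onb] by blast

text \<open>\<open>s\<close> is the orthogonal projection of \<open>x\<close> onto the span of
  \<open>F\<close>; both claims are Pythagoras, the second being the property of best
  approximation.\<close>

lemma orthonormal_residual:
  assumes "orthonormal F" "finite F" and s: "s = (\<Sum>e\<in>F. cinner e x *\<^sub>C e)"
  shows "(norm (x - s))\<^sup>2 = (norm x)\<^sup>2 - (\<Sum>e\<in>F. (cmod (cinner e x))\<^sup>2)"
    and "norm (x - s) \<le> norm (x - (\<Sum>e\<in>F. c e *\<^sub>C e))"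
proof -
  have F: "cinner e f = (if e = f then 1 else 0)" if "e \<in> F" "f \<in> F" for e f
    using assms(1) that by (simp add: orthonormal_def)
  have "cinner e s = cinner e x" if "e \<in> F" for e
  proof -
    have "cinner e s = (\<Sum>f\<in>F. cinner f x * cinner e f)" by (simp add: s cinner_sum_right cinner_scaleC_right)
    also have "\<dots> = (\<Sum>f\<in>F. if f = e then cinner f x else 0)" using F that by (intro sum.cong) auto
    finally show ?thesis using assms(2) that by simp
  qed
  then have "cinner e (x - s) = 0" if "e \<in> F" for e using that by (simp add: cinner_diff_right)
  then have perp: "cinner (\<Sum>e\<in>F. c e *\<^sub>C e) (x - s) = 0" for c
    by (simp add: cinner_sum_left cinner_scaleC_left)
  have pyth: "(norm (a + b))\<^sup>2 = (norm a)\<^sup>2 + (norm b)\<^sup>2" if "cinner a b = 0" for a b :: 'a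
    proof -
    have "inner a b = 0" using that by (simp add: inner_eq_Re_cinner)
    then show ?thesis by (simp add: power2_norm_eq_inner inner_add inner_commute)
  qed
  have "(norm (s + (x - s)))\<^sup>2 = (norm s)\<^sup>2 + (norm (x - s))\<^sup>2"
    by (rule pyth) (use perp[of "\<lambda>e. cinner e x"] s in simp)
  moreover have "complex_of_real ((norm s)\<^sup>2) = complex_of_real (\<Sum>e\<in>F. (cmod (cinner e x))\<^sup>2)"
  proof -
    have "cinner s (x - s) = 0" using perp[of "\<lambda>e. cinner e x"] s by simp
    then have "cinner s s = cinner s x" by (simp add: cinner_diff_right)
    also have "\<dots> = (\<Sum>e\<in>F. cnj (cinner e x) * cinner e x)" by (simp add: s cinner_sum_left cinner_scaleC_left)
    also have "\<dots> = (\<Sum>e\<in>F. complex_of_real ((cmod (cinner e x))\<^sup>2))"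
      by (intro sum.cong refl) (simp add: complex_norm_square mult.commute del: of_real_power)
    finally show ?thesis unfolding cinner_self by simp
  qed
  then have "(norm s)\<^sup>2 = (\<Sum>e\<in>F. (cmod (cinner e x))\<^sup>2)" by (simp only: of_real_eq_iff)
  ultimately show "(norm (x - s))\<^sup>2 = (norm x)\<^sup>2 - (\<Sum>e\<in>F. (cmod (cinner e x))\<^sup>2)" by simp
  let ?y = "\<Sum>e\<in>F. c e *\<^sub>C e"
  have "s - ?y = (\<Sum>e\<in>F. (cinner e x - c e) *\<^sub>C e)"
    by (simp add: s sum_subtractf cvs.scale_left_diff_distrib)
  then have "cinner (s - ?y) (x - s) = 0" using perp by simp
  from pyth[OF this] have "(norm (x - ?y))\<^sup>2 = (norm (s - ?y))\<^sup>2 + (norm (x - s))\<^sup>2" by simp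
  then have "(norm (x - s))\<^sup>2 \<le> (norm (x - ?y))\<^sup>2" by simp
  then show "norm (x - s) \<le> norm (x - ?y)" by (rule power2_le_imp_le) simp
qed

lemma Bessel_inequality:
  assumes "orthonormal F" "finite F"
  shows "(\<Sum>e\<in>F. (cmod (cinner e x))\<^sup>2) \<le> (norm x)\<^sup>2"
  using orthonormal_residual(1)[OF assms refl, of x] zero_le_power2[of "norm (x - (\<Sum>e\<in>F. cinner e x *\<^sub>C e))"]
  by linarith

text \<open>Parseval up to \<epsilon> without infinite sums. A finite combination near
  \<open>x\<close> exists by density, and the best approximation over any larger finite set is at
  least as good. Stability under enlargement lets finitely many vectors share one finite
  set.\<close>

lemma Parseval_approx:
  fixes x :: "'a::complex_hilbert"
  assumes "\<epsilon> > 0"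
  obtains F where "finite F" "F \<subseteq> onb"
    "\<And>G. finite G \<Longrightarrow> F \<subseteq> G \<Longrightarrow> G \<subseteq> onb \<Longrightarrow> (norm x)\<^sup>2 \<le> (\<Sum>e\<in>G. (cmod (cinner e x))\<^sup>2) + \<epsilon>"
proof -
  have "x \<in> closure (cvs.span onb)" using is_onb_onb unfolding is_onb_iff[of onb] by blast
  moreover have "sqrt \<epsilon> > 0" using assms by simp
  ultimately obtain y where y: "y \<in> cvs.span onb" "dist y x < sqrt \<epsilon>" by (meson closure_approachable)
  then obtain F c where F: "finite F" "F \<subseteq> onb" "y = (\<Sum>e\<in>F. c e *\<^sub>C e)"
    unfolding cvs.span_explicit by blast
  show ?thesis
  proof (rule that[OF F(1,2)])
    fix G :: "'a set" assume G: "finite G" "F \<subseteq> G" "G \<subseteq> onb"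
    let ?s = "\<Sum>e\<in>G. cinner e x *\<^sub>C e"
    have on: "orthonormal G" by (rule orthonormal_subset[OF orthonormal_onb G(3)])
    have "y = (\<Sum>e\<in>G. (if e \<in> F then c e else 0) *\<^sub>C e)"
      unfolding F(3) using G by (intro sum.mono_neutral_cong_left) auto
    then have "norm (x - ?s) \<le> norm (x - y)" using orthonormal_residual(2)[OF on G(1) refl] by simp
    then have "norm (x - ?s) \<le> sqrt \<epsilon>" using y(2) by (simp add: dist_norm norm_minus_commute)
    then have "(norm (x - ?s))\<^sup>2 \<le> (sqrt \<epsilon>)\<^sup>2" by (rule power_mono) simp
    then show "(norm x)\<^sup>2 \<le> (\<Sum>e\<in>G. (cmod (cinner e x))\<^sup>2) + \<epsilon>"
      using orthonormal_residual(1)[OF on G(1) refl, of x] assms by simp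
  qed
qed

section \<open>The Hilbert-Schmidt norm\<close>

lemma hs_norm_nonneg [simp]: "0 \<le> hs_norm A"
  by (simp add: hs_norm_def infsum_nonneg)

lemma hs_norm_minus [simp]: "hs_norm (- A) = hs_norm A"
  by (simp add: hs_norm_def blinfun.minus_left)

lemma hs_sum_le:
  fixes A :: "'a::complex_hilbert \<Rightarrow>\<^sub>L 'a"
  assumes "hilbert_schmidt A" "finite F" "F \<subseteq> onb"
  shows "(\<Sum>e\<in>F. (norm (blinfun_apply A e))\<^sup>2) \<le> (hs_norm A)\<^sup>2"
proof -
  have "(\<Sum>e\<in>F. (norm (blinfun_apply A e))\<^sup>2) \<le> (\<Sum>\<^sub>\<infinity>e\<in>onb. (norm (blinfun_apply A e))\<^sup>2)"
    using assms by (intro finite_sum_le_infsum) (auto simp: hilbert_schmidt_def)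
  then show ?thesis by (simp add: hs_norm_def infsum_nonneg)
qed

lemma
  fixes A :: "'a::complex_hilbert \<Rightarrow>\<^sub>L 'a"
  assumes "clinear_op A" "0 \<le> C"
    and "\<And>F. finite F \<Longrightarrow> F \<subseteq> onb \<Longrightarrow> (\<Sum>e\<in>F. (norm (blinfun_apply A e))\<^sup>2) \<le> C\<^sup>2"
  \<comment> \<open>Both facts follow from a bound on finite partial sums, the form in which the
    later Hilbert-Schmidt estimates are proved.\<close>
  shows hilbert_schmidtI: "hilbert_schmidt A" and hs_norm_le: "hs_norm A \<le> C"
proof -
  have s: "(\<lambda>e. (norm (blinfun_apply A e))\<^sup>2) summable_on onb"
    by (rule nonneg_bdd_above_summable_on) (use assms(3) in \<open>auto intro!: bdd_aboveI[of _ "C\<^sup>2"]\<close>)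
  then show "hilbert_schmidt A" using assms(1) by (simp add: hilbert_schmidt_def)
  have "(\<Sum>\<^sub>\<infinity>e\<in>onb. (norm (blinfun_apply A e))\<^sup>2) \<le> C\<^sup>2"
    by (rule infsum_le_finite_sums[OF s assms(3)])
  then show "hs_norm A \<le> C" unfolding hs_norm_def using assms(2) by (rule real_le_lsqrt[rotated])
qed

lemma hilbert_schmidt_clinear: "hilbert_schmidt A \<Longrightarrow> clinear_op A"
  by (simp add: hilbert_schmidt_def)

lemma
  fixes A :: "'a::complex_hilbert \<Rightarrow>\<^sub>L 'a"
  assumes A: "hilbert_schmidt A"
  shows hilbert_schmidt_cadj: "hilbert_schmidt (cadj A)" and hs_norm_cadj_le: "hs_norm (cadj A) \<le> hs_norm A"
proof -
  have cl: "clinear_op A" by (rule hilbert_schmidt_clinear[OF A])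
  \<comment> \<open>Finite double sums of squared matrix entries are swapped: Parseval bounds the
    left side from above by them up to \<epsilon>, and Bessel bounds them by the sum for
    \<open>A\<close>.\<close>
  have *: "(\<Sum>f\<in>F. (norm (blinfun_apply (cadj A) f))\<^sup>2) \<le> (hs_norm A)\<^sup>2" if F: "finite F" "F \<subseteq> onb" for F
  proof (rule field_le_epsilon)
    fix \<epsilon> :: real assume e: "\<epsilon> > 0"
    \<comment> \<open>Each of the \<open>card F\<close> vectors may lose \<open>d\<close>; the total
      loss stays below \<epsilon>, also when \<open>F\<close> is empty.\<close>
    define d where "d = \<epsilon> / (card F + 1)"
    have d: "d > 0" using e by (simp add: d_def)
    have "\<exists>E. finite E \<and> E \<subseteq> onb \<and> (\<forall>G. finite G \<longrightarrow> E \<subseteq> G \<longrightarrow> G \<subseteq> onb \<longrightarrow>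
        (norm (blinfun_apply (cadj A) f))\<^sup>2 \<le> (\<Sum>e\<in>G. (cmod (cinner e (blinfun_apply (cadj A) f)))\<^sup>2) + d)" for f
      by (rule Parseval_approx[OF d, of "blinfun_apply (cadj A) f"]) blast
    then obtain E where E: "finite (E f)" "E f \<subseteq> onb" "\<And>G. finite G \<Longrightarrow> E f \<subseteq> G \<Longrightarrow> G \<subseteq> onb \<Longrightarrow>
        (norm (blinfun_apply (cadj A) f))\<^sup>2 \<le> (\<Sum>e\<in>G. (cmod (cinner e (blinfun_apply (cadj A) f)))\<^sup>2) + d" for f
      by metis
    define G where "G = (\<Union>f\<in>F. E f)"
    have G: "finite G" "G \<subseteq> onb" unfolding G_def using F E by auto
    have on: "orthonormal F" by (rule orthonormal_subset[OF orthonormal_onb F(2)])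
    have "(\<Sum>f\<in>F. (norm (blinfun_apply (cadj A) f))\<^sup>2) \<le>
        (\<Sum>f\<in>F. (\<Sum>e\<in>G. (cmod (cinner e (blinfun_apply (cadj A) f)))\<^sup>2) + d)"
      using G by (intro sum_mono E(3)) (auto simp: G_def)
    also have "\<dots> = (\<Sum>e\<in>G. \<Sum>f\<in>F. (cmod (cinner f (blinfun_apply A e)))\<^sup>2) + card F * d"
    proof -
      have "cmod (cinner e (blinfun_apply (cadj A) f)) = cmod (cinner f (blinfun_apply A e))" for e f
        by (metis cinner_cadj[OF cl] cinner_commute complex_mod_cnj)
      then show ?thesis by (simp add: sum.distrib sum.swap[of _ F G])
    qed
    also have "\<dots> \<le> (\<Sum>e\<in>G. (norm (blinfun_apply A e))\<^sup>2) + card F * d"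
      using Bessel_inequality[OF on F(1)] by (intro add_mono sum_mono) auto
    also have "\<dots> \<le> (hs_norm A)\<^sup>2 + \<epsilon>"
    proof (intro add_mono hs_sum_le[OF A G])
      have "card F * d \<le> (card F + 1) * d" using d by simp
      also have "\<dots> = \<epsilon>" by (simp add: d_def)
      finally show "card F * d \<le> \<epsilon>" .
    qed
    finally show "(\<Sum>f\<in>F. (norm (blinfun_apply (cadj A) f))\<^sup>2) \<le> (hs_norm A)\<^sup>2 + \<epsilon>" .
  qed
  show "hilbert_schmidt (cadj A)" "hs_norm (cadj A) \<le> hs_norm A"
    by (rule hilbert_schmidtI[OF _ _ *] hs_norm_le[OF _ _ *]; use assms in \<open>auto simp: hilbert_schmidt_clinear\<close>)+
qed

text \<open>Expand \<open>A x\<close> in the basis, move \<open>A\<close> to the basis vectors as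
  \<open>cadj A\<close>, and apply Cauchy-Schwarz to each coefficient; what remains is the
  Hilbert-Schmidt norm of the adjoint.\<close>

lemma norm_le_hs_norm:
  fixes A :: "'a::complex_hilbert \<Rightarrow>\<^sub>L 'a"
  assumes A: "hilbert_schmidt A"
  shows "norm A \<le> hs_norm A"
proof (rule norm_blinfun_bound)
  have cl: "clinear_op A" by (rule hilbert_schmidt_clinear[OF A])
  fix x
  have "(norm (blinfun_apply A x))\<^sup>2 \<le> (hs_norm A * norm x)\<^sup>2"
  proof (rule field_le_epsilon)
    fix \<epsilon> :: real assume e: "\<epsilon> > 0"
    have "\<exists>F. finite F \<and> F \<subseteq> onb \<and>
        (norm (blinfun_apply A x))\<^sup>2 \<le> (\<Sum>e\<in>F. (cmod (cinner e (blinfun_apply A x)))\<^sup>2) + \<epsilon>"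
      by (rule Parseval_approx[OF e, of "blinfun_apply A x"]) blast
    then obtain F where F: "finite F" "F \<subseteq> onb"
      "(norm (blinfun_apply A x))\<^sup>2 \<le> (\<Sum>e\<in>F. (cmod (cinner e (blinfun_apply A x)))\<^sup>2) + \<epsilon>" by blast
    have "(\<Sum>e\<in>F. (cmod (cinner e (blinfun_apply A x)))\<^sup>2) \<le> (\<Sum>e\<in>F. (norm (blinfun_apply (cadj A) e))\<^sup>2 * (norm x)\<^sup>2)"
    proof (rule sum_mono)
      fix e
      have "cmod (cinner e (blinfun_apply A x)) \<le> norm (blinfun_apply (cadj A) e) * norm x"
        using cmod_cinner_le[of "blinfun_apply (cadj A) e" x] by (simp add: cinner_cadj'[OF cl])
      from power_mono[OF this, of 2]
      show "(cmod (cinner e (blinfun_apply A x)))\<^sup>2 \<le> (norm (blinfun_apply (cadj A) e))\<^sup>2 * (norm x)\<^sup>2"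
        by (simp add: power_mult_distrib)
    qed
    also have "\<dots> = (\<Sum>e\<in>F. (norm (blinfun_apply (cadj A) e))\<^sup>2) * (norm x)\<^sup>2" by (simp add: sum_distrib_right)
    also have "\<dots> \<le> (hs_norm A)\<^sup>2 * (norm x)\<^sup>2"
    proof (intro mult_right_mono order.trans[OF hs_sum_le[OF hilbert_schmidt_cadj[OF A] F(1,2)]])
      show "(hs_norm (cadj A))\<^sup>2 \<le> (hs_norm A)\<^sup>2" using hs_norm_cadj_le[OF A] by (intro power_mono) auto
    qed simp
    finally show "(norm (blinfun_apply A x))\<^sup>2 \<le> (hs_norm A * norm x)\<^sup>2 + \<epsilon>"
      using F(3) by (simp add: power_mult_distrib)
  qed
  then show "norm (blinfun_apply A x) \<le> hs_norm A * norm x" by (rule power2_le_imp_le) simp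
qed simp

lemma
  fixes A B :: "'a::complex_hilbert \<Rightarrow>\<^sub>L 'a"
  assumes A: "hilbert_schmidt A" and B: "hilbert_schmidt B"
  shows hilbert_schmidt_add: "hilbert_schmidt (A + B)" and hs_norm_triangle: "hs_norm (A + B) \<le> hs_norm A + hs_norm B"
proof -
  have *: "(\<Sum>e\<in>F. (norm (blinfun_apply (A + B) e))\<^sup>2) \<le> (hs_norm A + hs_norm B)\<^sup>2" if F: "finite F" "F \<subseteq> onb" for F
  proof -
    have "L2_set (\<lambda>e. norm (blinfun_apply (A + B) e)) F \<le> L2_set (\<lambda>e. norm (blinfun_apply A e) + norm (blinfun_apply B e)) F"
      by (intro L2_set_mono) (auto simp: blinfun.add_left norm_triangle_ineq)
    also have "\<dots> \<le> L2_set (\<lambda>e. norm (blinfun_apply A e)) F + L2_set (\<lambda>e. norm (blinfun_apply B e)) F"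
      by (rule L2_set_triangle_ineq)
    also have "\<dots> \<le> hs_norm A + hs_norm B"
      unfolding L2_set_def using hs_sum_le[OF A F] hs_sum_le[OF B F] by (intro add_mono real_le_lsqrt) auto
    finally have "(L2_set (\<lambda>e. norm (blinfun_apply (A + B) e)) F)\<^sup>2 \<le> (hs_norm A + hs_norm B)\<^sup>2"
      by (intro power_mono) auto
    then show ?thesis by (simp add: L2_set_def sum_nonneg)
  qed
  show "hilbert_schmidt (A + B)" "hs_norm (A + B) \<le> hs_norm A + hs_norm B"
    by (rule hilbert_schmidtI[OF _ _ *] hs_norm_le[OF _ _ *]; use assms in \<open>auto simp: hilbert_schmidt_clinear\<close>)+
qed

lemma
  fixes A B :: "'a::complex_hilbert \<Rightarrow>\<^sub>L 'a"
  assumes A: "hilbert_schmidt A" and B: "clinear_op B"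
  shows hilbert_schmidt_comp_left: "hilbert_schmidt (B o\<^sub>L A)"
    and hs_norm_comp_left: "hs_norm (B o\<^sub>L A) \<le> norm B * hs_norm A"
proof -
  have *: "(\<Sum>e\<in>F. (norm (blinfun_apply (B o\<^sub>L A) e))\<^sup>2) \<le> (norm B * hs_norm A)\<^sup>2" if F: "finite F" "F \<subseteq> onb" for F
  proof -
    have "(\<Sum>e\<in>F. (norm (blinfun_apply (B o\<^sub>L A) e))\<^sup>2) \<le> (\<Sum>e\<in>F. (norm B)\<^sup>2 * (norm (blinfun_apply A e))\<^sup>2)"
      by (intro sum_mono) (simp add: norm_blinfun flip: power_mult_distrib)
    also have "\<dots> \<le> (norm B)\<^sup>2 * (hs_norm A)\<^sup>2"
      unfolding sum_distrib_left[symmetric] by (intro mult_left_mono hs_sum_le[OF A F]) simp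
    finally show ?thesis by (simp add: power_mult_distrib)
  qed
  show "hilbert_schmidt (B o\<^sub>L A)" "hs_norm (B o\<^sub>L A) \<le> norm B * hs_norm A"
    by (rule hilbert_schmidtI[OF _ _ *] hs_norm_le[OF _ _ *]; use assms in \<open>auto simp: hilbert_schmidt_clinear\<close>)+
qed

lemma
  fixes A B :: "'a::complex_hilbert \<Rightarrow>\<^sub>L 'a"
  assumes A: "hilbert_schmidt A" and B: "clinear_op B"
  shows hilbert_schmidt_comp_right: "hilbert_schmidt (A o\<^sub>L B)"
    and hs_norm_comp_right: "hs_norm (A o\<^sub>L B) \<le> hs_norm A * norm B"
proof -
  have cA: "clinear_op A" by (rule hilbert_schmidt_clinear[OF A])
  \<comment> \<open>Composition on the right is composition on the left for the adjoints.\<close>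
  let ?T = "cadj B o\<^sub>L cadj A"
  have T: "hilbert_schmidt ?T" by (intro hilbert_schmidt_comp_left hilbert_schmidt_cadj A clinear_cadj B)
  have eq: "cadj ?T = A o\<^sub>L B" using cA B by (simp add: cadj_comp)
  show "hilbert_schmidt (A o\<^sub>L B)" using hilbert_schmidt_cadj[OF T] eq by simp
  have "hs_norm (A o\<^sub>L B) \<le> hs_norm ?T" using hs_norm_cadj_le[OF T] eq by simp
  also have "\<dots> \<le> norm (cadj B) * hs_norm (cadj A)"
    by (intro hs_norm_comp_left hilbert_schmidt_cadj A clinear_cadj B)
  also have "\<dots> \<le> norm B * hs_norm A"
    by (intro mult_mono norm_cadj_le B hs_norm_cadj_le A) auto
  finally show "hs_norm (A o\<^sub>L B) \<le> hs_norm A * norm B" by (simp add: mult.commute)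
qed

lemma hilbert_schmidt_zero [simp]: "hilbert_schmidt (0 :: 'a::complex_hilbert \<Rightarrow>\<^sub>L 'a)"
  by (rule hilbert_schmidtI[of _ 0]) auto

lemma hilbert_schmidt_scaleR:
  fixes A :: "'a::complex_hilbert \<Rightarrow>\<^sub>L 'a"
  shows "hilbert_schmidt A \<Longrightarrow> hilbert_schmidt (r *\<^sub>R A)"
proof -
  have "(r *\<^sub>R id_blinfun) o\<^sub>L A = r *\<^sub>R A" by (rule blinfun_eqI) (simp add: blinfun.bilinear_simps)
  then show "hilbert_schmidt A \<Longrightarrow> hilbert_schmidt (r *\<^sub>R A)"
    using hilbert_schmidt_comp_left[of A "r *\<^sub>R id_blinfun"] by simp
qed

lemma hs_norm_scaleR: "hs_norm (r *\<^sub>R A) = \<bar>r\<bar> * hs_norm A"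
proof (cases "r = 0")
  case False
  then show ?thesis
    by (simp add: hs_norm_def blinfun.scaleR_left power_mult_distrib infsum_cmult_right' real_sqrt_mult)
qed (simp add: hs_norm_def)

lemma hilbert_schmidt_diff:
  fixes A B :: "'a::complex_hilbert \<Rightarrow>\<^sub>L 'a"
  shows "hilbert_schmidt A \<Longrightarrow> hilbert_schmidt B \<Longrightarrow> hilbert_schmidt (A - B)"
  using hilbert_schmidt_add[of A "- 1 *\<^sub>R B"] hilbert_schmidt_scaleR[of B "- 1"] by simp

instance complex_hilbert \<subseteq> banach ..

text \<open>The limit is found in the operator norm, which \<open>hs_norm\<close> dominates. Finite
  partial sums of \<open>hs_norm\<close> pass to this limit, so the Cauchy estimate survives and
  gives convergence in the Hilbert-Schmidt norm.\<close>

lemma hs_complete: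
  fixes \<sigma> :: "nat \<Rightarrow> 'a::complex_hilbert \<Rightarrow>\<^sub>L 'a"
  assumes hs: "\<And>n. hilbert_schmidt (\<sigma> n)"
    and cauchy: "\<And>\<epsilon>. \<epsilon> > 0 \<Longrightarrow> \<exists>N. \<forall>m n. N \<le> m \<longrightarrow> N \<le> n \<longrightarrow> hs_norm (\<sigma> m - \<sigma> n) < \<epsilon>"
  obtains A where "hilbert_schmidt A" "\<sigma> \<longlonglongrightarrow> A" "\<And>\<epsilon>. \<epsilon> > 0 \<Longrightarrow> \<exists>N. \<forall>n\<ge>N. hs_norm (\<sigma> n - A) < \<epsilon>"
proof -
  have "Cauchy \<sigma>"
  proof (rule CauchyI)
    fix e :: real assume "e > 0"
    from cauchy[OF this] obtain N where N: "\<forall>m n. N \<le> m \<longrightarrow> N \<le> n \<longrightarrow> hs_norm (\<sigma> m - \<sigma> n) < e" by blast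
    then have "\<forall>m\<ge>N. \<forall>n\<ge>N. norm (\<sigma> m - \<sigma> n) < e"
      using norm_le_hs_norm[OF hilbert_schmidt_diff[OF hs hs]] by (meson le_less_trans)
    then show "\<exists>M. \<forall>m\<ge>M. \<forall>n\<ge>M. norm (\<sigma> m - \<sigma> n) < e" by blast
  qed
  then obtain A where A: "\<sigma> \<longlonglongrightarrow> A" by (meson Cauchy_convergent convergent_def)
  have cA: "clinear_op A" by (rule clinear_limit[OF A]) (rule hilbert_schmidt_clinear[OF hs])
  have *: "hilbert_schmidt (\<sigma> n - A) \<and> hs_norm (\<sigma> n - A) \<le> \<epsilon>"
    if e: "\<epsilon> > 0" and N: "\<forall>m n. N \<le> m \<longrightarrow> N \<le> n \<longrightarrow> hs_norm (\<sigma> m - \<sigma> n) < \<epsilon>" and n: "n \<ge> N" for \<epsilon> n N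
  proof -
    have "(\<Sum>e\<in>F. (norm (blinfun_apply (\<sigma> n - A) e))\<^sup>2) \<le> \<epsilon>\<^sup>2" if F: "finite F" "F \<subseteq> onb" for F
    proof (rule LIMSEQ_le_const2)
      show "(\<lambda>m. \<Sum>e\<in>F. (norm (blinfun_apply (\<sigma> n - \<sigma> m) e))\<^sup>2) \<longlonglongrightarrow> (\<Sum>e\<in>F. (norm (blinfun_apply (\<sigma> n - A) e))\<^sup>2)"
        by (intro tendsto_intros A)
      have "(\<Sum>e\<in>F. (norm (blinfun_apply (\<sigma> n - \<sigma> m) e))\<^sup>2) \<le> \<epsilon>\<^sup>2" if "m \<ge> N" for m
      proof -
        have "hs_norm (\<sigma> n - \<sigma> m) < \<epsilon>" using N n that by blast
        then have "(hs_norm (\<sigma> n - \<sigma> m))\<^sup>2 \<le> \<epsilon>\<^sup>2" by (intro power_mono) auto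
        then show ?thesis using hs_sum_le[OF hilbert_schmidt_diff[OF hs hs] F] by (rule order.trans[rotated])
      qed
      then show "\<exists>N. \<forall>m\<ge>N. (\<Sum>e\<in>F. (norm (blinfun_apply (\<sigma> n - \<sigma> m) e))\<^sup>2) \<le> \<epsilon>\<^sup>2" by blast
    qed
    moreover have "clinear_op (\<sigma> n - A)" using cA hilbert_schmidt_clinear[OF hs] by simp
    ultimately show ?thesis using e by (intro conjI hilbert_schmidtI[of _ \<epsilon>] hs_norm_le) auto
  qed
  obtain N where N: "\<forall>m n. N \<le> m \<longrightarrow> N \<le> n \<longrightarrow> hs_norm (\<sigma> m - \<sigma> n) < 1" using cauchy[of 1] by auto
  have "hilbert_schmidt (\<sigma> N - A)" using *[OF zero_less_one N] by blast
  from hilbert_schmidt_diff[OF hs[of N] this] have "hilbert_schmidt A" by simp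
  moreover have "\<exists>N. \<forall>n\<ge>N. hs_norm (\<sigma> n - A) < \<epsilon>" if e: "\<epsilon> > 0" for \<epsilon>
  proof -
    have "\<epsilon> / 2 > 0" using e by simp
    from cauchy[OF this] obtain N where N: "\<forall>m n. N \<le> m \<longrightarrow> N \<le> n \<longrightarrow> hs_norm (\<sigma> m - \<sigma> n) < \<epsilon> / 2" by blast
    have "hs_norm (\<sigma> n - A) < \<epsilon>" if "n \<ge> N" for n
      using *[OF \<open>\<epsilon> / 2 > 0\<close> N that] e by linarith
    then show ?thesis by blast
  qed
  ultimately show ?thesis using A that by blast
qed

section \<open>Spaces of operators\<close>

text \<open>Not a model space but the common target: sections, unitaries of \<open>Hp\<close> and
  partial isometries all become smooth maps into it.\<close>

definition op_space :: "('a::complex_hilbert \<Rightarrow>\<^sub>L 'a) nspace"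
  where "op_space = NSpace {A. clinear_op A} norm"

definition hs_space :: "('a::complex_hilbert \<Rightarrow>\<^sub>L 'a) nspace"
  where "hs_space = NSpace {A. hilbert_schmidt A} hs_norm"

lemma op_space_simps [simp]: "vecs op_space = {A. clinear_op A}" "nrm op_space = norm"
  by (simp_all add: op_space_def)

lemma hs_space_simps [simp]: "vecs hs_space = {A. hilbert_schmidt A}" "nrm hs_space = hs_norm"
  by (simp_all add: hs_space_def)

lemma L2_perp_simps: "vecs (L2_perp W) = {A. hilbert_schmidt A \<and> proj (ocomp W) o\<^sub>L A o\<^sub>L proj W = A}"
  "nrm (L2_perp W) = hs_norm"
  by (simp_all add: L2_perp_def)

lemma lie_u_plus_simps:
  "vecs (lie_u_plus Hp) = {x. clinear_op x \<and> cadj x = - x \<and> proj Hp o\<^sub>L x o\<^sub>L proj Hp = x}"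
  "nrm (lie_u_plus Hp) = norm"
  by (simp_all add: lie_u_plus_def)

lemma lie_u_res_simps:
  "vecs (lie_u_res Hp) = {x. clinear_op x \<and> cadj x = - x \<and> hilbert_schmidt (commutator x (proj Hp))}"
  "nrm (lie_u_res Hp) = (\<lambda>x. norm x + hs_norm (commutator x (proj Hp)))"
  by (simp_all add: lie_u_res_def)

lemma blinfun_compose_simps:
  "(A + B) o\<^sub>L C = (A o\<^sub>L C) + (B o\<^sub>L C)" "C o\<^sub>L (A + B) = (C o\<^sub>L A) + (C o\<^sub>L B)"
  "(A - B) o\<^sub>L C = (A o\<^sub>L C) - (B o\<^sub>L C)" "C o\<^sub>L (A - B) = (C o\<^sub>L A) - (C o\<^sub>L B)"
  "(r *\<^sub>R A) o\<^sub>L C = r *\<^sub>R (A o\<^sub>L C)" "C o\<^sub>L (r *\<^sub>R A) = r *\<^sub>R (C o\<^sub>L A)"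
  "(- A) o\<^sub>L C = - (A o\<^sub>L C)" "C o\<^sub>L (- A) = - (C o\<^sub>L A)" "0 o\<^sub>L C = 0" "C o\<^sub>L 0 = 0"
  by (rule blinfun_eqI; simp add: blinfun.bilinear_simps)+

lemma blinfun_compose_assoc: "(A o\<^sub>L B) o\<^sub>L C = A o\<^sub>L (B o\<^sub>L C)"
  by (rule blinfun_eqI) simp

lemma comp_id_blinfun [simp]: "A o\<^sub>L id_blinfun = A" "id_blinfun o\<^sub>L A = A"
  by (rule blinfun_eqI; simp)+

lemma normed_op_space: "normed_nspace op_space"
  by unfold_locales (auto simp: subspace_def norm_triangle_ineq)

lemma openin_op_space:
  assumes S: "open S"
  shows "openin (ntop op_space) (S \<inter> {T. clinear_op T})"
proof -
  interpret O: normed_nspace op_space by (rule normed_op_space)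
  show ?thesis unfolding O.openin_ntop
  proof (intro conjI ballI)
    fix T assume T: "T \<in> S \<inter> {T. clinear_op T}"
    then obtain d where d: "d > 0" "\<And>y. dist y T < d \<Longrightarrow> y \<in> S" using S unfolding open_dist by blast
    then show "\<exists>d>0. \<forall>h\<in>vecs op_space. nrm op_space h < d \<longrightarrow> T + h \<in> S \<inter> {T. clinear_op T}"
      using T by (intro exI[of _ d]) (auto simp: dist_norm)
  qed auto
qed

lemma normed_hs_space: "normed_nspace hs_space"
proof
  fix x :: "'a \<Rightarrow>\<^sub>L 'a" assume "x \<in> vecs hs_space" "nrm hs_space x = 0"
  then show "x = 0" using norm_le_hs_norm[of x] by simp
qed (auto simp: subspace_def hilbert_schmidt_add hilbert_schmidt_scaleR hs_norm_scaleR hs_norm_triangle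
    dest!: norm_le_hs_norm)

lemma normed_nspace_subset:
  assumes "normed_nspace E" "subspace (vecs F)" "vecs F \<subseteq> vecs E" "nrm F = nrm E"
  shows "normed_nspace F"
proof -
  interpret E: normed_nspace E by fact
  show ?thesis
    by unfold_locales (use assms(2-) in \<open>auto simp: E.nrm_eq_0 E.nrm_scaleR E.nrm_triangle subset_iff\<close>)
qed

lemma normed_L2_perp: "normed_nspace (L2_perp W)"
  by (rule normed_nspace_subset[OF normed_hs_space])
    (auto simp: L2_perp_simps subspace_def hilbert_schmidt_add hilbert_schmidt_scaleR blinfun_compose_simps)

lemma normed_lie_u_plus: "normed_nspace (lie_u_plus Hp)"
  by (rule normed_nspace_subset[OF normed_op_space])
    (auto simp: lie_u_plus_simps subspace_def blinfun_compose_simps cadj_add cadj_scaleR cadj_eqI[of 0 0])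

lemma commutator_simps:
  "commutator (x + y) p = commutator x p + commutator y p" "commutator (r *\<^sub>R x) p = r *\<^sub>R commutator x p"
  "commutator (- x) p = - commutator x p" "commutator 0 p = 0"
  by (simp_all add: commutator_def blinfun_compose_simps scaleR_diff_right)

lemma normed_lie_u_res: "normed_nspace (lie_u_res Hp)"
proof
  show "subspace (vecs (lie_u_res Hp))"
    by (auto simp: lie_u_res_simps subspace_def commutator_simps hilbert_schmidt_add hilbert_schmidt_scaleR
      cadj_add cadj_scaleR cadj_eqI[of 0 0])
next
  fix x y assume "x \<in> vecs (lie_u_res Hp)" "y \<in> vecs (lie_u_res Hp)"
  then show "nrm (lie_u_res Hp) (x + y) \<le> nrm (lie_u_res Hp) x + nrm (lie_u_res Hp) y"
    using norm_triangle_ineq[of x y] hs_norm_triangle[of "commutator x (proj Hp)" "commutator y (proj Hp)"]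
    by (auto simp: lie_u_res_simps commutator_simps)
next
  fix x assume "nrm (lie_u_res Hp) x = 0"
  then have "norm x = 0"
    using hs_norm_nonneg[of "commutator x (proj Hp)"] norm_ge_zero[of x]
    by (simp add: lie_u_res_simps add_nonneg_eq_0_iff)
  then show "x = 0" by simp
qed (auto simp: lie_u_res_simps commutator_simps hs_norm_scaleR distrib_left)

text \<open>Hilbert-Schmidt convergence implies operator-norm convergence, under which the corner
  condition on the operators is preserved.\<close>

lemma complete_L2_perp: "Metric_space.mcomplete (vecs (L2_perp W)) (ndist (L2_perp W))"
proof -
  interpret E: normed_nspace "L2_perp W" by (rule normed_L2_perp)
  show ?thesis unfolding E.mcomplete_iff
  proof (intro allI impI, elim conjE)
    fix \<sigma> :: "nat \<Rightarrow> 'a \<Rightarrow>\<^sub>L 'a"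
    assume r: "range \<sigma> \<subseteq> vecs (L2_perp W)"
      and c: "\<forall>\<epsilon>>0. \<exists>N. \<forall>m n. N \<le> m \<longrightarrow> N \<le> n \<longrightarrow> nrm (L2_perp W) (\<sigma> m - \<sigma> n) < \<epsilon>"
    have hs: "hilbert_schmidt (\<sigma> n)" and pp: "proj (ocomp W) o\<^sub>L \<sigma> n o\<^sub>L proj W = \<sigma> n" for n
      using r by (auto simp: L2_perp_simps)
    have c': "\<exists>N. \<forall>m n. N \<le> m \<longrightarrow> N \<le> n \<longrightarrow> hs_norm (\<sigma> m - \<sigma> n) < \<epsilon>" if "\<epsilon> > 0" for \<epsilon>
      using c that by (simp add: L2_perp_simps)
    have "\<exists>A. hilbert_schmidt A \<and> \<sigma> \<longlonglongrightarrow> A \<and> (\<forall>\<epsilon>>0. \<exists>N. \<forall>n\<ge>N. hs_norm (\<sigma> n - A) < \<epsilon>)"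
      by (rule hs_complete[OF hs c']) blast+
    then obtain A where A: "hilbert_schmidt A" "\<sigma> \<longlonglongrightarrow> A" "\<forall>\<epsilon>>0. \<exists>N. \<forall>n\<ge>N. hs_norm (\<sigma> n - A) < \<epsilon>" by blast
    have "(\<lambda>n. proj (ocomp W) o\<^sub>L \<sigma> n o\<^sub>L proj W) \<longlonglongrightarrow> (proj (ocomp W) o\<^sub>L A o\<^sub>L proj W)"
      by (intro bounded_bilinear.tendsto[OF bounded_bilinear_blinfun_compose] tendsto_const A(2))
    then have "proj (ocomp W) o\<^sub>L A o\<^sub>L proj W = A" unfolding pp using A(2) LIMSEQ_unique by blast
    then show "\<exists>l\<in>vecs (L2_perp W). \<forall>\<epsilon>>0. \<exists>N. \<forall>n\<ge>N. nrm (L2_perp W) (\<sigma> n - l) < \<epsilon>"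
      using A(1,3) by (intro bexI[of _ A]) (auto simp: L2_perp_simps)
  qed
qed

lemma norm_cadj: "clinear_op A \<Longrightarrow> norm (cadj A) = norm A"
  for A :: "'a::complex_hilbert \<Rightarrow>\<^sub>L 'a"
  using norm_cadj_le[of A] norm_cadj_le[of "cadj A"] by simp

lemma tendsto_cadj:
  fixes A :: "'a::complex_hilbert \<Rightarrow>\<^sub>L 'a"
  assumes "\<sigma> \<longlonglongrightarrow> A" "\<And>n. clinear_op (\<sigma> n)"
  shows "(\<lambda>n. cadj (\<sigma> n)) \<longlonglongrightarrow> cadj A"
proof -
  have A: "clinear_op A" by (rule clinear_limit[OF assms])
  have "norm (cadj (\<sigma> n) - cadj A) = norm (\<sigma> n - A)" for n
    using A assms(2)[of n] by (simp add: norm_cadj flip: cadj_diff)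
  then show ?thesis using assms(1) unfolding LIMSEQ_iff by simp
qed

lemma complete_lie_u_plus: "Metric_space.mcomplete (vecs (lie_u_plus Hp)) (ndist (lie_u_plus Hp))"
proof -
  interpret E: normed_nspace "lie_u_plus Hp" by (rule normed_lie_u_plus)
  show ?thesis unfolding E.mcomplete_iff
  proof (intro allI impI, elim conjE)
    fix \<sigma> :: "nat \<Rightarrow> 'a \<Rightarrow>\<^sub>L 'a"
    assume r: "range \<sigma> \<subseteq> vecs (lie_u_plus Hp)"
      and c: "\<forall>\<epsilon>>0. \<exists>N. \<forall>m n. N \<le> m \<longrightarrow> N \<le> n \<longrightarrow> nrm (lie_u_plus Hp) (\<sigma> m - \<sigma> n) < \<epsilon>"
    have cl: "clinear_op (\<sigma> n)" and ad: "cadj (\<sigma> n) = - \<sigma> n" and pp: "proj Hp o\<^sub>L \<sigma> n o\<^sub>L proj Hp = \<sigma> n" for n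
      using r by (auto simp: lie_u_plus_simps)
    have "Cauchy \<sigma>" unfolding Cauchy_iff using c by (auto simp: lie_u_plus_simps)
    then obtain A where A: "\<sigma> \<longlonglongrightarrow> A" by (meson Cauchy_convergent convergent_def)
    have "(\<lambda>n. proj Hp o\<^sub>L \<sigma> n o\<^sub>L proj Hp) \<longlonglongrightarrow> (proj Hp o\<^sub>L A o\<^sub>L proj Hp)"
      by (intro bounded_bilinear.tendsto[OF bounded_bilinear_blinfun_compose] tendsto_const A)
    then have "proj Hp o\<^sub>L A o\<^sub>L proj Hp = A" unfolding pp using A LIMSEQ_unique by blast
    moreover have "cadj A = - A"
      using tendsto_cadj[OF A cl] tendsto_minus[OF A] unfolding ad by (rule LIMSEQ_unique)
    moreover have "clinear_op A" by (rule clinear_limit[OF A cl])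
    ultimately show "\<exists>l\<in>vecs (lie_u_plus Hp). \<forall>\<epsilon>>0. \<exists>N. \<forall>n\<ge>N. nrm (lie_u_plus Hp) (\<sigma> n - l) < \<epsilon>"
      using A by (intro bexI[of _ A]) (auto simp: lie_u_plus_simps LIMSEQ_iff)
  qed
qed

section \<open>Bounded linear and bilinear maps between operator spaces, and inversion\<close>

lemma bounded_linear_betweenI:
  assumes "\<And>x. x \<in> vecs E \<Longrightarrow> l x \<in> vecs F"
    and "\<And>x y. x \<in> vecs E \<Longrightarrow> y \<in> vecs E \<Longrightarrow> l (x + y) = l x + l y"
    and "\<And>x r. x \<in> vecs E \<Longrightarrow> l (r *\<^sub>R x) = r *\<^sub>R l x"
    and "\<And>x. x \<in> vecs E \<Longrightarrow> nrm F (l x) \<le> C * nrm E x" and "0 \<le> C" and "normed_nspace E"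
  shows "bounded_linear_between E F l"
  using assms unfolding bounded_linear_between_def linear_between_def
  by (auto simp: normed_nspace.scale_mem)

lemma bounded_bilinear_comp: "bounded_bilinear_between op_space op_space op_space (o\<^sub>L)"
  unfolding bounded_bilinear_between_def linear_between_def
  by (auto simp: blinfun_compose_simps norm_blinfun_compose intro!: exI[of _ 1])

text \<open>The sign is included because the derivative of an inverse has the form of a negated
  product.\<close>

lemma bounded_bilinear_neg_comp: "bounded_bilinear_between op_space op_space op_space (\<lambda>A B. - (A o\<^sub>L B))"
  unfolding bounded_bilinear_between_def linear_between_def
  by (auto simp: blinfun_compose_simps norm_blinfun_compose intro!: exI[of _ 1])

text \<open>The ideal property with its norm estimate: one factor smooth in the Hilbert-Schmidt norm
  and one smooth in the operator norm give a product smooth in the Hilbert-Schmidt norm.\<close>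

lemma bounded_bilinear_hs_comp: "bounded_bilinear_between hs_space op_space hs_space (o\<^sub>L)"
  unfolding bounded_bilinear_between_def linear_between_def
  by (auto simp: blinfun_compose_simps hilbert_schmidt_comp_right hs_norm_comp_right intro!: exI[of _ 1])

lemma bounded_linear_cadj: "bounded_linear_between op_space op_space cadj"
  by (rule bounded_linear_betweenI[where C = 1]) (auto simp: cadj_add cadj_scaleR norm_cadj_le normed_op_space)

lemma bounded_linear_L2_perp_op: "bounded_linear_between (L2_perp W) op_space (\<lambda>A. A)"
  by (rule bounded_linear_betweenI[where C = 1])
    (auto simp: L2_perp_simps hilbert_schmidt_clinear norm_le_hs_norm normed_L2_perp)

lemma bounded_linear_L2_perp_hs:
  assumes "clinear_op B"
  shows "bounded_linear_between (L2_perp W) hs_space (\<lambda>A. B o\<^sub>L A)"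
  by (rule bounded_linear_betweenI[where C = "norm B"])
    (use assms in \<open>auto simp: L2_perp_simps hilbert_schmidt_comp_left hs_norm_comp_left normed_L2_perp blinfun_compose_simps\<close>)

lemma bounded_linear_lie_u_plus_op: "bounded_linear_between (lie_u_plus Hp) op_space (\<lambda>A. A)"
  by (rule bounded_linear_betweenI[where C = 1]) (auto simp: lie_u_plus_simps normed_lie_u_plus)

lemma bounded_linear_lie_u_res_op: "bounded_linear_between (lie_u_res Hp) op_space (\<lambda>A. A)"
  by (rule bounded_linear_betweenI[where C = 1]) (auto simp: lie_u_res_simps normed_lie_u_res)

lemma norm_proj_le:
  fixes W :: "'a::complex_hilbert set"
  assumes W: "closed_csubspace W"
  shows "norm (proj W) \<le> 1"
proof (rule norm_blinfun_bound)
  fix x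
  have "inner (blinfun_apply (proj W) x) (x - blinfun_apply (proj W) x) = 0"
    using proj_perp[OF W, of x] proj_mem[OF W, of x] by (simp add: ocomp_def inner_eq_Re_cinner)
  then have "(norm x)\<^sup>2 = (norm (blinfun_apply (proj W) x))\<^sup>2 + (norm (x - blinfun_apply (proj W) x))\<^sup>2"
    by (simp add: power2_norm_eq_inner inner_diff inner_commute algebra_simps)
  then have "(norm (blinfun_apply (proj W) x))\<^sup>2 \<le> (norm x)\<^sup>2" by simp
  then have "norm (blinfun_apply (proj W) x) \<le> norm x" by (rule power2_le_imp_le) simp
  then show "norm (blinfun_apply (proj W) x) \<le> 1 * norm x" by simp
qed simp

text \<open>A bounded retraction of \<open>hs_space\<close> onto the subspace
  \<open>L2_perp W\<close>. It upgrades a smooth map into \<open>hs_space\<close> with values in the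
  subspace to a smooth map into \<open>L2_perp W\<close>.\<close>

lemma bounded_linear_hs_L2_perp:
  assumes W: "closed_csubspace W"
  shows "bounded_linear_between hs_space (L2_perp W) (\<lambda>A. proj (ocomp W) o\<^sub>L A o\<^sub>L proj W)"
proof (rule bounded_linear_betweenI)
  note oW = closed_csubspace_ocomp[of W]
  note c = clinear_proj[OF W] clinear_proj[OF oW]
  fix A :: "'a \<Rightarrow>\<^sub>L 'a" assume "A \<in> vecs hs_space"
  then have A: "hilbert_schmidt A" by simp
  note hs = hilbert_schmidt_comp_left[OF A c(2)]
  have "proj (ocomp W) o\<^sub>L (proj (ocomp W) o\<^sub>L A o\<^sub>L proj W) o\<^sub>L proj W =
    (proj (ocomp W) o\<^sub>L proj (ocomp W)) o\<^sub>L A o\<^sub>L (proj W o\<^sub>L proj W)"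
    by (simp only: blinfun_compose_assoc)
  then show "proj (ocomp W) o\<^sub>L A o\<^sub>L proj W \<in> vecs (L2_perp W)"
    using hilbert_schmidt_comp_right[OF hs c(1)] by (simp add: L2_perp_simps proj_idem[OF W] proj_idem[OF oW])
  have "hs_norm (proj (ocomp W) o\<^sub>L A o\<^sub>L proj W) \<le> hs_norm (proj (ocomp W) o\<^sub>L A) * norm (proj W)"
    by (rule hs_norm_comp_right[OF hs c(1)])
  also have "\<dots> \<le> (norm (proj (ocomp W)) * hs_norm A) * norm (proj W)"
    by (intro mult_right_mono hs_norm_comp_left[OF A c(2)]) simp
  finally show "nrm (L2_perp W) (proj (ocomp W) o\<^sub>L A o\<^sub>L proj W) \<le> (norm (proj (ocomp W)) * norm (proj W)) * nrm hs_space A"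
    by (simp add: L2_perp_simps mult_ac)
qed (simp_all add: blinfun_compose_simps normed_hs_space)

text \<open>Compression followed by taking the skew-adjoint part: a bounded retraction of
  \<open>op_space\<close> onto \<open>lie_u_plus Hp\<close>, with the same purpose.\<close>

lemma bounded_linear_op_lie_u_plus:
  assumes H: "closed_csubspace Hp"
  shows "bounded_linear_between op_space (lie_u_plus Hp)
    (\<lambda>x. (1 / 2) *\<^sub>R (proj Hp o\<^sub>L (x - cadj x) o\<^sub>L proj Hp))"
proof (rule bounded_linear_betweenI)
  note c = clinear_proj[OF H]
  fix x :: "'a \<Rightarrow>\<^sub>L 'a" assume "x \<in> vecs op_space"
  then have x: "clinear_op x" by simp
  let ?y = "proj Hp o\<^sub>L (x - cadj x) o\<^sub>L proj Hp"
  have "proj Hp o\<^sub>L ?y o\<^sub>L proj Hp = (proj Hp o\<^sub>L proj Hp) o\<^sub>L (x - cadj x) o\<^sub>L (proj Hp o\<^sub>L proj Hp)"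
    by (simp only: blinfun_compose_assoc)
  then have p: "proj Hp o\<^sub>L ?y o\<^sub>L proj Hp = ?y" by (simp add: proj_idem[OF H])
  have y: "clinear_op ?y" using x c by simp
  have "cadj ?y = proj Hp o\<^sub>L (cadj x - x) o\<^sub>L proj Hp"
    using x c by (simp add: cadj_comp cadj_diff cadj_proj[OF H] blinfun_compose_assoc)
  also have "\<dots> = - ?y" by (simp add: blinfun_compose_simps)
  finally have "cadj ((1 / 2) *\<^sub>R ?y) = - ((1 / 2) *\<^sub>R ?y)"
    by (simp only: cadj_scaleR[OF y] scaleR_minus_right)
  moreover have "proj Hp o\<^sub>L ((1 / 2) *\<^sub>R ?y) o\<^sub>L proj Hp = (1 / 2) *\<^sub>R ?y"
    by (simp only: blinfun_compose_simps(5,6) p)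
  ultimately show "(1 / 2) *\<^sub>R ?y \<in> vecs (lie_u_plus Hp)"
    unfolding lie_u_plus_simps using clinear_op_scaleR[OF y] by blast
  have "norm ?y \<le> norm (proj Hp o\<^sub>L (x - cadj x)) * norm (proj Hp)" by (rule norm_blinfun_compose)
  also have "\<dots> \<le> (norm (proj Hp) * norm (x - cadj x)) * norm (proj Hp)"
    by (intro mult_right_mono norm_blinfun_compose) simp
  also have "\<dots> \<le> (1 * (norm x + norm x)) * 1"
    using norm_proj_le[OF H] norm_triangle_ineq4[of x "cadj x"] norm_cadj_le[OF x]
    by (intro mult_mono) auto
  finally show "nrm (lie_u_plus Hp) ((1 / 2) *\<^sub>R ?y) \<le> 1 * nrm op_space x"
    by (simp add: lie_u_plus_simps)
qed (auto simp: blinfun_compose_simps normed_op_space cadj_add cadj_scaleR scaleR_add_right algebra_simps)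

text \<open>Differentiating \<open>a r = e'\<close> gives \<open>r' = - r a' r\<close>, so each further derivative of \<open>a\<close> yields one
  of \<open>r\<close>.\<close>

lemma equi_C_inverse:
  fixes a r :: "'v::real_vector \<Rightarrow> ('a::complex_hilbert \<Rightarrow>\<^sub>L 'a)"
  assumes nE: "normed_nspace E" and a: "equi_C (Suc n) E op_space N {a}"
    and inv: "\<And>x. x \<in> N \<Longrightarrow> clinear_op (r x) \<and> a x o\<^sub>L r x = e' \<and> r x o\<^sub>L a x = e \<and> r x o\<^sub>L e' = r x \<and> e o\<^sub>L r x = r x"
  shows "equi_C n E op_space N {r}"
  using a
proof (induction n)
  interpret E: normed_nspace E by fact
  note nO = normed_op_space
  \<comment> \<open>The resolvent identity: insert the products of \<open>r\<close> and
    \<open>a\<close> at \<open>y\<close> and at \<open>x\<close>, which act as units on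
    \<open>r\<close>.\<close>
  have diff: "r y - r x = - (r y o\<^sub>L (a y - a x) o\<^sub>L r x)" if "x \<in> N" "y \<in> N" for x y
  proof -
    have "r y o\<^sub>L (a y - a x) o\<^sub>L r x = ((r y o\<^sub>L a y) o\<^sub>L r x) - (r y o\<^sub>L (a x o\<^sub>L r x))"
      by (simp add: blinfun_compose_simps blinfun_compose_assoc)
    also have "\<dots> = r x - r y" using inv that by simp
    finally show ?thesis by simp
  qed
  have n3: "norm (A o\<^sub>L B o\<^sub>L C) \<le> norm A * norm B * norm C" for A B C :: "'a \<Rightarrow>\<^sub>L 'a"
    by (rule order.trans[OF norm_blinfun_compose]) (intro mult_right_mono norm_blinfun_compose norm_ge_zero)
  \<comment> \<open>Once the increment of \<open>a\<close> times \<open>norm (r x)\<close> is at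
    most 1/2, the resolvent identity bounds the increment of \<open>r\<close> by half of
    \<open>norm (r (x + h))\<close>, which can be absorbed on the left.\<close>
  have bd: "\<forall>\<^sub>F h in nsmall E. x + h \<in> N \<longrightarrow> norm (r (x + h)) \<le> 2 * norm (r x)"
    if a: "equi_C (Suc 0) E op_space N {a}" and x: "x \<in> N" for x
  proof -
    obtain P where P: "{a} = fst ` P" "unif_deriv E op_space N P" "equi_C 0 E op_space N (deriv_family E P)"
      using a by (rule equi_C_SucE)
    obtain a' where a': "(a, a') \<in> P" using P(1) by force
    obtain L where L: "L \<ge> 0" "\<forall>f f' h. (f, f') \<in> P \<longrightarrow> h \<in> vecs E \<longrightarrow> nrm op_space (f' x h) \<le> L * nrm E h"
        "\<forall>\<^sub>F h in nsmall E. x + h \<in> N \<longrightarrow> (\<forall>f f'. (f, f') \<in> P \<longrightarrow> nrm op_space (f (x + h) - f x) \<le> L * nrm E h)"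
      by (rule unif_deriv_lipschitz[OF nE nO P(2) equi_C_locally_bounded[OF P(3)] x
            equi_C_locally_bounded[OF a, unfolded P(1)]])
    have h0: "(1 / 2 :: real) > 0" by simp
    have "0 \<le> L * norm (r x)" using L(1) by simp
    from L(3) eventually_nsmall_mult_less[OF h0 this, of E] show ?thesis
    proof eventually_elim
      case (elim h)
      show ?case
      proof
        assume y: "x + h \<in> N"
        have "norm (a (x + h) - a x) \<le> L * nrm E h" using elim(1) y a' by fastforce
        then have "norm (a (x + h) - a x) * norm (r x) \<le> L * nrm E h * norm (r x)" by (intro mult_right_mono) auto
        also have "\<dots> \<le> 1 / 2" using elim(2) by (simp add: mult_ac)
        finally have 1: "norm (a (x + h) - a x) * norm (r x) \<le> 1 / 2" .
        have "norm (r (x + h) - r x) \<le> norm (r (x + h)) * (norm (a (x + h) - a x) * norm (r x))"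
          using n3[of "r (x + h)" "a (x + h) - a x" "r x"] unfolding diff[OF x y] by (simp add: mult_ac)
        also have "\<dots> \<le> norm (r (x + h)) * (1 / 2)" using 1 by (intro mult_left_mono) auto
        finally show "norm (r (x + h)) \<le> 2 * norm (r x)"
          using norm_triangle_ineq2[of "r (x + h)" "r x"] by linarith
      qed
    qed
  qed
  have lb: "locally_bounded E op_space N {r}" if "equi_C (Suc 0) E op_space N {a}"
    unfolding locally_bounded_def using inv bd[OF that] by fastforce
  { case 0 then show ?case using lb by simp }
  { case (Suc n)
    have a1: "equi_C (Suc 0) E op_space N {a}" by (rule equi_C_le[OF Suc.prems]) simp
    have rn: "equi_C n E op_space N {r}" by (rule Suc.IH[OF equi_C_SucD[OF Suc.prems]])
    obtain P where P: "{a} = fst ` P" "unif_deriv E op_space N P" "equi_C (Suc n) E op_space N (deriv_family E P)"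
      using Suc.prems by (rule equi_C_SucE)
    obtain a' where a': "(a, a') \<in> P" using P(1) by force
    define r' where "r' x h = - (r x o\<^sub>L (a' x h o\<^sub>L r x))" for x h
    let ?Q = "{(r, r')}"
    have al: "linear_between E op_space (a' x)" if "x \<in> N" for x
      using unif_derivD(1)[OF P(2) that a'] .
    have "unif_deriv E op_space N ?Q"
    proof (rule unif_derivI)
      fix x f f' assume x: "x \<in> N" and "(f, f') \<in> ?Q"
      then show "linear_between E op_space (f' x)"
        using linear_betweenD(1)[OF al[OF x]] linear_betweenD(2)[OF al[OF x]] inv[OF x]
        by (auto simp: linear_between_def r'_def blinfun_compose_simps)
    next
      fix x and \<epsilon> :: real assume x: "x \<in> N" and e: "\<epsilon> > 0"
      obtain L where L: "L \<ge> 0" "\<forall>f f' h. (f, f') \<in> P \<longrightarrow> h \<in> vecs E \<longrightarrow> nrm op_space (f' x h) \<le> L * nrm E h"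
          "\<forall>\<^sub>F h in nsmall E. x + h \<in> N \<longrightarrow> (\<forall>f f'. (f, f') \<in> P \<longrightarrow> nrm op_space (f (x + h) - f x) \<le> L * nrm E h)"
        by (rule unif_deriv_lipschitz[OF nE nO P(2) equi_C_locally_bounded[OF P(3)] x
              equi_C_locally_bounded[OF a1, unfolded P(1)]])
      define B where "B = 2 * norm (r x) + 1"
      have B: "B > 0" "norm (r x) \<le> B" "2 * norm (r x) \<le> B" by (auto simp: B_def add_nonneg_pos)
      define \<eta> where "\<eta> = \<epsilon> / 2 / (B * B)"
      have \<eta>: "\<eta> > 0" "B * \<eta> * B = \<epsilon> / 2" using e B by (auto simp: \<eta>_def)
      have e2: "\<epsilon> / 2 > 0" using e by simp
      have c: "0 \<le> B * L * B * L * B" using B L(1) by simp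
      from bd[OF a1 x] L(3) unif_derivD(2)[OF P(2) x \<eta>(1)] eventually_nsmall_mem
        eventually_nsmall_mult_less[OF e2 c, of E]
      show "\<forall>\<^sub>F h in nsmall E. x + h \<in> N \<longrightarrow>
          (\<forall>f f'. (f, f') \<in> ?Q \<longrightarrow> nrm op_space (f (x + h) - f x - f' x h) \<le> \<epsilon> * nrm E h)"
      proof eventually_elim
        case (elim h)
        let ?t = "nrm E h"
        { assume y: "x + h \<in> N"
          let ?R = "r (x + h)" and ?d = "a (x + h) - a x"
          have R: "norm ?R \<le> B" using elim(1) y B by linarith
          have d: "norm ?d \<le> L * ?t" using elim(2) y a' by fastforce
          have d1: "norm (?d - a' x h) \<le> \<eta> * ?t" using elim(3) y a' by fastforce
          have ah: "norm (a' x h) \<le> L * ?t" using L(2) a' elim(4) by fastforce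
          have dr: "norm (?R - r x) \<le> B * (L * ?t) * B"
          proof -
            have "norm (?R - r x) \<le> norm ?R * norm ?d * norm (r x)"
              using n3 unfolding diff[OF x y] by simp
            also have "\<dots> \<le> B * (L * ?t) * B"
              using R d B L(1) by (intro mult_mono mult_nonneg_nonneg) auto
            finally show ?thesis .
          qed
          \<comment> \<open>The first term is the remainder of \<open>a\<close> between two bounded
            inverses; the second moves the left inverse from \<open>x + h\<close> to
            \<open>x\<close> and is of second order.\<close>
          have eq: "?R - r x - r' x h = - (?R o\<^sub>L (?d - a' x h) o\<^sub>L r x) - ((?R - r x) o\<^sub>L a' x h o\<^sub>L r x)"
          proof -
            have "?R o\<^sub>L (?d - a' x h) o\<^sub>L r x = (?R o\<^sub>L ?d o\<^sub>L r x) - (?R o\<^sub>L a' x h o\<^sub>L r x)"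
              "(?R - r x) o\<^sub>L a' x h o\<^sub>L r x = (?R o\<^sub>L a' x h o\<^sub>L r x) - (r x o\<^sub>L a' x h o\<^sub>L r x)"
              by (simp_all only: blinfun_compose_simps)
            moreover have "r' x h = - (r x o\<^sub>L a' x h o\<^sub>L r x)" by (simp add: r'_def blinfun_compose_assoc)
            ultimately show ?thesis using diff[OF x y] by (simp only:) simp
          qed
          have "norm (?R - r x - r' x h) \<le> norm (?R o\<^sub>L (?d - a' x h) o\<^sub>L r x) + norm ((?R - r x) o\<^sub>L a' x h o\<^sub>L r x)"
            unfolding eq using norm_triangle_ineq4[of "- (?R o\<^sub>L (?d - a' x h) o\<^sub>L r x)"] by simp
          also have "\<dots> \<le> B * (\<eta> * ?t) * B + B * (L * ?t) * B * (L * ?t) * B"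
          proof (intro add_mono)
            have "norm (?R o\<^sub>L (?d - a' x h) o\<^sub>L r x) \<le> norm ?R * norm (?d - a' x h) * norm (r x)" by (rule n3)
            also have "\<dots> \<le> B * (\<eta> * ?t) * B"
              using R d1 B \<eta>(1) by (intro mult_mono mult_nonneg_nonneg) auto
            finally show "norm (?R o\<^sub>L (?d - a' x h) o\<^sub>L r x) \<le> B * (\<eta> * ?t) * B" .
            have "norm ((?R - r x) o\<^sub>L a' x h o\<^sub>L r x) \<le> norm (?R - r x) * norm (a' x h) * norm (r x)" by (rule n3)
            also have "\<dots> \<le> B * (L * ?t) * B * (L * ?t) * B"
              using dr ah B L(1) by (intro mult_mono mult_nonneg_nonneg) auto
            finally show "norm ((?R - r x) o\<^sub>L a' x h o\<^sub>L r x) \<le> B * (L * ?t) * B * (L * ?t) * B" .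
          qed
          also have "\<dots> = (B * \<eta> * B + B * L * B * L * B * ?t) * ?t" by (simp add: algebra_simps)
          also have "\<dots> \<le> \<epsilon> * ?t"
            using elim(5) \<eta>(2) by (intro mult_right_mono E.nrm_nonneg) linarith
          finally have "norm (?R - r x - r' x h) \<le> \<epsilon> * ?t" . }
        then show ?case by simp
      qed
    qed
    moreover have "equi_C n E op_space N (deriv_family E ?Q)"
    proof (rule equi_C_mono)
      show "equi_C n E op_space N (pointwise2 (\<lambda>A B. - (A o\<^sub>L B)) {r} (pointwise2 (o\<^sub>L) (deriv_family E P) {r}))"
        by (intro equi_C_bilinear[OF nE nO nO nO] bounded_bilinear_comp bounded_bilinear_neg_comp rn equi_C_SucD[OF P(3)])
      show "deriv_family E ?Q \<subseteq> pointwise2 (\<lambda>A B. - (A o\<^sub>L B)) {r} (pointwise2 (o\<^sub>L) (deriv_family E P) {r})"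
      proof
        fix k assume "k \<in> deriv_family E ?Q"
        then obtain h where h: "h \<in> vecs E" "nrm E h \<le> 1" and k: "k = (\<lambda>x. - (r x o\<^sub>L (a' x h o\<^sub>L r x)))"
          by (elim deriv_familyE) (auto simp: r'_def)
        show "k \<in> pointwise2 (\<lambda>A B. - (A o\<^sub>L B)) {r} (pointwise2 (o\<^sub>L) (deriv_family E P) {r})"
          unfolding k by (intro pointwise2I deriv_familyI[OF a' h] singletonI)
      qed
    qed simp
    ultimately show ?case using lb[OF a1] by (auto intro!: exI[of _ ?Q]) }
qed

text \<open>There are two units because graph coordinates require inversion between two different
  subspaces: \<open>a x\<close> goes from the range of \<open>e\<close> to that of
  \<open>e'\<close>, and \<open>r x\<close> goes back.\<close>

lemma smooth_at_inverse:
  fixes a r :: "'v::real_vector \<Rightarrow> ('a::complex_hilbert \<Rightarrow>\<^sub>L 'a)"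
  assumes nE: "normed_nspace E" and a: "smooth_at E op_space a x" and N: "openin (ntop E) N" "x \<in> N"
    and inv: "\<And>x. x \<in> N \<Longrightarrow> clinear_op (r x) \<and> a x o\<^sub>L r x = e' \<and> r x o\<^sub>L a x = e \<and> r x o\<^sub>L e' = r x \<and> e o\<^sub>L r x = r x"
  shows "smooth_at E op_space r x"
  unfolding smooth_at_def
proof
  fix n
  obtain M where M: "openin (ntop E) M" "x \<in> M" "equi_C (Suc n) E op_space M {a}" using smooth_atE[OF a] by blast
  have "equi_C n E op_space (M \<inter> N) {r}"
    by (rule equi_C_inverse[OF nE equi_C_mono[OF M(3)], of _ _ r e' e]) (use inv in auto)
  then show "\<exists>N. openin (ntop E) N \<and> x \<in> N \<and> equi_C n E op_space N {r}" using M(1,2) N by blast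
qed

lemma smooth_at_const_op:
  "normed_nspace E \<Longrightarrow> clinear_op C \<Longrightarrow> x \<in> vecs E \<Longrightarrow> smooth_at E op_space (\<lambda>_. C) x"
  by (rule smooth_at_const[OF _ normed_op_space]) auto

lemma smooth_at_comp:
  "normed_nspace E \<Longrightarrow> smooth_at E op_space f x \<Longrightarrow> smooth_at E op_space g x \<Longrightarrow>
    smooth_at E op_space (\<lambda>x. f x o\<^sub>L g x) x"
  by (rule smooth_at_bilinear[OF _ normed_op_space normed_op_space normed_op_space _ _ bounded_bilinear_comp])

lemma smooth_at_cadj:
  "normed_nspace E \<Longrightarrow> smooth_at E op_space f x \<Longrightarrow> smooth_at E op_space (\<lambda>x. cadj (f x)) x"
  by (rule smooth_at_linear[OF _ normed_op_space normed_op_space _ bounded_linear_cadj])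

lemma smooth_at_scaleR_op:
  assumes "normed_nspace E" "smooth_at E op_space f x"
  shows "smooth_at E op_space (\<lambda>x. c *\<^sub>R f x) x"
proof (rule smooth_at_linear[OF assms(1) normed_op_space normed_op_space assms(2)])
  show "bounded_linear_between op_space op_space (\<lambda>A. c *\<^sub>R A)"
    by (rule bounded_linear_betweenI[where C = "\<bar>c\<bar>"]) (auto simp: normed_op_space scaleR_add_right)
qed

lemma smooth_at_diff_op:
  assumes "normed_nspace E" "smooth_at E op_space f x" "smooth_at E op_space g x"
  shows "smooth_at E op_space (\<lambda>x. f x - g x) x"
  using smooth_at_add[OF assms(1) normed_op_space assms(2) smooth_at_scaleR_op[OF assms(1,3), of "- 1"]] by simp

section \<open>Graph coordinates of closed subspaces\<close>

text \<open>For \<open>V\<close> a graph over \<open>W\<close> this is the oblique projection onto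
  \<open>V\<close> along the orthogonal complement of \<open>W\<close>: it sends \<open>x\<close> to
  the point of \<open>V\<close> with the same projection to \<open>W\<close>.\<close>

definition graph_lift :: "'a::complex_hilbert set \<Rightarrow> 'a set \<Rightarrow> ('a \<Rightarrow>\<^sub>L 'a)"
  where "graph_lift W V = proj W + graph_coord W V"

context
  fixes W V :: "'a::complex_hilbert set"
  assumes W: "closed_csubspace W" and V: "closed_csubspace V" and inv: "invertible_between V W (proj W)"
begin

lemma graph_lift_apply:
  "blinfun_apply (graph_lift W V) x = inv_into V (blinfun_apply (proj W)) (blinfun_apply (proj W) x)"
proof -
  let ?p = "blinfun_apply (proj W)" and ?q = "blinfun_apply (proj (ocomp W))"
  let ?j = "inv_into V ?p"
  have bij: "bij_betw ?p V W" using inv by (simp add: invertible_between_def)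
  have j: "?j w \<in> V" "?p (?j w) = w" if "w \<in> W" for w
    using bij that by (auto simp: bij_betw_def inv_into_into f_inv_into_f)
  have jv: "?j (?p v) = v" if "v \<in> V" for v
    using bij that by (simp add: bij_betw_def)
  obtain C where C: "\<And>v. v \<in> V \<Longrightarrow> norm v \<le> C * norm (?p v)"
    using inv by (auto simp: invertible_between_def)
  have sV: "subspace V" using V csubspace_subspace by (auto simp: closed_csubspace_def)
  \<comment> \<open>\<open>Blinfun\<close> in \<open>graph_coord\<close> is meaningful only for
    bounded linear functions. Linearity comes from injectivity of the projection on
    \<open>V\<close>, the bound from the constant in \<open>invertible_between\<close>, replaced by
    its absolute value since its sign is unknown.\<close>
  have "bounded_linear (\<lambda>x. ?q (?j (?p x)))"
  proof (rule bounded_linear_intro)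
    fix x y and r :: real
    have "?j (?p x + ?p y) = ?j (?p (?j (?p x) + ?j (?p y)))"
      by (simp add: blinfun.add_right j proj_mem[OF W])
    also have "\<dots> = ?j (?p x) + ?j (?p y)"
      using j sV proj_mem[OF W] by (intro jv) (auto simp: subspace_add)
    finally show "?q (?j (?p (x + y))) = ?q (?j (?p x)) + ?q (?j (?p y))"
      by (simp add: blinfun.add_right)
    have "?j (r *\<^sub>R ?p x) = ?j (?p (r *\<^sub>R ?j (?p x)))"
      by (simp add: blinfun.scaleR_right j proj_mem[OF W])
    also have "\<dots> = r *\<^sub>R ?j (?p x)"
      using j sV proj_mem[OF W] by (intro jv) (auto simp: subspace_scale)
    finally show "?q (?j (?p (r *\<^sub>R x))) = r *\<^sub>R ?q (?j (?p x))"
      by (simp add: blinfun.scaleR_right)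
    have "norm (?j (?p x)) \<le> C * norm (?p x)"
      using C[OF j(1)[OF proj_mem[OF W]]] j(2)[OF proj_mem[OF W]] by simp
    also have "\<dots> \<le> \<bar>C\<bar> * norm (?p x)" by (intro mult_right_mono) auto
    also have "\<dots> \<le> \<bar>C\<bar> * (norm (proj W) * norm x)" by (intro mult_left_mono norm_blinfun) auto
    finally have "norm (proj (ocomp W)) * norm (?j (?p x)) \<le> norm (proj (ocomp W)) * (\<bar>C\<bar> * (norm (proj W) * norm x))"
      by (intro mult_left_mono) auto
    with norm_blinfun[of "proj (ocomp W)" "?j (?p x)"]
    show "norm (?q (?j (?p x))) \<le> norm x * (norm (proj (ocomp W)) * (\<bar>C\<bar> * norm (proj W)))"
      by (simp add: mult_ac)
  qed
  then have "blinfun_apply (graph_coord W V) x = ?q (?j (?p x))"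
    by (simp add: graph_coord_def bounded_linear_Blinfun_apply)
  also have "\<dots> = ?j (?p x) - ?p x"
    by (simp add: proj_ocomp[OF W] blinfun.bilinear_simps j proj_mem[OF W])
  finally show ?thesis by (simp add: graph_lift_def blinfun.bilinear_simps)
qed

lemma graph_lift_mem: "blinfun_apply (graph_lift W V) x \<in> V"
  using inv proj_mem[OF W] by (auto simp: graph_lift_apply invertible_between_def bij_betw_def intro!: inv_into_into)

lemma graph_lift_self: "v \<in> V \<Longrightarrow> blinfun_apply (graph_lift W V) v = v"
  using inv by (simp add: graph_lift_apply invertible_between_def bij_betw_def)

lemma proj_graph_lift: "proj W o\<^sub>L graph_lift W V = proj W"
  using inv proj_mem[OF W]
  by (intro blinfun_eqI) (simp add: graph_lift_apply invertible_between_def bij_betw_def f_inv_into_f)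

lemma graph_lift_proj: "graph_lift W V o\<^sub>L proj W = graph_lift W V"
  by (rule blinfun_eqI) (simp add: graph_lift_apply proj_eq_self[OF W] proj_mem[OF W])

lemma perp_graph_lift: "proj (ocomp W) o\<^sub>L graph_lift W V = graph_coord W V"
  by (simp add: proj_ocomp[OF W] blinfun_compose_simps proj_graph_lift) (simp add: graph_lift_def)

lemma range_graph_lift: "range (blinfun_apply (graph_lift W V)) = V"
  using graph_lift_mem graph_lift_self by (metis image_subsetI rangeI subsetI subset_antisym)

text \<open>A complex multiple of a lifted vector lies in \<open>V\<close> and is fixed by the lift,
  while the lift depends only on the projection to \<open>W\<close>, which is
  complex-linear.\<close>

lemma clinear_graph_lift: "clinear_op (graph_lift W V)"
  unfolding clinear_op_iff
proof (intro allI)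
  fix c x
  let ?S = "blinfun_apply (graph_lift W V)"
  have "c *\<^sub>C ?S x \<in> V" using V graph_lift_mem by (simp add: closed_csubspace_def cvs.subspace_scale)
  then have "c *\<^sub>C ?S x = ?S (c *\<^sub>C ?S x)" by (simp add: graph_lift_self)
  also have "\<dots> = ?S (blinfun_apply (proj W) (c *\<^sub>C ?S x))"
    using graph_lift_proj by (metis blinfun_apply_blinfun_compose)
  also have "blinfun_apply (proj W) (c *\<^sub>C ?S x) = blinfun_apply (proj W) (c *\<^sub>C x)"
  proof -
    have "blinfun_apply (proj W) (?S x) = blinfun_apply (proj W) x"
      using proj_graph_lift by (metis blinfun_apply_blinfun_compose)
    then show ?thesis using clinear_proj[OF W] by (simp add: clinear_op_iff)
  qed
  also have "?S (blinfun_apply (proj W) (c *\<^sub>C x)) = ?S (c *\<^sub>C x)"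
    using graph_lift_proj by (metis blinfun_apply_blinfun_compose)
  finally show "?S (c *\<^sub>C x) = c *\<^sub>C ?S x" by simp
qed

end

lemma graph_coord_inj:
  assumes "closed_csubspace W" "closed_csubspace V" "closed_csubspace V'"
    and "invertible_between V W (proj W)" "invertible_between V' W (proj W)"
    and "graph_coord W V = graph_coord W V'"
  shows "V = V'"
proof -
  have "graph_lift W V = graph_lift W V'" using assms(6) by (simp add: graph_lift_def)
  then show ?thesis
    using range_graph_lift[OF assms(1,2,4)] range_graph_lift[OF assms(1,3,5)] by metis
qed

text \<open>If \<open>S\<close> and \<open>S'\<close> are the graph maps of the same subspace over \<open>W\<close> and \<open>W'\<close>, then \<open>P\<^sub>W S'\<close> is
  inverse to \<open>P\<^sub>W\<^sub>' S\<close>, and \<open>S' = S (P\<^sub>W S')\<close>; this expresses the coordinate over \<open>W'\<close> by that over \<open>W\<close>.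
  One point where both coordinates are Hilbert--Schmidt suffices for \<open>P\<^sub>W\<^sub>'\<^sup>\<bottom> P\<^sub>W\<close> to be
  Hilbert--Schmidt.\<close>

lemma graph_change_smooth_at:
  fixes W W' :: "'a::complex_hilbert set"
  assumes W: "closed_csubspace W" and W': "closed_csubspace W'"
    and N: "openin (ntop (L2_perp W)) N" and A0: "A0 \<in> N"
    and g: "\<And>A. A \<in> N \<Longrightarrow> closed_csubspace (g A) \<and> invertible_between (g A) W (proj W) \<and>
      invertible_between (g A) W' (proj W') \<and> graph_coord W (g A) = A \<and> graph_coord W' (g A) \<in> vecs (L2_perp W')"
  shows "smooth_at (L2_perp W) (L2_perp W') (\<lambda>A. graph_coord W' (g A)) A0"
proof -
  let ?E = "L2_perp W" and ?q = "proj (ocomp W')"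
  note nE = normed_L2_perp[of W] and nO = normed_op_space and nH = normed_hs_space
  interpret E: normed_nspace ?E by (rule nE)
  note c = clinear_proj[OF W] clinear_proj[OF W'] clinear_proj[OF closed_csubspace_ocomp[of W']]
  define S where "S A = graph_lift W (g A)" for A
  define S' where "S' A = graph_lift W' (g A)" for A
  \<comment> \<open>On the coordinates in \<open>N\<close> this is the projection to
    \<open>W'\<close> of the lift over \<open>W\<close>, written so as to be affine in
    \<open>A\<close>; \<open>r\<close> below is its inverse, from \<open>W'\<close> back to
    \<open>W\<close>.\<close>
  define a where "a A = proj W' o\<^sub>L (proj W + A)" for A
  define r where "r A = proj W o\<^sub>L S' A" for A
  have AE: "A \<in> vecs ?E" if "A \<in> N" for A using N that by (auto simp: E.openin_ntop)
  have S: "S A = proj W + A" if "A \<in> N" for A using g[OF that] by (simp add: S_def graph_lift_def)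
  have facts: "proj W o\<^sub>L S A = proj W" "S A o\<^sub>L proj W = S A" "proj W' o\<^sub>L S' A = proj W'" "S' A o\<^sub>L proj W' = S' A"
      "?q o\<^sub>L S' A = graph_coord W' (g A)" "clinear_op (S A)" "clinear_op (S' A)"
      "S A o\<^sub>L S' A = S' A" "S' A o\<^sub>L S A = S A" if A: "A \<in> N" for A
  proof -
    from g[OF A] have V: "closed_csubspace (g A)" "invertible_between (g A) W (proj W)"
      "invertible_between (g A) W' (proj W')" by auto
    show "proj W o\<^sub>L S A = proj W" "S A o\<^sub>L proj W = S A" "clinear_op (S A)"
      unfolding S_def by (rule proj_graph_lift[OF W V(1,2)] graph_lift_proj[OF W V(1,2)] clinear_graph_lift[OF W V(1,2)])+
    show "proj W' o\<^sub>L S' A = proj W'" "S' A o\<^sub>L proj W' = S' A" "clinear_op (S' A)" "?q o\<^sub>L S' A = graph_coord W' (g A)"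
      unfolding S'_def by (rule proj_graph_lift[OF W' V(1,3)] graph_lift_proj[OF W' V(1,3)]
          clinear_graph_lift[OF W' V(1,3)] perp_graph_lift[OF W' V(1,3)])+
    show "S A o\<^sub>L S' A = S' A" "S' A o\<^sub>L S A = S A"
      unfolding S_def S'_def
      by (rule blinfun_eqI; simp add: graph_lift_self[OF W V(1,2)] graph_lift_self[OF W' V(1,3)]
          graph_lift_mem[OF W V(1,2)] graph_lift_mem[OF W' V(1,3)])+
  qed
  have inv: "clinear_op (r A) \<and> a A o\<^sub>L r A = proj W' \<and> r A o\<^sub>L a A = proj W \<and> r A o\<^sub>L proj W' = r A \<and> proj W o\<^sub>L r A = r A"
    if A: "A \<in> N" for A
  proof (intro conjI)
    note f = facts[OF A] and SA = S[OF A, symmetric]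
    show "clinear_op (r A)" using c f by (simp add: r_def)
    have "a A o\<^sub>L r A = proj W' o\<^sub>L ((S A o\<^sub>L proj W) o\<^sub>L S' A)" unfolding a_def r_def SA by (simp only: blinfun_compose_assoc)
    then show "a A o\<^sub>L r A = proj W'" by (simp only: f)
    have "r A o\<^sub>L a A = proj W o\<^sub>L ((S' A o\<^sub>L proj W') o\<^sub>L S A)" unfolding a_def r_def SA by (simp only: blinfun_compose_assoc)
    then show "r A o\<^sub>L a A = proj W" by (simp only: f)
    show "r A o\<^sub>L proj W' = r A" unfolding r_def by (simp only: blinfun_compose_assoc f)
    show "proj W o\<^sub>L r A = r A" unfolding r_def by (simp only: blinfun_compose_assoc[symmetric] proj_idem[OF W])
  qed
  have id: "smooth_at ?E op_space (\<lambda>A. A) A0"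
    by (rule smooth_at_linear[OF nE nE nO smooth_at_id[OF nE AE[OF A0]] bounded_linear_L2_perp_op])
  have a: "smooth_at ?E op_space a A0"
    unfolding a_def
    by (intro smooth_at_comp nE smooth_at_add[OF nE nO] smooth_at_const_op c AE A0 id)
  have r: "smooth_at ?E op_space r A0"
    by (rule smooth_at_inverse[OF nE a N A0 inv])
  have gc: "graph_coord W' (g A) = ?q o\<^sub>L S A o\<^sub>L r A" if A: "A \<in> N" for A
  proof -
    note f = facts[OF A]
    have "?q o\<^sub>L S A o\<^sub>L r A = ?q o\<^sub>L ((S A o\<^sub>L proj W) o\<^sub>L S' A)" unfolding r_def by (simp only: blinfun_compose_assoc)
    then show ?thesis by (simp only: f)
  qed
  define C where "C = ?q o\<^sub>L proj W"
  have qS: "?q o\<^sub>L S A = C + (?q o\<^sub>L A)" if "A \<in> N" for A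
    unfolding S[OF that] C_def by (simp only: blinfun_compose_simps)
  have "hilbert_schmidt C"
  proof -
    \<comment> \<open>At \<open>A0\<close>, the coordinate over \<open>W'\<close> composed with
      \<open>a A0\<close> equals \<open>C\<close> plus a Hilbert-Schmidt operator, and it is itself
      Hilbert-Schmidt. This is the only place where \<open>C\<close> is controlled.\<close>
    note f = facts[OF A0]
    have "graph_coord W' (g A0) o\<^sub>L a A0 = ?q o\<^sub>L S A0 o\<^sub>L (r A0 o\<^sub>L a A0)"
      unfolding gc[OF A0] by (simp only: blinfun_compose_assoc)
    also have "\<dots> = ?q o\<^sub>L (S A0 o\<^sub>L proj W)" using inv[OF A0] by (simp only: blinfun_compose_assoc)
    finally have eq: "graph_coord W' (g A0) o\<^sub>L a A0 = C + (?q o\<^sub>L A0)" using f qS[OF A0] by simp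
    have "hilbert_schmidt (graph_coord W' (g A0))" using g[OF A0] by (simp add: L2_perp_simps)
    moreover have hA: "hilbert_schmidt A0" using AE[OF A0] by (simp add: L2_perp_simps)
    then have "clinear_op (a A0)" using c hilbert_schmidt_clinear[OF hA] by (simp add: a_def)
    ultimately have "hilbert_schmidt (graph_coord W' (g A0) o\<^sub>L a A0)" by (rule hilbert_schmidt_comp_right)
    from hilbert_schmidt_diff[OF this hilbert_schmidt_comp_left[OF hA c(3)]] show ?thesis unfolding eq by simp
  qed
  then have "smooth_at ?E hs_space (\<lambda>A. C + (?q o\<^sub>L A)) A0"
    by (intro smooth_at_add[OF nE nH] smooth_at_const[OF nE nH] AE A0
        smooth_at_linear[OF nE nE nH smooth_at_id[OF nE AE[OF A0]] bounded_linear_L2_perp_hs[OF c(3)]]) simp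
  \<comment> \<open>The left factor is smooth in the Hilbert-Schmidt norm, the inverse
    \<open>r\<close> in the operator norm only; the product is then compressed into
    \<open>L2_perp W'\<close>.\<close>
  from smooth_at_bilinear[OF nE nH nO nH this r bounded_bilinear_hs_comp]
  have "smooth_at ?E (L2_perp W') (\<lambda>A. ?q o\<^sub>L ((C + (?q o\<^sub>L A)) o\<^sub>L r A) o\<^sub>L proj W') A0"
    by (rule smooth_at_linear[OF nE nH normed_L2_perp _ bounded_linear_hs_L2_perp[OF W']])
  then show ?thesis
  proof (rule smooth_at_cong[OF _ N A0])
    fix A assume A: "A \<in> N"
    have "(C + (?q o\<^sub>L A)) o\<^sub>L r A = graph_coord W' (g A)" using gc[OF A] qS[OF A] by simp
    then show "?q o\<^sub>L ((C + (?q o\<^sub>L A)) o\<^sub>L r A) o\<^sub>L proj W' = graph_coord W' (g A)"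
      using g[OF A] by (simp add: L2_perp_simps)
  qed
qed

section \<open>Cayley coordinates\<close>

lemma inverse_in_unique:
  assumes "inverse_in e a b" "inverse_in e a b'" "e o\<^sub>L e = e"
  shows "b = b'"
proof -
  have e: "b o\<^sub>L e = b" "e o\<^sub>L b' = b'"
    using assms unfolding inverse_in_def by (metis blinfun_compose_assoc)+
  have "b o\<^sub>L (a o\<^sub>L b') = (b o\<^sub>L a) o\<^sub>L b'" by (simp only: blinfun_compose_assoc)
  then show ?thesis using assms(1,2) e by (simp add: inverse_in_def)
qed

lemma op_inverse_eq: "inverse_in e a b \<Longrightarrow> e o\<^sub>L e = e \<Longrightarrow> op_inverse e a = b"
  unfolding op_inverse_def by (rule the_equality) (auto intro: inverse_in_unique)

text \<open>The inverse is given only as a bounded real-linear operator; complex linearity is pulled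
  back through \<open>a\<close>.\<close>

lemma clinear_inverse_in:
  assumes "inverse_in e a b" "clinear_op a" "clinear_op e" "e o\<^sub>L e = e"
  shows "clinear_op b"
  unfolding clinear_op_iff
proof (intro allI)
  fix c x
  have e: "b o\<^sub>L e = b" "e o\<^sub>L b = b" "a o\<^sub>L b = e" "b o\<^sub>L a = e"
    using assms unfolding inverse_in_def by (metis blinfun_compose_assoc)+
  have ap: "blinfun_apply b (blinfun_apply e y) = blinfun_apply b y" "blinfun_apply e (blinfun_apply b y) = blinfun_apply b y"
    "blinfun_apply a (blinfun_apply b y) = blinfun_apply e y" "blinfun_apply b (blinfun_apply a y) = blinfun_apply e y" for y
    using e by (metis blinfun_apply_blinfun_compose)+
  have "blinfun_apply b (c *\<^sub>C x) = blinfun_apply b (blinfun_apply e (c *\<^sub>C x))" by (simp add: ap)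
  also have "\<dots> = blinfun_apply b (blinfun_apply a (c *\<^sub>C blinfun_apply b x))"
    using assms(2,3) by (simp add: clinear_op_iff ap(3))
  also have "\<dots> = blinfun_apply e (c *\<^sub>C blinfun_apply b x)" by (rule ap(4))
  also have "\<dots> = c *\<^sub>C blinfun_apply b x" using assms(3) by (simp add: clinear_op_iff ap(2))
  finally show "blinfun_apply b (c *\<^sub>C x) = c *\<^sub>C blinfun_apply b x" .
qed

lemma orth_projector_simps:
  "orth_projector e \<Longrightarrow> clinear_op e" "orth_projector e \<Longrightarrow> e o\<^sub>L e = e" "orth_projector e \<Longrightarrow> cadj e = e"
  by (simp_all add: orth_projector_def)

lemma orth_projector_proj: "closed_csubspace W \<Longrightarrow> orth_projector (proj W)"
  for W :: "'a::complex_hilbert set"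
  by (simp add: orth_projector_def)

lemma orth_projector_id: "orth_projector (id_blinfun :: 'a::complex_hilbert \<Rightarrow>\<^sub>L 'a)"
  by (simp add: orth_projector_def)

lemma unitaries_simps:
  fixes e :: "'a::complex_hilbert \<Rightarrow>\<^sub>L 'a"
  assumes e: "orth_projector e" and u: "u \<in> unitaries e"
  shows "clinear_op u" "clinear_op (cadj u)" "cadj u o\<^sub>L u = e" "u o\<^sub>L cadj u = e"
    "e o\<^sub>L u = u" "u o\<^sub>L e = u" "e o\<^sub>L cadj u = cadj u" "cadj u o\<^sub>L e = cadj u" "op_inverse e u = cadj u"
proof -
  note e = orth_projector_simps[OF e]
  have u': "clinear_op u" "e o\<^sub>L u o\<^sub>L e = u" "cadj u o\<^sub>L u = e" "u o\<^sub>L cadj u = e"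
    using u by (auto simp: unitaries_def)
  then show "clinear_op u" "clinear_op (cadj u)" "cadj u o\<^sub>L u = e" "u o\<^sub>L cadj u = e" by auto
  show eu: "e o\<^sub>L u = u" "u o\<^sub>L e = u" using u'(2) e(2) by (metis blinfun_compose_assoc)+
  show eu': "e o\<^sub>L cadj u = cadj u" "cadj u o\<^sub>L e = cadj u"
    using arg_cong[OF eu(2), of cadj] arg_cong[OF eu(1), of cadj] u'(1) e by (simp_all add: cadj_comp)
  show "op_inverse e u = cadj u"
    by (rule op_inverse_eq) (use u' eu eu' e in \<open>simp_all add: inverse_in_def\<close>)
qed

lemma cayley_chart_simps:
  "chart_dom (cayley_chart e G L g) = {u \<in> G. \<exists>b. inverse_in e ((op_inverse e g o\<^sub>L u) + e) b}"
  "coord (cayley_chart e G L g) = (\<lambda>u. 2 *\<^sub>R (((op_inverse e g o\<^sub>L u) - e) o\<^sub>L op_inverse e ((op_inverse e g o\<^sub>L u) + e)))"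
  "model (cayley_chart e G L g) = L"
  by (simp_all add: cayley_chart_def)

text \<open>For \<open>w = g\<^sup>* v\<close> and \<open>x = 2 (w - e) (w + e)\<^sup>-\<^sup>1\<close>, the operator \<open>(w + e) / 2\<close> is inverse to
  \<open>e - x / 2\<close>.\<close>

lemma cayley_inverse:
  fixes e :: "'a::complex_hilbert \<Rightarrow>\<^sub>L 'a"
  assumes e: "orth_projector e" and g: "g \<in> unitaries e" and v: "v \<in> unitaries e"
    and dom: "v \<in> chart_dom (cayley_chart e G L g)"
  defines "x \<equiv> coord (cayley_chart e G L g) v"
  defines "r \<equiv> (1 / 2) *\<^sub>R ((cadj g o\<^sub>L v) + e)"
  shows "clinear_op r" "(e - (1 / 2) *\<^sub>R x) o\<^sub>L r = e" "r o\<^sub>L (e - (1 / 2) *\<^sub>R x) = e" "r o\<^sub>L e = r" "e o\<^sub>L r = r"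
    "v = g o\<^sub>L (2 *\<^sub>R r - e)"
proof -
  note es = orth_projector_simps[OF e]
  note gs = unitaries_simps[OF e g] and vs = unitaries_simps[OF e v]
  define w where "w = cadj g o\<^sub>L v"
  obtain b where b: "inverse_in e (w + e) b" using dom by (auto simp: cayley_chart_simps gs w_def)
  then have b': "e o\<^sub>L b = b" "(w + e) o\<^sub>L b = e" "b o\<^sub>L (w + e) = e"
    using es unfolding inverse_in_def by (metis blinfun_compose_assoc)+
  have x: "x = 2 *\<^sub>R ((w - e) o\<^sub>L b)"
    by (simp add: x_def cayley_chart_simps gs w_def[symmetric] op_inverse_eq[OF b es(2)])
  have "(w - e) o\<^sub>L b = e - 2 *\<^sub>R b"
    using b' by (simp add: blinfun_compose_simps scaleR_2 algebra_simps)
  then have ex: "e - (1 / 2) *\<^sub>R x = 2 *\<^sub>R b" by (simp add: x)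
  have r: "r = (1 / 2) *\<^sub>R (w + e)" by (simp add: r_def w_def)
  have ew: "e o\<^sub>L w = w" "w o\<^sub>L e = w"
    unfolding w_def by (simp add: blinfun_compose_assoc[symmetric] gs) (simp add: blinfun_compose_assoc vs)
  show "clinear_op r" unfolding r_def using gs vs es by simp
  show "(e - (1 / 2) *\<^sub>R x) o\<^sub>L r = e" "r o\<^sub>L (e - (1 / 2) *\<^sub>R x) = e"
    unfolding ex r using b' by (simp_all only: blinfun_compose_simps(5,6)) simp_all
  show "r o\<^sub>L e = r" "e o\<^sub>L r = r" unfolding r by (simp_all add: blinfun_compose_simps ew es)
  have "2 *\<^sub>R r - e = w" unfolding r by simp
  then have "g o\<^sub>L (2 *\<^sub>R r - e) = (g o\<^sub>L cadj g) o\<^sub>L v" by (simp add: w_def blinfun_compose_assoc)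
  then show "v = g o\<^sub>L (2 *\<^sub>R r - e)" by (simp add: gs vs)
qed

text \<open>The coordinate \<open>x\<close> determines the inverse \<open>r\<close> of
  \<open>e - x / 2\<close> in the corner algebra, and \<open>r\<close> determines the unitary as
  \<open>g o\<^sub>L (2 *\<^sub>R r - e)\<close>.\<close>

lemma cayley_inj_on:
  fixes e :: "'a::complex_hilbert \<Rightarrow>\<^sub>L 'a"
  assumes e: "orth_projector e" and g: "g \<in> unitaries e" and G: "G \<subseteq> unitaries e"
  shows "inj_on (coord (cayley_chart e G L g)) (chart_dom (cayley_chart e G L g))"
proof (rule inj_onI)
  fix u v assume u: "u \<in> chart_dom (cayley_chart e G L g)" and v: "v \<in> chart_dom (cayley_chart e G L g)"
    and eq: "coord (cayley_chart e G L g) u = coord (cayley_chart e G L g) v"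
  have uG: "u \<in> unitaries e" and vG: "v \<in> unitaries e" using u v G by (auto simp: cayley_chart_simps)
  let ?r = "\<lambda>v. (1 / 2) *\<^sub>R ((cadj g o\<^sub>L v) + e)"
  have "inverse_in e (e - (1 / 2) *\<^sub>R coord (cayley_chart e G L g) v) (?r v)"
    if "v \<in> unitaries e" "v \<in> chart_dom (cayley_chart e G L g)" for v
    using cayley_inverse(2-5)[OF e g that] by (simp add: inverse_in_def)
  from inverse_in_unique[OF this[OF uG u] this[OF vG v, folded eq] orth_projector_simps(2)[OF e]]
  show "u = v" using cayley_inverse(6)[OF e g uG u] cayley_inverse(6)[OF e g vG v] by metis
qed

text \<open>Smoothness in a Cayley coordinate implies smoothness as an operator-valued map: invert
  \<open>e - x / 2\<close> and recover \<open>f\<close> by the formula of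
  \<open>cayley_inverse\<close>.\<close>

lemma smooth_at_cayley_inverse:
  fixes e :: "'a::complex_hilbert \<Rightarrow>\<^sub>L 'a"
  assumes nE: "normed_nspace E" and e: "orth_projector e" and g: "g \<in> unitaries e"
    and N: "openin (ntop E) N" "p \<in> N"
    and f: "\<And>y. y \<in> N \<Longrightarrow> f y \<in> unitaries e \<and> f y \<in> chart_dom (cayley_chart e G L g)"
    and x: "smooth_at E op_space (\<lambda>y. coord (cayley_chart e G L g) (f y)) p"
  shows "smooth_at E op_space f p"
proof -
  interpret E: normed_nspace E by fact
  have p: "p \<in> vecs E" using N by (auto simp: E.openin_ntop)
  note es = orth_projector_simps[OF e] and gs = unitaries_simps[OF e g]
  define r where "r y = (1 / 2) *\<^sub>R ((cadj g o\<^sub>L f y) + e)" for y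
  have "smooth_at E op_space r p"
  proof (rule smooth_at_inverse[OF nE _ N])
    show "smooth_at E op_space (\<lambda>y. e - (1 / 2) *\<^sub>R coord (cayley_chart e G L g) (f y)) p"
      by (intro smooth_at_diff_op smooth_at_scaleR_op smooth_at_const_op nE es p x)
    fix y assume "y \<in> N"
    then have "f y \<in> unitaries e" "f y \<in> chart_dom (cayley_chart e G L g)" using f by auto
    from cayley_inverse[OF e g this]
    show "clinear_op (r y) \<and> (e - (1 / 2) *\<^sub>R coord (cayley_chart e G L g) (f y)) o\<^sub>L r y = e \<and>
      r y o\<^sub>L (e - (1 / 2) *\<^sub>R coord (cayley_chart e G L g) (f y)) = e \<and> r y o\<^sub>L e = r y \<and> e o\<^sub>L r y = r y"
      by (simp add: r_def)
  qed
  then have "smooth_at E op_space (\<lambda>y. g o\<^sub>L (2 *\<^sub>R r y - e)) p"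
    by (intro smooth_at_comp smooth_at_diff_op smooth_at_scaleR_op smooth_at_const_op nE es gs p)
  then show ?thesis
    by (rule smooth_at_cong[OF _ N]) (use f cayley_inverse(6)[OF e g] r_def in metis)
qed

text \<open>Solving \<open>T z = y\<close> is a fixed-point problem for a contraction whose constant
  is the distance of \<open>T\<close> from the identity; that constant also bounds the
  inverse.\<close>

lemma near_identity_invertible:
  fixes T :: "'a::banach \<Rightarrow>\<^sub>L 'a"
  assumes "norm (T - id_blinfun) < 1"
  obtains S where "T o\<^sub>L S = id_blinfun" "S o\<^sub>L T = id_blinfun"
proof -
  let ?c = "norm (T - id_blinfun)"
  have "\<exists>!z. y - blinfun_apply (T - id_blinfun) z = z" for y
  proof (rule banach_fix_type[of ?c])
    have "dist (y - blinfun_apply (T - id_blinfun) x) (y - blinfun_apply (T - id_blinfun) z) \<le> ?c * dist x z" for x z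
    proof -
      have "dist (y - blinfun_apply (T - id_blinfun) x) (y - blinfun_apply (T - id_blinfun) z) =
          norm (blinfun_apply (T - id_blinfun) (z - x))"
        by (simp add: dist_norm blinfun.diff_right)
      also have "\<dots> \<le> ?c * dist x z"
        using norm_blinfun[of "T - id_blinfun" "z - x"] by (simp add: dist_norm norm_minus_commute)
      finally show ?thesis .
    qed
    then show "\<forall>x z. dist (y - blinfun_apply (T - id_blinfun) x) (y - blinfun_apply (T - id_blinfun) z) \<le> ?c * dist x z"
      by blast
  qed (use assms in auto)
  moreover have "y - blinfun_apply (T - id_blinfun) z = z \<longleftrightarrow> blinfun_apply T z = y" for y z
    by (auto simp: blinfun.bilinear_simps algebra_simps)
  ultimately have ex1: "\<exists>!z. blinfun_apply T z = y" for y by simp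
  define s where "s y = (THE z. blinfun_apply T z = y)" for y
  have Ts: "blinfun_apply T (s y) = y" for y unfolding s_def using theI'[OF ex1] .
  have sT: "s (blinfun_apply T z) = z" for z unfolding s_def by (rule the1_equality[OF ex1 refl])
  have "bounded_linear s"
  proof (rule bounded_linear_intro)
    fix x y r
    show "s (x + y) = s x + s y" using sT[of "s x + s y"] by (simp add: blinfun.add_right Ts)
    show "s (r *\<^sub>R x) = r *\<^sub>R s x" using sT[of "r *\<^sub>R s x"] by (simp add: blinfun.scaleR_right Ts)
    have "s x = x - blinfun_apply (T - id_blinfun) (s x)" by (simp add: blinfun.bilinear_simps Ts)
    then have "norm (s x) \<le> norm x + ?c * norm (s x)"
      by (metis norm_triangle_ineq4 norm_blinfun add_left_mono order.trans)
    then have "(1 - ?c) * norm (s x) \<le> norm x" by (simp add: algebra_simps)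
    then show "norm (s x) \<le> norm x * (1 / (1 - ?c))" using assms by (simp add: field_simps)
  qed
  then show ?thesis
    by (intro that[of "Blinfun s"] blinfun_eqI) (simp_all add: bounded_linear_Blinfun_apply Ts sT)
qed

text \<open>The corner problem is moved to the full algebra: \<open>T\<close> is near the identity,
  commutes with \<open>e\<close>, and compresses to half of \<open>w + e\<close>. Its inverse
  commutes with \<open>e\<close> as well and can be cut down to the corner.\<close>

lemma near_projector_invertible:
  fixes e :: "'a::complex_hilbert \<Rightarrow>\<^sub>L 'a"
  assumes e: "e o\<^sub>L e = e" and w: "e o\<^sub>L w = w" "w o\<^sub>L e = w" and n: "norm (w - e) < 1"
  shows "\<exists>b. inverse_in e (w + e) b"
proof -
  define T where "T = id_blinfun + (1 / 2) *\<^sub>R (w - e)"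
  have "norm (T - id_blinfun) < 1" using n by (simp add: T_def)
  then obtain S where S: "T o\<^sub>L S = id_blinfun" "S o\<^sub>L T = id_blinfun" by (rule near_identity_invertible)
  have "e - (1 / 2) *\<^sub>R e = (1 / 2) *\<^sub>R e"
    by (metis (no_types, lifting) add_diff_cancel scaleR_half_double scaleR_right_distrib)
  then have Te: "T o\<^sub>L e = (1 / 2) *\<^sub>R (w + e)" and eT: "e o\<^sub>L T = (1 / 2) *\<^sub>R (w + e)"
    by (simp_all add: T_def blinfun_compose_simps w e scaleR_add_right scaleR_diff_right algebra_simps)
  have "S o\<^sub>L (T o\<^sub>L e) o\<^sub>L S = (S o\<^sub>L T) o\<^sub>L e o\<^sub>L S" "S o\<^sub>L (e o\<^sub>L T) o\<^sub>L S = S o\<^sub>L e o\<^sub>L (T o\<^sub>L S)"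
    by (simp_all only: blinfun_compose_assoc)
  then have Se: "e o\<^sub>L S = S o\<^sub>L e" unfolding S Te eT by simp
  have 1: "(T o\<^sub>L e) o\<^sub>L (S o\<^sub>L e) = e"
  proof -
    have "(T o\<^sub>L e) o\<^sub>L (S o\<^sub>L e) = T o\<^sub>L (e o\<^sub>L S) o\<^sub>L e" by (simp only: blinfun_compose_assoc)
    also have "\<dots> = (T o\<^sub>L S) o\<^sub>L (e o\<^sub>L e)" unfolding Se by (simp only: blinfun_compose_assoc)
    finally show ?thesis by (simp add: S e)
  qed
  have 2: "(S o\<^sub>L e) o\<^sub>L (e o\<^sub>L T) = e"
  proof -
    have "(S o\<^sub>L e) o\<^sub>L (e o\<^sub>L T) = S o\<^sub>L (e o\<^sub>L e) o\<^sub>L T" by (simp only: blinfun_compose_assoc)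
    also have "\<dots> = e o\<^sub>L (S o\<^sub>L T)" unfolding e Se[symmetric] by (simp only: blinfun_compose_assoc)
    finally show ?thesis by (simp add: S)
  qed
  have "e o\<^sub>L (S o\<^sub>L e) o\<^sub>L e = (e o\<^sub>L S) o\<^sub>L (e o\<^sub>L e)" by (simp only: blinfun_compose_assoc)
  then have 3: "e o\<^sub>L (S o\<^sub>L e) o\<^sub>L e = S o\<^sub>L e" unfolding e Se by (simp only: blinfun_compose_assoc e)
  have "inverse_in e (w + e) ((1 / 2) *\<^sub>R (S o\<^sub>L e))"
    unfolding inverse_in_def
  proof (intro conjI)
    show "e o\<^sub>L (1 / 2) *\<^sub>R (S o\<^sub>L e) o\<^sub>L e = (1 / 2) *\<^sub>R (S o\<^sub>L e)"
      using 3 by (simp only: blinfun_compose_simps)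
    show "(w + e) o\<^sub>L (1 / 2) *\<^sub>R (S o\<^sub>L e) = e" using 1 unfolding Te by (simp only: blinfun_compose_simps(5,6))
    show "(1 / 2) *\<^sub>R (S o\<^sub>L e) o\<^sub>L (w + e) = e" using 2 unfolding eT by (simp only: blinfun_compose_simps(5,6))
  qed
  then show ?thesis ..
qed

text \<open>The converse of \<open>smooth_at_cayley_inverse\<close>. The chart is centred at the
  value \<open>f p\<close>, so \<open>w p = e\<close>; by continuity \<open>w\<close> stays within
  distance 1 of \<open>e\<close>, where \<open>w + e\<close> is invertible.\<close>

lemma smooth_at_cayley:
  fixes e :: "'a::complex_hilbert \<Rightarrow>\<^sub>L 'a"
  assumes nE: "normed_nspace E" and e: "orth_projector e"
    and N: "openin (ntop E) N" "p \<in> N" and f: "\<And>y. y \<in> N \<Longrightarrow> f y \<in> unitaries e"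
    and sf: "smooth_at E op_space f p"
  obtains M where "openin (ntop E) M" "p \<in> M" "M \<subseteq> N"
    "\<forall>y\<in>M. f y \<in> chart_dom (cayley_chart e (unitaries e) L (f p))"
    "smooth_at E op_space (\<lambda>y. coord (cayley_chart e (unitaries e) L (f p)) (f y)) p"
proof -
  interpret E: normed_nspace E by fact
  have p: "p \<in> vecs E" using N by (auto simp: E.openin_ntop)
  note es = orth_projector_simps[OF e] and gs = unitaries_simps[OF e f[OF N(2)]]
  define w where "w y = cadj (f p) o\<^sub>L f y" for y
  have sw: "smooth_at E op_space w p"
    unfolding w_def by (intro smooth_at_comp nE smooth_at_const_op gs p sf)
  have wp: "w p = e" by (simp add: w_def gs)
  let ?V = "{T. clinear_op T \<and> norm (T - e) < 1}"
  have "?V = ball e 1 \<inter> {T. clinear_op T}" by (auto simp: dist_norm norm_minus_commute)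
  with openin_op_space[OF open_ball, of e 1] have V: "openin (ntop op_space) ?V" by (simp only:)
  obtain M where M: "openin (ntop E) M" "p \<in> M" "\<And>y. y \<in> M \<Longrightarrow> w y \<in> ?V"
    by (rule smooth_at_continuous[OF nE normed_op_space sw V]) (use wp es in auto)
  let ?M = "M \<inter> N"
  have oM: "openin (ntop E) ?M" "p \<in> ?M" using M(1,2) N by auto
  have ex: "\<exists>b. inverse_in e (w y + e) b" if "y \<in> ?M" for y
  proof (rule near_projector_invertible[OF es(2)])
    have fy: "f y \<in> unitaries e" using that f by blast
    note fs = unitaries_simps[OF e fy]
    show "e o\<^sub>L w y = w y" by (simp add: w_def blinfun_compose_assoc[symmetric] gs)
    show "w y o\<^sub>L e = w y" by (simp add: w_def blinfun_compose_assoc fs)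
    show "norm (w y - e) < 1" using M(3) that by blast
  qed
  define b where "b y = op_inverse e (w y + e)" for y
  have b: "inverse_in e (w y + e) (b y)" if "y \<in> ?M" for y
    using ex[OF that] op_inverse_eq[OF _ es(2)] unfolding b_def by metis
  have sb: "smooth_at E op_space b p"
  proof (rule smooth_at_inverse[OF nE _ oM])
    show "smooth_at E op_space (\<lambda>y. w y + e) p"
      by (intro smooth_at_add[OF nE normed_op_space] sw smooth_at_const_op nE es p)
    fix y assume y: "y \<in> ?M"
    have "clinear_op (w y + e)" using M(3) y es by auto
    then have "clinear_op (b y)" using clinear_inverse_in[OF b[OF y]] es by blast
    moreover have "b y o\<^sub>L e = b y" "e o\<^sub>L b y = b y"
      using b[OF y] es unfolding inverse_in_def by (metis blinfun_compose_assoc)+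
    ultimately show "clinear_op (b y) \<and> (w y + e) o\<^sub>L b y = e \<and> b y o\<^sub>L (w y + e) = e \<and> b y o\<^sub>L e = b y \<and> e o\<^sub>L b y = b y"
      using b[OF y] by (simp add: inverse_in_def)
  qed
  show ?thesis
  proof (rule that[OF oM])
    show "\<forall>y\<in>?M. f y \<in> chart_dom (cayley_chart e (unitaries e) L (f p))"
      using ex f by (auto simp: cayley_chart_simps gs w_def)
    have "smooth_at E op_space (\<lambda>y. 2 *\<^sub>R ((w y - e) o\<^sub>L b y)) p"
      by (intro smooth_at_scaleR_op smooth_at_comp smooth_at_diff_op nE sw sb smooth_at_const_op es p)
    then show "smooth_at E op_space (\<lambda>y. coord (cayley_chart e (unitaries e) L (f p)) (f y)) p"
      by (simp add: cayley_chart_simps gs w_def b_def)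
  qed auto
qed

section \<open>The topology of an atlas\<close>

text \<open>\<open>topology\<close> returns the given predicate only if that is a topology.
  Injectivity of the coordinates makes images commute with intersections, which is the nontrivial
  axiom.\<close>

lemma openin_atlas_topology:
  assumes "\<And>c. c \<in> A \<Longrightarrow> inj_on (coord c) (chart_dom c)"
  shows "openin (atlas_topology M A) S \<longleftrightarrow>
    S \<subseteq> M \<and> (\<forall>c\<in>A. openin (ntop (model c)) (coord c ` (S \<inter> chart_dom c)))"
proof -
  have "istopology (\<lambda>S. S \<subseteq> M \<and> (\<forall>c\<in>A. openin (ntop (model c)) (coord c ` (S \<inter> chart_dom c))))"
    unfolding istopology_def
  proof (intro conjI allI impI ballI)
    fix S T c
    assume S: "S \<subseteq> M \<and> (\<forall>c\<in>A. openin (ntop (model c)) (coord c ` (S \<inter> chart_dom c)))"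
      and T: "T \<subseteq> M \<and> (\<forall>c\<in>A. openin (ntop (model c)) (coord c ` (T \<inter> chart_dom c)))"
    show "S \<inter> T \<subseteq> M" using S by blast
    assume c: "c \<in> A"
    have "coord c ` (S \<inter> T \<inter> chart_dom c) = coord c ` (S \<inter> chart_dom c) \<inter> coord c ` (T \<inter> chart_dom c)"
      using inj_on_image_Int[OF assms[OF c], of "S \<inter> chart_dom c" "T \<inter> chart_dom c"] by (simp add: Int_ac)
    then show "openin (ntop (model c)) (coord c ` (S \<inter> T \<inter> chart_dom c))"
      using S T c by (simp add: openin_Int)
  next
    fix K c
    assume K: "\<forall>S\<in>K. S \<subseteq> M \<and> (\<forall>c\<in>A. openin (ntop (model c)) (coord c ` (S \<inter> chart_dom c)))"
    show "\<Union>K \<subseteq> M" using K by blast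
    assume c: "c \<in> A"
    have "coord c ` (\<Union>K \<inter> chart_dom c) = (\<Union>S\<in>K. coord c ` (S \<inter> chart_dom c))" by blast
    then show "openin (ntop (model c)) (coord c ` (\<Union>K \<inter> chart_dom c))"
      using K c by (auto intro!: openin_Union)
  qed
  then show ?thesis unfolding atlas_topology_def by (simp add: topology_inverse')
qed

section \<open>Restricted partial isometries\<close>

lemma partial_isometryD:
  fixes u :: "'a::complex_hilbert \<Rightarrow>\<^sub>L 'a"
  assumes "partial_isometry u"
  shows "clinear_op u" "closed_csubspace (ini u)" "cadj u o\<^sub>L u = proj (ini u)" "u o\<^sub>L cadj u = proj (fin u)"
    "u o\<^sub>L proj (ini u) = u"
proof -
  have u: "clinear_op u" and e: "orth_projector (cadj u o\<^sub>L u)" using assms by (auto simp: partial_isometry_def)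
  show "clinear_op u" by (rule u)
  note c = clinear_cadj[OF u]
  show "closed_csubspace (ini u)" and 1: "cadj u o\<^sub>L u = proj (ini u)"
    using orth_projectorD[OF e] by (simp_all add: ini_def)
  note es = orth_projector_simps[OF e]
  \<comment> \<open>Since \<open>cadj u o\<^sub>L u\<close> is idempotent, the four terms of
    \<open>cadj k o\<^sub>L k\<close> cancel; so \<open>k = 0\<close>, which makes
    \<open>u o\<^sub>L cadj u\<close> idempotent too.\<close>
  define k where "k = u - (u o\<^sub>L (cadj u o\<^sub>L u))"
  have kc: "clinear_op k" using u c by (simp add: k_def)
  have "cadj k o\<^sub>L k = (cadj u o\<^sub>L u) - ((cadj u o\<^sub>L u) o\<^sub>L (cadj u o\<^sub>L u)) -
      ((cadj u o\<^sub>L u) o\<^sub>L (cadj u o\<^sub>L u)) + ((cadj u o\<^sub>L u) o\<^sub>L (cadj u o\<^sub>L u) o\<^sub>L (cadj u o\<^sub>L u))"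
  proof -
    have "cadj k = cadj u - ((cadj u o\<^sub>L u) o\<^sub>L cadj u)"
      using u c es by (simp add: k_def cadj_diff cadj_comp blinfun_compose_assoc)
    then show ?thesis by (simp add: k_def blinfun_compose_simps blinfun_compose_assoc)
  qed
  then have k0: "cadj k o\<^sub>L k = 0" by (simp only: es) simp
  have "k = 0"
  proof (rule blinfun_eqI)
    fix x
    have "cinner (blinfun_apply k x) (blinfun_apply k x) = cinner x (blinfun_apply (cadj k o\<^sub>L k) x)"
      by (simp add: cinner_cadj[OF kc])
    then show "blinfun_apply k x = blinfun_apply 0 x" by (simp add: k0 cinner_self)
  qed
  then have uuu: "u o\<^sub>L (cadj u o\<^sub>L u) = u" by (simp add: k_def)
  then show "u o\<^sub>L proj (ini u) = u" by (simp only: 1)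
  have "orth_projector (u o\<^sub>L cadj u)"
    unfolding orth_projector_def
  proof (intro conjI)
    have "(u o\<^sub>L cadj u) o\<^sub>L (u o\<^sub>L cadj u) = (u o\<^sub>L (cadj u o\<^sub>L u)) o\<^sub>L cadj u" by (simp only: blinfun_compose_assoc)
    then show "(u o\<^sub>L cadj u) o\<^sub>L (u o\<^sub>L cadj u) = u o\<^sub>L cadj u" by (simp only: uuu)
  qed (use u c in \<open>simp_all add: cadj_comp\<close>)
  from orth_projectorD(2)[OF this] show "u o\<^sub>L cadj u = proj (fin u)" by (simp add: fin_def)
qed

lemma unitary_conjugate_proj:
  fixes s :: "'a::complex_hilbert \<Rightarrow>\<^sub>L 'a"
  assumes s: "s \<in> unitaries id_blinfun" and H: "closed_csubspace Hp" and X: "blinfun_apply s ` Hp = X"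
  shows "s o\<^sub>L proj Hp o\<^sub>L cadj s = proj X"
proof -
  note ss = unitaries_simps[OF orth_projector_id s]
  note p = clinear_proj[OF H] proj_idem[OF H] cadj_proj[OF H]
  let ?E = "s o\<^sub>L proj Hp o\<^sub>L cadj s"
  have "orth_projector ?E"
    unfolding orth_projector_def
  proof (intro conjI)
    have "?E o\<^sub>L ?E = s o\<^sub>L proj Hp o\<^sub>L (cadj s o\<^sub>L s) o\<^sub>L proj Hp o\<^sub>L cadj s" by (simp only: blinfun_compose_assoc)
    also have "\<dots> = s o\<^sub>L (proj Hp o\<^sub>L proj Hp) o\<^sub>L cadj s" by (simp add: ss(3) blinfun_compose_assoc)
    finally show "?E o\<^sub>L ?E = ?E" by (simp only: p)
    show "cadj ?E = ?E" using ss p by (simp add: cadj_comp blinfun_compose_assoc)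
  qed (use ss p in simp)
  moreover have "range (blinfun_apply ?E) = X"
  proof -
    have "surj (blinfun_apply (cadj s))"
      using ss(3) by (metis blinfun_apply_blinfun_compose blinfun_apply_id_blinfun id_apply surjI)
    moreover have "blinfun_apply ?E = blinfun_apply s \<circ> blinfun_apply (proj Hp) \<circ> blinfun_apply (cadj s)"
      by (rule ext) simp
    then have "range (blinfun_apply ?E) = blinfun_apply s ` blinfun_apply (proj Hp) ` range (blinfun_apply (cadj s))"
      by (simp only: image_comp comp_assoc)
    ultimately have "range (blinfun_apply ?E) = blinfun_apply s ` range (blinfun_apply (proj Hp))" by simp
    then show ?thesis by (simp add: range_proj[OF H] X)
  qed
  ultimately show ?thesis using orth_projectorD(2) by metis
qed

text \<open>The data of the theorem, collected so that facts about one chart can be used for two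
  index triples at once in the transition maps.\<close>

locale section_atlas =
  fixes Hp Hm :: "'a::complex_hilbert set"
    and I :: "'i set" and J :: "'j set"
    and V :: "'i \<Rightarrow> ('a \<Rightarrow>\<^sub>L 'a) set"
    and \<psi> :: "'i \<Rightarrow> ('a \<Rightarrow>\<^sub>L 'a) \<Rightarrow> ('a \<Rightarrow>\<^sub>L 'a)"
    and \<Omega> :: "'j \<Rightarrow> 'a set set"
    and \<sigma> :: "'j \<Rightarrow> 'a set \<Rightarrow> ('a \<Rightarrow>\<^sub>L 'a)"
    and W :: "'j \<Rightarrow> 'a set"
    and Dom :: "'i \<Rightarrow> 'j \<Rightarrow> 'j \<Rightarrow> ('a \<Rightarrow>\<^sub>L 'a) set"
    and \<Phi> :: "'i \<Rightarrow> 'j \<Rightarrow> 'j \<Rightarrow> ('a \<Rightarrow>\<^sub>L 'a) \<Rightarrow> ('a \<Rightarrow>\<^sub>L 'a) \<times> ('a \<Rightarrow>\<^sub>L 'a) \<times> ('a \<Rightarrow>\<^sub>L 'a)"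
  assumes Hp: "closed_csubspace Hp"
    and V_open: "\<And>\<alpha>. \<alpha> \<in> I \<Longrightarrow> openin (top_of_set (U_plus Hp)) (V \<alpha>)"
    and V_atlas: "atlas_of_manifold (U_plus Hp) (U_plus_atlas Hp)
                    ((\<lambda>\<alpha>. Chart (V \<alpha>) (\<psi> \<alpha>) (lie_u_plus Hp)) ` I)"
    and Omega_open: "\<And>\<beta>. \<beta> \<in> J \<Longrightarrow>
                       openin (atlas_topology (Gr_res Hp Hm) (Gr_atlas Hp Hm)) (\<Omega> \<beta>)"
    and Omega_cover: "(\<Union>\<beta>\<in>J. \<Omega> \<beta>) = Gr_res Hp Hm"
    and sigma_smooth: "\<And>\<beta>. \<beta> \<in> J \<Longrightarrow>
                         smooth_map (Gr_res Hp Hm) (Gr_atlas Hp Hm) (\<Omega> \<beta>) (U_res_atlas Hp) (\<sigma> \<beta>)"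
    and sigma_section: "\<And>\<beta> X. \<beta> \<in> J \<Longrightarrow> X \<in> \<Omega> \<beta> \<Longrightarrow> blinfun_apply (\<sigma> \<beta> X) ` Hp = X"
    and W_center: "\<And>\<beta>. \<beta> \<in> J \<Longrightarrow> W \<beta> \<in> \<Omega> \<beta> \<and> \<Omega> \<beta> \<subseteq> graph_dom Hp Hm (W \<beta>)"
    and Dom_def: "\<And>\<alpha> \<beta> \<gamma>. Dom \<alpha> \<beta> \<gamma> =
                    {u \<in> PI_res Hp Hm. ini u \<in> \<Omega> \<beta> \<and> fin u \<in> \<Omega> \<gamma> \<and>
                       middle Hp (\<sigma> \<beta>) (\<sigma> \<gamma>) u \<in> V \<alpha>}"
    and Phi_def: "\<And>\<alpha> \<beta> \<gamma> u. \<Phi> \<alpha> \<beta> \<gamma> u =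
                    (graph_coord (W \<gamma>) (fin u), graph_coord (W \<beta>) (ini u),
                     \<psi> \<alpha> (middle Hp (\<sigma> \<beta>) (\<sigma> \<gamma>) u))"
begin

abbreviation "Gr \<equiv> Gr_res Hp Hm"
abbreviation "Gr_top \<equiv> atlas_topology Gr (Gr_atlas Hp Hm)"
abbreviation "L \<equiv> lie_u_plus Hp"
abbreviation "E \<beta> \<equiv> L2_perp (W \<beta>)"
abbreviation "ch \<beta> \<equiv> graph_coord (W \<beta>)"

text \<open>Decodes a graph coordinate over \<open>W \<beta>\<close> into the subspace; restricting
  to \<open>\<Omega> \<beta>\<close> makes it take values where the section is defined.\<close>

definition dg :: "'j \<Rightarrow> ('a \<Rightarrow>\<^sub>L 'a) \<Rightarrow> 'a set" where "dg \<beta> = inv_into (\<Omega> \<beta>) (ch \<beta>)"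

lemmas nE = normed_L2_perp and nL = normed_lie_u_plus[of Hp] and nO = normed_op_space

section \<open>Grassmannian coordinates, and the sections as operator-valued maps\<close>

lemma U_plus_unitaries: "U_plus Hp = unitaries (proj Hp)" by (simp add: U_plus_def)

lemma Gr_closed: "X \<in> Gr \<Longrightarrow> closed_csubspace X" by (simp add: Gr_res_def)

lemma graph_coord_inj_on:
  assumes "X \<in> Gr" shows "inj_on (graph_coord X) (graph_dom Hp Hm X)"
  by (rule inj_onI, rule graph_coord_inj[OF Gr_closed[OF assms]]) (auto simp: graph_dom_def Gr_closed)

lemma openin_Gr:
  "openin Gr_top S \<longleftrightarrow> S \<subseteq> Gr \<and> (\<forall>X\<in>Gr. openin (ntop (L2_perp X)) (graph_coord X ` (S \<inter> graph_dom Hp Hm X)))"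
  by (subst openin_atlas_topology) (auto simp: Gr_atlas_def graph_coord_inj_on)

lemma Omega_Gr: "\<beta> \<in> J \<Longrightarrow> X \<in> \<Omega> \<beta> \<Longrightarrow> X \<in> Gr"
  using Omega_cover by blast

lemma W_Gr: "\<beta> \<in> J \<Longrightarrow> W \<beta> \<in> Gr"
  using Omega_Gr[OF _ conjunct1[OF W_center]] .

lemma ch_inj: "\<beta> \<in> J \<Longrightarrow> inj_on (ch \<beta>) (\<Omega> \<beta>)"
  by (rule inj_on_subset[OF graph_coord_inj_on[OF W_Gr]]) (simp_all add: W_center)

lemma dg_ch: "\<beta> \<in> J \<Longrightarrow> X \<in> \<Omega> \<beta> \<Longrightarrow> dg \<beta> (ch \<beta> X) = X"
  by (simp add: dg_def ch_inj)

lemma dg_mem: "A \<in> ch \<beta> ` \<Omega> \<beta> \<Longrightarrow> dg \<beta> A \<in> \<Omega> \<beta>"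
  by (simp add: dg_def inv_into_into)

lemma ch_dg: "A \<in> ch \<beta> ` \<Omega> \<beta> \<Longrightarrow> ch \<beta> (dg \<beta> A) = A"
  by (simp add: dg_def f_inv_into_f)

lemma ch_open:
  assumes "\<beta> \<in> J" "openin Gr_top N" "N \<subseteq> \<Omega> \<beta>"
  shows "openin (ntop (E \<beta>)) (ch \<beta> ` N)"
proof -
  have "N \<inter> graph_dom Hp Hm (W \<beta>) = N" using assms(3) W_center[OF assms(1)] by blast
  moreover have "openin (ntop (E \<beta>)) (ch \<beta> ` (N \<inter> graph_dom Hp Hm (W \<beta>)))"
    using assms(2) W_Gr[OF assms(1)] unfolding openin_Gr by blast
  ultimately show ?thesis by simp
qed

text \<open>\<open>X\<close> is any base point, not only some \<open>W \<gamma>\<close>, because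
  smoothness of a section is given in charts of the full Grassmannian atlas.\<close>

lemma chart_change:
  assumes \<beta>: "\<beta> \<in> J" and N: "openin Gr_top N" "N \<subseteq> \<Omega> \<beta>" and X: "X \<in> Gr" "N \<subseteq> graph_dom Hp Hm X"
    and A: "A \<in> ch \<beta> ` N"
  shows "smooth_at (E \<beta>) (L2_perp X) (\<lambda>A. graph_coord X (dg \<beta> A)) A"
proof (rule graph_change_smooth_at[OF Gr_closed[OF W_Gr[OF \<beta>]] Gr_closed[OF X(1)] ch_open[OF \<beta> N] A])
  fix A assume A: "A \<in> ch \<beta> ` N"
  then obtain Y where Y: "Y \<in> N" "A = ch \<beta> Y" by blast
  have dY: "dg \<beta> A = Y" using Y(1) N(2) unfolding Y(2) by (intro dg_ch[OF \<beta>]) blast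
  have Y1: "Y \<in> graph_dom Hp Hm (W \<beta>)" "Y \<in> graph_dom Hp Hm X" using Y N X W_center[OF \<beta>] by auto
  \<comment> \<open>That coordinates over \<open>X\<close> are Hilbert-Schmidt is read off from
    openness of \<open>N\<close>: the coordinate image of an open set lies in the model
    space.\<close>
  have "openin (ntop (L2_perp X)) (graph_coord X ` (N \<inter> graph_dom Hp Hm X))" using N(1) X(1) by (simp add: openin_Gr)
  then have "graph_coord X ` (N \<inter> graph_dom Hp Hm X) \<subseteq> vecs (L2_perp X)"
    by (rule normed_nspace.openin_vecs[OF normed_L2_perp])
  then show "closed_csubspace (dg \<beta> A) \<and> invertible_between (dg \<beta> A) (W \<beta>) (proj (W \<beta>)) \<and>
      invertible_between (dg \<beta> A) X (proj X) \<and> graph_coord (W \<beta>) (dg \<beta> A) = A \<and>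
      graph_coord X (dg \<beta> A) \<in> vecs (L2_perp X)"
    using Y Y1 unfolding dY by (auto simp: graph_dom_def Gr_closed)
qed

lemma sigma_unitary:
  assumes "\<beta> \<in> J" "X \<in> \<Omega> \<beta>"
  shows "\<sigma> \<beta> X \<in> unitaries id_blinfun"
proof -
  obtain d N where "d \<in> U_res_atlas Hp" "X \<in> N" "\<sigma> \<beta> ` N \<subseteq> chart_dom d"
    using sigma_smooth[OF assms(1)] assms(2) unfolding smooth_map_def by meson
  then have "\<sigma> \<beta> X \<in> U_res Hp" by (auto simp: U_res_atlas_def cayley_chart_simps)
  then show ?thesis by (simp add: U_res_def)
qed

text \<open>Change from the base point \<open>W \<beta>\<close> to the base point of the chart
  supplied by \<open>smooth_map\<close>, pass from the norm of \<open>lie_u_res\<close> to the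
  operator norm, and undo the Cayley coordinate.\<close>

lemma sigma_smooth_at:
  assumes \<beta>: "\<beta> \<in> J" and A: "A \<in> ch \<beta> ` \<Omega> \<beta>"
  shows "smooth_at (E \<beta>) op_space (\<lambda>A. \<sigma> \<beta> (dg \<beta> A)) A"
proof -
  have "dg \<beta> A \<in> \<Omega> \<beta>" by (rule dg_mem[OF A])
  then obtain c d N where c: "c \<in> Gr_atlas Hp Hm" and d: "d \<in> U_res_atlas Hp" and N: "openin Gr_top N" "dg \<beta> A \<in> N"
    "N \<subseteq> chart_dom c \<inter> \<Omega> \<beta>" "\<sigma> \<beta> ` N \<subseteq> chart_dom d"
    and s: "smooth_on (model c) (model d) (coord c ` N) (coord d \<circ> \<sigma> \<beta> \<circ> inv_into (chart_dom c) (coord c))"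
    using sigma_smooth[OF \<beta>] unfolding smooth_map_def by meson
  obtain X where X: "X \<in> Gr" "c = Chart (graph_dom Hp Hm X) (graph_coord X) (L2_perp X)"
    using c by (auto simp: Gr_atlas_def)
  obtain g where g: "g \<in> U_res Hp" "d = cayley_chart id_blinfun (U_res Hp) (lie_u_res Hp) g"
    using d by (auto simp: U_res_atlas_def)
  have NX: "N \<subseteq> graph_dom Hp Hm X" "N \<subseteq> \<Omega> \<beta>" using N(3) X(2) by auto
  have md: "model d = lie_u_res Hp" by (simp add: g cayley_chart_simps)
  have AN: "A \<in> ch \<beta> ` N" using N(2) ch_dg[OF A] by force
  have oN: "openin (ntop (E \<beta>)) (ch \<beta> ` N)" by (rule ch_open[OF \<beta> N(1) NX(2)])
  have gN: "dg \<beta> B \<in> N" if "B \<in> ch \<beta> ` N" for B using that NX(2) dg_ch[OF \<beta>] by auto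
  have "smooth_on (L2_perp X) (lie_u_res Hp) (graph_coord X ` N)
      (coord d \<circ> \<sigma> \<beta> \<circ> inv_into (graph_dom Hp Hm X) (graph_coord X))"
    using s unfolding md X(2) chart.sel .
  from smooth_at_compose[OF nE nE normed_lie_u_res chart_change[OF \<beta> N(1) NX(2) X(1) NX(1) AN] this] N(2)
  have "smooth_at (E \<beta>) (lie_u_res Hp)
      (\<lambda>A. (coord d \<circ> \<sigma> \<beta> \<circ> inv_into (graph_dom Hp Hm X) (graph_coord X)) (graph_coord X (dg \<beta> A))) A"
    by blast
  then have "smooth_at (E \<beta>) (lie_u_res Hp) (\<lambda>A. coord d (\<sigma> \<beta> (dg \<beta> A))) A"
  proof (rule smooth_at_cong[OF _ oN AN])
    fix B assume "B \<in> ch \<beta> ` N"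
    then have "dg \<beta> B \<in> graph_dom Hp Hm X" using gN NX(1) by blast
    then show "(coord d \<circ> \<sigma> \<beta> \<circ> inv_into (graph_dom Hp Hm X) (graph_coord X)) (graph_coord X (dg \<beta> B)) =
        coord d (\<sigma> \<beta> (dg \<beta> B))"
      using inv_into_f_f[OF graph_coord_inj_on[OF X(1)]] by simp
  qed
  from smooth_at_linear[OF nE normed_lie_u_res nO this bounded_linear_lie_u_res_op]
  have x: "smooth_at (E \<beta>) op_space (\<lambda>A. coord (cayley_chart id_blinfun (U_res Hp) (lie_u_res Hp) g) (\<sigma> \<beta> (dg \<beta> A))) A"
    by (simp add: g(2))
  show ?thesis
  proof (rule smooth_at_cayley_inverse[OF nE orth_projector_id _ oN AN _ x])
    show "g \<in> unitaries id_blinfun" using g(1) by (simp add: U_res_def)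
    fix B assume "B \<in> ch \<beta> ` N"
    then have "dg \<beta> B \<in> N" by (rule gN)
    then show "\<sigma> \<beta> (dg \<beta> B) \<in> unitaries id_blinfun \<and>
        \<sigma> \<beta> (dg \<beta> B) \<in> chart_dom (cayley_chart id_blinfun (U_res Hp) (lie_u_res Hp) g)"
      using N(4) g(2) sigma_unitary[OF \<beta>] NX(2) by blast
  qed
qed

lemma sigma_smooth_on: "\<beta> \<in> J \<Longrightarrow> smooth_on (E \<beta>) op_space (ch \<beta> ` \<Omega> \<beta>) (\<lambda>A. \<sigma> \<beta> (dg \<beta> A))"
  unfolding smooth_on_iff_smooth_at[OF nE nO]
  by (intro conjI ballI ch_open[OF _ Omega_open order.refl] sigma_smooth_at)

lemma Omega_Int_open: "\<beta> \<in> J \<Longrightarrow> \<beta>' \<in> J \<Longrightarrow> openin Gr_top (\<Omega> \<beta> \<inter> \<Omega> \<beta>')"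
  by (intro openin_Int Omega_open)

lemma ch_change_smooth_on:
  assumes "\<beta> \<in> J" "\<beta>' \<in> J"
  shows "smooth_on (E \<beta>) (E \<beta>') (ch \<beta> ` (\<Omega> \<beta> \<inter> \<Omega> \<beta>')) (\<lambda>A. ch \<beta>' (dg \<beta> A))"
  unfolding smooth_on_iff_smooth_at[OF nE nE]
proof (intro conjI ballI)
  show "openin (ntop (E \<beta>)) (ch \<beta> ` (\<Omega> \<beta> \<inter> \<Omega> \<beta>'))"
    by (rule ch_open[OF assms(1) Omega_Int_open[OF assms] Int_lower1])
  have "\<Omega> \<beta> \<inter> \<Omega> \<beta>' \<subseteq> graph_dom Hp Hm (W \<beta>')" using W_center[OF assms(2)] by auto
  then show "smooth_at (E \<beta>) (E \<beta>') (\<lambda>A. ch \<beta>' (dg \<beta> A)) A" if "A \<in> ch \<beta> ` (\<Omega> \<beta> \<inter> \<Omega> \<beta>')" for A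
    by (rule chart_change[OF assms(1) Omega_Int_open[OF assms] Int_lower1 W_Gr[OF assms(2)] _ that])
qed

text \<open>A transition map uses the sections of both charts in the coordinates of the first; this
  provides the second section there.\<close>

lemma sigma_change_smooth_on:
  assumes "\<beta> \<in> J" "\<beta>' \<in> J"
  shows "smooth_on (E \<beta>) op_space (ch \<beta> ` (\<Omega> \<beta> \<inter> \<Omega> \<beta>')) (\<lambda>A. \<sigma> \<beta>' (dg \<beta> A))"
  unfolding smooth_on_iff_smooth_at[OF nE nO]
proof (intro conjI ballI)
  let ?N = "\<Omega> \<beta> \<inter> \<Omega> \<beta>'"
  show o: "openin (ntop (E \<beta>)) (ch \<beta> ` ?N)" by (rule ch_open[OF assms(1) Omega_Int_open[OF assms]]) simp
  fix A assume A: "A \<in> ch \<beta> ` ?N"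
  have g: "dg \<beta> B \<in> ?N" if "B \<in> ch \<beta> ` ?N" for B using that dg_ch[OF assms(1)] by auto
  have "smooth_at (E \<beta>) (E \<beta>') (\<lambda>A. ch \<beta>' (dg \<beta> A)) A"
    using ch_change_smooth_on[OF assms] A unfolding smooth_on_iff_smooth_at[OF nE nE] by blast
  from smooth_at_compose[OF nE nE nO this sigma_smooth_on[OF assms(2)]] g[OF A]
  have "smooth_at (E \<beta>) op_space (\<lambda>A. \<sigma> \<beta>' (dg \<beta>' (ch \<beta>' (dg \<beta> A)))) A" by blast
  then show "smooth_at (E \<beta>) op_space (\<lambda>A. \<sigma> \<beta>' (dg \<beta> A)) A"
    by (rule smooth_at_cong[OF _ o A]) (use g dg_ch[OF assms(2)] in auto)
qed

section \<open>Charts of the unitary group of \<open>Hp\<close> against operator-valued maps\<close>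

lemma V_chart:
  assumes "\<alpha> \<in> I"
  shows "V \<alpha> \<subseteq> U_plus Hp" "inj_on (\<psi> \<alpha>) (V \<alpha>)" "openin (ntop L) (\<psi> \<alpha> ` V \<alpha>)"
  using V_atlas assms unfolding atlas_of_manifold_def smooth_atlas_def is_chart_def by auto

lemma V_cover: "(\<Union>\<alpha>\<in>I. V \<alpha>) = U_plus Hp"
  using V_atlas unfolding atlas_of_manifold_def smooth_atlas_def by auto

abbreviation "cay v \<equiv> cayley_chart (proj Hp) (U_plus Hp) L v"

lemma V_compatible:
  assumes "\<alpha> \<in> I" "v \<in> U_plus Hp"
  shows "smooth_on L L (\<psi> \<alpha> ` (V \<alpha> \<inter> chart_dom (cay v))) (coord (cay v) \<circ> inv_into (V \<alpha>) (\<psi> \<alpha>))"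
    and "smooth_on L L (coord (cay v) ` (V \<alpha> \<inter> chart_dom (cay v))) (\<psi> \<alpha> \<circ> inv_into (chart_dom (cay v)) (coord (cay v)))"
proof -
  have "cay v \<in> U_plus_atlas Hp" using assms(2) by (simp add: U_plus_atlas_def)
  then have "compatible (Chart (V \<alpha>) (\<psi> \<alpha>) L) (cay v)"
    using V_atlas assms(1) unfolding atlas_of_manifold_def by blast
  then show "smooth_on L L (\<psi> \<alpha> ` (V \<alpha> \<inter> chart_dom (cay v))) (coord (cay v) \<circ> inv_into (V \<alpha>) (\<psi> \<alpha>))"
    "smooth_on L L (coord (cay v) ` (V \<alpha> \<inter> chart_dom (cay v))) (\<psi> \<alpha> \<circ> inv_into (chart_dom (cay v)) (coord (cay v)))"
    unfolding compatible_def by (simp_all add: cayley_chart_simps(3) Int_commute)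
qed

lemmas orth_p = orth_projector_proj[OF Hp]

lemma cay_center:
  assumes "v \<in> U_plus Hp" shows "v \<in> chart_dom (cay v)"
proof -
  note vs = unitaries_simps[OF orth_p assms[unfolded U_plus_unitaries]]
  note ps = orth_projector_simps[OF orth_p]
  have "\<exists>b. inverse_in (proj Hp) (proj Hp + proj Hp) b"
    by (rule near_projector_invertible) (simp_all add: ps)
  then show ?thesis using assms by (simp add: cayley_chart_simps vs)
qed

text \<open>Near the coordinate of \<open>v\<close>, compatibility with the Cayley chart centred at
  \<open>v\<close> gives smoothness of the Cayley coordinate, from which \<open>v\<close> is
  recovered.\<close>

lemma psi_inverse_smooth_on:
  assumes \<alpha>: "\<alpha> \<in> I"
  shows "smooth_on L op_space (\<psi> \<alpha> ` V \<alpha>) (inv_into (V \<alpha>) (\<psi> \<alpha>))"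
  unfolding smooth_on_iff_smooth_at[OF nL nO]
proof (intro conjI ballI)
  show "openin (ntop L) (\<psi> \<alpha> ` V \<alpha>)" by (rule V_chart[OF \<alpha>])
  fix x assume "x \<in> \<psi> \<alpha> ` V \<alpha>"
  then obtain v where v: "v \<in> V \<alpha>" "x = \<psi> \<alpha> v" by blast
  then have vU: "v \<in> U_plus Hp" using V_chart(1)[OF \<alpha>] by blast
  let ?N = "\<psi> \<alpha> ` (V \<alpha> \<inter> chart_dom (cay v))"
  have s: "openin (ntop L) ?N" "\<forall>x\<in>?N. smooth_at L L (coord (cay v) \<circ> inv_into (V \<alpha>) (\<psi> \<alpha>)) x"
    using V_compatible(1)[OF \<alpha> vU] unfolding smooth_on_iff_smooth_at[OF nL nL] by auto
  have xN: "x \<in> ?N" using v cay_center[OF vU] by blast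
  have "smooth_at L op_space (\<lambda>x. (coord (cay v) \<circ> inv_into (V \<alpha>) (\<psi> \<alpha>)) x) x"
    by (rule smooth_at_linear[OF nL nL nO _ bounded_linear_lie_u_plus_op]) (use s(2) xN in \<open>auto simp: o_def\<close>)
  then have sx: "smooth_at L op_space (\<lambda>x. coord (cay v) (inv_into (V \<alpha>) (\<psi> \<alpha>) x)) x" by (simp add: o_def)
  show "smooth_at L op_space (inv_into (V \<alpha>) (\<psi> \<alpha>)) x"
  proof (rule smooth_at_cayley_inverse[OF nL orth_p vU[unfolded U_plus_unitaries] s(1) xN _ sx])
    fix y assume "y \<in> ?N"
    then obtain w where w: "w \<in> V \<alpha>" "w \<in> chart_dom (cay v)" "y = \<psi> \<alpha> w" by blast
    then have "inv_into (V \<alpha>) (\<psi> \<alpha>) y = w" using inv_into_f_f[OF V_chart(2)[OF \<alpha>]] by blast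
    then show "inv_into (V \<alpha>) (\<psi> \<alpha>) y \<in> unitaries (proj Hp) \<and> inv_into (V \<alpha>) (\<psi> \<alpha>) y \<in> chart_dom (cay v)"
      using w V_chart(1)[OF \<alpha>] by (auto simp: U_plus_unitaries)
  qed
qed

text \<open>Smoothness in operator norm yields a smooth Cayley coordinate, the retraction onto
  \<open>lie_u_plus Hp\<close> makes it smooth in the model space, and compatibility replaces the
  Cayley coordinate by \<open>\<psi> \<alpha>\<close>.\<close>

lemma psi_smooth_at:
  assumes \<alpha>: "\<alpha> \<in> I" and n: "normed_nspace F" and N: "openin (ntop F) N" "p \<in> N"
    and f: "\<And>y. y \<in> N \<Longrightarrow> f y \<in> V \<alpha>" and s: "smooth_at F op_space f p"
  shows "smooth_at F L (\<lambda>y. \<psi> \<alpha> (f y)) p"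
proof -
  have fU: "f y \<in> unitaries (proj Hp)" if "y \<in> N" for y
    using f[OF that] V_chart(1)[OF \<alpha>] by (auto simp: U_plus_unitaries)
  define v where "v = f p"
  have vU: "v \<in> U_plus Hp" using fU[OF N(2)] by (simp add: v_def U_plus_unitaries)
  obtain M where M: "openin (ntop F) M" "p \<in> M" "M \<subseteq> N" "\<forall>y\<in>M. f y \<in> chart_dom (cay v)"
    and sc: "smooth_at F op_space (\<lambda>y. coord (cay v) (f y)) p"
    unfolding U_plus_unitaries v_def by (rule smooth_at_cayley[OF n orth_p N fU s])
  let ?U = "coord (cay v) ` (V \<alpha> \<inter> chart_dom (cay v))"
  have U: "coord (cay v) (f y) \<in> ?U" if "y \<in> M" for y using that M f by blast
  have "openin (ntop L) ?U" using V_compatible(2)[OF \<alpha> vU] by (simp add: smooth_on_def)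
  then have UL: "?U \<subseteq> vecs L" by (rule normed_nspace.openin_vecs[OF nL])
  have pr: "(1 / 2) *\<^sub>R (proj Hp o\<^sub>L (x - cadj x) o\<^sub>L proj Hp) = x" if "x \<in> vecs L" for x
  proof -
    have "x - cadj x = 2 *\<^sub>R x" using that by (simp add: lie_u_plus_simps scaleR_2)
    then show ?thesis using that by (simp add: lie_u_plus_simps blinfun_compose_simps)
  qed
  have "smooth_at F L (\<lambda>y. (1 / 2) *\<^sub>R (proj Hp o\<^sub>L (coord (cay v) (f y) - cadj (coord (cay v) (f y))) o\<^sub>L proj Hp)) p"
    by (rule smooth_at_linear[OF n nO nL sc bounded_linear_op_lie_u_plus[OF Hp]])
  then have "smooth_at F L (\<lambda>y. coord (cay v) (f y)) p"
    by (rule smooth_at_cong[OF _ M(1,2)]) (use pr U UL in blast)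
  from smooth_at_compose[OF n nL nL this V_compatible(2)[OF \<alpha> vU] U[OF M(2)]]
  show ?thesis
  proof (rule smooth_at_cong[OF _ M(1,2)])
    fix y assume "y \<in> M"
    have "inj_on (coord (cay v)) (chart_dom (cay v))"
      by (rule cayley_inj_on[OF orth_p vU[unfolded U_plus_unitaries]]) (simp add: U_plus_unitaries)
    from inv_into_f_f[OF this] M(4) \<open>y \<in> M\<close>
    show "(\<psi> \<alpha> \<circ> inv_into (chart_dom (cay v)) (coord (cay v))) (coord (cay v) (f y)) = \<psi> \<alpha> (f y)" by simp
  qed
qed

subsection \<open>Reconstruction of a partial isometry from its coordinates\<close>

lemma middle_eq:
  assumes "\<gamma> \<in> J" "fin u \<in> \<Omega> \<gamma>"
  shows "middle Hp s (\<sigma> \<gamma>) u = cadj (\<sigma> \<gamma> (fin u)) o\<^sub>L u o\<^sub>L s (ini u) o\<^sub>L proj Hp"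
  by (simp add: middle_def unitaries_simps(9)[OF orth_projector_id sigma_unitary[OF assms]])

text \<open>The section property makes the conjugates of \<open>proj Hp\<close> by the two sections
  equal to the initial and final projectors of \<open>u\<close>. With these two identities all
  claims are associativity.\<close>

lemma PI_decompose:
  assumes \<beta>: "\<beta> \<in> J" and \<gamma>: "\<gamma> \<in> J" and u: "u \<in> PI_res Hp Hm" and i: "ini u \<in> \<Omega> \<beta>" and f: "fin u \<in> \<Omega> \<gamma>"
  shows "middle Hp (\<sigma> \<beta>) (\<sigma> \<gamma>) u \<in> U_plus Hp"
    and "u = \<sigma> \<gamma> (fin u) o\<^sub>L middle Hp (\<sigma> \<beta>) (\<sigma> \<gamma>) u o\<^sub>L cadj (\<sigma> \<beta> (ini u))"
proof -
  define s where "s = \<sigma> \<beta> (ini u)"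
  define t where "t = \<sigma> \<gamma> (fin u)"
  define m where "m = middle Hp (\<sigma> \<beta>) (\<sigma> \<gamma>) u"
  let ?p = "proj Hp"
  have "partial_isometry u" using u by (simp add: PI_res_def)
  note us = partial_isometryD[OF this]
  have su: "s \<in> unitaries id_blinfun" "t \<in> unitaries id_blinfun"
    unfolding s_def t_def by (rule sigma_unitary[OF \<beta> i], rule sigma_unitary[OF \<gamma> f])
  note ss = unitaries_simps[OF orth_projector_id su(1)] and ts = unitaries_simps[OF orth_projector_id su(2)]
  note p = clinear_proj[OF Hp] proj_idem[OF Hp] cadj_proj[OF Hp]
  have m: "m = cadj t o\<^sub>L u o\<^sub>L s o\<^sub>L ?p" using middle_eq[OF \<gamma> f] by (simp add: m_def s_def t_def)
  have sP: "s o\<^sub>L ?p o\<^sub>L cadj s = cadj u o\<^sub>L u"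
    unfolding us(3) by (rule unitary_conjugate_proj[OF su(1) Hp]) (unfold s_def, rule sigma_section[OF \<beta> i])
  have tQ: "t o\<^sub>L ?p o\<^sub>L cadj t = u o\<^sub>L cadj u"
    unfolding us(4) by (rule unitary_conjugate_proj[OF su(2) Hp]) (unfold t_def, rule sigma_section[OF \<gamma> f])
  have uu: "u o\<^sub>L (cadj u o\<^sub>L u) = u" unfolding us(3) by (rule us(5))
  have mc: "cadj m = ?p o\<^sub>L cadj s o\<^sub>L cadj u o\<^sub>L t"
    unfolding m using ss ts us p by (simp add: cadj_comp blinfun_compose_assoc)
  \<comment> \<open>The adjoint section intertwines the final projector of \<open>u\<close> with
    \<open>proj Hp\<close>.\<close>
  have pt: "?p o\<^sub>L cadj t = cadj t o\<^sub>L (u o\<^sub>L cadj u)"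
  proof -
    have "cadj t o\<^sub>L (u o\<^sub>L cadj u) = (cadj t o\<^sub>L t) o\<^sub>L ?p o\<^sub>L cadj t" unfolding tQ[symmetric] by (simp only: blinfun_compose_assoc)
    then show ?thesis by (simp add: ts)
  qed
  have pm: "?p o\<^sub>L m = m"
  proof -
    have "?p o\<^sub>L m = (?p o\<^sub>L cadj t) o\<^sub>L u o\<^sub>L s o\<^sub>L ?p" unfolding m by (simp only: blinfun_compose_assoc)
    also have "\<dots> = cadj t o\<^sub>L (u o\<^sub>L (cadj u o\<^sub>L u)) o\<^sub>L s o\<^sub>L ?p" unfolding pt by (simp only: blinfun_compose_assoc)
    finally show ?thesis unfolding uu m .
  qed
  have mp: "m o\<^sub>L ?p = m" unfolding m by (simp only: blinfun_compose_assoc p)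
  have "cadj m o\<^sub>L m = ?p o\<^sub>L cadj s o\<^sub>L cadj u o\<^sub>L (t o\<^sub>L cadj t) o\<^sub>L u o\<^sub>L s o\<^sub>L ?p"
    unfolding mc unfolding m by (simp only: blinfun_compose_assoc)
  also have "\<dots> = ?p o\<^sub>L cadj s o\<^sub>L (cadj u o\<^sub>L u) o\<^sub>L s o\<^sub>L ?p" by (simp add: ts(4) blinfun_compose_assoc)
  also have "\<dots> = ?p o\<^sub>L (cadj s o\<^sub>L s) o\<^sub>L ?p o\<^sub>L (cadj s o\<^sub>L s) o\<^sub>L ?p"
    unfolding sP[symmetric] by (simp only: blinfun_compose_assoc)
  also have "\<dots> = ?p" by (simp add: ss(3) p(2))
  finally have 1: "cadj m o\<^sub>L m = ?p" .
  have "m o\<^sub>L cadj m = cadj t o\<^sub>L u o\<^sub>L (s o\<^sub>L (?p o\<^sub>L ?p) o\<^sub>L cadj s) o\<^sub>L cadj u o\<^sub>L t"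
    unfolding mc unfolding m by (simp only: blinfun_compose_assoc)
  also have "\<dots> = cadj t o\<^sub>L (u o\<^sub>L (cadj u o\<^sub>L u)) o\<^sub>L cadj u o\<^sub>L t"
    unfolding p(2) sP by (simp only: blinfun_compose_assoc)
  also have "\<dots> = cadj t o\<^sub>L (u o\<^sub>L cadj u) o\<^sub>L t" unfolding uu by (simp only: blinfun_compose_assoc)
  also have "\<dots> = (cadj t o\<^sub>L t) o\<^sub>L ?p o\<^sub>L (cadj t o\<^sub>L t)" unfolding tQ[symmetric] by (simp only: blinfun_compose_assoc)
  also have "\<dots> = ?p" by (simp add: ts)
  finally have 2: "m o\<^sub>L cadj m = ?p" .
  have "clinear_op m" unfolding m using ss ts us p by simp
  then have "m \<in> U_plus Hp" using 1 2 pm mp by (simp add: U_plus_def unitaries_def)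
  then show "middle Hp (\<sigma> \<beta>) (\<sigma> \<gamma>) u \<in> U_plus Hp" by (simp add: m_def)
  have "t o\<^sub>L m o\<^sub>L cadj s = (t o\<^sub>L cadj t) o\<^sub>L u o\<^sub>L (s o\<^sub>L ?p o\<^sub>L cadj s)"
    unfolding m by (simp only: blinfun_compose_assoc)
  also have "\<dots> = u" unfolding sP by (simp add: ts(4) uu)
  finally show "u = \<sigma> \<gamma> (fin u) o\<^sub>L middle Hp (\<sigma> \<beta>) (\<sigma> \<gamma>) u o\<^sub>L cadj (\<sigma> \<beta> (ini u))"
    by (simp add: m_def s_def t_def)
qed

lemma PI_compose:
  assumes \<beta>: "\<beta> \<in> J" and \<gamma>: "\<gamma> \<in> J" and P: "P \<in> \<Omega> \<beta>" and Q: "Q \<in> \<Omega> \<gamma>" and v: "v \<in> U_plus Hp"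
  defines "u \<equiv> \<sigma> \<gamma> Q o\<^sub>L v o\<^sub>L cadj (\<sigma> \<beta> P)"
  shows "u \<in> PI_res Hp Hm" "ini u = P" "fin u = Q" "middle Hp (\<sigma> \<beta>) (\<sigma> \<gamma>) u = v"
proof -
  define s where "s = \<sigma> \<beta> P"
  define t where "t = \<sigma> \<gamma> Q"
  let ?p = "proj Hp"
  have su: "s \<in> unitaries id_blinfun" "t \<in> unitaries id_blinfun"
    unfolding s_def t_def by (rule sigma_unitary[OF \<beta> P], rule sigma_unitary[OF \<gamma> Q])
  note ss = unitaries_simps[OF orth_projector_id su(1)] and ts = unitaries_simps[OF orth_projector_id su(2)]
  note vs = unitaries_simps[OF orth_p v[unfolded U_plus_unitaries]]
  have PQ: "closed_csubspace P" "closed_csubspace Q" "P \<in> Gr" "Q \<in> Gr"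
    using Omega_Gr[OF \<beta> P] Omega_Gr[OF \<gamma> Q] Gr_closed by auto
  have sP: "s o\<^sub>L ?p o\<^sub>L cadj s = proj P"
    by (rule unitary_conjugate_proj[OF su(1) Hp]) (unfold s_def, rule sigma_section[OF \<beta> P])
  have tQ: "t o\<^sub>L ?p o\<^sub>L cadj t = proj Q"
    by (rule unitary_conjugate_proj[OF su(2) Hp]) (unfold t_def, rule sigma_section[OF \<gamma> Q])
  have u: "u = t o\<^sub>L v o\<^sub>L cadj s" by (simp add: u_def s_def t_def)
  have uc: "clinear_op u" using ss ts vs by (simp add: u)
  have ua: "cadj u = s o\<^sub>L cadj v o\<^sub>L cadj t" unfolding u using ss ts vs by (simp add: cadj_comp blinfun_compose_assoc)
  have "cadj u o\<^sub>L u = s o\<^sub>L cadj v o\<^sub>L (cadj t o\<^sub>L t) o\<^sub>L v o\<^sub>L cadj s" unfolding ua unfolding u by (simp only: blinfun_compose_assoc)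
  also have "\<dots> = s o\<^sub>L (cadj v o\<^sub>L v) o\<^sub>L cadj s" by (simp add: ts(3) blinfun_compose_assoc)
  finally have 1: "cadj u o\<^sub>L u = proj P" by (simp only: vs(3) sP)
  have "u o\<^sub>L cadj u = t o\<^sub>L v o\<^sub>L (cadj s o\<^sub>L s) o\<^sub>L cadj v o\<^sub>L cadj t" unfolding ua unfolding u by (simp only: blinfun_compose_assoc)
  also have "\<dots> = t o\<^sub>L (v o\<^sub>L cadj v) o\<^sub>L cadj t" by (simp add: ss(3) blinfun_compose_assoc)
  finally have 2: "u o\<^sub>L cadj u = proj Q" by (simp only: vs(4) tQ)
  show i: "ini u = P" and f: "fin u = Q"
    by (simp_all add: ini_def fin_def 1 2 range_proj[OF PQ(1)] range_proj[OF PQ(2)])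
  show "u \<in> PI_res Hp Hm"
    using i f PQ uc 1 orth_projector_proj[OF PQ(1)] by (simp add: PI_res_def partial_isometry_def)
  have "middle Hp (\<sigma> \<beta>) (\<sigma> \<gamma>) u = cadj t o\<^sub>L u o\<^sub>L s o\<^sub>L ?p"
    using middle_eq[OF \<gamma>, of u "\<sigma> \<beta>"] i f Q by (simp add: s_def t_def)
  also have "\<dots> = (cadj t o\<^sub>L t) o\<^sub>L v o\<^sub>L (cadj s o\<^sub>L s) o\<^sub>L ?p" unfolding u by (simp only: blinfun_compose_assoc)
  also have "\<dots> = v" by (simp add: ts(3) ss(3) vs)
  finally show "middle Hp (\<sigma> \<beta>) (\<sigma> \<gamma>) u = v" .
qed

text \<open>The inverse of the chart. The first component of \<open>z\<close> encodes the final
  space, the second the initial one, in the order of \<open>\<Phi>\<close>.\<close>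

definition \<Theta> :: "'i \<Rightarrow> 'j \<Rightarrow> 'j \<Rightarrow> ('a \<Rightarrow>\<^sub>L 'a) \<times> ('a \<Rightarrow>\<^sub>L 'a) \<times> ('a \<Rightarrow>\<^sub>L 'a) \<Rightarrow> ('a \<Rightarrow>\<^sub>L 'a)"
  where "\<Theta> \<alpha> \<beta> \<gamma> z = \<sigma> \<gamma> (dg \<gamma> (fst z)) o\<^sub>L inv_into (V \<alpha>) (\<psi> \<alpha>) (snd (snd z)) o\<^sub>L cadj (\<sigma> \<beta> (dg \<beta> (fst (snd z))))"

abbreviation "Img \<alpha> \<beta> \<gamma> \<equiv> (ch \<gamma> ` \<Omega> \<gamma>) \<times> (ch \<beta> ` \<Omega> \<beta>) \<times> (\<psi> \<alpha> ` V \<alpha>)"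

abbreviation "Mod \<beta> \<gamma> \<equiv> prod_nspace (E \<gamma>) (prod_nspace (E \<beta>) L)"

lemma nP: "normed_nspace (prod_nspace (E \<beta>) L)" "normed_nspace (Mod \<beta> \<gamma>)"
  by (intro normed_prod_nspace nE nL)+

context
  fixes \<alpha> \<beta> \<gamma> assumes \<alpha>: "\<alpha> \<in> I" and \<beta>: "\<beta> \<in> J" and \<gamma>: "\<gamma> \<in> J"
begin

lemma Theta_props:
  assumes "z \<in> Img \<alpha> \<beta> \<gamma>"
  shows "\<Theta> \<alpha> \<beta> \<gamma> z \<in> PI_res Hp Hm" "ini (\<Theta> \<alpha> \<beta> \<gamma> z) = dg \<beta> (fst (snd z))" "fin (\<Theta> \<alpha> \<beta> \<gamma> z) = dg \<gamma> (fst z)"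
    "middle Hp (\<sigma> \<beta>) (\<sigma> \<gamma>) (\<Theta> \<alpha> \<beta> \<gamma> z) = inv_into (V \<alpha>) (\<psi> \<alpha>) (snd (snd z))"
    "\<Theta> \<alpha> \<beta> \<gamma> z \<in> Dom \<alpha> \<beta> \<gamma>" "\<Phi> \<alpha> \<beta> \<gamma> (\<Theta> \<alpha> \<beta> \<gamma> z) = z"
proof -
  obtain A B x where z: "z = (A, B, x)" "A \<in> ch \<gamma> ` \<Omega> \<gamma>" "B \<in> ch \<beta> ` \<Omega> \<beta>" "x \<in> \<psi> \<alpha> ` V \<alpha>"
    using assms by auto
  have v: "inv_into (V \<alpha>) (\<psi> \<alpha>) x \<in> V \<alpha>" "\<psi> \<alpha> (inv_into (V \<alpha>) (\<psi> \<alpha>) x) = x"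
    using z(4) by (simp_all add: inv_into_into f_inv_into_f)
  then have "inv_into (V \<alpha>) (\<psi> \<alpha>) x \<in> U_plus Hp" using V_chart(1)[OF \<alpha>] by blast
  from PI_compose[OF \<beta> \<gamma> dg_mem[OF z(3)] dg_mem[OF z(2)] this]
  have 1: "\<Theta> \<alpha> \<beta> \<gamma> z \<in> PI_res Hp Hm" and 2: "ini (\<Theta> \<alpha> \<beta> \<gamma> z) = dg \<beta> B" and 3: "fin (\<Theta> \<alpha> \<beta> \<gamma> z) = dg \<gamma> A" and
    4: "middle Hp (\<sigma> \<beta>) (\<sigma> \<gamma>) (\<Theta> \<alpha> \<beta> \<gamma> z) = inv_into (V \<alpha>) (\<psi> \<alpha>) x"
    by (simp_all add: \<Theta>_def z)
  show "\<Theta> \<alpha> \<beta> \<gamma> z \<in> PI_res Hp Hm" "ini (\<Theta> \<alpha> \<beta> \<gamma> z) = dg \<beta> (fst (snd z))" "fin (\<Theta> \<alpha> \<beta> \<gamma> z) = dg \<gamma> (fst z)"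
    "middle Hp (\<sigma> \<beta>) (\<sigma> \<gamma>) (\<Theta> \<alpha> \<beta> \<gamma> z) = inv_into (V \<alpha>) (\<psi> \<alpha>) (snd (snd z))"
    using 1 2 3 4 by (simp_all add: z(1))
  show "\<Theta> \<alpha> \<beta> \<gamma> z \<in> Dom \<alpha> \<beta> \<gamma>"
    using 1 v dg_mem[OF z(2)] dg_mem[OF z(3)] by (simp add: Dom_def 2 3 4)
  show "\<Phi> \<alpha> \<beta> \<gamma> (\<Theta> \<alpha> \<beta> \<gamma> z) = z"
    unfolding Phi_def 2 3 4 by (simp add: v ch_dg[OF z(2)] ch_dg[OF z(3)] z(1))
qed

lemma Phi_props:
  assumes "u \<in> Dom \<alpha> \<beta> \<gamma>"
  shows "\<Phi> \<alpha> \<beta> \<gamma> u \<in> Img \<alpha> \<beta> \<gamma>" "\<Theta> \<alpha> \<beta> \<gamma> (\<Phi> \<alpha> \<beta> \<gamma> u) = u"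
proof -
  have u: "u \<in> PI_res Hp Hm" "ini u \<in> \<Omega> \<beta>" "fin u \<in> \<Omega> \<gamma>" "middle Hp (\<sigma> \<beta>) (\<sigma> \<gamma>) u \<in> V \<alpha>"
    using assms unfolding Dom_def by blast+
  show "\<Phi> \<alpha> \<beta> \<gamma> u \<in> Img \<alpha> \<beta> \<gamma>" using u by (simp add: Phi_def)
  show "\<Theta> \<alpha> \<beta> \<gamma> (\<Phi> \<alpha> \<beta> \<gamma> u) = u"
  proof -
    have "\<Theta> \<alpha> \<beta> \<gamma> (\<Phi> \<alpha> \<beta> \<gamma> u) = \<sigma> \<gamma> (fin u) o\<^sub>L middle Hp (\<sigma> \<beta>) (\<sigma> \<gamma>) u o\<^sub>L cadj (\<sigma> \<beta> (ini u))"
      by (simp add: \<Theta>_def Phi_def dg_ch[OF \<beta> u(2)] dg_ch[OF \<gamma> u(3)] inv_into_f_f[OF V_chart(2)[OF \<alpha>] u(4)])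
    also have "\<dots> = u" by (rule PI_decompose(2)[OF \<beta> \<gamma> u(1-3), symmetric])
    finally show ?thesis .
  qed
qed

lemma Phi_inj: "inj_on (\<Phi> \<alpha> \<beta> \<gamma>) (Dom \<alpha> \<beta> \<gamma>)"
  using Phi_props(2) by (metis inj_onI)

lemma Phi_image: "\<Phi> \<alpha> \<beta> \<gamma> ` Dom \<alpha> \<beta> \<gamma> = Img \<alpha> \<beta> \<gamma>"
proof (intro equalityI subsetI)
  fix z assume "z \<in> \<Phi> \<alpha> \<beta> \<gamma> ` Dom \<alpha> \<beta> \<gamma>"
  then show "z \<in> Img \<alpha> \<beta> \<gamma>" using Phi_props(1) by (elim imageE) (simp only:)
next
  fix z assume z: "z \<in> Img \<alpha> \<beta> \<gamma>"
  show "z \<in> \<Phi> \<alpha> \<beta> \<gamma> ` Dom \<alpha> \<beta> \<gamma>"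
    by (rule image_eqI[where x = "\<Theta> \<alpha> \<beta> \<gamma> z"]) (rule Theta_props(6)[OF z, symmetric], rule Theta_props(5)[OF z])
qed

lemma inv_Phi: "z \<in> Img \<alpha> \<beta> \<gamma> \<Longrightarrow> inv_into (Dom \<alpha> \<beta> \<gamma>) (\<Phi> \<alpha> \<beta> \<gamma>) z = \<Theta> \<alpha> \<beta> \<gamma> z"
  by (rule inv_into_f_eq[OF Phi_inj Theta_props(5,6)])

lemma Im_open: "openin (ntop (Mod \<beta> \<gamma>)) (Img \<alpha> \<beta> \<gamma>)"
  by (intro openin_prod_nspace nE nL nP ch_open \<beta> \<gamma> Omega_open V_chart \<alpha> order.refl)

lemma Mod_projections:
  assumes "z \<in> vecs (Mod \<beta> \<gamma>)"
  shows "smooth_at (Mod \<beta> \<gamma>) (E \<gamma>) fst z" "smooth_at (Mod \<beta> \<gamma>) (E \<beta>) (\<lambda>z. fst (snd z)) z"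
    "smooth_at (Mod \<beta> \<gamma>) L (\<lambda>z. snd (snd z)) z"
proof -
  note id = smooth_at_id[OF nP(2) assms]
  show "smooth_at (Mod \<beta> \<gamma>) (E \<gamma>) fst z"
    by (rule smooth_at_linear[OF nP(2) nP(2) nE id bounded_linear_prod_nspace(1)[OF nE nP(1)]])
  have "smooth_at (Mod \<beta> \<gamma>) (prod_nspace (E \<beta>) L) snd z"
    by (rule smooth_at_linear[OF nP(2) nP(2) nP(1) id bounded_linear_prod_nspace(2)[OF nE nP(1)]])
  then show "smooth_at (Mod \<beta> \<gamma>) (E \<beta>) (\<lambda>z. fst (snd z)) z" "smooth_at (Mod \<beta> \<gamma>) L (\<lambda>z. snd (snd z)) z"
    by (rule smooth_at_linear[OF nP(2) nP(1) nE _ bounded_linear_prod_nspace(1)[OF nE nL]]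
        smooth_at_linear[OF nP(2) nP(1) nL _ bounded_linear_prod_nspace(2)[OF nE nL]])+
qed

lemma Im_vecs: "z \<in> Img \<alpha> \<beta> \<gamma> \<Longrightarrow> z \<in> vecs (Mod \<beta> \<gamma>)"
  using normed_nspace.openin_vecs[OF nP(2) Im_open] by blast

lemma Theta_smooth_at:
  assumes z: "z \<in> Img \<alpha> \<beta> \<gamma>"
  shows "smooth_at (Mod \<beta> \<gamma>) op_space (\<Theta> \<alpha> \<beta> \<gamma>) z"
proof -
  note pr = Mod_projections[OF Im_vecs[OF z]]
  have "smooth_at (Mod \<beta> \<gamma>) op_space (\<lambda>z. \<sigma> \<gamma> (dg \<gamma> (fst z))) z"
    by (rule smooth_at_compose[OF nP(2) nE nO pr(1) sigma_smooth_on[OF \<gamma>]]) (use z in auto)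
  moreover have "smooth_at (Mod \<beta> \<gamma>) op_space (\<lambda>z. \<sigma> \<beta> (dg \<beta> (fst (snd z)))) z"
    by (rule smooth_at_compose[OF nP(2) nE nO pr(2) sigma_smooth_on[OF \<beta>]]) (use z in auto)
  moreover have "smooth_at (Mod \<beta> \<gamma>) op_space (\<lambda>z. inv_into (V \<alpha>) (\<psi> \<alpha>) (snd (snd z))) z"
    by (rule smooth_at_compose[OF nP(2) nL nO pr(3) psi_inverse_smooth_on[OF \<alpha>]]) (use z in auto)
  ultimately show ?thesis
    unfolding \<Theta>_def by (intro smooth_at_comp smooth_at_cadj nP(2))
qed

text \<open>Continuity of the inverse chart into the bounded operators, used to separate points of
  the manifold.\<close>

lemma Theta_preimage_open:
  assumes S: "open S"
  shows "openin (ntop (Mod \<beta> \<gamma>)) {z \<in> Img \<alpha> \<beta> \<gamma>. \<Theta> \<alpha> \<beta> \<gamma> z \<in> S}"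
proof (subst openin_subopen, intro ballI)
  fix z assume z: "z \<in> {z \<in> Img \<alpha> \<beta> \<gamma>. \<Theta> \<alpha> \<beta> \<gamma> z \<in> S}"
  note T = openin_op_space[OF S]
  have "\<Theta> \<alpha> \<beta> \<gamma> z \<in> S \<inter> {T. clinear_op T}"
    using z Theta_props(1) partial_isometryD(1) by (auto simp: PI_res_def)
  then obtain N where N: "openin (ntop (Mod \<beta> \<gamma>)) N" "z \<in> N" "\<And>y. y \<in> N \<Longrightarrow> \<Theta> \<alpha> \<beta> \<gamma> y \<in> S \<inter> {T. clinear_op T}"
    using smooth_at_continuous[OF nP(2) nO Theta_smooth_at T] z by blast
  then show "\<exists>T. openin (ntop (Mod \<beta> \<gamma>)) T \<and> z \<in> T \<and> T \<subseteq> {z \<in> Img \<alpha> \<beta> \<gamma>. \<Theta> \<alpha> \<beta> \<gamma> z \<in> S}"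
    using z Im_open by (intro exI[of _ "N \<inter> Img \<alpha> \<beta> \<gamma>"]) auto
qed

lemma transition_smooth:
  assumes \<alpha>': "\<alpha>' \<in> I" and \<beta>': "\<beta>' \<in> J" and \<gamma>': "\<gamma>' \<in> J"
  shows "smooth_on (Mod \<beta> \<gamma>) (Mod \<beta>' \<gamma>') (\<Phi> \<alpha> \<beta> \<gamma> ` (Dom \<alpha> \<beta> \<gamma> \<inter> Dom \<alpha>' \<beta>' \<gamma>'))
    (\<Phi> \<alpha>' \<beta>' \<gamma>' \<circ> inv_into (Dom \<alpha> \<beta> \<gamma>) (\<Phi> \<alpha> \<beta> \<gamma>))"
proof -
  let ?M = "Mod \<beta> \<gamma>" and ?N\<beta> = "ch \<beta> ` (\<Omega> \<beta> \<inter> \<Omega> \<beta>')" and ?N\<gamma> = "ch \<gamma> ` (\<Omega> \<gamma> \<inter> \<Omega> \<gamma>')"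
  \<comment> \<open>Coordinates whose initial and final subspaces lie in both charts. On this set
    \<open>m\<close> is the middle operator formed with the second pair of sections, and the overlap
    of the charts is where \<open>m\<close> falls into \<open>V \<alpha>'\<close>.\<close>
  define O' where "O' = ?N\<gamma> \<times> ?N\<beta> \<times> (\<psi> \<alpha> ` V \<alpha>)"
  define m where "m z = cadj (\<sigma> \<gamma>' (dg \<gamma> (fst z))) o\<^sub>L \<Theta> \<alpha> \<beta> \<gamma> z o\<^sub>L \<sigma> \<beta>' (dg \<beta> (fst (snd z))) o\<^sub>L proj Hp" for z
  have O'_open: "openin (ntop ?M) O'"
    unfolding O'_def
    by (intro openin_prod_nspace nE nL nP ch_open \<beta> \<gamma> Omega_Int_open \<beta>' \<gamma>' V_chart \<alpha> Int_lower1)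
  have O'_Im: "O' \<subseteq> Img \<alpha> \<beta> \<gamma>" unfolding O'_def by auto
  have dgO: "dg \<gamma> (fst z) \<in> \<Omega> \<gamma> \<inter> \<Omega> \<gamma>'" "dg \<beta> (fst (snd z)) \<in> \<Omega> \<beta> \<inter> \<Omega> \<beta>'" if "z \<in> O'" for z
    using that dg_ch[OF \<beta>] dg_ch[OF \<gamma>] unfolding O'_def by auto
  have mid: "middle Hp (\<sigma> \<beta>') (\<sigma> \<gamma>') (\<Theta> \<alpha> \<beta> \<gamma> z) = m z" if z: "z \<in> O'" for z
  proof -
    have zI: "z \<in> Img \<alpha> \<beta> \<gamma>" using O'_Im z by blast
    note T = Theta_props[OF zI]
    show ?thesis using middle_eq[OF \<gamma>', of "\<Theta> \<alpha> \<beta> \<gamma> z" "\<sigma> \<beta>'"] dgO[OF z] by (simp add: T(2,3) m_def)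
  qed
  have mU: "m z \<in> U_plus Hp" if z: "z \<in> O'" for z
  proof -
    have zI: "z \<in> Img \<alpha> \<beta> \<gamma>" using O'_Im z by blast
    note T = Theta_props[OF zI]
    show ?thesis
      using PI_decompose(1)[OF \<beta>' \<gamma>' T(1)] dgO[OF z] mid[OF z] by (simp add: T(2,3))
  qed
  have m_smooth: "smooth_at ?M op_space m z" if z: "z \<in> O'" for z
  proof -
    have zI: "z \<in> Img \<alpha> \<beta> \<gamma>" using O'_Im z by blast
    note pr = Mod_projections[OF Im_vecs[OF zI]]
    have 1: "smooth_at ?M op_space (\<lambda>z. \<sigma> \<gamma>' (dg \<gamma> (fst z))) z"
      by (rule smooth_at_compose[OF nP(2) nE nO pr(1) sigma_change_smooth_on[OF \<gamma> \<gamma>']]) (use z in \<open>auto simp: O'_def\<close>)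
    have 2: "smooth_at ?M op_space (\<lambda>z. \<sigma> \<beta>' (dg \<beta> (fst (snd z)))) z"
      by (rule smooth_at_compose[OF nP(2) nE nO pr(2) sigma_change_smooth_on[OF \<beta> \<beta>']]) (use z in \<open>auto simp: O'_def\<close>)
    show ?thesis
      unfolding m_def
      by (intro smooth_at_comp smooth_at_cadj nP(2) 1 2 Theta_smooth_at zI smooth_at_const_op clinear_proj Hp Im_vecs)
  qed
  let ?U = "{z \<in> O'. m z \<in> V \<alpha>'}"
  have U_open: "openin (ntop ?M) ?U"
  proof (subst openin_subopen, intro ballI)
    fix z assume z: "z \<in> ?U"
    \<comment> \<open>On \<open>O'\<close> the values of \<open>m\<close> lie in
      \<open>U_plus Hp\<close>, so belonging to \<open>V \<alpha>'\<close> means belonging to the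
      norm-open \<open>S\<close>, a condition stable near \<open>z\<close> by continuity of
      \<open>m\<close>.\<close>
    obtain S where S: "open S" "V \<alpha>' = U_plus Hp \<inter> S" using V_open[OF \<alpha>'] unfolding openin_open by blast
    note T = openin_op_space[OF S(1)]
    have zO: "z \<in> O'" using z by blast
    have "m z \<in> S \<inter> {T. clinear_op T}"
      using z mU[OF zO] S(2) by (auto simp: U_plus_def unitaries_def)
    then obtain N where N: "openin (ntop ?M) N" "z \<in> N" "\<And>y. y \<in> N \<Longrightarrow> m y \<in> S \<inter> {T. clinear_op T}"
      using smooth_at_continuous[OF nP(2) nO m_smooth[OF zO] T] by blast
    then show "\<exists>T. openin (ntop ?M) T \<and> z \<in> T \<and> T \<subseteq> ?U"
      using zO O'_open mU S(2) by (intro exI[of _ "N \<inter> O'"]) auto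
  qed
  have U_eq: "\<Phi> \<alpha> \<beta> \<gamma> ` (Dom \<alpha> \<beta> \<gamma> \<inter> Dom \<alpha>' \<beta>' \<gamma>') = ?U"
  proof (intro equalityI subsetI)
    fix z assume "z \<in> \<Phi> \<alpha> \<beta> \<gamma> ` (Dom \<alpha> \<beta> \<gamma> \<inter> Dom \<alpha>' \<beta>' \<gamma>')"
    then obtain u where u: "u \<in> Dom \<alpha> \<beta> \<gamma>" "u \<in> Dom \<alpha>' \<beta>' \<gamma>'" "z = \<Phi> \<alpha> \<beta> \<gamma> u" by blast
    have zO: "z \<in> O'" using u by (auto simp: O'_def Dom_def Phi_def)
    have "\<Theta> \<alpha> \<beta> \<gamma> z = u" using Phi_props(2)[OF u(1)] u(3) by simp
    then show "z \<in> ?U" using zO mid[OF zO] u(2) by (simp add: Dom_def)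
  next
    fix z assume z: "z \<in> ?U"
    then have zO: "z \<in> O'" and zI: "z \<in> Img \<alpha> \<beta> \<gamma>" using O'_Im by auto
    note T = Theta_props[OF zI]
    have "\<Theta> \<alpha> \<beta> \<gamma> z \<in> Dom \<alpha>' \<beta>' \<gamma>'"
      using z dgO[OF zO] mid[OF zO] T(1) by (simp add: Dom_def T(2,3))
    then show "z \<in> \<Phi> \<alpha> \<beta> \<gamma> ` (Dom \<alpha> \<beta> \<gamma> \<inter> Dom \<alpha>' \<beta>' \<gamma>')" using T(5,6) by (metis IntI image_eqI)
  qed
  show ?thesis
    unfolding U_eq smooth_on_iff_smooth_at[OF nP(2) nP(2)]
  proof (intro conjI ballI U_open)
    fix z assume z: "z \<in> ?U"
    then have zO: "z \<in> O'" and zI: "z \<in> Img \<alpha> \<beta> \<gamma>" using O'_Im by auto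
    note pr = Mod_projections[OF Im_vecs[OF zI]]
    have "smooth_at ?M (E \<gamma>') (\<lambda>z. ch \<gamma>' (dg \<gamma> (fst z))) z"
      by (rule smooth_at_compose[OF nP(2) nE nE pr(1) ch_change_smooth_on[OF \<gamma> \<gamma>']]) (use zO in \<open>auto simp: O'_def\<close>)
    moreover have "smooth_at ?M (E \<beta>') (\<lambda>z. ch \<beta>' (dg \<beta> (fst (snd z)))) z"
      by (rule smooth_at_compose[OF nP(2) nE nE pr(2) ch_change_smooth_on[OF \<beta> \<beta>']]) (use zO in \<open>auto simp: O'_def\<close>)
    moreover have "smooth_at ?M L (\<lambda>z. \<psi> \<alpha>' (m z)) z"
      by (rule psi_smooth_at[OF \<alpha>' nP(2) U_open z _ m_smooth[OF zO]]) blast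
    ultimately have "smooth_at ?M (Mod \<beta>' \<gamma>')
        (\<lambda>z. (ch \<gamma>' (dg \<gamma> (fst z)), ch \<beta>' (dg \<beta> (fst (snd z))), \<psi> \<alpha>' (m z))) z"
      by (intro smooth_at_Pair nE nL nP)
    then show "smooth_at ?M (Mod \<beta>' \<gamma>') (\<Phi> \<alpha>' \<beta>' \<gamma>' \<circ> inv_into (Dom \<alpha> \<beta> \<gamma>) (\<Phi> \<alpha> \<beta> \<gamma>)) z"
    proof (rule smooth_at_cong[OF _ U_open z])
      fix y assume "y \<in> ?U"
      then have yO: "y \<in> O'" and yI: "y \<in> Img \<alpha> \<beta> \<gamma>" using O'_Im by auto
      show "(ch \<gamma>' (dg \<gamma> (fst y)), ch \<beta>' (dg \<beta> (fst (snd y))), \<psi> \<alpha>' (m y)) =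
          (\<Phi> \<alpha>' \<beta>' \<gamma>' \<circ> inv_into (Dom \<alpha> \<beta> \<gamma>) (\<Phi> \<alpha> \<beta> \<gamma>)) y"
        by (simp add: inv_Phi[OF yI] Phi_def Theta_props(2,3)[OF yI] mid[OF yO])
    qed
  qed
qed

end

section \<open>The atlas and its topology\<close>

definition charts where
  "charts = {Chart (Dom \<alpha> \<beta> \<gamma>) (\<Phi> \<alpha> \<beta> \<gamma>) (Mod \<beta> \<gamma>) | \<alpha> \<beta> \<gamma>. \<alpha> \<in> I \<and> \<beta> \<in> J \<and> \<gamma> \<in> J}"

lemma banach_Mod: "banach_space (Mod \<beta> \<gamma>)"
  by (intro normed_nspaceI_banach nP banach_prod_nspace nE nL complete_L2_perp complete_lie_u_plus)

lemma smooth_atlas_charts: "smooth_atlas (PI_res Hp Hm) charts"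
  unfolding smooth_atlas_def
proof (intro conjI ballI)
  show "(\<Union>c\<in>charts. chart_dom c) = PI_res Hp Hm"
  proof (intro equalityI subsetI)
    fix u assume "u \<in> (\<Union>c\<in>charts. chart_dom c)"
    then show "u \<in> PI_res Hp Hm" by (auto simp: charts_def Dom_def)
  next
    fix u assume u: "u \<in> PI_res Hp Hm"
    then have "ini u \<in> (\<Union>\<beta>\<in>J. \<Omega> \<beta>)" "fin u \<in> (\<Union>\<beta>\<in>J. \<Omega> \<beta>)" unfolding Omega_cover by (auto simp: PI_res_def)
    then obtain \<beta> \<gamma> where bg: "\<beta> \<in> J" "ini u \<in> \<Omega> \<beta>" "\<gamma> \<in> J" "fin u \<in> \<Omega> \<gamma>" by blast
    have "middle Hp (\<sigma> \<beta>) (\<sigma> \<gamma>) u \<in> U_plus Hp" by (rule PI_decompose(1)[OF bg(1,3) u bg(2,4)])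
    then obtain \<alpha> where a: "\<alpha> \<in> I" "middle Hp (\<sigma> \<beta>) (\<sigma> \<gamma>) u \<in> V \<alpha>" using V_cover by blast
    have "Chart (Dom \<alpha> \<beta> \<gamma>) (\<Phi> \<alpha> \<beta> \<gamma>) (Mod \<beta> \<gamma>) \<in> charts" using a bg unfolding charts_def by blast
    moreover have "u \<in> Dom \<alpha> \<beta> \<gamma>" using u a bg by (simp add: Dom_def)
    ultimately show "u \<in> (\<Union>c\<in>charts. chart_dom c)" by (metis UN_iff chart.sel(1))
  qed
next
  fix c assume "c \<in> charts"
  then obtain \<alpha> \<beta> \<gamma> where c: "c = Chart (Dom \<alpha> \<beta> \<gamma>) (\<Phi> \<alpha> \<beta> \<gamma>) (Mod \<beta> \<gamma>)" "\<alpha> \<in> I" "\<beta> \<in> J" "\<gamma> \<in> J"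
    unfolding charts_def by blast
  show "is_chart (PI_res Hp Hm) c"
    unfolding is_chart_def c(1) chart.sel Phi_image[OF c(2-4)]
    using Phi_inj[OF c(2-4)] Im_open[OF c(2-4)] banach_Mod by (auto simp: Dom_def)
  fix d assume "d \<in> charts"
  then obtain \<alpha>' \<beta>' \<gamma>' where d: "d = Chart (Dom \<alpha>' \<beta>' \<gamma>') (\<Phi> \<alpha>' \<beta>' \<gamma>') (Mod \<beta>' \<gamma>')" "\<alpha>' \<in> I" "\<beta>' \<in> J" "\<gamma>' \<in> J"
    unfolding charts_def by blast
  show "compatible c d"
    unfolding compatible_def c(1) d(1) chart.sel
    using transition_smooth[OF c(2-4) d(2-4)] transition_smooth[OF d(2-4) c(2-4)] by (simp only: Int_commute)
qed

text \<open>The inclusion of the partial isometries into the bounded operators is continuous for the atlas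
  topology, which is therefore Hausdorff.\<close>

lemma Hausdorff_charts: "Hausdorff_space (atlas_topology (PI_res Hp Hm) charts)"
proof -
  let ?T = "atlas_topology (PI_res Hp Hm) charts"
  have inj: "inj_on (coord c) (chart_dom c)" if "c \<in> charts" for c
    using smooth_atlas_charts that unfolding smooth_atlas_def is_chart_def by blast
  have oT: "openin ?T S \<longleftrightarrow> S \<subseteq> PI_res Hp Hm \<and>
      (\<forall>c\<in>charts. openin (ntop (model c)) (coord c ` (S \<inter> chart_dom c)))" for S
    by (rule openin_atlas_topology) (rule inj)
  have "topspace ?T \<subseteq> PI_res Hp Hm" using openin_topspace[of ?T] oT[of "topspace ?T"] by blast
  \<comment> \<open>In each chart the trace of a norm-open set is its preimage under
    \<open>\<Theta>\<close>, so disjoint norm-open sets separate points in the atlas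
    topology.\<close>
  have op: "openin ?T (S \<inter> PI_res Hp Hm)" if S: "open S" for S
    unfolding oT
  proof (intro conjI ballI)
    fix c assume "c \<in> charts"
    then obtain \<alpha> \<beta> \<gamma> where c: "c = Chart (Dom \<alpha> \<beta> \<gamma>) (\<Phi> \<alpha> \<beta> \<gamma>) (Mod \<beta> \<gamma>)" "\<alpha> \<in> I" "\<beta> \<in> J" "\<gamma> \<in> J"
      unfolding charts_def by blast
    have "\<Phi> \<alpha> \<beta> \<gamma> ` (S \<inter> PI_res Hp Hm \<inter> Dom \<alpha> \<beta> \<gamma>) = {z \<in> Img \<alpha> \<beta> \<gamma>. \<Theta> \<alpha> \<beta> \<gamma> z \<in> S}"
    proof (intro equalityI subsetI)
      fix z assume "z \<in> \<Phi> \<alpha> \<beta> \<gamma> ` (S \<inter> PI_res Hp Hm \<inter> Dom \<alpha> \<beta> \<gamma>)"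
      then obtain u where "u \<in> S" "u \<in> Dom \<alpha> \<beta> \<gamma>" "z = \<Phi> \<alpha> \<beta> \<gamma> u" by blast
      then show "z \<in> {z \<in> Img \<alpha> \<beta> \<gamma>. \<Theta> \<alpha> \<beta> \<gamma> z \<in> S}" using Phi_props[OF c(2-4)] by simp
    next
      fix z assume z: "z \<in> {z \<in> Img \<alpha> \<beta> \<gamma>. \<Theta> \<alpha> \<beta> \<gamma> z \<in> S}"
      then have zI: "z \<in> Img \<alpha> \<beta> \<gamma>" by blast
      note T = Theta_props[OF c(2-4) zI]
      have "\<Theta> \<alpha> \<beta> \<gamma> z \<in> S \<inter> PI_res Hp Hm \<inter> Dom \<alpha> \<beta> \<gamma>" using z T(1,5) by blast
      then show "z \<in> \<Phi> \<alpha> \<beta> \<gamma> ` (S \<inter> PI_res Hp Hm \<inter> Dom \<alpha> \<beta> \<gamma>)" using T(6) by (metis image_eqI)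
    qed
    then show "openin (ntop (model c)) (coord c ` (S \<inter> PI_res Hp Hm \<inter> chart_dom c))"
      using Theta_preimage_open[OF c(2-4) S] unfolding c(1) chart.sel by simp
  qed simp
  show ?thesis
    unfolding Hausdorff_space_def
  proof (intro allI impI, elim conjE)
    fix u v assume "u \<in> topspace ?T" "v \<in> topspace ?T" "u \<noteq> v"
    then have uv: "u \<in> PI_res Hp Hm" "v \<in> PI_res Hp Hm" using \<open>topspace ?T \<subseteq> PI_res Hp Hm\<close> by auto
    obtain S S' where "open S" "open S'" "u \<in> S" "v \<in> S'" "S \<inter> S' = {}" using hausdorff[OF \<open>u \<noteq> v\<close>] by blast
    then show "\<exists>U Va. openin ?T U \<and> openin ?T Va \<and> u \<in> U \<and> v \<in> Va \<and> disjnt U Va"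
      using op uv by (intro exI[of _ "S \<inter> PI_res Hp Hm"] exI[of _ "S' \<inter> PI_res Hp Hm"]) (auto simp: disjnt_def)
  qed
qed

lemma banach_manifold_charts: "banach_manifold (PI_res Hp Hm) charts"
  unfolding banach_manifold_def using smooth_atlas_charts Hausdorff_charts by blast

end

theorem theorem5p3:
  fixes Hp Hm :: "'a::complex_hilbert set"
    and I :: "'i set" and J :: "'j set"
    and V :: "'i \<Rightarrow> ('a \<Rightarrow>\<^sub>L 'a) set"
    and \<psi> :: "'i \<Rightarrow> ('a \<Rightarrow>\<^sub>L 'a) \<Rightarrow> ('a \<Rightarrow>\<^sub>L 'a)"
    and \<Omega> :: "'j \<Rightarrow> 'a set set"
    and \<sigma> :: "'j \<Rightarrow> 'a set \<Rightarrow> ('a \<Rightarrow>\<^sub>L 'a)"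
    and W :: "'j \<Rightarrow> 'a set"
    and Dom :: "'i \<Rightarrow> 'j \<Rightarrow> 'j \<Rightarrow> ('a \<Rightarrow>\<^sub>L 'a) set"
    and \<Phi> :: "'i \<Rightarrow> 'j \<Rightarrow> 'j \<Rightarrow> ('a \<Rightarrow>\<^sub>L 'a) \<Rightarrow> ('a \<Rightarrow>\<^sub>L 'a) \<times> ('a \<Rightarrow>\<^sub>L 'a) \<times> ('a \<Rightarrow>\<^sub>L 'a)"
  assumes separable: "separable_space (euclidean :: 'a topology)"
    and polarization: "polarization Hp Hm"
    and V_open: "\<And>\<alpha>. \<alpha> \<in> I \<Longrightarrow> openin (top_of_set (U_plus Hp)) (V \<alpha>)"
    and V_atlas: "atlas_of_manifold (U_plus Hp) (U_plus_atlas Hp)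
                    ((\<lambda>\<alpha>. Chart (V \<alpha>) (\<psi> \<alpha>) (lie_u_plus Hp)) ` I)"
    and Omega_open: "\<And>\<beta>. \<beta> \<in> J \<Longrightarrow>
                       openin (atlas_topology (Gr_res Hp Hm) (Gr_atlas Hp Hm)) (\<Omega> \<beta>)"
    and Omega_cover: "(\<Union>\<beta>\<in>J. \<Omega> \<beta>) = Gr_res Hp Hm"
    and sigma_smooth: "\<And>\<beta>. \<beta> \<in> J \<Longrightarrow>
                         smooth_map (Gr_res Hp Hm) (Gr_atlas Hp Hm) (\<Omega> \<beta>) (U_res_atlas Hp) (\<sigma> \<beta>)"
    and sigma_section: "\<And>\<beta> X. \<beta> \<in> J \<Longrightarrow> X \<in> \<Omega> \<beta> \<Longrightarrow> blinfun_apply (\<sigma> \<beta> X) ` Hp = X"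
    and W_center: "\<And>\<beta>. \<beta> \<in> J \<Longrightarrow> W \<beta> \<in> \<Omega> \<beta> \<and> \<Omega> \<beta> \<subseteq> graph_dom Hp Hm (W \<beta>)"
    and Dom_def: "\<And>\<alpha> \<beta> \<gamma>. Dom \<alpha> \<beta> \<gamma> =
                    {u \<in> PI_res Hp Hm. ini u \<in> \<Omega> \<beta> \<and> fin u \<in> \<Omega> \<gamma> \<and>
                       middle Hp (\<sigma> \<beta>) (\<sigma> \<gamma>) u \<in> V \<alpha>}"
    and Phi_def: "\<And>\<alpha> \<beta> \<gamma> u. \<Phi> \<alpha> \<beta> \<gamma> u =
                    (graph_coord (W \<gamma>) (fin u), graph_coord (W \<beta>) (ini u),
                     \<psi> \<alpha> (middle Hp (\<sigma> \<beta>) (\<sigma> \<gamma>) u))"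
  shows "banach_manifold (PI_res Hp Hm)
           {Chart (Dom \<alpha> \<beta> \<gamma>) (\<Phi> \<alpha> \<beta> \<gamma>)
              (prod_nspace (L2_perp (W \<gamma>)) (prod_nspace (L2_perp (W \<beta>)) (lie_u_plus Hp)))
            | \<alpha> \<beta> \<gamma>. \<alpha> \<in> I \<and> \<beta> \<in> J \<and> \<gamma> \<in> J}"
proof -
  interpret section_atlas Hp Hm I J V \<psi> \<Omega> \<sigma> W Dom \<Phi>
    by (rule section_atlas.intro)
      (rule polarization[unfolded polarization_def, THEN conjunct1] | erule V_open | rule V_atlas |
        erule Omega_open | rule Omega_cover | erule sigma_smooth | (erule sigma_section, assumption) |
        erule W_center | rule Dom_def | rule Phi_def)+
  show ?thesis using banach_manifold_charts unfolding charts_def .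
qed

end
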